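(* Let $0<\alpha\le1$ be fixed and let $X(\xi,t)$ be a solution on $\mathbb{S}^1\times[0,T]$ of $$\alpha\,\partial_tX+(1-\alpha)(\partial_tX\cdot\mathcal{N})\mathcal{N}=\frac{\partial_{\xi\xi}X}{|\partial_\xi X|^2}-f(L)\mathcal{N},\qquad X(\xi,0)=X^0(\xi),$$ with $X^0\in H^2(\mathbb{S}^1)$, such that $X\in W^{1,\infty}([0,T],H^2(\mathbb{S}^1))$, with $K_2(X):=\|X\|_{W^{1,\infty}([0,T],H^2(\mathbb{S}^1))}<\infty$, and such that there are constants $0<C_1<C_2$ with $C_1\le|\partial_\xi X(\xi,t)|\le C_2$ for all $(\xi,t)\in\mathbb{S}^1\times[0,T]$. Assume that the partition $0=\xi_0<\xi_1<\dots<\xi_N=2\pi$ of $\mathbb{S}^1$, with $h_j=\xi_j-\xi_{j-1}$ and $h=\max_jh_j$, satisfies, for constants $c_p>0$ and $c_P$, $$\min_jh_j\ge c_ph,\qquad|h_{j+1}-h_j|\le c_Ph^2,\quad1\le j\le N.$$ Then there exists $h_0>0$ such that for all $0<h\le h_0$ there exists a unique semi-discrete solution $x_h(\xi,t)=\sum_{j=1}^Nx_j(t)\varphi_j(\xi):\mathbb{S}^1\times[0,T]\to\mathbb{R}^2$, that is, a unique such function with $x_h(\xi,0)=I_hX^0$ and, for all $v_h\in V_h$, $$\int_{\mathbb{S}^1}|\partial_\xi x_h|^2\big(\alpha\,\partial_tx_h+(1-\alpha)(\partial_tx_h\cdot n_h)n_h\big)\cdot v_h\,d\xi+\int_{\mathbb{S}^1}\partial_\xi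 x_h\cdot\partial_\xi v_h\,d\xi+\int_{\mathbb{S}^1}f(l_h)|\partial_\xi x_h|^2\,n_h\cdot v_h\,d\xi=0.$$ Furthermore, the solution satisfies $$\sup_{t\in[0,T]}|X-x_h|_{H^1}^2+\alpha\int_0^T\|\partial_tX-\partial_tx_h\|_{L^2}^2\,dt+(1-\alpha)\int_0^T\|n_h\cdot(\partial_tX-\partial_tx_h)\|_{L^2}^2\,dt\le CTh^2+Ce^{MT/\alpha}h^2,$$ where $h_0$, $C$ and $M$ depend on $c_p,c_P,C_1,C_2,K_2(X)$ and $f$.
   Context: $\mathbb{S}^1=[0,2\pi]$ with endpoints identified (all functions on it are $2\pi$-periodic; indices are periodic, $a_j=a_{j\pm N}$); $(a,b)^\perp:=(-b,a)$; $X:\mathbb{S}^1\times[0,T]\to\mathbb{R}^2$ parametrizes a closed plane curve; $\mathcal{N}=(\partial_\xi X/|\partial_\xi X|)^\perp$ is its unit normal; $L=L(t)=\int_{\mathbb{S}^1}|\partial_\xi X|\,d\xi$ is its perimeter; $f$ is a given real-valued Lipschitz function of the perimeter (a positive real variable). Norms are over $\mathbb{S}^1$ in $\xi$, and $|v|_{H^1}=\|\partial_\xi v\|_{L^2}$. $I_j=[\xi_{j-1},\xi_j]$. $V_h=\{v\in C(\mathbb{S}^1,\mathbb{R}^2): v|_{I_j}\text{ is a polynomial of degree}\le1\text{ for }1\le j\le N,\ v(\xi_0)=v(\xi_N)\}$; $\varphi_j$ is the periodic piecewise linear Lagrange basis function with $\varphi_j(\xi_i)=\delta_{ij}$; $I_hv=\sum_{j=1}^Nv(\xi_j)\varphi_j$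 is linear interpolation. For $x_h=\sum_jx_j\varphi_j$: $n_h=(\partial_\xi x_h/|\partial_\xi x_h|)^\perp$ is the piecewise constant unit normal and $l_h=\sum_{j=1}^N|x_j-x_{j-1}|$ is the perimeter of the polygon with vertices $x_j$.
   Formalization: Here h_0 may depend also on the fixed α and on T, besides the listed quantities (C and M may not); an h_0 independent of T is impossible: for f=1, α=1 and the stationary unit circle, the semi-discrete polygon collapses in finite time for every h. *)

theory Defs
  imports "HOL-Analysis.Analysis" "HOL-Probability.Essential_Supremum"
begin

text \<open>Functions on the circle are \<open>2\<pi>\<close>-periodic functions on the real line, integrated over one period.
  Time-dependent functions take the time argument first, so that \<open>X t\<close> is the curve at time \<open>t\<close>.\<close>

abbreviation circle :: "real measure" where
  "circle \<equiv> lebesgue_on {0..2*pi}"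

definition periodic :: "(real \<Rightarrow> 'a) \<Rightarrow> bool" where
  "periodic v \<longleftrightarrow> (\<forall>\<xi>. v (\<xi> + 2*pi) = v \<xi>)"


section \<open>Sobolev spaces on the circle\<close>

definition L2_fun :: "(real \<Rightarrow> 'a::euclidean_space) \<Rightarrow> bool" where
  "L2_fun v \<longleftrightarrow> periodic v \<and> v \<in> borel_measurable circle \<and> integrable circle (\<lambda>\<xi>. (norm (v \<xi>))\<^sup>2)"

definition L2_norm :: "(real \<Rightarrow> 'a::euclidean_space) \<Rightarrow> real" where
  "L2_norm v = sqrt (LINT \<xi>|circle. (norm (v \<xi>))\<^sup>2)"

definition has_weak_deriv :: "(real \<Rightarrow> 'a::euclidean_space) \<Rightarrow> (real \<Rightarrow> 'a) \<Rightarrow> bool" where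
  "has_weak_deriv v g \<longleftrightarrow>
     (\<forall>(\<phi>::real \<Rightarrow> real) \<phi>'. periodic \<phi> \<and> (\<forall>\<xi>. (\<phi> has_real_derivative \<phi>' \<xi>) (at \<xi>)) \<and> continuous_on UNIV \<phi>' \<longrightarrow>
        (LINT \<xi>|circle. \<phi>' \<xi> *\<^sub>R v \<xi>) = - (LINT \<xi>|circle. \<phi> \<xi> *\<^sub>R g \<xi>))"

text \<open>The weak derivative is determined almost everywhere only; \<open>weak_deriv v\<close> is a representative.\<close>

definition weak_deriv :: "(real \<Rightarrow> 'a::euclidean_space) \<Rightarrow> real \<Rightarrow> 'a" where
  "weak_deriv v = (SOME g. L2_fun g \<and> has_weak_deriv v g)"

definition H1_fun :: "(real \<Rightarrow> 'a::euclidean_space) \<Rightarrow> bool" where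
  "H1_fun v \<longleftrightarrow> L2_fun v \<and> (\<exists>g. L2_fun g \<and> has_weak_deriv v g)"

definition H2_fun :: "(real \<Rightarrow> 'a::euclidean_space) \<Rightarrow> bool" where
  "H2_fun v \<longleftrightarrow> H1_fun v \<and> H1_fun (weak_deriv v)"

definition H1_seminorm :: "(real \<Rightarrow> 'a::euclidean_space) \<Rightarrow> real" where
  "H1_seminorm v = L2_norm (weak_deriv v)"

definition H2_norm :: "(real \<Rightarrow> 'a::euclidean_space) \<Rightarrow> real" where
  "H2_norm v = sqrt ((L2_norm v)\<^sup>2 + (L2_norm (weak_deriv v))\<^sup>2 + (L2_norm (weak_deriv (weak_deriv v)))\<^sup>2)"


section \<open>The Bochner-Sobolev space \<open>W\<^sup>1\<^sup>,\<^sup>\<infinity>([0,T], H\<^sup>2)\<close>\<close>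

definition H2_simple :: "real \<Rightarrow> (real \<Rightarrow> real \<Rightarrow> real^2) \<Rightarrow> bool" where
  "H2_simple T s \<longleftrightarrow> finite (s ` {0..T}) \<and> (\<forall>t\<in>{0..T}. H2_fun (s t)) \<and>
     (\<forall>v. {t \<in> {0..T}. s t = v} \<in> sets lebesgue)"

definition H2_strongly_measurable :: "real \<Rightarrow> (real \<Rightarrow> real \<Rightarrow> real^2) \<Rightarrow> bool" where
  "H2_strongly_measurable T u \<longleftrightarrow> (\<forall>t\<in>{0..T}. H2_fun (u t)) \<and>
     (\<exists>s. (\<forall>n::nat. H2_simple T (s n)) \<and>
          (AE t in lebesgue_on {0..T}. (\<lambda>n. H2_norm (\<lambda>\<xi>. s n t \<xi> - u t \<xi>)) \<longlonglongrightarrow> 0))"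

definition Linf_H2_norm :: "real \<Rightarrow> (real \<Rightarrow> real \<Rightarrow> real^2) \<Rightarrow> ereal" where
  "Linf_H2_norm T u = esssup (lebesgue_on {0..T}) (\<lambda>t. ereal (H2_norm (u t)))"

definition Linf_H2 :: "real \<Rightarrow> (real \<Rightarrow> real \<Rightarrow> real^2) \<Rightarrow> bool" where
  "Linf_H2 T u \<longleftrightarrow> H2_strongly_measurable T u \<and> Linf_H2_norm T u < \<infinity>"

text \<open>The defining identity \<open>\<integral> \<phi>'(t) u(t) dt = - \<integral> \<phi>(t) w(t) dt\<close> of the weak time derivative is an identity of
  Bochner integrals in \<open>H\<^sup>2\<close>. As \<open>H\<^sup>2\<close> embeds in \<open>L\<^sup>2\<close> and bounded functionals commute with the Bochner
  integral, it is stated by pairing both sides with an arbitrary \<open>\<psi>\<close> in \<open>L\<^sup>2\<close>.\<close>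

definition has_weak_time_deriv :: "real \<Rightarrow> (real \<Rightarrow> real \<Rightarrow> real^2) \<Rightarrow> (real \<Rightarrow> real \<Rightarrow> real^2) \<Rightarrow> bool" where
  "has_weak_time_deriv T u w \<longleftrightarrow>
     (\<forall>(\<phi>::real \<Rightarrow> real) \<phi>' a b (\<psi>::real \<Rightarrow> real^2).
        (\<forall>t. (\<phi> has_real_derivative \<phi>' t) (at t)) \<and> continuous_on UNIV \<phi>' \<and>
        0 < a \<and> b < T \<and> (\<forall>t. t \<notin> {a..b} \<longrightarrow> \<phi> t = 0) \<and> L2_fun \<psi> \<longrightarrow>
        (LINT t|lebesgue_on {0..T}. \<phi>' t * (LINT \<xi>|circle. u t \<xi> \<bullet> \<psi> \<xi>)) =
        - (LINT t|lebesgue_on {0..T}. \<phi> t * (LINT \<xi>|circle. w t \<xi> \<bullet> \<psi> \<xi>)))"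

definition time_deriv :: "real \<Rightarrow> (real \<Rightarrow> real \<Rightarrow> real^2) \<Rightarrow> real \<Rightarrow> real \<Rightarrow> real^2" where
  "time_deriv T u = (SOME w. Linf_H2 T w \<and> has_weak_time_deriv T u w)"

definition W1inf_H2 :: "real \<Rightarrow> (real \<Rightarrow> real \<Rightarrow> real^2) \<Rightarrow> bool" where
  "W1inf_H2 T u \<longleftrightarrow> Linf_H2 T u \<and> (\<exists>w. Linf_H2 T w \<and> has_weak_time_deriv T u w)"

definition W1inf_H2_norm :: "real \<Rightarrow> (real \<Rightarrow> real \<Rightarrow> real^2) \<Rightarrow> ereal" where
  "W1inf_H2_norm T u = Linf_H2_norm T u + Linf_H2_norm T (time_deriv T u)"


section \<open>The flow\<close>

definition perp :: "real^2 \<Rightarrow> real^2" where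
  "perp v = vector [- v $ 2, v $ 1]"

abbreviation dxi :: "(real \<Rightarrow> real^2) \<Rightarrow> real \<Rightarrow> real^2" where
  "dxi x \<xi> \<equiv> vector_derivative x (at \<xi>)"

definition unit_normal :: "(real \<Rightarrow> real^2) \<Rightarrow> real \<Rightarrow> real^2" where
  "unit_normal x \<xi> = perp (dxi x \<xi> /\<^sub>R norm (dxi x \<xi>))"

definition perimeter :: "(real \<Rightarrow> real^2) \<Rightarrow> real" where
  "perimeter x = (LINT \<xi>|circle. norm (dxi x \<xi>))"

text \<open>Functions in \<open>W\<^sup>1\<^sup>,\<^sup>\<infinity>([0,T], H\<^sup>2)\<close> have a unique jointly continuous representative, which is continuously
  differentiable in \<open>\<xi>\<close>. Continuity is required here so that \<open>X\<close> is this representative; only then do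
  \<open>X 0\<close> and pointwise values of \<open>dxi (X t)\<close> make sense.\<close>

definition flow_solution ::
  "real \<Rightarrow> (real \<Rightarrow> real) \<Rightarrow> real \<Rightarrow> (real \<Rightarrow> real^2) \<Rightarrow> (real \<Rightarrow> real \<Rightarrow> real^2) \<Rightarrow> bool" where
  "flow_solution \<alpha> f T X0 X \<longleftrightarrow>
     W1inf_H2 T X \<and> continuous_on ({0..T} \<times> UNIV) (\<lambda>(t, \<xi>). X t \<xi>) \<and>
     (\<forall>\<xi>. X 0 \<xi> = X0 \<xi>) \<and>
     (AE t in lebesgue_on {0..T}. AE \<xi> in circle.
        \<alpha> *\<^sub>R time_deriv T X t \<xi>
        + (1 - \<alpha>) *\<^sub>R ((time_deriv T X t \<xi> \<bullet> unit_normal (X t) \<xi>) *\<^sub>R unit_normal (X t) \<xi>)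
        = weak_deriv (weak_deriv (X t)) \<xi> /\<^sub>R (norm (dxi (X t) \<xi>))\<^sup>2
          - f (perimeter (X t)) *\<^sub>R unit_normal (X t) \<xi>)"


section \<open>Finite elements\<close>

definition circle_partition :: "nat \<Rightarrow> (nat \<Rightarrow> real) \<Rightarrow> bool" where
  "circle_partition N p \<longleftrightarrow> 1 \<le> N \<and> p 0 = 0 \<and> p N = 2*pi \<and> (\<forall>j<N. p j < p (Suc j))"

text \<open>\<open>h\<^sub>j\<close> for \<open>j \<ge> 1\<close>, with periodic index: \<open>mesh_step N p (N + 1) = mesh_step N p 1\<close>.\<close>

definition mesh_step :: "nat \<Rightarrow> (nat \<Rightarrow> real) \<Rightarrow> nat \<Rightarrow> real" where
  "mesh_step N p j = p (Suc ((j - 1) mod N)) - p ((j - 1) mod N)"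

definition mesh_size :: "nat \<Rightarrow> (nat \<Rightarrow> real) \<Rightarrow> real" where
  "mesh_size N p = Max (mesh_step N p ` {1..N})"

definition P1_space :: "nat \<Rightarrow> (nat \<Rightarrow> real) \<Rightarrow> (real \<Rightarrow> 'a::real_normed_vector) set" where
  "P1_space N p = {v. periodic v \<and> continuous_on UNIV v \<and>
     (\<forall>j\<in>{1..N}. \<exists>a b. \<forall>\<xi>\<in>{p (j - 1)..p j}. v \<xi> = a + \<xi> *\<^sub>R b)}"

text \<open>The degrees of freedom are indexed by \<open>1, \<dots>, N\<close>; node \<open>0\<close> is identified with node \<open>N\<close>.\<close>

definition hat :: "nat \<Rightarrow> (nat \<Rightarrow> real) \<Rightarrow> nat \<Rightarrow> real \<Rightarrow> real" where
  "hat N p j = (THE \<phi>. \<phi> \<in> P1_space N p \<and> (\<forall>i\<in>{1..N}. \<phi> (p i) = (if i = j then 1 else 0)))"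

definition interpolant :: "nat \<Rightarrow> (nat \<Rightarrow> real) \<Rightarrow> (real \<Rightarrow> real^2) \<Rightarrow> real \<Rightarrow> real^2" where
  "interpolant N p v \<xi> = (\<Sum>j=1..N. hat N p j \<xi> *\<^sub>R v (p j))"

definition polygon_length :: "nat \<Rightarrow> (nat \<Rightarrow> real) \<Rightarrow> (real \<Rightarrow> real^2) \<Rightarrow> real" where
  "polygon_length N p x = (\<Sum>j=1..N. norm (x (p j) - x (p (j - 1))))"

abbreviation dt_on :: "real \<Rightarrow> (real \<Rightarrow> real \<Rightarrow> real^2) \<Rightarrow> real \<Rightarrow> real \<Rightarrow> real^2" where
  "dt_on T x t \<xi> \<equiv> vector_derivative (\<lambda>s. x s \<xi>) (at t within {0..T})"

text \<open>The condition that consecutive vertices are distinct says that \<open>\<partial>\<^sub>\<xi>x\<^sub>h\<close> vanishes on no element, that is,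
  that the normal \<open>n\<^sub>h\<close> in the equation is defined. The derivative \<open>dxi (x t)\<close> is unspecified at the nodes,
  which form a null set.\<close>

definition semidiscrete_solution ::
  "real \<Rightarrow> (real \<Rightarrow> real) \<Rightarrow> real \<Rightarrow> nat \<Rightarrow> (nat \<Rightarrow> real) \<Rightarrow> (real \<Rightarrow> real^2) \<Rightarrow> (real \<Rightarrow> real \<Rightarrow> real^2) \<Rightarrow> bool" where
  "semidiscrete_solution \<alpha> f T N p X0 x \<longleftrightarrow>
     (\<exists>c :: nat \<Rightarrow> real \<Rightarrow> real^2. (\<forall>j\<in>{1..N}. c j differentiable_on {0..T}) \<and>
        (\<forall>t\<in>{0..T}. \<forall>\<xi>. x t \<xi> = (\<Sum>j=1..N. hat N p j \<xi> *\<^sub>R c j t))) \<and>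
     (\<forall>t\<in>{0..T}. \<forall>j\<in>{1..N}. x t (p j) \<noteq> x t (p (j - 1))) \<and>
     (\<forall>\<xi>. x 0 \<xi> = interpolant N p X0 \<xi>) \<and>
     (\<forall>t\<in>{0..T}. \<forall>v\<in>P1_space N p.
        (LINT \<xi>|circle. (norm (dxi (x t) \<xi>))\<^sup>2 *
           ((\<alpha> *\<^sub>R dt_on T x t \<xi>
             + (1 - \<alpha>) *\<^sub>R ((dt_on T x t \<xi> \<bullet> unit_normal (x t) \<xi>) *\<^sub>R unit_normal (x t) \<xi>)) \<bullet> v \<xi>))
        + (LINT \<xi>|circle. dxi (x t) \<xi> \<bullet> dxi v \<xi>)
        + (LINT \<xi>|circle. f (polygon_length N p (x t)) * (norm (dxi (x t) \<xi>))\<^sup>2 * (unit_normal (x t) \<xi> \<bullet> v \<xi>))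
        = 0)"

end

theory Submission
  imports Defs
begin

text \<open>Let \<open>R\<^sub>j\<close> be the difference between the \<open>j\<close>-th edges of the interpolated exact curve and of the discrete curve. Testing
  the difference of the two equations with the time derivative of the nodal error bounds the sum of \<open>E'\<close>, where
  \<open>E = \<Sum>\<^sub>j |R\<^sub>j|\<^sup>2 / h\<^sub>j\<close>, and of a multiple of the weighted \<open>L\<^sup>2\<close> norm of the velocity error by
  \<open>\<kappa>/\<alpha> (h\<^sup>2 + E)\<close>; the forcing contributes through the Lipschitz constant of \<open>f\<close>, because the error of the perimeter is
  at most \<open>O(h) + \<Sum>\<^sub>j |R\<^sub>j|\<close>. Gronwall's inequality gives \<open>E = O(h\<^sup>2)\<close>.

  The estimate needs \<open>|\<partial>\<^sub>\<xi>x\<^sub>h|\<close> to stay between \<open>C\<^sub>1/2\<close> and \<open>2C\<^sub>2\<close>. By quasi-uniformity \<open>(|R\<^sub>j|/h\<^sub>j)\<^sup>2 \<le> E/h\<^sub>j = O(h)\<close>,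
  so for small \<open>h\<close> these bounds improve themselves. The scheme is therefore solved first with clipped edge
  vectors, where Lax-Milgram makes it a globally Lipschitz differential equation, and a continuation argument shows
  that the clipping is never active on \<open>[0,T]\<close>.

  On the side of \<open>X\<close>, a bounded weak time derivative in \<open>H\<^sup>2\<close> yields \<open>X(\<xi>,t) = X(\<xi>,0) + \<integral>\<^sub>0\<^sup>t \<partial>\<^sub>tX(\<xi>,s) ds\<close> for every \<open>\<xi>\<close>, and the
  equation itself makes \<open>\<partial>\<^sub>\<xi>X\<close> Lipschitz in \<open>\<xi>\<close>.\<close>

section \<open>Integral inequalities and the du Bois-Reymond lemma\<close>

text \<open>The flow equation is used multiplied by the squared length of the tangent, that is,
  solved for the second \<xi>-derivative of \<open>X\<close> (\<open>flow_rhs\<close>). In this form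
  it matches the scheme: the stiffness terms agree and no normalised tangent occurs, so the two
  equations differ only through tangents, velocities and perimeters. The obstacle is regularity.
  \<open>X\<close> is merely Lipschitz in time, so \<open>E\<close> is differentiated only in
  integrated form. In space, \<open>H\<^sup>2\<close> alone makes the tangent Hoelder continuous of
  exponent 1/2, too weak for pointwise errors of order \<open>h\<close>; bounding the second
  derivative through the equation (constant \<open>La\<close>) repairs this. The factor
  \<open>1/\<alpha>\<close> is the cost of Young's inequality: the velocity error is absorbed by a
  mass term that controls it only with weight \<open>\<alpha> * C1\<^sup>2 / 4\<close>. Gronwall
  then yields \<open>4 * z * exp (4 * z)\<close> with \<open>z = \<kappa> * T / \<alpha>\<close>;
  integrating this once more for the velocity error and absorbing the powers of \<open>z\<close>
  gives \<open>exp (12 * z)\<close>, whence \<open>M = 12 * \<kappa>\<close>. The continuation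
  closes only if \<open>h\<close> beats this exponential, so \<open>h0\<close> is chosen after
  \<alpha> and \<open>T\<close>, unlike \<open>C\<close> and \<open>M\<close>.\<close>

lemma sets_lebesgue_Icc: "{a..b::real} \<in> sets lebesgue"
  using fmeasurableD[OF lmeasurable_cbox[of a b]] by simp

text \<open>At the point \<open>s\<close> where \<open>exp (- 2 * \<kappa> * s) * E s\<close> is
  largest, the integral of \<open>E\<close> is at most \<open>E s / (2 * \<kappa>)\<close>, so the
  hypothesis gives \<open>E s \<le> 2 * A\<close>. The factor 2 and the exponent
  \<open>2 * \<kappa>\<close> are the price of this argument, which uses neither a derivative of
  \<open>E\<close> nor an iteration.\<close>

lemma gronwall:
  fixes E :: "real \<Rightarrow> real"
  assumes cont: "continuous_on {0..T} E" and "0 \<le> T" and \<kappa>: "0 < \<kappa>"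
    and nonneg: "\<And>t. t \<in> {0..T} \<Longrightarrow> 0 \<le> E t"
    and le: "\<And>t. t \<in> {0..T} \<Longrightarrow> E t \<le> A + \<kappa> * integral {0..t} E"
    and t: "t \<in> {0..T}"
  shows "E t \<le> 2 * A * exp (2 * \<kappa> * t)"
proof -
  define m where "m s = exp (- 2 * \<kappa> * s) * E s" for s
  have "continuous_on {0..T} m"
    unfolding m_def by (intro continuous_intros cont)
  then obtain s where s: "s \<in> {0..T}" and max: "\<And>r. r \<in> {0..T} \<Longrightarrow> m r \<le> m s"
    using continuous_attains_sup[of "{0..T}" m] \<open>0 \<le> T\<close> by auto
  have E_eq: "E r = m r * exp (2 * \<kappa> * r)" for r
    by (simp add: m_def flip: exp_add)
  have E_le: "E r \<le> m s * exp (2 * \<kappa> * r)" if "r \<in> {0..T}" for r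
    using max[OF that] by (subst E_eq) (intro mult_right_mono, auto)
  have I: "((\<lambda>r. m s * exp (2 * \<kappa> * r)) has_integral
      (m s * exp (2 * \<kappa> * s) / (2*\<kappa>) - m s * exp (2 * \<kappa> * 0) / (2*\<kappa>))) {0..s}"
    using s \<kappa> by (intro fundamental_theorem_of_calculus)
      (auto intro!: derivative_eq_intros simp flip: has_real_derivative_iff_has_vector_derivative)
  have m0: "0 \<le> m s" using nonneg[OF s] by (simp add: m_def)
  have "integral {0..s} E \<le> m s * exp (2 * \<kappa> * s) / (2*\<kappa>) - m s * exp (2 * \<kappa> * 0) / (2*\<kappa>)"
  proof (rule has_integral_le[OF _ I])
    show "(E has_integral integral {0..s} E) {0..s}"
      using s by (intro integrable_integral integrable_continuous_real continuous_on_subset[OF cont]) auto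
    show "E r \<le> m s * exp (2 * \<kappa> * r)" if "r \<in> {0..s}" for r
      using that s by (intro E_le) auto
  qed
  also have "\<dots> \<le> E s / (2 * \<kappa>)"
    using \<kappa> m0 E_eq[of s] by simp
  finally have "\<kappa> * integral {0..s} E \<le> E s / 2"
    using \<kappa> by (simp add: field_simps)
  with le[OF s] have "E s \<le> 2 * A" by simp
  moreover have "m s \<le> E s"
    unfolding E_eq[of s] using m0 s \<kappa> by (simp add: mult_le_cancel_left1)
  ultimately have "m s * exp (2 * \<kappa> * t) \<le> 2 * A * exp (2 * \<kappa> * t)"
    by (intro mult_right_mono) auto
  with E_le[OF t] show ?thesis by linarith
qed

text \<open>At the first time \<open>s\<close> where \<open>E\<close> reaches \<epsilon>, the weak
  bound holds on all of \<open>{0..s}\<close>, and \<open>improve\<close> makes it strict at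
  \<open>s\<close>, a contradiction.\<close>

lemma continuation:
  fixes E :: "real \<Rightarrow> real"
  assumes cont: "continuous_on {0..T} E" and "0 \<le> T" and E0: "E 0 \<le> \<epsilon>"
    and improve: "\<And>\<tau>. \<tau> \<in> {0..T} \<Longrightarrow> (\<And>s. s \<in> {0..\<tau>} \<Longrightarrow> E s \<le> \<epsilon>) \<Longrightarrow> E \<tau> < \<epsilon>"
    and t: "t \<in> {0..T}"
  shows "E t < \<epsilon>"
proof (rule ccontr)
  assume "\<not> E t < \<epsilon>"
  define S where "S = {s \<in> {0..T}. \<epsilon> \<le> E s}"
  have "S \<noteq> {}" using t \<open>\<not> E t < \<epsilon>\<close> by (auto simp: S_def)
  have "compact S"
    unfolding S_def using continuous_closed_preimage[OF cont, of "{\<epsilon>..}"]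
    by (simp add: compact_eq_bounded_closed bounded_subset[of "{0..T}"] Int_def vimage_def subset_eq)
  obtain s where s: "s \<in> S" and first: "\<And>r. r \<in> S \<Longrightarrow> s \<le> r"
    using compact_attains_inf[OF \<open>compact S\<close> \<open>S \<noteq> {}\<close>] by auto
  have below: "E r < \<epsilon>" if "0 \<le> r" "r < s" for r
  proof -
    have "r \<notin> S" using first[of r] that by auto
    then show ?thesis using that s by (auto simp: S_def)
  qed
  \<comment> \<open>At \<open>s\<close> itself only \<open>\<epsilon> \<le> E s\<close> is known; a
    strict excess would, by the intermediate value theorem, make \<open>E\<close> equal to
    \<epsilon> before \<open>s\<close>.\<close>
  have "E r \<le> \<epsilon>" if "r \<in> {0..s}" for r
  proof (cases "r < s")
    case True
    with below that show ?thesis by fastforce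
  next
    case False
    then have [simp]: "r = s" using that by auto
    show ?thesis
    proof (rule ccontr)
      assume "\<not> E r \<le> \<epsilon>"
      then have "\<epsilon> < E s" by simp
      moreover have "continuous_on {0..s} E"
        using s by (intro continuous_on_subset[OF cont]) (auto simp: S_def)
      moreover have "0 \<le> s" using s by (auto simp: S_def)
      ultimately obtain x where "0 \<le> x" "x \<le> s" "E x = \<epsilon>"
        using IVT'[of E 0 \<epsilon> s] E0 by auto
      with below[of x] \<open>\<epsilon> < E s\<close> show False by (cases "x = s") auto
    qed
  qed
  with improve[of s] s show False by (fastforce simp: S_def)
qed

text \<open>Integration by parts for an absolutely continuous \<open>u\<close> and a Lipschitz
  \<open>w\<close>. The defect \<open>D\<close> of the product formula has increments bounded by
  \<open>t - s\<close> times something that tends to 0, because \<open>k\<close> is bounded; hence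
  \<open>D\<close> has derivative 0 at every point, and a.e. differentiability never enters.\<close>

lemma integral_product_rule:
  fixes u g :: "real \<Rightarrow> 'a::euclidean_space" and w k :: "real \<Rightarrow> 'b::euclidean_space"
    and P :: "'a \<Rightarrow> 'b \<Rightarrow> 'c::euclidean_space"
  assumes bil: "bounded_bilinear P" and "a \<le> b"
    and g: "g absolutely_integrable_on {a..b}"
    and k: "k \<in> borel_measurable (lebesgue_on {a..b})" and B: "\<And>t. t \<in> {a..b} \<Longrightarrow> norm (k t) \<le> B"
    and u: "\<And>t. t \<in> {a..b} \<Longrightarrow> u t = u a + integral {a..t} g"
    and w: "\<And>t. t \<in> {a..b} \<Longrightarrow> w t = w a + integral {a..t} k"
  shows "((\<lambda>t. P (g t) (w t) + P (u t) (k t)) has_integral (P (u b) (w b) - P (u a) (w a))) {a..b}"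
proof -
  interpret bounded_bilinear P by (rule bil)
  have h: "bilinear P" using bil by (simp add: bilinear_conv_bounded_bilinear)
  have h': "bilinear (\<lambda>x y. P y x)" using bounded_bilinear.flip[OF bil] by (simp add: bilinear_conv_bounded_bilinear)
  have k_int: "k absolutely_integrable_on {a..b}"
  proof (rule measurable_bounded_by_integrable_imp_absolutely_integrable[OF k])
    show "(\<lambda>_. B) integrable_on {a..b}" by (rule integrable_const_ivl)
  qed (use B in auto)
  have g_on: "g integrable_on {s..t}" "(\<lambda>x. norm (g x)) integrable_on {s..t}" "k integrable_on {s..t}"
    if "a \<le> s" "t \<le> b" for s t
    using g k_int that by (auto simp: absolutely_integrable_on_def intro: integrable_subinterval_real)
  have u_cont: "continuous_on {a..b} u"
    by (rule continuous_on_eq[where f = "\<lambda>t. u a + integral {a..t} g"])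
      (auto intro!: continuous_intros indefinite_integral_continuous_1 g_on u[symmetric])
  have w_cont: "continuous_on {a..b} w"
    by (rule continuous_on_eq[where f = "\<lambda>t. w a + integral {a..t} k"])
      (auto intro!: continuous_intros indefinite_integral_continuous_1 g_on w[symmetric])
  have u_diff: "u t - u s = integral {s..t} g" if "a \<le> s" "s \<le> t" "t \<le> b" for s t
  proof -
    have "integral {a..s} g + integral {s..t} g = integral {a..t} g"
      using that g_on(1)[of a t] by (intro Henstock_Kurzweil_Integration.integral_combine) auto
    moreover have "u s = u a + integral {a..s} g" "u t = u a + integral {a..t} g"
      using that by (intro u; simp)+
    ultimately show ?thesis by (metis add_diff_cancel_left add_diff_cancel_left')
  qed
  have w_diff: "w t - w s = integral {s..t} k" if "a \<le> s" "s \<le> t" "t \<le> b" for s t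
  proof -
    have "integral {a..s} k + integral {s..t} k = integral {a..t} k"
      using that g_on(3)[of a t] by (intro Henstock_Kurzweil_Integration.integral_combine) auto
    moreover have "w s = w a + integral {a..s} k" "w t = w a + integral {a..t} k"
      using that by (intro w; simp)+
    ultimately show ?thesis by (metis add_diff_cancel_left add_diff_cancel_left')
  qed
  have gw: "(\<lambda>t. P (g t) (w t)) absolutely_integrable_on {a..b}"
    by (rule absolutely_integrable_bounded_measurable_product[OF h'])
      (use w_cont g in \<open>auto intro: continuous_imp_measurable_on_sets_lebesgue
        compact_imp_bounded compact_continuous_image\<close>)
  have uk: "(\<lambda>t. P (u t) (k t)) absolutely_integrable_on {a..b}"
    by (rule absolutely_integrable_bounded_measurable_product[OF h])
      (use u_cont k_int in \<open>auto intro: continuous_imp_measurable_on_sets_lebesgue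
        compact_imp_bounded compact_continuous_image\<close>)
  define f where "f t = P (g t) (w t) + P (u t) (k t)" for t
  have f_int: "f absolutely_integrable_on {a..b}"
    unfolding f_def using gw uk by (rule set_integral_add)
  have f_on: "f integrable_on {s..t}" if "a \<le> s" "t \<le> b" for s t
    using f_int that by (auto simp: absolutely_integrable_on_def intro: integrable_subinterval_real)
  define D where "D t = P (u t) (w t) - integral {a..t} f" for t
  obtain K where K: "\<And>x y. norm (P x y) \<le> norm x * norm y * K" and "0 \<le> K"
    using nonneg_bounded by auto
  have "0 \<le> B" using B[of a] \<open>a \<le> b\<close> norm_ge_zero[of "k a"] by (simp del: norm_ge_zero)
  have D_diff: "norm (D t - D s) \<le> (t - s) * (2 * B * K * integral {s..t} (\<lambda>x. norm (g x)))"
    if st: "a \<le> s" "s \<le> t" "t \<le> b" for s t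
  proof -
    define G where "G = integral {s..t} (\<lambda>x. norm (g x))"
    have G0: "0 \<le> G" unfolding G_def by (intro integral_nonneg g_on st) auto
    have G: "norm (integral {s'..t'} g) \<le> G" if "s \<le> s'" "s' \<le> t'" "t' \<le> t" for s' t'
    proof -
      have "norm (integral {s'..t'} g) \<le> integral {s'..t'} (\<lambda>x. norm (g x))"
        using that st by (intro integral_norm_bound_integral g_on) auto
      also have "\<dots> \<le> G"
        unfolding G_def using that st by (intro integral_subset_le g_on) auto
      finally show ?thesis .
    qed
    have Kk: "norm (integral {s'..t'} k) \<le> B * (t - s)" if "s \<le> s'" "s' \<le> t'" "t' \<le> t" for s' t'
    proof -
      have "norm (integral {s'..t'} k) \<le> integral {s'..t'} (\<lambda>x. B)"
        using that st B by (intro integral_norm_bound_integral g_on) auto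
      also have "\<dots> \<le> B * (t - s)" using that \<open>0 \<le> B\<close> by (simp add: mult.commute mult_left_mono)
      finally show ?thesis .
    qed
    have "D t - D s = P (u t) (w t) - P (u s) (w s) - integral {s..t} f"
      using Henstock_Kurzweil_Integration.integral_combine[of a s t f] f_on[of a t] st by (simp add: D_def algebra_simps)
    \<comment> \<open>The increment is split with \<open>w\<close> frozen at \<open>t\<close> and
      \<open>u\<close> frozen at \<open>s\<close>. After subtracting the integral of
      \<open>f\<close>, each remaining integrand pairs a density with an increment over
      \<open>{s..t}\<close>, which is the source of the factor \<open>t - s\<close>.\<close>
    also have "P (u t) (w t) - P (u s) (w s) = P (integral {s..t} g) (w t) + P (u s) (integral {s..t} k)"
      using st by (simp add: diff_left diff_right flip: u_diff w_diff)
    finally have "D t - D s = integral {s..t} (\<lambda>x. P (g x) (w t)) + integral {s..t} (\<lambda>x. P (u s) (k x)) - integral {s..t} f"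
      using integral_linear[OF g_on(1) bounded_linear_left, of s t "w t"]
        integral_linear[OF g_on(3) bounded_linear_right, of s t "u s"] st
      by (simp add: o_def)
    also have "\<dots> = integral {s..t} (\<lambda>x. P (g x) (w t - w x) + P (u s - u x) (k x))"
    proof -
      have i: "(\<lambda>x. P (g x) (w t)) integrable_on {s..t}" "(\<lambda>x. P (u s) (k x)) integrable_on {s..t}"
        using integrable_linear[OF g_on(1) bounded_linear_left, of s t "w t"]
        integrable_linear[OF g_on(3) bounded_linear_right, of s t "u s"] st
        by (simp_all add: o_def)
      show ?thesis
        using i f_on[of s t] st
        by (subst integral_add[symmetric], simp, simp, subst integral_diff[symmetric])
           (auto intro!: integral_cong integrable_add simp: f_def diff_left diff_right)
    qed
    finally have *: "D t - D s = integral {s..t} (\<lambda>x. P (g x) (w t - w x) + P (u s - u x) (k x))" .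
    have "norm (D t - D s) \<le> integral {s..t} (\<lambda>x. norm (g x) * (B * (t - s)) * K + G * B * K)"
      unfolding *
    proof (rule integral_norm_bound_integral)
      show "(\<lambda>x. P (g x) (w t - w x) + P (u s - u x) (k x)) integrable_on {s..t}"
      proof -
        have "(\<lambda>x. P (g x) (w t) + P (u s) (k x) - f x) integrable_on {s..t}"
          using integrable_linear[OF g_on(1) bounded_linear_left, of s t "w t"]
            integrable_linear[OF g_on(3) bounded_linear_right, of s t "u s"] st
          by (auto simp add: o_def intro!: integrable_add integrable_diff f_on)
        then show ?thesis by (simp add: f_def diff_left diff_right algebra_simps)
      qed
      show "(\<lambda>x. norm (g x) * (B * (t - s)) * K + G * B * K) integrable_on {s..t}"
        using g_on(2)[of s t] st by (auto intro!: integrable_add integrable_on_mult_left)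
      fix x assume x: "x \<in> {s..t}"
      have "norm (P (g x) (w t - w x)) \<le> norm (g x) * norm (w t - w x) * K" by (rule K)
      also have "\<dots> \<le> norm (g x) * (B * (t - s)) * K"
        using Kk[of x t] x st \<open>0 \<le> K\<close> by (intro mult_right_mono mult_left_mono) (auto simp: w_diff)
      finally have 1: "norm (P (g x) (w t - w x)) \<le> norm (g x) * (B * (t - s)) * K" .
      have "norm (P (u s - u x) (k x)) \<le> norm (u s - u x) * norm (k x) * K" by (rule K)
      also have "\<dots> \<le> G * B * K"
        using G[of s x] x st \<open>0 \<le> K\<close> B[of x] G0 u_diff[of s x]
        by (intro mult_right_mono mult_mono) (auto simp: norm_minus_commute[of "u s"])
      finally have 2: "norm (P (u s - u x) (k x)) \<le> G * B * K" .
      show "norm (P (g x) (w t - w x) + P (u s - u x) (k x)) \<le> norm (g x) * (B * (t - s)) * K + G * B * K"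
        by (rule norm_triangle_mono[OF 1 2])
    qed
    also have "\<dots> = (t - s) * (2 * B * K * G)"
    proof -
      have "((\<lambda>x. norm (g x) * (B * (t - s)) * K + G * B * K) has_integral
          (G * (B * (t - s)) * K + (t - s) *\<^sub>R (G * B * K))) {s..t}"
        using integrable_integral[OF g_on(2)[of s t]] has_integral_const_real[of "G * B * K" s t] st
        by (intro has_integral_add has_integral_mult_left) (auto simp: G_def)
      then show ?thesis by (simp add: integral_unique algebra_simps)
    qed
    finally show ?thesis by (simp add: G_def)
  qed
  have cG: "continuous_on {a..b} (\<lambda>x. integral {a..x} (\<lambda>x. norm (g x)))"
    by (intro indefinite_integral_continuous_1 g_on) auto
  \<comment> \<open>By \<open>D_diff\<close> the difference quotient of \<open>D\<close> is bounded
    by a multiple of an increment of \<open>H\<close>, the indefinite integral of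
    \<open>norm (g x)\<close>, and \<open>H\<close> is continuous.\<close>
  have "(D has_derivative (\<lambda>_. 0)) (at x within {a..b})" if x: "x \<in> {a..b}" for x
    unfolding has_derivative_within_alt
  proof (intro conjI allI impI)
    fix e :: real assume "e > 0"
    define H where "H t = integral {a..t} (\<lambda>x. norm (g x))" for t
    have "continuous (at x within {a..b}) H" using cG x by (simp add: H_def[abs_def] continuous_on_eq_continuous_within)
    then obtain d where d: "d > 0" "\<And>y. y \<in> {a..b} \<Longrightarrow> dist y x < d \<Longrightarrow> dist (H y) (H x) < e / (2 * B * K + 1)"
      unfolding continuous_within_eps_delta
      using \<open>e > 0\<close> \<open>0 \<le> B\<close> \<open>0 \<le> K\<close> by (metis add_nonneg_pos divide_pos_pos mult_nonneg_nonneg zero_le_numeral zero_less_one)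
    have H: "integral {s..t} (\<lambda>x. norm (g x)) = H t - H s" if "a \<le> s" "s \<le> t" "t \<le> b" for s t
      using Henstock_Kurzweil_Integration.integral_combine[of a s t "\<lambda>x. norm (g x)"] g_on(2)[of a t] that by (simp add: H_def)
    show "\<exists>d>0. \<forall>y\<in>{a..b}. norm (y - x) < d \<longrightarrow> norm (D y - D x - 0) \<le> e * norm (y - x)"
    proof (intro exI conjI ballI impI)
      fix y assume y: "y \<in> {a..b}" "norm (y - x) < d"
      have main: "2 * B * K * \<bar>H y - H x\<bar> \<le> e"
      proof -
        have "\<bar>H y - H x\<bar> * (2 * B * K + 1) \<le> e"
          using d(2)[of y] y \<open>0 \<le> B\<close> \<open>0 \<le> K\<close>
          by (simp add: dist_norm pos_less_divide_eq add_nonneg_pos)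
        then show ?thesis by (simp add: algebra_simps)
      qed
      show "norm (D y - D x - 0) \<le> e * norm (y - x)"
      proof (cases "x \<le> y")
        case True
        have "norm (D y - D x) \<le> (y - x) * (2 * B * K * (H y - H x))"
          using D_diff[of x y] x y True by (simp add: H)
        also have "\<dots> \<le> (y - x) * e"
          using mult_left_mono[of "H y - H x" "\<bar>H y - H x\<bar>" "2*B*K"] main True \<open>0 \<le> B\<close> \<open>0 \<le> K\<close>
          by (intro mult_left_mono order_trans[OF _ main]) auto
        finally show ?thesis using True by (simp add: mult.commute)
      next
        case False
        have "norm (D x - D y) \<le> (x - y) * (2 * B * K * (H x - H y))"
          using D_diff[of y x] x y False by (simp add: H)
        also have "\<dots> \<le> (x - y) * e"
          using mult_left_mono[of "H x - H y" "\<bar>H y - H x\<bar>" "2*B*K"] main False \<open>0 \<le> B\<close> \<open>0 \<le> K\<close>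
          by (intro mult_left_mono order_trans[OF _ main]) auto
        finally show ?thesis using False by (simp add: mult.commute norm_minus_commute)
      qed
    qed (use d in auto)
  qed auto
  then have "D a = D b"
    using has_derivative_zero_unique[of "{a..b}" D a b] \<open>a \<le> b\<close> by (metis atLeastAtMost_iff convex_real_interval(5) order_refl)
  then have "integral {a..b} f = P (u b) (w b) - P (u a) (w a)"
    by (simp add: D_def algebra_simps)
  then show ?thesis
    using integrable_integral[OF f_on[of a b]] by (simp add: f_def[abs_def])
qed

text \<open>Henstock's lemma bounds the summed deviations of \<open>w x\<close> times the length
  from the integral over each piece. Here the integrals vanish, so the deviations are the Riemann
  sums of \<open>norm (w x)\<close>, and the integral of the norm is 0.\<close>

lemma AE_zero_of_indefinite_integral_zero:
  fixes w :: "real \<Rightarrow> 'a::euclidean_space"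
  assumes w: "w absolutely_integrable_on {a..b}"
    and zero: "\<And>s t. a \<le> s \<Longrightarrow> s \<le> t \<Longrightarrow> t \<le> b \<Longrightarrow> integral {s..t} w = 0"
  shows "AE t in lebesgue_on {a..b}. w t = 0"
proof -
  have int: "w integrable_on {a..b}" "(\<lambda>x. norm (w x)) absolutely_integrable_on {a..b}"
    using w absolutely_integrable_norm[OF w] by (auto simp: absolutely_integrable_on_def o_def)
  have "((\<lambda>x. norm (w x)) has_integral 0) (cbox a b)"
    unfolding has_integral
  proof (intro allI impI)
    fix e :: real assume "e > 0"
    then obtain \<gamma> where \<gamma>: "gauge \<gamma>"
      and le: "\<And>p. \<lbrakk>p tagged_partial_division_of (cbox a b); \<gamma> fine p\<rbrakk> \<Longrightarrow>
             sum (\<lambda>(x,k). norm(measure lborel k *\<^sub>R w x - integral k w)) p < e"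
      using int(1) Henstock_lemma[of w a b e] by (metis (no_types, lifting) interval_cbox)
    show "\<exists>\<gamma>. gauge \<gamma> \<and> (\<forall>p. p tagged_division_of (cbox a b) \<and> \<gamma> fine p \<longrightarrow>
        norm ((\<Sum>(x,k)\<in>p. measure lborel k *\<^sub>R norm (w x)) - 0) < e)"
    proof (intro exI conjI allI impI)
      fix p assume p: "p tagged_division_of (cbox a b) \<and> \<gamma> fine p"
      have "(\<Sum>(x,k)\<in>p. measure lborel k *\<^sub>R norm (w x)) = sum (\<lambda>(x,k). norm(measure lborel k *\<^sub>R w x - integral k w)) p"
      proof (rule sum.cong[OF refl], safe)
        fix x k assume "(x, k) \<in> p"
        then obtain s t where k: "k = cbox s t" "k \<subseteq> cbox a b" "x \<in> k"
          using p by (metis tagged_division_ofD(2) tagged_division_ofD(3) tagged_division_ofD(4))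
        then have "s \<le> t" "a \<le> s" "t \<le> b" by auto
        then have "integral k w = 0" using zero k by simp
        then show "measure lborel k *\<^sub>R norm (w x) = norm (measure lborel k *\<^sub>R w x - integral k w)" by simp
      qed
      with le[of p] p show "norm ((\<Sum>(x,k)\<in>p. measure lborel k *\<^sub>R norm (w x)) - 0) < e"
        by (auto simp: tagged_division_of_def sum_nonneg split_def)
    qed (rule \<gamma>)
  qed
  then have "integral {a..b} (\<lambda>x. norm (w x)) = 0" by (simp add: integral_unique)
  moreover have i: "integrable (lebesgue_on {a..b}) (\<lambda>x. norm (w x))"
    using int(2) by (simp add: absolutely_integrable_imp_integrable)
  ultimately have "integral\<^sup>L (lebesgue_on {a..b}) (\<lambda>x. norm (w x)) = 0"
    by (simp add: lebesgue_integral_eq_integral)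
  then show ?thesis
    using integral_nonneg_eq_0_iff_AE[OF i] by simp
qed

text \<open>A trapezoid of slope \<open>n\<close> supported in \<open>{s..t}\<close>. It serves as
  the derivative of a test function, for which continuity is enough, and increases to the indicator
  of the open interval.\<close>

definition plateau :: "real \<Rightarrow> real \<Rightarrow> real \<Rightarrow> real \<Rightarrow> real" where
  "plateau s t n x = min 1 (n * max 0 (min (x - s) (t - x)))"

lemma plateau_continuous: "continuous_on S (plateau s t n)"
  unfolding plateau_def by (intro continuous_intros)

lemma plateau_bounds: "0 \<le> n \<Longrightarrow> 0 \<le> plateau s t n x" "plateau s t n x \<le> 1"
  by (auto simp: plateau_def)

lemma plateau_outside: "x \<notin> {s<..<t} \<Longrightarrow> plateau s t n x = 0"
proof -
  assume "x \<notin> {s<..<t}"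
  then have "max 0 (min (x - s) (t - x)) = 0" by auto
  then show ?thesis by (simp add: plateau_def)
qed

lemma plateau_pos: "0 < n \<Longrightarrow> x \<in> {s<..<t} \<Longrightarrow> 0 < plateau s t n x"
  by (auto simp: plateau_def)

lemma plateau_tendsto: "(\<lambda>n. plateau s t (real n) x) \<longlonglongrightarrow> indicator {s<..<t} x"
proof (cases "x \<in> {s<..<t}")
  case True
  then have pos: "0 < min (x - s) (t - x)" by auto
  obtain n0 where n0: "1 \<le> real n0 * min (x - s) (t - x)"
    using ex_less_of_nat_mult[OF pos, of 1] by (auto intro: less_imp_le)
  have "\<forall>\<^sub>F n in sequentially. plateau s t (real n) x = 1"
  proof (rule eventually_sequentiallyI)
    fix n assume "n0 \<le> n"
    then have "real n0 * min (x - s) (t - x) \<le> real n * min (x - s) (t - x)"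
      using pos by (intro mult_right_mono) auto
    with n0 have "1 \<le> real n * min (x - s) (t - x)" by linarith
    moreover have "max 0 (min (x - s) (t - x)) = min (x - s) (t - x)" using pos by simp
    ultimately have "1 \<le> real n * max 0 (min (x - s) (t - x))" by simp
    then show "plateau s t (real n) x = 1" by (simp add: plateau_def)
  qed
  with True show ?thesis by (simp add: tendsto_eventually)
qed (simp add: plateau_outside)

text \<open>The difference \<open>w\<close> of \<open>u\<close> and the primitive of
  \<open>g\<close> annihilates every continuous function of mean zero with support inside the
  interval, because such a function is the derivative of an admissible test function. So
  \<open>w\<close> acts on arbitrary continuous weights as a constant \<open>c\<close>, and weights
  close to indicators show that \<open>w - c\<close> has zero integral over every interval.\<close>

lemma du_Bois_Reymond:
  fixes u g :: "real \<Rightarrow> 'a::euclidean_space"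
  assumes "a < b" and u: "u absolutely_integrable_on {a..b}" and g: "g absolutely_integrable_on {a..b}"
    and weak: "\<And>\<phi> \<phi>' s t. (\<And>x. (\<phi> has_real_derivative \<phi>' x) (at x)) \<Longrightarrow> continuous_on UNIV \<phi>' \<Longrightarrow>
      a < s \<Longrightarrow> t < b \<Longrightarrow> (\<And>x. x \<notin> {s..t} \<Longrightarrow> \<phi> x = 0) \<Longrightarrow> (\<And>x. x \<notin> {s..t} \<Longrightarrow> \<phi>' x = 0) \<Longrightarrow>
      integral {a..b} (\<lambda>x. \<phi>' x *\<^sub>R u x) = - integral {a..b} (\<lambda>x. \<phi> x *\<^sub>R g x)"
  obtains c where "AE x in lebesgue_on {a..b}. u x = c + integral {a..x} g"
proof -
  define G where "G x = integral {a..x} g" for x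
  have g_int: "g integrable_on {a..b}" using g by (simp add: absolutely_integrable_on_def)
  have G_cont: "continuous_on {a..b} G"
    unfolding G_def by (rule indefinite_integral_continuous_1[OF g_int])
  have G_ai: "G absolutely_integrable_on {a..b}"
    using G_cont by (rule absolutely_integrable_continuous_real)
  define w where "w x = u x - G x" for x
  have w: "w absolutely_integrable_on {a..b}"
    unfolding w_def using u G_ai by (rule set_integral_diff)
  have mult: "(\<lambda>x. \<zeta> x *\<^sub>R v x) absolutely_integrable_on {a..b}"
    if "continuous_on {a..b} \<zeta>" "v absolutely_integrable_on {a..b}" for \<zeta> :: "real \<Rightarrow> real" and v :: "real \<Rightarrow> 'a"
    by (rule absolutely_integrable_bounded_measurable_product)
      (use that in \<open>auto intro: continuous_imp_measurable_on_sets_lebesgue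
        compact_imp_bounded compact_continuous_image simp: bilinear_conv_bounded_bilinear bounded_bilinear_scaleR\<close>)
  \<comment> \<open>The middle third carries a fixed reference weight of integral \<open>Z\<close>,
    used to make other weights mean-free.\<close>
  define s0 t0 where "s0 = (2*a+b)/3" and "t0 = (a+2*b)/3"
  have s0: "a < s0" "s0 < t0" "t0 < b" using \<open>a < b\<close> by (auto simp: s0_def t0_def)
  define Z where "Z = integral {a..b} (plateau s0 t0 1)"
  have pl_int: "plateau s t n integrable_on {x..y}" for s t n x y
    by (rule integrable_continuous_real) (rule plateau_continuous)
  have "Z > 0"
  proof -
    have "Z \<noteq> 0"
    proof
      assume "Z = 0"
      then have "\<forall>x\<in>{a..b}. plateau s0 t0 1 x = 0"
        unfolding Z_def using \<open>a < b\<close> integral_eq_0_iff[of a b "plateau s0 t0 1"]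
        by (simp add: plateau_continuous plateau_bounds)
      moreover have "(s0 + t0) / 2 \<in> {a..b}" "(s0+t0)/2 \<in> {s0<..<t0}" using s0 by auto
      ultimately show False using plateau_pos[of 1 "(s0+t0)/2" s0 t0] by auto
    qed
    moreover have "0 \<le> Z" unfolding Z_def by (intro integral_nonneg pl_int plateau_bounds) auto
    ultimately show ?thesis by simp
  qed
  define c where "c = (1/Z) *\<^sub>R integral {a..b} (\<lambda>x. plateau s0 t0 1 x *\<^sub>R w x)"
  \<comment> \<open>Subtracting the multiple of the reference plateau with the same integral makes
    \<zeta> mean-free; this is exactly what lets the primitive \<phi> vanish to the right of the
    support as well as to the left.\<close>
  have key: "integral {a..b} (\<lambda>x. \<zeta> x *\<^sub>R w x) = integral {a..b} \<zeta> *\<^sub>R c"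
    if \<zeta>: "continuous_on UNIV \<zeta>" and st: "a < s" "s \<le> t" "t < b" and out: "\<And>x. x \<notin> {s..t} \<Longrightarrow> \<zeta> x = 0"
    for \<zeta> :: "real \<Rightarrow> real" and s t
  proof -
    have \<zeta>': "continuous_on A \<zeta>" for A using \<zeta> by (rule continuous_on_subset) auto
    define I where "I = integral {a..b} \<zeta>"
    define \<phi>' where "\<phi>' x = \<zeta> x - (I / Z) * plateau s0 t0 1 x" for x
    define \<phi> where "\<phi> x = (if x < a then 0 else integral {a..x} \<phi>')" for x
    define S T where "S = min s s0" and "T = max t t0"
    have ST: "a < S" "S \<le> T" "T < b" using st s0 by (auto simp: S_def T_def)
    have \<phi>'_cont: "continuous_on A \<phi>'" for A
      unfolding \<phi>'_def by (intro continuous_intros \<zeta>' plateau_continuous)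
    have \<phi>'_out: "\<phi>' x = 0" if "x \<notin> {S..T}" for x
    proof -
      have "x \<notin> {s..t}" "x \<notin> {s0<..<t0}" using that by (auto simp: S_def T_def)
      then show ?thesis using out[of x] plateau_outside[of x s0 t0 1] by (simp add: \<phi>'_def)
    qed
    have \<phi>'_int: "\<phi>' integrable_on {x..y}" for x y by (rule integrable_continuous_real[OF \<phi>'_cont])
    have total: "integral {a..b} \<phi>' = 0"
      unfolding \<phi>'_def using \<open>Z > 0\<close>
      by (subst integral_diff) (auto intro!: integrable_continuous_real continuous_intros \<zeta>' plateau_continuous simp: I_def Z_def)
    have \<phi>_left: "\<phi> x = 0" if "x < S" for x
    proof -
      have "integral {a..x} \<phi>' = integral {a..x} (\<lambda>x. 0)"
        by (rule integral_cong) (use that in \<open>auto intro!: \<phi>'_out\<close>)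
      then show ?thesis by (simp add: \<phi>_def)
    qed
    have \<phi>_right: "\<phi> x = 0" if "T < x" for x
    proof -
      have 0: "integral {T'..x'} \<phi>' = 0" if "T < T'" for T' x'
      proof -
        have "integral {T'..x'} \<phi>' = integral {T'..x'} (\<lambda>x. 0)"
          by (rule integral_cong) (use that in \<open>auto intro!: \<phi>'_out\<close>)
        then show ?thesis by simp
      qed
      have "integral {a..x} \<phi>' = integral {a..b} \<phi>'"
      proof (cases "x \<le> b")
        case True
        have "integral {a..x} \<phi>' + integral {x..b} \<phi>' = integral {a..b} \<phi>'"
          using True ST that by (intro Henstock_Kurzweil_Integration.integral_combine \<phi>'_int) auto
        with 0[of x b] that show ?thesis by simp
      next
        case False
        have "integral {a..b} \<phi>' + integral {b..x} \<phi>' = integral {a..x} \<phi>'"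
          using False ST that by (intro Henstock_Kurzweil_Integration.integral_combine \<phi>'_int) auto
        with 0[of b x] ST show ?thesis by simp
      qed
      with total show ?thesis by (simp add: \<phi>_def)
    qed
    have \<phi>_deriv: "(\<phi> has_real_derivative \<phi>' x) (at x)" for x
    proof (cases "x < S")
      case True
      have "((\<lambda>_. 0) has_real_derivative 0) (at x)" by simp
      then have "(\<phi> has_real_derivative 0) (at x)"
        by (rule has_field_derivative_transform_within_open[where S="{..<S}"]) (use True \<phi>_left in auto)
      then show ?thesis using \<phi>'_out[of x] True by simp
    next
      case False
      then have "a < x" using ST by auto
      have "((\<lambda>y. integral {a..y} \<phi>') has_vector_derivative \<phi>' x) (at x within {a..x+1})"
        by (rule integral_has_vector_derivative[OF \<phi>'_cont]) (use \<open>a < x\<close> in auto)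
      then have "((\<lambda>y. integral {a..y} \<phi>') has_real_derivative \<phi>' x) (at x)"
        using \<open>a < x\<close> by (simp add: has_real_derivative_iff_has_vector_derivative at_within_Icc_at)
      then show ?thesis
        by (rule has_field_derivative_transform_within_open[where S="{a<..}"]) (use \<open>a < x\<close> in \<open>auto simp: \<phi>_def\<close>)
    qed
    have "integral {a..b} (\<lambda>x. \<phi>' x *\<^sub>R u x) = - integral {a..b} (\<lambda>x. \<phi> x *\<^sub>R g x)"
      by (rule weak[OF \<phi>_deriv \<phi>'_cont \<open>a < S\<close> \<open>T < b\<close>]) (use \<phi>_left \<phi>_right \<phi>'_out in force)+
    moreover have "((\<lambda>x. \<phi> x *\<^sub>R g x + \<phi>' x *\<^sub>R G x) has_integral (\<phi> b *\<^sub>R G b - \<phi> a *\<^sub>R G a)) {a..b}"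
    proof -
      obtain B where B: "\<And>x. x \<in> {a..b} \<Longrightarrow> norm (\<phi>' x) \<le> B"
        using compact_imp_bounded[OF compact_continuous_image[OF \<phi>'_cont, of "{a..b}"]]
        unfolding bounded_iff by blast
      have "((\<lambda>x. (\<lambda>x y. y *\<^sub>R x) (g x) (\<phi> x) + (\<lambda>x y. y *\<^sub>R x) (G x) (\<phi>' x)) has_integral
          ((\<lambda>x y. y *\<^sub>R x) (G b) (\<phi> b) - (\<lambda>x y. y *\<^sub>R x) (G a) (\<phi> a))) {a..b}"
        by (rule integral_product_rule[OF bounded_bilinear.flip[OF bounded_bilinear_scaleR] _ g _ B])
          (use \<open>a < b\<close> in \<open>auto simp: G_def \<phi>_def intro!: continuous_imp_measurable_on_sets_lebesgue \<phi>'_cont\<close>)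
      then show ?thesis by simp
    qed
    then have "integral {a..b} (\<lambda>x. \<phi> x *\<^sub>R g x + \<phi>' x *\<^sub>R G x) = 0"
      using \<phi>_left[of a] \<phi>_right[of b] ST by (simp add: integral_unique)
    moreover have \<phi>_cont: "continuous_on A \<phi>" for A
      using \<phi>_deriv by (meson DERIV_continuous continuous_at_imp_continuous_on)
    have i: "(\<lambda>x. \<phi> x *\<^sub>R g x) integrable_on {a..b}" "(\<lambda>x. \<phi>' x *\<^sub>R G x) integrable_on {a..b}"
      "(\<lambda>x. \<phi>' x *\<^sub>R u x) integrable_on {a..b}"
      "(\<lambda>x. \<zeta> x *\<^sub>R w x) integrable_on {a..b}" "(\<lambda>x. plateau s0 t0 1 x *\<^sub>R w x) integrable_on {a..b}"
      using mult[OF \<phi>_cont g] mult[OF \<phi>'_cont G_ai] mult[OF \<phi>'_cont u] mult[OF \<zeta>' w]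
        mult[OF plateau_continuous w] by (auto simp: absolutely_integrable_on_def)
    ultimately have "integral {a..b} (\<lambda>x. \<phi>' x *\<^sub>R w x) = 0"
      by (simp add: w_def scaleR_diff_right integral_diff integral_add minus_unique)
    then have "integral {a..b} (\<lambda>x. \<zeta> x *\<^sub>R w x - (I / Z) *\<^sub>R (plateau s0 t0 1 x *\<^sub>R w x)) = 0"
      by (simp add: \<phi>'_def scaleR_diff_left)
    then have "integral {a..b} (\<lambda>x. \<zeta> x *\<^sub>R w x) - (I / Z) *\<^sub>R integral {a..b} (\<lambda>x. plateau s0 t0 1 x *\<^sub>R w x) = 0"
      by (simp only: integral_diff[OF i(4) integrable_cmul[OF i(5)]] integral_cmul)
    then show ?thesis
      by (simp add: c_def I_def)
  qed
  \<comment> \<open>Plateaus are admissible weights in \<open>key\<close>, and dominated convergence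
    replaces them by indicators. The intervals must stay inside the open one; those reaching the
    ends follow below from the continuity of \<open>W\<close>.\<close>
  have sub: "integral {s..t} (\<lambda>x. w x - c) = 0" if "a < s" "s \<le> t" "t < b" for s t
  proof -
    have wi: "integrable (lebesgue_on {a..b}) w"
      using w by (simp add: absolutely_integrable_imp_integrable)
    let ?p = "\<lambda>n x. plateau s t (real n) x"
    have wm: "w \<in> borel_measurable (lebesgue_on {a..b})" using wi by simp
    have pm: "?p n \<in> borel_measurable (lebesgue_on {a..b})" for n
      by (intro continuous_imp_measurable_on_sets_lebesgue plateau_continuous) simp
    have im: "(indicator {s<..<t} :: real \<Rightarrow> real) \<in> borel_measurable (lebesgue_on {a..b})"
      by (rule borel_measurable_LIMSEQ_real[OF plateau_tendsto pm])
    have "(\<lambda>n. LINT x|lebesgue_on {a..b}. ?p n x *\<^sub>R (w x - c)) \<longlonglongrightarrow> (LINT x|lebesgue_on {a..b}. indicator {s<..<t} x *\<^sub>R (w x - c))"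
    proof (rule integral_dominated_convergence[where w = "\<lambda>x. norm (w x - c)"])
      show "integrable (lebesgue_on {a..b}) (\<lambda>x. norm (w x - c))"
        using wi by (intro integrable_norm Bochner_Integration.integrable_diff) auto
      show "AE x in lebesgue_on {a..b}. (\<lambda>n. ?p n x *\<^sub>R (w x - c)) \<longlonglongrightarrow> indicator {s<..<t} x *\<^sub>R (w x - c)"
        by (intro AE_I2 tendsto_scaleR plateau_tendsto tendsto_const)
      show "AE x in lebesgue_on {a..b}. norm (?p n x *\<^sub>R (w x - c)) \<le> norm (w x - c)" for n
        by (intro AE_I2) (auto simp: plateau_bounds mult_left_le_one_le)
    qed (use wm pm im in auto)
    moreover have "(LINT x|lebesgue_on {a..b}. ?p n x *\<^sub>R (w x - c)) = 0" for n
    proof -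
      have 1: "(\<lambda>x. ?p n x *\<^sub>R w x) absolutely_integrable_on {a..b}" "(\<lambda>x. ?p n x *\<^sub>R c) absolutely_integrable_on {a..b}"
        using mult[OF plateau_continuous w] mult[OF plateau_continuous, of "\<lambda>_. c"] by auto
      have "(LINT x|lebesgue_on {a..b}. ?p n x *\<^sub>R (w x - c)) = integral {a..b} (\<lambda>x. ?p n x *\<^sub>R w x - ?p n x *\<^sub>R c)"
        using set_integral_diff(1)[OF 1]
        by (subst lebesgue_integral_eq_integral) (auto simp: absolutely_integrable_imp_integrable scaleR_diff_right)
      also have "\<dots> = integral {a..b} (\<lambda>x. ?p n x *\<^sub>R w x) - integral {a..b} (\<lambda>x. ?p n x *\<^sub>R c)"
        using 1 by (intro integral_diff) (auto simp: absolutely_integrable_on_def)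
      also have "integral {a..b} (\<lambda>x. ?p n x *\<^sub>R c) = integral {a..b} (?p n) *\<^sub>R c"
        using integral_linear[OF pl_int bounded_linear_scaleR_left[of c], of a b s t n] by (simp add: o_def)
      also have "integral {a..b} (\<lambda>x. ?p n x *\<^sub>R w x) = integral {a..b} (?p n) *\<^sub>R c"
        by (rule key[OF plateau_continuous that]) (rule plateau_outside, auto)
      finally show ?thesis by simp
    qed
    ultimately have 0: "(LINT x|lebesgue_on {a..b}. indicator {s<..<t} x *\<^sub>R (w x - c)) = 0"
      by (simp add: LIMSEQ_const_iff)
    have "(LINT x|lebesgue_on {a..b}. indicator {s<..<t} x *\<^sub>R (w x - c)) =
        (LINT x|lebesgue_on {a..b}. (if x \<in> {s<..<t} then w x - c else 0))"
      by (rule Bochner_Integration.integral_cong) (auto simp: indicator_def)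
    also have "\<dots> = (LINT x|lebesgue_on {s<..<t}. w x - c)"
      using that by (intro Lebesgue_Measure.integral_restrict) auto
    also have "\<dots> = integral {s<..<t} (\<lambda>x. w x - c)"
    proof (rule lebesgue_integral_eq_integral)
      have "(\<lambda>x. w x - c) absolutely_integrable_on {s<..<t}"
        using set_integral_diff(1)[OF w, of "\<lambda>_. c"] that
        by (auto intro: set_integrable_subset)
      then show "integrable (lebesgue_on {s<..<t}) (\<lambda>x. w x - c)"
        by (rule absolutely_integrable_imp_integrable) auto
    qed auto
    also have "\<dots> = integral {s..t} (\<lambda>x. w x - c)"
      by (rule integral_open_interval_real[symmetric])
    finally show ?thesis using 0 by simp
  qed
  have wc: "(\<lambda>x. w x - c) absolutely_integrable_on {a..b}"
    by (rule set_integral_diff(1)[OF w]) auto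
  have wci: "(\<lambda>x. w x - c) integrable_on {x..y}" if "a \<le> x" "y \<le> b" for x y
    using wc that by (auto simp: absolutely_integrable_on_def intro: integrable_subinterval_real)
  define W where "W x = integral {a..x} (\<lambda>x. w x - c)" for x
  have W_cont: "continuous_on {a..b} W" unfolding W_def by (rule indefinite_integral_continuous_1[OF wci]) auto
  have W_diff: "integral {x..y} (\<lambda>x. w x - c) = W y - W x" if "a \<le> x" "x \<le> y" "y \<le> b" for x y
    unfolding W_def
    using Henstock_Kurzweil_Integration.integral_combine[of a x y "\<lambda>x. w x - c"] wci[of a y] that by (simp add: algebra_simps)
  define m where "m = (a + b) / 2"
  have m: "a < m" "m < b" using \<open>a < b\<close> by (auto simp: m_def)
  have const: "W x = W m" if "x \<in> {a<..<b}" for x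
    using sub[of x m] sub[of m x] W_diff[of x m] W_diff[of m x] that m by (cases "x \<le> m") auto
  have "W x = W m" if "x \<in> {a..b}" for x
  proof (rule continuous_constant_on_closure[of "{a<..<b}" W])
    show "continuous_on (closure {a<..<b}) W" using W_cont \<open>a < b\<close> by simp
    show "x \<in> closure {a<..<b}" using \<open>a < b\<close> that by simp
  qed (rule const)
  then have "AE x in lebesgue_on {a..b}. w x - c = 0"
    by (intro AE_zero_of_indefinite_integral_zero[OF wc]) (auto simp: W_diff)
  then have "AE x in lebesgue_on {a..b}. u x = c + integral {a..x} g"
    by eventually_elim (simp add: w_def G_def algebra_simps)
  then show thesis by (rule that)
qed

section \<open>Differential equations and Galerkin systems\<close>

text \<open>In the unknown \<open>exp (- 2 * L * t) *\<^sub>R u t\<close> the Picard map contracts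
  by 1/2 on the whole of \<open>{0..T}\<close>, whatever \<open>T\<close> is, so no local solutions
  have to be glued.\<close>

lemma ode_existence:
  fixes G :: "'a::banach \<Rightarrow> 'a"
  assumes lip: "\<And>x y. norm (G x - G y) \<le> L * norm (x - y)" and L: "0 < L" and "0 \<le> T"
  obtains u where "u 0 = u0"
    and "\<And>t. t \<in> {0..T} \<Longrightarrow> (u has_vector_derivative G (u t)) (at t within {0..T})"
proof -
  have G_cont: "continuous_on S G" for S
    by (rule lipschitz_on_continuous_on[of L]) (use lip L in \<open>auto intro!: lipschitz_onI simp: dist_norm\<close>)
  define F where "F v c = exp (- 2 * L * c) *\<^sub>R (u0 + integral {0..c} (\<lambda>s. G (exp (2 * L * s) *\<^sub>R apply_bcontfun v s)))"
    for v :: "real \<Rightarrow>\<^sub>C 'a" and c :: real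
  have inner_cont: "continuous_on S (\<lambda>s. G (exp (2 * L * s) *\<^sub>R apply_bcontfun v s))" for v :: "real \<Rightarrow>\<^sub>C 'a" and S
    by (rule continuous_on_compose2[OF G_cont[of UNIV]]) (auto intro!: continuous_intros)
  have inner_int: "(\<lambda>s. G (exp (2 * L * s) *\<^sub>R apply_bcontfun v s)) integrable_on {a..b}" for v :: "real \<Rightarrow>\<^sub>C 'a" and a b
    by (rule integrable_continuous_real[OF inner_cont])
  have F_cont: "continuous_on (cbox 0 T) (F v)" for v
    unfolding F_def by (auto intro!: continuous_intros indefinite_integral_continuous_1 inner_int)
  \<comment> \<open>Clamping the time to \<open>{0..T}\<close> turns the image into a bounded
    continuous function on the line, so that the Banach space of all such functions can host the
    iteration.\<close>
  have "\<exists>w. \<forall>x. apply_bcontfun w x = F v (clamp 0 T x)" for v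
    using continuous_on_cbox_bcontfunE[OF F_cont] by metis
  then obtain \<Phi> where \<Phi>: "\<And>v x. apply_bcontfun (\<Phi> v) x = F v (clamp 0 T x)" by metis
  have contr: "dist (\<Phi> v) (\<Phi> w) \<le> 1/2 * dist v w" for v w
  proof (rule dist_bound)
    fix x :: real
    define c where "c = clamp 0 T x"
    have c: "0 \<le> c" using clamp_in_interval[of 0 T x] \<open>0 \<le> T\<close> by (simp add: c_def)
    have "F v c - F w c = exp (- 2 * L * c) *\<^sub>R integral {0..c} (\<lambda>s. G (exp (2 * L * s) *\<^sub>R v s) - G (exp (2 * L * s) *\<^sub>R w s))"
      by (simp add: F_def integral_diff[OF inner_int inner_int] flip: scaleR_diff_right)
    then have "norm (F v c - F w c) = exp (- 2 * L * c) * norm (integral {0..c} (\<lambda>s. G (exp (2 * L * s) *\<^sub>R v s) - G (exp (2 * L * s) *\<^sub>R w s)))"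
      by simp
    also have "\<dots> \<le> exp (- 2 * L * c) * (dist v w / 2 * (exp (2 * L * c) - 1))"
    proof (rule mult_left_mono)
      have I: "((\<lambda>s. L * (exp (2 * L * s) * dist v w)) has_integral
          (dist v w / 2 * exp (2 * L * c) - dist v w / 2 * exp (2 * L * 0))) {0..c}"
        using c L by (intro fundamental_theorem_of_calculus)
          (auto intro!: derivative_eq_intros simp flip: has_real_derivative_iff_has_vector_derivative)
      have "norm (integral {0..c} (\<lambda>s. G (exp (2 * L * s) *\<^sub>R v s) - G (exp (2 * L * s) *\<^sub>R w s)))
          \<le> integral {0..c} (\<lambda>s. L * (exp (2 * L * s) * dist v w))"
      proof (rule integral_norm_bound_integral)
        show "(\<lambda>s. G (exp (2 * L * s) *\<^sub>R v s) - G (exp (2 * L * s) *\<^sub>R w s)) integrable_on {0..c}"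
          by (intro integrable_diff inner_int)
        fix s
        have "norm (G (exp (2 * L * s) *\<^sub>R v s) - G (exp (2 * L * s) *\<^sub>R w s)) \<le> L * norm (exp (2 * L * s) *\<^sub>R v s - exp (2 * L * s) *\<^sub>R w s)"
          by (rule lip)
        also have "\<dots> = L * (exp (2 * L * s) * dist (v s) (w s))"
          by (simp add: dist_norm flip: scaleR_diff_right)
        also have "\<dots> \<le> L * (exp (2 * L * s) * dist v w)"
          using L by (intro mult_left_mono dist_bounded) auto
        finally show "norm (G (exp (2 * L * s) *\<^sub>R v s) - G (exp (2 * L * s) *\<^sub>R w s)) \<le> L * (exp (2 * L * s) * dist v w)" .
      qed (use I in blast)
      also have "\<dots> = dist v w / 2 * (exp (2 * L * c) - 1)"
        unfolding integral_unique[OF I] by (simp add: algebra_simps)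
      finally show "norm (integral {0..c} (\<lambda>s. G (exp (2 * L * s) *\<^sub>R v s) - G (exp (2 * L * s) *\<^sub>R w s)))
        \<le> dist v w / 2 * (exp (2 * L * c) - 1)" .
    qed auto
    also have "\<dots> = dist v w / 2 * (1 - exp (- 2 * L * c))"
      by (simp add: algebra_simps flip: exp_add)
    also have "\<dots> \<le> dist v w / 2 * 1"
      by (intro mult_left_mono) auto
    finally show "dist (\<Phi> v x) (\<Phi> w x) \<le> 1/2 * dist v w"
      by (simp add: \<Phi> c_def dist_norm)
  qed
  then obtain v where v: "\<Phi> v = v"
    using banach_fix_type[of "1/2" \<Phi>] by auto
  define u where "u t = exp (2 * L * t) *\<^sub>R apply_bcontfun v t" for t
  have u_eq: "u t = u0 + integral {0..t} (\<lambda>s. G (u s))" if "t \<in> {0..T}" for t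
  proof -
    have "clamp 0 T t = t" using that by (intro clamp_cancel_cbox) auto
    then have "apply_bcontfun v t = F v t" using \<Phi>[of v t] by (simp add: v)
    then show ?thesis by (simp add: u_def F_def flip: exp_add)
  qed
  show thesis
  proof
    show "u 0 = u0" using u_eq[of 0] \<open>0 \<le> T\<close> by simp
    fix t assume t: "t \<in> {0..T}"
    have "((\<lambda>t. u0 + integral {0..t} (\<lambda>s. G (u s))) has_vector_derivative (0 + G (u t))) (at t within {0..T})"
      by (intro derivative_intros integral_has_vector_derivative[OF _ t]) (use inner_cont[of "{0..T}" v] in \<open>simp add: u_def\<close>)
    then have "((\<lambda>t. u0 + integral {0..t} (\<lambda>s. G (u s))) has_vector_derivative G (u t)) (at t within {0..T})" by simp
    then show "(u has_vector_derivative G (u t)) (at t within {0..T})"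
      by (rule has_vector_derivative_transform[OF t, rotated]) (rule u_eq)
  qed
qed

text \<open>The distance of two solutions satisfies the hypothesis of \<open>gronwall\<close> with
  \<open>A = 0\<close>.\<close>

lemma ode_uniqueness:
  fixes G :: "'a::banach \<Rightarrow> 'a"
  assumes lip: "\<And>x y. norm (G x - G y) \<le> L * norm (x - y)" and L: "0 < L" and "0 \<le> T"
    and u: "\<And>t. t \<in> {0..T} \<Longrightarrow> (u has_vector_derivative G (u t)) (at t within {0..T})"
    and w: "\<And>t. t \<in> {0..T} \<Longrightarrow> (w has_vector_derivative G (w t)) (at t within {0..T})"
    and "u 0 = w 0" and t: "t \<in> {0..T}"
  shows "u t = w t"
proof -
  have cont: "continuous_on {0..T} u" "continuous_on {0..T} w"
    unfolding continuous_on_eq_continuous_within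
    using has_vector_derivative_continuous[OF u] has_vector_derivative_continuous[OF w] by blast+
  have G_cont: "continuous_on S G" for S
    by (rule lipschitz_on_continuous_on[of L]) (use lip L in \<open>auto intro!: lipschitz_onI simp: dist_norm\<close>)
  define E where "E t = norm (u t - w t)" for t
  have E_cont: "continuous_on {0..T} E" unfolding E_def by (intro continuous_intros cont)
  have "E t \<le> 2 * 0 * exp (2 * L * t)"
  proof (rule gronwall[OF E_cont \<open>0 \<le> T\<close> L _ _ t])
    fix t assume t: "t \<in> {0..T}"
    have D: "((\<lambda>s. G (u s) - G (w s)) has_integral ((u t - w t) - (u 0 - w 0))) {0..t}"
      using t by (intro fundamental_theorem_of_calculus)
        (auto intro!: has_vector_derivative_diff has_vector_derivative_within_subset[OF u] has_vector_derivative_within_subset[OF w])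
    then have "E t = norm (integral {0..t} (\<lambda>s. G (u s) - G (w s)))"
      using \<open>u 0 = w 0\<close> by (simp add: E_def integral_unique)
    also have "\<dots> \<le> integral {0..t} (\<lambda>s. L * E s)"
      using D t by (intro integral_norm_bound_integral)
        (auto simp: E_def lip intro!: integrable_continuous_real continuous_intros continuous_on_compose2[OF G_cont[of UNIV]]
          continuous_on_subset[OF cont(1)] continuous_on_subset[OF cont(2)])
    finally show "E t \<le> 0 + L * integral {0..t} E" by simp
  qed (simp add: E_def)
  then show ?thesis by (simp add: E_def)
qed

text \<open>Induction on the generators, one step of Gram-Schmidt for a form that need not be
  symmetric: \<open>z\<close> represents \<open>B e\<close> on the smaller span,
  \<open>d = e - z\<close> is annihilated there, and a multiple of \<open>d\<close> corrects the
  solution of the smaller problem. Positivity on the span replaces any completeness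
  argument.\<close>

lemma lax_milgram_span:
  fixes B :: "'a::real_vector \<Rightarrow> 'a \<Rightarrow> real"
  assumes "finite S" and lin1: "\<And>y. linear (\<lambda>x. B x y)" and lin2: "\<And>x. linear (B x)"
    and pos: "\<And>x. x \<in> span S \<Longrightarrow> x \<noteq> 0 \<Longrightarrow> 0 < B x x"
    and "linear F"
  shows "\<exists>u\<in>span S. \<forall>v\<in>span S. B u v = F v"
  using \<open>finite S\<close> pos \<open>linear F\<close>
proof (induction S arbitrary: F rule: finite_induct)
  case empty
  then show ?case using linear_0[OF lin2] linear_0[of F] by auto
next
  case (insert e S)
  have pos: "0 < B x x" if "x \<in> span S" "x \<noteq> 0" for x
    using insert.prems(1)[of x] that span_mono[of S "insert e S"] by auto
  obtain z where z: "z \<in> span S" "\<And>v. v \<in> span S \<Longrightarrow> B z v = B e v"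
    using insert.IH[OF pos lin2[of e]] by auto
  obtain u where u: "u \<in> span S" "\<And>v. v \<in> span S \<Longrightarrow> B u v = F v"
    using insert.IH[OF pos insert.prems(2)] by auto
  define d where "d = e - z"
  have d0: "B d v = 0" if "v \<in> span S" for v
    using z(2)[OF that] linear_diff[OF lin1, of e z v] by (simp add: d_def)
  show ?case
  proof (cases "d = 0")
    case True
    then have "span (insert e S) = span S" using z(1) by (simp add: d_def span_redundant)
    then show ?thesis using u by auto
  next
    case False
    have dS: "d \<in> span (insert e S)"
      unfolding d_def using z(1) span_mono[of S "insert e S"] by (intro span_diff) (auto intro: span_base)
    have "0 < B d d" using insert.prems(1)[OF dS False] .
    \<comment> \<open>The only coefficient for which testing with \<open>d\<close> itself succeeds;
      testing with the smaller span is unaffected since \<open>B d\<close> vanishes there.\<close>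
    define s where "s = (F d - B u d) / B d d"
    show ?thesis
    proof (intro bexI[of _ "u + s *\<^sub>R d"] ballI)
      show "u + s *\<^sub>R d \<in> span (insert e S)"
        using u(1) dS span_mono[of S "insert e S"] by (intro span_add span_scale) auto
      fix v assume "v \<in> span (insert e S)"
      then obtain k where k: "v - k *\<^sub>R e \<in> span S" by (auto simp: span_insert)
      define y where "y = v - k *\<^sub>R d"
      have y: "y \<in> span S"
        using span_add[OF k span_scale[OF z(1), of k]] by (simp add: y_def d_def algebra_simps)
      have v: "v = y + k *\<^sub>R d" by (simp add: y_def)
      have "B (u + s *\<^sub>R d) v = B u v + s * B d v"
        by (simp add: linear_add[OF lin1] linear_cmul[OF lin1])
      also have "B d v = k * B d d"
        using d0[OF y] by (simp add: v linear_add[OF lin2] linear_cmul[OF lin2])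
      also have "B u v = F y + k * B u d"
        using u(2)[OF y] by (simp add: v linear_add[OF lin2] linear_cmul[OF lin2])
      also have "F y + k * B u d + s * (k * B d d) = F y + k * F d"
        using \<open>0 < B d d\<close> by (simp add: s_def field_simps)
      also have "\<dots> = F v" by (simp add: v linear_add[OF insert.prems(2)] linear_cmul[OF insert.prems(2)])
      finally show "B (u + s *\<^sub>R d) v = F v" .
    qed
  qed
qed

text \<open>The equations at \<open>q\<close> and \<open>r\<close> are subtracted and tested with
  \<open>G q - G r\<close>. Coercivity first bounds \<open>G\<close> by \<open>K / l\<close> and
  then bounds the difference by the variation of \<open>F\<close> and \<open>B\<close>, where the
  latter is multiplied by the bounded \<open>G r\<close>.\<close>

lemma lax_milgram_lipschitz:
  fixes B :: "'q::real_normed_vector \<Rightarrow> 'a::real_normed_vector \<Rightarrow> 'a \<Rightarrow> real"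
  assumes "finite S" and lin1: "\<And>q y. linear (\<lambda>x. B q x y)" and lin2: "\<And>q x. linear (B q x)"
    and linF: "\<And>q. linear (F q)"
    and coer: "\<And>q x. x \<in> span S \<Longrightarrow> l * (norm x)\<^sup>2 \<le> B q x x" and l: "0 < l"
    and K: "0 \<le> K" "\<And>q v. \<bar>F q v\<bar> \<le> K * norm v" "\<And>q r v. \<bar>F q v - F r v\<bar> \<le> K * norm v * norm (q - r)"
      "\<And>q r u v. \<bar>B q u v - B r u v\<bar> \<le> K * (norm u * norm v) * norm (q - r)"
  obtains G L where "0 < L" and "\<And>q r. norm (G q - G r) \<le> L * norm (q - r)" and "\<And>q. G q \<in> span S"
    and "\<And>q v. v \<in> span S \<Longrightarrow> B q (G q) v = F q v"
    and "\<And>q u. u \<in> span S \<Longrightarrow> (\<And>v. v \<in> span S \<Longrightarrow> B q u v = F q v) \<Longrightarrow> u = G q"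
proof -
  have pos: "0 < B q x x" if "x \<in> span S" "x \<noteq> 0" for q x
    using coer[OF that(1), of q] l that(2) by (smt (verit) mult_pos_pos zero_less_norm_iff zero_less_power)
  have "\<exists>u\<in>span S. \<forall>v\<in>span S. B q u v = F q v" for q
    by (rule lax_milgram_span[OF \<open>finite S\<close> lin1 lin2 pos linF])
  then obtain G where G: "\<And>q. G q \<in> span S" "\<And>q v. v \<in> span S \<Longrightarrow> B q (G q) v = F q v"
    by metis
  have G_bound: "norm (G q) \<le> K / l" for q
  proof -
    have "l * (norm (G q))\<^sup>2 \<le> K * norm (G q)"
      using coer[OF G(1), of q q] G(2)[OF G(1), of q] K(2)[of q "G q"] by auto
    then have "l * norm (G q) \<le> K" using K(1) l
      by (cases "norm (G q) = 0") (auto simp: power2_eq_square)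
    then show ?thesis using l by (simp add: field_simps)
  qed
  \<comment> \<open>The summand 1 only keeps \<open>L\<close> positive when
    \<open>K = 0\<close>.\<close>
  define L where "L = (K + K * (K / l)) / l + 1"
  show thesis
  proof
    show "0 < L" using K(1) l by (simp add: L_def add_nonneg_pos)
    show "norm (G q - G r) \<le> L * norm (q - r)" for q r
    proof -
      define d where "d = G q - G r"
      have d: "d \<in> span S" unfolding d_def by (intro span_diff G)
      have "l * (norm d)\<^sup>2 \<le> B q d d" by (rule coer[OF d])
      also have "\<dots> = (F q d - F r d) + (B r (G r) d - B q (G r) d)"
        using G(2)[OF d, of q] G(2)[OF d, of r] linear_diff[OF lin1, of q "G q" "G r" d] by (simp add: d_def)
      also have "\<dots> \<le> K * norm d * norm (q - r) + K * (norm (G r) * norm d) * norm (q - r)"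
        using K(3)[of q d r] K(4)[of q "G r" d r] by linarith
      also have "\<dots> \<le> K * norm d * norm (q - r) + K * (K / l * norm d) * norm (q - r)"
        using K(1) G_bound by (intro add_left_mono mult_right_mono mult_left_mono) auto
      finally have *: "norm d * (l * norm d) \<le> norm d * ((K + K * (K / l)) * norm (q - r))"
        by (simp add: power2_eq_square algebra_simps)
      have "l * norm d \<le> (K + K * (K / l)) * norm (q - r)"
      proof (cases "norm d = 0")
        case True
        then show ?thesis using K(1) l by simp
      next
        case False
        with * show ?thesis by (simp add: mult_le_cancel_left_pos)
      qed
      then have "norm d \<le> (K + K * (K / l)) / l * norm (q - r)" using l by (simp add: field_simps)
      also have "\<dots> \<le> L * norm (q - r)" by (intro mult_right_mono) (auto simp: L_def)
      finally show ?thesis by (simp add: d_def)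
    qed
    fix q u assume u: "u \<in> span S" and eq: "\<And>v. v \<in> span S \<Longrightarrow> B q u v = F q v"
    have d: "u - G q \<in> span S" by (intro span_diff u G)
    have "B q (u - G q) (u - G q) = 0"
      using eq[OF d] G(2)[OF d, of q] by (simp add: linear_diff[OF lin1])
    then show "u = G q" using pos[OF d, of q] by force
  qed (use G in auto)
qed

section \<open>The clipped nodal system\<close>

text \<open>The parameter \<open>z\<close> stands for the test vectors and the weight
  \<open>\<omega> z\<close> for their norms. With one constant valid for all \<open>z\<close>, such
  families are closed under sums and under products with multiplied weights, and their bounds have
  the shape that \<open>lax_milgram_lipschitz\<close> requires of \<open>F\<close> and
  \<open>B\<close>.\<close>

definition bounded_lipschitz_family :: "('z \<Rightarrow> real) \<Rightarrow> ('z \<Rightarrow> 'x::metric_space \<Rightarrow> real) \<Rightarrow> bool" where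
  "bounded_lipschitz_family \<omega> \<Psi> \<longleftrightarrow> (\<forall>z. 0 \<le> \<omega> z) \<and>
     (\<exists>L\<ge>0. \<forall>z x y. \<bar>\<Psi> z x\<bar> \<le> L * \<omega> z \<and> \<bar>\<Psi> z x - \<Psi> z y\<bar> \<le> L * \<omega> z * dist x y)"

lemma bounded_lipschitz_familyI:
  fixes \<Psi> :: "'z \<Rightarrow> 'x::metric_space \<Rightarrow> real"
  assumes "\<And>z. 0 \<le> \<omega> z" "\<And>z x. \<bar>\<Psi> z x\<bar> \<le> A * \<omega> z" "\<And>z x y. \<bar>\<Psi> z x - \<Psi> z y\<bar> \<le> B * \<omega> z * dist x y"
  shows "bounded_lipschitz_family \<omega> \<Psi>"
  unfolding bounded_lipschitz_family_def
proof (intro conjI allI exI)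
  define L where "L = max 0 (max A B)"
  show "0 \<le> L" by (simp add: L_def)
  fix z and x y :: 'x
  have "A * \<omega> z \<le> L * \<omega> z" "B * \<omega> z * dist x y \<le> L * \<omega> z * dist x y"
    using assms(1)[of z] by (auto simp: L_def intro!: mult_right_mono)
  then show "\<bar>\<Psi> z x\<bar> \<le> L * \<omega> z" "\<bar>\<Psi> z x - \<Psi> z y\<bar> \<le> L * \<omega> z * dist x y"
    using assms(2)[of z x] assms(3)[of z x y] by linarith+
qed (rule assms)

lemma bounded_lipschitz_family_const:
  assumes "\<And>z. \<bar>g z\<bar> \<le> A * \<omega> z" "\<And>z. 0 \<le> \<omega> z"
  shows "bounded_lipschitz_family \<omega> (\<lambda>z x. g z)"
  using assms by (intro bounded_lipschitz_familyI[where A=A and B=0]) auto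

lemma bounded_lipschitz_family_add:
  assumes "bounded_lipschitz_family \<omega> \<Psi>" "bounded_lipschitz_family \<omega> \<Psi>'"
  shows "bounded_lipschitz_family \<omega> (\<lambda>z x. \<Psi> z x + \<Psi>' z x)"
proof -
  obtain L where L: "0 \<le> L" "\<And>z. 0 \<le> \<omega> z" "\<And>z x. \<bar>\<Psi> z x\<bar> \<le> L * \<omega> z" "\<And>z x y. \<bar>\<Psi> z x - \<Psi> z y\<bar> \<le> L * \<omega> z * dist x y"
    using assms(1) by (auto simp: bounded_lipschitz_family_def)
  obtain M where M: "0 \<le> M" "\<And>z x. \<bar>\<Psi>' z x\<bar> \<le> M * \<omega> z" "\<And>z x y. \<bar>\<Psi>' z x - \<Psi>' z y\<bar> \<le> M * \<omega> z * dist x y"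
    using assms(2) by (auto simp: bounded_lipschitz_family_def)
  show ?thesis
  proof (rule bounded_lipschitz_familyI[where A="L+M" and B="L+M", OF L(2)])
    show "\<bar>\<Psi> z x + \<Psi>' z x\<bar> \<le> (L + M) * \<omega> z" for z x
      using L(3)[of z x] M(2)[of z x] abs_triangle_ineq[of "\<Psi> z x" "\<Psi>' z x"] by (simp add: distrib_right)
    show "\<bar>\<Psi> z x + \<Psi>' z x - (\<Psi> z y + \<Psi>' z y)\<bar> \<le> (L + M) * \<omega> z * dist x y" for z x y
      using L(4)[of z x y] M(3)[of z x y] by (simp add: distrib_right)
  qed
qed

lemma bounded_lipschitz_family_mult:
  assumes "bounded_lipschitz_family \<omega> \<Psi>" "bounded_lipschitz_family \<omega>' \<Psi>'"
  shows "bounded_lipschitz_family (\<lambda>z. \<omega> z * \<omega>' z) (\<lambda>z x. \<Psi> z x * \<Psi>' z x)"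
proof -
  obtain L where L: "0 \<le> L" "\<And>z. 0 \<le> \<omega> z" "\<And>z x. \<bar>\<Psi> z x\<bar> \<le> L * \<omega> z" "\<And>z x y. \<bar>\<Psi> z x - \<Psi> z y\<bar> \<le> L * \<omega> z * dist x y"
    using assms(1) by (auto simp: bounded_lipschitz_family_def)
  obtain M where M: "0 \<le> M" "\<And>z. 0 \<le> \<omega>' z" "\<And>z x. \<bar>\<Psi>' z x\<bar> \<le> M * \<omega>' z" "\<And>z x y. \<bar>\<Psi>' z x - \<Psi>' z y\<bar> \<le> M * \<omega>' z * dist x y"
    using assms(2) by (auto simp: bounded_lipschitz_family_def)
  show ?thesis
  proof (rule bounded_lipschitz_familyI[where A="L*M" and B="2*L*M"])
    show "0 \<le> \<omega> z * \<omega>' z" for z using L(2) M(2) by simp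
    show "\<bar>\<Psi> z x * \<Psi>' z x\<bar> \<le> L * M * (\<omega> z * \<omega>' z)" for z x
      using mult_mono[OF L(3)[of z x] M(3)[of z x]] L(1) L(2)[of z] by (simp add: abs_mult algebra_simps)
    fix z x y
    have "\<Psi> z x * \<Psi>' z x - \<Psi> z y * \<Psi>' z y = (\<Psi> z x - \<Psi> z y) * \<Psi>' z x + \<Psi> z y * (\<Psi>' z x - \<Psi>' z y)"
      by (simp add: algebra_simps)
    moreover have "\<bar>(\<Psi> z x - \<Psi> z y) * \<Psi>' z x\<bar> \<le> (L * \<omega> z * dist x y) * (M * \<omega>' z)"
      unfolding abs_mult by (rule mult_mono[OF L(4) M(3)]) (use L(1) L(2)[of z] in auto)
    moreover have "\<bar>\<Psi> z y * (\<Psi>' z x - \<Psi>' z y)\<bar> \<le> (L * \<omega> z) * (M * \<omega>' z * dist x y)"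
      unfolding abs_mult by (rule mult_mono[OF L(3) M(4)]) (use L(1) L(2)[of z] in auto)
    ultimately show "\<bar>\<Psi> z x * \<Psi>' z x - \<Psi> z y * \<Psi>' z y\<bar> \<le> 2 * L * M * (\<omega> z * \<omega>' z) * dist x y"
      by (simp add: algebra_simps)
  qed
qed

lemma bounded_lipschitz_family_sum:
  assumes "finite I" "\<And>i. i \<in> I \<Longrightarrow> bounded_lipschitz_family \<omega> (\<Psi> i)" "\<And>z. 0 \<le> \<omega> z"
  shows "bounded_lipschitz_family \<omega> (\<lambda>z x. \<Sum>i\<in>I. \<Psi> i z x)"
  using assms(1,2)
proof (induction I rule: finite_induct)
  case empty
  then show ?case using assms(3) by (intro bounded_lipschitz_familyI[of _ _ 0 0]) auto
next
  case (insert i I)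
  then show ?case by (simp add: bounded_lipschitz_family_add)
qed

lemma bounded_lipschitz_family_cmult:
  assumes "bounded_lipschitz_family \<omega> \<Psi>"
  shows "bounded_lipschitz_family \<omega> (\<lambda>z x. a * \<Psi> z x)"
proof -
  have "bounded_lipschitz_family (\<lambda>z. 1) (\<lambda>z x. a)"
    by (rule bounded_lipschitz_family_const[of _ "\<bar>a\<bar>"]) auto
  from bounded_lipschitz_family_mult[OF this assms] show ?thesis by simp
qed

lemma bounded_lipschitz_family_reindex:
  assumes "bounded_lipschitz_family \<omega> \<Psi>"
  shows "bounded_lipschitz_family (\<lambda>z. \<omega> (g z)) (\<lambda>z. \<Psi> (g z))"
  using assms unfolding bounded_lipschitz_family_def by blast

section \<open>The discrete mass and load forms\<close>

lemma perp_simps [simp]: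
  "perp v $ 1 = - v $ 2" "perp v $ 2 = v $ 1"
  by (simp_all add: perp_def)

lemma perp_linear: "linear perp"
  by (rule linearI) (simp_all add: vec_eq_iff forall_2)

lemmas perp_diff = linear_diff[OF perp_linear]
  and perp_scaleR = linear_cmul[OF perp_linear]
  and perp_0 [simp] = linear_0[OF perp_linear]

lemma norm_perp [simp]: "norm (perp v) = norm v"
  by (simp add: norm_vec_def L2_set_def sum_2 add.commute)

text \<open>For \<open>s = (norm q)\<^sup>2\<close> this is \<open>(norm q)\<^sup>2\<close> times
  the pairing of \<open>\<alpha> u + (1 - \<alpha>) (u \<bullet> n) n\<close> with \<open>v\<close>,
  where \<open>perp q = norm q *\<^sub>R n\<close>; it is polynomial in \<open>q\<close> and does
  not degenerate in form at \<open>q = 0\<close>. The weight \<open>s\<close> is a separate argument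
  so that it alone can be bounded from below by clipping.\<close>

definition mass_density :: "real \<Rightarrow> real \<Rightarrow> real^2 \<Rightarrow> real^2 \<Rightarrow> real^2 \<Rightarrow> real" where
  "mass_density \<alpha> s q u v = \<alpha> * s * (u \<bullet> v) + (1 - \<alpha>) * ((u \<bullet> perp q) * (v \<bullet> perp q))"

text \<open>Simpson's rule is exact for the quadratic integrands on each element; this is where the weights come from.\<close>

definition mass_form ::
  "real \<Rightarrow> nat \<Rightarrow> (nat \<Rightarrow> real) \<Rightarrow> (nat \<Rightarrow> real) \<Rightarrow> (nat \<Rightarrow> real^2) \<Rightarrow> (nat \<Rightarrow> real^2) \<Rightarrow> (nat \<Rightarrow> real^2) \<Rightarrow> real" where
  "mass_form \<alpha> N h s q u v = (\<Sum>j=1..N. 1 / (6 * h j) *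
     (2 * mass_density \<alpha> (s j) (q j) (u (j-1)) (v (j-1)) + mass_density \<alpha> (s j) (q j) (u (j-1)) (v j)
      + mass_density \<alpha> (s j) (q j) (u j) (v (j-1)) + 2 * mass_density \<alpha> (s j) (q j) (u j) (v j)))"

text \<open>The stiffness term plus the forcing term for a given value \<open>y\<close> of
  \<open>f\<close>. As \<open>q\<close> is an edge, not a derivative, each term carries
  \<open>1 / h j\<close>; the forcing integrand is affine on an element, so the mean of the end
  values is exact.\<close>

definition load_form :: "nat \<Rightarrow> (nat \<Rightarrow> real) \<Rightarrow> (nat \<Rightarrow> real^2) \<Rightarrow> real \<Rightarrow> (nat \<Rightarrow> real^2) \<Rightarrow> real" where
  "load_form N h q y v = (\<Sum>j=1..N. 1 / h j * (q j \<bullet> (v j - v (j-1))))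
     + y * (\<Sum>j=1..N. 1 / (2 * h j) * (norm (q j) * ((v (j-1) + v j) \<bullet> perp (q j))))"

lemma linear_mass_density: "linear (\<lambda>u. mass_density \<alpha> s q u v)" "linear (mass_density \<alpha> s q u)"
  by (rule linearI; simp add: mass_density_def inner_simps algebra_simps)+

lemma mass_form_add:
  "mass_form \<alpha> N h s q (\<lambda>j. u j + u' j) v = mass_form \<alpha> N h s q u v + mass_form \<alpha> N h s q u' v"
  "mass_form \<alpha> N h s q v (\<lambda>j. u j + u' j) = mass_form \<alpha> N h s q v u + mass_form \<alpha> N h s q v u'"
  unfolding mass_form_def sum.distrib[symmetric]
  by (intro sum.cong refl; simp only: linear_add[OF linear_mass_density(1)] linear_add[OF linear_mass_density(2)]; simp only: algebra_simps)+

lemma mass_form_scaleR: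
  "mass_form \<alpha> N h s q (\<lambda>j. r *\<^sub>R u j) v = r * mass_form \<alpha> N h s q u v"
  "mass_form \<alpha> N h s q v (\<lambda>j. r *\<^sub>R u j) = r * mass_form \<alpha> N h s q v u"
  unfolding mass_form_def sum_distrib_left
  by (intro sum.cong refl; simp only: linear_cmul[OF linear_mass_density(1)] linear_cmul[OF linear_mass_density(2)] real_scaleR_def; simp only: algebra_simps)+

lemma load_form_add: "load_form N h q y (\<lambda>j. u j + v j) = load_form N h q y u + load_form N h q y v"
  unfolding load_form_def
  by (simp add: inner_simps sum.distrib sum_subtractf distrib_left right_diff_distrib add_divide_distrib diff_divide_distrib)

lemma load_form_scaleR: "load_form N h q y (\<lambda>j. r *\<^sub>R u j) = r * load_form N h q y u"
  unfolding load_form_def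
  by (simp add: inner_simps distrib_left sum_distrib_left mult.left_commute flip: scaleR_diff_right scaleR_add_right)

lemma mass_density_ge: "0 \<le> \<alpha> \<Longrightarrow> \<alpha> \<le> 1 \<Longrightarrow> \<alpha> * s * (norm u)\<^sup>2 \<le> mass_density \<alpha> s q u u"
  by (simp add: mass_density_def power2_norm_eq_inner)

text \<open>The difference of the two sides is \<open>m (u + v) (u + v)\<close>. In other words, the
  element mass matrix with diagonal 2 and off-diagonal 1 dominates the identity.\<close>

lemma quadratic_pair_ge:
  assumes "\<And>u. 0 \<le> m u u" and lin: "\<And>v. linear (\<lambda>u. m u v)" "\<And>u. linear (m u)"
  shows "m u u + m v v \<le> 2 * m u u + m u v + m v u + 2 * (m v v :: real)"
proof -
  have "0 \<le> m (u + v) (u + v)" by (rule assms)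
  also have "m (u + v) (u + v) = m u u + m u v + m v u + m v v"
    by (simp add: linear_add[OF lin(1)] linear_add[OF lin(2)])
  finally show ?thesis by simp
qed

section \<open>A Banach space of nodal vectors\<close>

instantiation nat :: metric_space
begin

definition dist_nat :: "nat \<Rightarrow> nat \<Rightarrow> real" where
  "dist_nat m n = (if m = n then 0 else 1)"

definition uniformity_nat :: "(nat \<times> nat) filter" where
  "uniformity_nat = (INF e\<in>{0 <..}. principal {(x, y). dist x y < e})"

instance
proof
  fix U :: "nat set" and x y z :: nat
  show "open U = (\<forall>x\<in>U. \<forall>\<^sub>F (x', y) in uniformity. x' = x \<longrightarrow> y \<in> U)"
    unfolding uniformity_nat_def
    by (auto simp: open_discrete eventually_principal dist_nat_def intro!: eventually_INF1[of 1])
  show "dist x y \<le> dist x z + dist y z" by (simp add: dist_nat_def)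
qed (auto simp: dist_nat_def uniformity_nat_def)

end

instance bcontfun :: (metric_space, banach) banach ..

text \<open>The number of nodes is not a type, so nodal vectors live in a fixed Banach space of sequences and are supported
  on \<open>{1..N}\<close>. The discrete metric turns \<open>nat\<close> into a domain for \<open>bcontfun\<close>.\<close>

type_synonym nodal = "nat \<Rightarrow>\<^sub>C (real^2)"

lemma apply_Bcontfun_nat:
  fixes c :: "nat \<Rightarrow> 'a::real_normed_vector"
  assumes "\<And>j. j \<notin> {1..N} \<Longrightarrow> c j = 0"
  shows "apply_bcontfun (Bcontfun c) = c"
proof (rule Bcontfun_inverse)
  have "range c \<subseteq> insert 0 (c ` {1..N})" using assms by (force simp: image_iff)
  then have "bounded (range c)" by (rule bounded_subset[rotated]) (simp add: finite_imp_bounded)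
  then show "c \<in> bcontfun" by (simp add: bcontfun_def continuous_on_discrete)
qed

definition unit_nodal :: "nat \<Rightarrow> real^2 \<Rightarrow> nodal" where
  "unit_nodal i e = Bcontfun (\<lambda>j. if j = i then e else 0)"

lemma apply_unit_nodal: "1 \<le> i \<Longrightarrow> apply_bcontfun (unit_nodal i e) j = (if j = i then e else 0)"
  unfolding unit_nodal_def by (subst apply_Bcontfun_nat[of i]) auto

text \<open>Only the generators; the space of nodal vectors is their span. Finiteness of this set is
  what the induction of \<open>lax_milgram_span\<close> runs on.\<close>

definition nodal_space :: "nat \<Rightarrow> nodal set" where
  "nodal_space N = (\<lambda>(i, e). unit_nodal i e) ` ({1..N} \<times> Basis)"

definition embed_nodal :: "nat \<Rightarrow> (nat \<Rightarrow> real^2) \<Rightarrow> nodal" where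
  "embed_nodal N c = (\<Sum>i=1..N. \<Sum>e\<in>Basis. (c i \<bullet> e) *\<^sub>R unit_nodal i e)"

lemma apply_bcontfun_sum: "apply_bcontfun (\<Sum>i\<in>I. f i) x = (\<Sum>i\<in>I. apply_bcontfun (f i) x)"
  by (induction I rule: infinite_finite_induct) auto

lemma apply_embed_nodal: "apply_bcontfun (embed_nodal N c) j = (if j \<in> {1..N} then c j else 0)"
proof -
  have "apply_bcontfun (embed_nodal N c) j = (\<Sum>i=1..N. \<Sum>e\<in>Basis. (c i \<bullet> e) *\<^sub>R (if j = i then e else 0))"
    unfolding embed_nodal_def by (simp add: apply_bcontfun_sum apply_unit_nodal)
  also have "\<dots> = (\<Sum>i=1..N. if j = i then c i else 0)"
    by (intro sum.cong refl) (auto simp: euclidean_representation)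
  finally show ?thesis by (simp add: sum.delta')
qed

lemma embed_nodal_in_span: "embed_nodal N c \<in> span (nodal_space N)"
  unfolding embed_nodal_def nodal_space_def
  by (intro span_sum span_scale span_base) (auto simp: image_iff)

lemma span_nodal_outside:
  assumes "x \<in> span (nodal_space N)" "j \<notin> {1..N}"
  shows "apply_bcontfun x j = 0"
  using assms(1)
  by (induction rule: span_induct_alt) (use assms(2) in \<open>auto simp: nodal_space_def apply_unit_nodal\<close>)

lemma finite_nodal_space: "finite (nodal_space N)"
  by (simp add: nodal_space_def)

text \<open>Unknowns carry the indices 1 to \<open>N\<close>, while edges and element integrals
  refer to \<open>j - 1\<close>; node 0 is read as node \<open>N\<close>.\<close>

definition wrap :: "nat \<Rightarrow> (nat \<Rightarrow> 'a) \<Rightarrow> nat \<Rightarrow> 'a" where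
  "wrap N x j = x (if j = 0 then N else j)"

definition edge :: "(nat \<Rightarrow> real^2) \<Rightarrow> nat \<Rightarrow> real^2" where
  "edge c j = c j - c (j - 1)"

section \<open>Clipped coefficients and the clipped evolution\<close>

definition clip :: "real \<Rightarrow> real^2 \<Rightarrow> real^2" where
  "clip R = closest_point (cball 0 R)"

lemma clip_bounds: "0 \<le> R \<Longrightarrow> norm (clip R q) \<le> R"
  using closest_point_in_set[of "cball 0 R" q] by (simp add: clip_def)

lemma clip_lipschitz: "0 \<le> R \<Longrightarrow> norm (clip R p - clip R q) \<le> norm (p - q)"
  using closest_point_lipschitz[of "cball 0 R" p q] by (simp add: clip_def dist_norm)

lemma clip_id: "norm q \<le> R \<Longrightarrow> clip R q = q"
  by (simp add: clip_def closest_point_self)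

text \<open>Three modifications make the system globally Lipschitz. Edges are cut to length
  \<open>R\<close>, so the coefficients are bounded; the weight of the \<alpha>-part is kept above
  \<open>\<mu>\<^sup>2\<close>, so the mass form stays coercive even for vanishing edges; the
  perimeter is kept above \<mu>, where \<open>f\<close> is known to be Lipschitz.\<close>

locale fem_ode =
  fixes \<alpha> :: real and N :: nat and h :: "nat \<Rightarrow> real" and \<mu> R :: real and f :: "real \<Rightarrow> real"
  assumes \<alpha>: "0 < \<alpha>" "\<alpha> \<le> 1" and N: "1 \<le> N" and h: "\<And>j. j \<in> {1..N} \<Longrightarrow> 0 < h j"
    and \<mu>: "0 < \<mu>" and R: "\<mu> \<le> R" and f: "\<exists>l. l-lipschitz_on {0<..} f"
begin

definition cq :: "nodal \<Rightarrow> nat \<Rightarrow> real^2" where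
  "cq x j = clip R (edge (wrap N x) j)"

definition cs :: "nodal \<Rightarrow> nat \<Rightarrow> real" where
  "cs x j = max (\<mu>\<^sup>2) ((norm (cq x j))\<^sup>2)"

definition cf :: "nodal \<Rightarrow> real" where
  "cf x = f (max \<mu> (\<Sum>j=1..N. norm (cq x j)))"

definition B :: "nodal \<Rightarrow> nodal \<Rightarrow> nodal \<Rightarrow> real" where
  "B x u v = mass_form \<alpha> N h (cs x) (cq x) (wrap N u) (wrap N v)"

definition F :: "nodal \<Rightarrow> nodal \<Rightarrow> real" where
  "F x v = - load_form N h (cq x) (cf x) (wrap N v)"

lemma R0: "0 \<le> R" using \<mu> R by simp

lemma cq_bound: "norm (cq x j) \<le> R"
  unfolding cq_def by (rule clip_bounds[OF R0])

lemma cq_lipschitz: "norm (cq x j - cq y j) \<le> 2 * dist x y"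
proof -
  have "norm (cq x j - cq y j) \<le> norm (edge (wrap N x) j - edge (wrap N y) j)"
    unfolding cq_def by (rule clip_lipschitz[OF R0])
  also have "\<dots> = norm ((wrap N x j - wrap N y j) - (wrap N x (j-1) - wrap N y (j-1)))"
    by (simp add: edge_def algebra_simps)
  also have "\<dots> \<le> norm (wrap N x j - wrap N y j) + norm (wrap N x (j-1) - wrap N y (j-1))"
    by (rule norm_triangle_ineq4)
  also have "\<dots> \<le> dist x y + dist x y"
    unfolding wrap_def by (intro add_mono) (simp_all add: dist_bounded flip: dist_norm)
  finally show ?thesis by simp
qed

lemma norm_cq_blf: "bounded_lipschitz_family (\<lambda>z. 1) (\<lambda>z x. norm (cq x j))"
proof (rule bounded_lipschitz_familyI[where A=R and B=2])
  show "\<bar>norm (cq x j) - norm (cq y j)\<bar> \<le> 2 * 1 * dist x y" for x y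
    using norm_triangle_ineq3[of "cq x j" "cq y j"] cq_lipschitz[of x j y] by linarith
qed (auto simp: cq_bound)

lemma cs_blf: "bounded_lipschitz_family (\<lambda>z. 1) (\<lambda>z x. cs x j)"
proof -
  obtain L where L: "0 \<le> L" "\<And>x. \<bar>norm (cq x j) * norm (cq x j)\<bar> \<le> L * (1 * 1)"
      "\<And>x y. \<bar>norm (cq x j) * norm (cq x j) - norm (cq y j) * norm (cq y j)\<bar> \<le> L * (1 * 1) * dist x y"
    using bounded_lipschitz_family_mult[OF norm_cq_blf[of j] norm_cq_blf[of j]]
    by (auto simp: bounded_lipschitz_family_def)
  show ?thesis
  proof (rule bounded_lipschitz_familyI[where A="L + \<mu>\<^sup>2" and B=L])
    show "\<bar>cs x j\<bar> \<le> (L + \<mu>\<^sup>2) * 1" for x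
    proof -
      have "0 \<le> cs x j" "cs x j \<le> \<mu>\<^sup>2 + norm (cq x j) * norm (cq x j)"
        by (auto simp: cs_def le_max_iff_disj power2_eq_square)
      with L(2)[of x] show ?thesis by simp
    qed
    show "\<bar>cs x j - cs y j\<bar> \<le> L * 1 * dist x y" for x y
      using L(3)[of x y] unfolding cs_def power2_eq_square by linarith
  qed auto
qed

text \<open>Both arguments of \<open>f\<close> lie above \<mu>, hence in the domain of its Lipschitz
  bound; boundedness follows by comparison with \<open>f \<mu>\<close>, since the clipped perimeter
  is bounded.\<close>

lemma cf_blf: "bounded_lipschitz_family (\<lambda>z. 1) (\<lambda>z x. cf x)"
proof -
  have "bounded_lipschitz_family (\<lambda>z. 1) (\<lambda>z x. \<Sum>j=1..N. norm (cq x j))"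
    by (intro bounded_lipschitz_family_sum norm_cq_blf) auto
  then obtain L where L: "0 \<le> L" "\<And>x. \<bar>\<Sum>j=1..N. norm (cq x j)\<bar> \<le> L * 1"
      "\<And>x y. \<bar>(\<Sum>j=1..N. norm (cq x j)) - (\<Sum>j=1..N. norm (cq y j))\<bar> \<le> L * 1 * dist x y"
    by (auto simp: bounded_lipschitz_family_def)
  obtain l where l: "l-lipschitz_on {0<..} f" using f by blast
  have l0: "0 \<le> l" using l by (rule lipschitz_on_nonneg)
  have lip: "\<bar>f a - f b\<bar> \<le> l * \<bar>a - b\<bar>" if "0 < a" "0 < b" for a b
    using lipschitz_onD[OF l, of a b] that by (simp add: dist_real_def)
  show ?thesis
  proof (rule bounded_lipschitz_familyI[where A="\<bar>f \<mu>\<bar> + l * L" and B="l * L"])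
    show "\<bar>cf x\<bar> \<le> (\<bar>f \<mu>\<bar> + l * L) * 1" for x
    proof -
      have "\<bar>cf x - f \<mu>\<bar> \<le> l * \<bar>max \<mu> (\<Sum>j=1..N. norm (cq x j)) - \<mu>\<bar>"
        unfolding cf_def using \<mu> by (intro lip) auto
      also have "\<dots> \<le> l * L" using L(1) L(2)[of x] l0 \<mu> by (intro mult_left_mono) auto
      finally show ?thesis using abs_triangle_ineq2[of "cf x" "f \<mu>"] by simp
    qed
    show "\<bar>cf x - cf y\<bar> \<le> l * L * 1 * dist x y" for x y
    proof -
      have "\<bar>cf x - cf y\<bar> \<le> l * \<bar>max \<mu> (\<Sum>j=1..N. norm (cq x j)) - max \<mu> (\<Sum>j=1..N. norm (cq y j))\<bar>"
        unfolding cf_def using \<mu> by (intro lip) auto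
      also have "\<dots> \<le> l * (L * dist x y)" using L(3)[of x y] l0 by (intro mult_left_mono) linarith+
      finally show ?thesis by simp
    qed
  qed auto
qed

lemma norm_wrap: "norm (wrap N (apply_bcontfun u) j) \<le> norm u"
  by (simp add: wrap_def norm_bounded)

lemma inner_cq_blf: "bounded_lipschitz_family norm (\<lambda>u x. wrap N (apply_bcontfun u) i \<bullet> cq x j)"
proof (rule bounded_lipschitz_familyI[where A=R and B=2])
  show "\<bar>wrap N (apply_bcontfun u) i \<bullet> cq x j\<bar> \<le> R * norm u" for u x
    using Cauchy_Schwarz_ineq2[of "wrap N (apply_bcontfun u) i" "cq x j"] mult_mono[OF norm_wrap[of u i] cq_bound[of x j]]
    by (simp add: mult.commute)
  show "\<bar>wrap N (apply_bcontfun u) i \<bullet> cq x j - wrap N (apply_bcontfun u) i \<bullet> cq y j\<bar> \<le> 2 * norm u * dist x y" for u x y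
    using Cauchy_Schwarz_ineq2[of "wrap N (apply_bcontfun u) i" "cq x j - cq y j"]
      mult_mono[OF norm_wrap[of u i] cq_lipschitz[of x j y]]
    by (simp add: inner_diff_right algebra_simps)
qed auto

lemma inner_perp_cq_blf: "bounded_lipschitz_family norm (\<lambda>u x. wrap N (apply_bcontfun u) i \<bullet> perp (cq x j))"
proof (rule bounded_lipschitz_familyI[where A=R and B=2])
  show "\<bar>wrap N (apply_bcontfun u) i \<bullet> perp (cq x j)\<bar> \<le> R * norm u" for u x
    using Cauchy_Schwarz_ineq2[of "wrap N (apply_bcontfun u) i" "perp (cq x j)"] mult_mono[OF norm_wrap[of u i] cq_bound[of x j]]
    by (simp add: mult.commute)
  show "\<bar>wrap N (apply_bcontfun u) i \<bullet> perp (cq x j) - wrap N (apply_bcontfun u) i \<bullet> perp (cq y j)\<bar> \<le> 2 * norm u * dist x y" for u x y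
  proof -
    have "\<bar>wrap N (apply_bcontfun u) i \<bullet> perp (cq x j - cq y j)\<bar> \<le> norm u * (2 * dist x y)"
      using Cauchy_Schwarz_ineq2[of "wrap N (apply_bcontfun u) i" "perp (cq x j - cq y j)"]
        mult_mono[OF norm_wrap[of u i] cq_lipschitz[of x j y]] by simp
    then show ?thesis by (simp add: perp_diff inner_diff_right algebra_simps)
  qed
qed auto

lemma density_blf: "bounded_lipschitz_family (\<lambda>(u,v). norm u * norm v)
  (\<lambda>(u,v) x. mass_density \<alpha> (cs x j) (cq x j) (wrap N (apply_bcontfun u) i) (wrap N (apply_bcontfun v) k))"
proof -
  have 1: "bounded_lipschitz_family (\<lambda>z. norm (fst z) * norm (snd z)) (\<lambda>(z::nodal\<times>nodal) (x::nodal). wrap N (apply_bcontfun (fst z)) i \<bullet> wrap N (apply_bcontfun (snd z)) k)"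
  proof (rule bounded_lipschitz_family_const[of _ 1])
    fix z :: "nodal \<times> nodal"
    show "\<bar>wrap N (apply_bcontfun (fst z)) i \<bullet> wrap N (apply_bcontfun (snd z)) k\<bar> \<le> 1 * (norm (fst z) * norm (snd z))"
      using Cauchy_Schwarz_ineq2[of "wrap N (apply_bcontfun (fst z)) i" "wrap N (apply_bcontfun (snd z)) k"]
        mult_mono[OF norm_wrap[of "fst z" i] norm_wrap[of "snd z" k]] by simp
  qed auto
  have 2: "bounded_lipschitz_family (\<lambda>z. 1 * (norm (fst z) * norm (snd z))) (\<lambda>(z::nodal\<times>nodal) x. cs x j * (wrap N (apply_bcontfun (fst z)) i \<bullet> wrap N (apply_bcontfun (snd z)) k))"
    by (rule bounded_lipschitz_family_mult[OF cs_blf 1])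
  have 3: "bounded_lipschitz_family (\<lambda>z. norm (fst z) * norm (snd z))
     (\<lambda>(z::nodal\<times>nodal) x. (wrap N (apply_bcontfun (fst z)) i \<bullet> perp (cq x j)) * (wrap N (apply_bcontfun (snd z)) k \<bullet> perp (cq x j)))"
    by (rule bounded_lipschitz_family_mult[OF bounded_lipschitz_family_reindex[OF inner_perp_cq_blf] bounded_lipschitz_family_reindex[OF inner_perp_cq_blf]])
  show ?thesis
    using bounded_lipschitz_family_add[OF bounded_lipschitz_family_cmult[OF 2[simplified mult_1], of \<alpha>] bounded_lipschitz_family_cmult[OF 3, of "1-\<alpha>"]]
    by (simp add: mass_density_def case_prod_unfold mult.assoc)
qed

lemma B_blf: "bounded_lipschitz_family (\<lambda>(u,v). norm u * norm v) (\<lambda>(u,v) x. B x u v)"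
proof -
  have "bounded_lipschitz_family (\<lambda>(u,v). norm u * norm v) (\<lambda>z x. B x (fst z) (snd z))"
    unfolding B_def mass_form_def
    using density_blf
    by (intro bounded_lipschitz_family_sum bounded_lipschitz_family_cmult bounded_lipschitz_family_add)
       (auto simp: case_prod_unfold)
  then show ?thesis by (simp add: case_prod_unfold)
qed

lemma F_blf: "bounded_lipschitz_family norm (\<lambda>v x. F x v)"
proof -
  have 1: "bounded_lipschitz_family norm (\<lambda>v x. (-1 / h j) * (wrap N (apply_bcontfun v) j \<bullet> cq x j) + 1 / h j * (wrap N (apply_bcontfun v) (j-1) \<bullet> cq x j))" for j
    by (intro bounded_lipschitz_family_add bounded_lipschitz_family_cmult inner_cq_blf)
  have 2: "bounded_lipschitz_family (\<lambda>v. 1 * (1 * norm v)) (\<lambda>v x. cf x * (norm (cq x j) *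
      (wrap N (apply_bcontfun v) (j-1) \<bullet> perp (cq x j) + wrap N (apply_bcontfun v) j \<bullet> perp (cq x j))))" for j
    by (intro bounded_lipschitz_family_add bounded_lipschitz_family_mult inner_perp_cq_blf cf_blf norm_cq_blf)
  have 3: "bounded_lipschitz_family norm (\<lambda>v x. (\<Sum>j=1..N. (-1 / h j) * (wrap N (apply_bcontfun v) j \<bullet> cq x j) + 1 / h j * (wrap N (apply_bcontfun v) (j-1) \<bullet> cq x j))
    + (\<Sum>j=1..N. (- 1 / (2 * h j)) * (cf x * (norm (cq x j) *
      (wrap N (apply_bcontfun v) (j-1) \<bullet> perp (cq x j) + wrap N (apply_bcontfun v) j \<bullet> perp (cq x j))))))"
    by (intro bounded_lipschitz_family_add bounded_lipschitz_family_sum 1 bounded_lipschitz_family_cmult 2[simplified mult_1]) auto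
  \<comment> \<open>Regrouped so that every summand is a constant times a product of the basic
    families above.\<close>
  have "F x v = (\<Sum>j=1..N. (-1 / h j) * (wrap N (apply_bcontfun v) j \<bullet> cq x j) + 1 / h j * (wrap N (apply_bcontfun v) (j-1) \<bullet> cq x j))
    + (\<Sum>j=1..N. (- 1 / (2 * h j)) * (cf x * (norm (cq x j) *
      (wrap N (apply_bcontfun v) (j-1) \<bullet> perp (cq x j) + wrap N (apply_bcontfun v) j \<bullet> perp (cq x j)))))" for x v
    unfolding F_def load_form_def minus_add_distrib sum_distrib_left sum_negf[symmetric]
    by (intro arg_cong2[of _ _ _ _ "(+)"] sum.cong refl)
       (simp_all add: inner_add_left inner_diff_right inner_commute algebra_simps diff_divide_distrib)
  with 3 show ?thesis by simp
qed

lemma wrap_add: "wrap N (apply_bcontfun (u + v)) = (\<lambda>j. wrap N (apply_bcontfun u) j + wrap N (apply_bcontfun v) j)"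
  and wrap_scaleR: "wrap N (apply_bcontfun (c *\<^sub>R u)) = (\<lambda>j. c *\<^sub>R wrap N (apply_bcontfun u) j)"
  by (auto simp: wrap_def fun_eq_iff)

lemma linear_B: "linear (\<lambda>u. B x u v)" "linear (B x u)"
  by (rule linearI; simp only: B_def wrap_add wrap_scaleR mass_form_add mass_form_scaleR real_scaleR_def)+

lemma linear_F: "linear (F x)"
  by (rule linearI; simp only: F_def wrap_add wrap_scaleR load_form_add load_form_scaleR real_scaleR_def; simp)

text \<open>Element \<open>i\<close> alone controls \<open>u i\<close>, and all other elements
  contribute nonnegative amounts. The dependence on \<open>h i\<close> is harmless: coercivity is
  used on one fixed mesh to solve for the velocities, never in the error estimate.\<close>

lemma mass_form_ge:
  assumes s: "\<And>j. j \<in> {1..N} \<Longrightarrow> \<mu>\<^sup>2 \<le> s j" and i: "i \<in> {1..N}"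
  shows "\<alpha> * \<mu>\<^sup>2 / (6 * h i) * (norm (u i))\<^sup>2 \<le> mass_form \<alpha> N h s q u u"
proof -
  define T where "T j = 1 / (6 * h j) *
     (2 * mass_density \<alpha> (s j) (q j) (u (j-1)) (u (j-1)) + mass_density \<alpha> (s j) (q j) (u (j-1)) (u j)
      + mass_density \<alpha> (s j) (q j) (u j) (u (j-1)) + 2 * mass_density \<alpha> (s j) (q j) (u j) (u j))" for j
  have T: "\<alpha> * \<mu>\<^sup>2 / (6 * h j) * (norm (u j))\<^sup>2 \<le> T j" if j: "j \<in> {1..N}" for j
  proof -
    have 0: "\<alpha> * \<mu>\<^sup>2 * (norm v)\<^sup>2 \<le> mass_density \<alpha> (s j) (q j) v v" for v
    proof -
      have "\<alpha> * \<mu>\<^sup>2 * (norm v)\<^sup>2 \<le> \<alpha> * s j * (norm v)\<^sup>2"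
        using s[OF j] \<alpha> by (intro mult_right_mono mult_left_mono) auto
      also have "\<dots> \<le> mass_density \<alpha> (s j) (q j) v v" using \<alpha> by (intro mass_density_ge) auto
      finally show ?thesis .
    qed
    have nn: "0 \<le> mass_density \<alpha> (s j) (q j) v v" for v
      using 0[of v] \<alpha> by (smt (verit) mult_nonneg_nonneg zero_le_power2)
    have "\<alpha> * \<mu>\<^sup>2 * (norm (u j))\<^sup>2 \<le> mass_density \<alpha> (s j) (q j) (u (j-1)) (u (j-1)) + mass_density \<alpha> (s j) (q j) (u j) (u j)"
      using 0[of "u j"] nn[of "u (j-1)"] by linarith
    also have "\<dots> \<le> 2 * mass_density \<alpha> (s j) (q j) (u (j-1)) (u (j-1)) + mass_density \<alpha> (s j) (q j) (u (j-1)) (u j)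
      + mass_density \<alpha> (s j) (q j) (u j) (u (j-1)) + 2 * mass_density \<alpha> (s j) (q j) (u j) (u j)"
      by (rule quadratic_pair_ge[OF nn linear_mass_density])
    finally have "1 / (6 * h j) * (\<alpha> * \<mu>\<^sup>2 * (norm (u j))\<^sup>2) \<le> T j"
      unfolding T_def using h[OF j] by (intro mult_left_mono) auto
    then show ?thesis by simp
  qed
  have "0 \<le> T j" if "j \<in> {1..N}" for j
  proof -
    have "0 \<le> \<alpha> * \<mu>\<^sup>2 / (6 * h j) * (norm (u j))\<^sup>2" using \<alpha> h[OF that] by simp
    with T[OF that] show ?thesis by linarith
  qed
  then have "T i \<le> (\<Sum>j=1..N. T j)" by (intro member_le_sum i) auto
  with T[OF i] show ?thesis unfolding mass_form_def T_def by linarith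
qed

text \<open>The norm of a nodal vector is the supremum over its entries, and entries outside
  \<open>{1..N}\<close> vanish on the span, so the bound at each single node suffices.\<close>

lemma B_coercive:
  obtains l where "0 < l" "\<And>x u. u \<in> span (nodal_space N) \<Longrightarrow> l * (norm u)\<^sup>2 \<le> B x u u"
proof -
  define H where "H = Max (h ` {1..N})"
  have H: "h i \<le> H" if "i \<in> {1..N}" for i using that by (auto simp: H_def)
  have "0 < H" using H[of 1] h[of 1] N by auto
  define l where "l = \<alpha> * \<mu>\<^sup>2 / (6 * H)"
  have l: "0 < l" using \<alpha> \<mu> \<open>0 < H\<close> by (simp add: l_def)
  have "l * (norm u)\<^sup>2 \<le> B x u u" if u: "u \<in> span (nodal_space N)" for x u
  proof -
    have ge: "l * (norm (apply_bcontfun u i))\<^sup>2 \<le> B x u u" if i: "i \<in> {1..N}" for i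
    proof -
      have eq: "apply_bcontfun u i = wrap N (apply_bcontfun u) i" using i by (simp add: wrap_def)
      have "l * (norm (apply_bcontfun u i))\<^sup>2 \<le> \<alpha> * \<mu>\<^sup>2 / (6 * h i) * (norm (apply_bcontfun u i))\<^sup>2"
        unfolding l_def using H[OF i] h[OF i] \<alpha> \<open>0 < H\<close>
        by (intro mult_right_mono divide_left_mono) auto
      also have "\<dots> \<le> B x u u"
        unfolding B_def eq by (rule mass_form_ge[OF _ i]) (simp add: cs_def)
      finally show ?thesis .
    qed
    have B0: "0 \<le> B x u u"
      using ge[of 1] N l by (smt (verit) atLeastAtMost_iff mult_nonneg_nonneg order_refl zero_le_power2)
    have "norm u \<le> sqrt (B x u u / l)"
    proof (rule norm_bound)
      fix i
      show "norm (apply_bcontfun u i) \<le> sqrt (B x u u / l)"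
      proof (cases "i \<in> {1..N}")
        case True
        then show ?thesis using ge[OF True] l by (intro real_le_rsqrt) (simp add: field_simps)
      next
        case False
        then show ?thesis using span_nodal_outside[OF u False] B0 l by simp
      qed
    qed
    then have "(norm u)\<^sup>2 \<le> (sqrt (B x u u / l))\<^sup>2" by (intro power_mono) auto
    also have "\<dots> = B x u u / l" using B0 l by simp
    finally show ?thesis using l by (simp add: field_simps)
  qed
  with l that show thesis by blast
qed

text \<open>The operator that assigns to nodal positions the velocities determined by the clipped
  scheme. Its Lipschitz bound makes the scheme an ordinary differential equation; its uniqueness
  clause identifies the velocities of any given solution.\<close>

lemma velocity_field:
  obtains G L where "0 < L" and "\<And>q r. norm (G q - G r) \<le> L * norm (q - r)" and "\<And>q. G q \<in> span (nodal_space N)"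
    and "\<And>q v. v \<in> span (nodal_space N) \<Longrightarrow> B q (G q) v = F q v"
    and "\<And>q u. u \<in> span (nodal_space N) \<Longrightarrow> (\<And>v. v \<in> span (nodal_space N) \<Longrightarrow> B q u v = F q v) \<Longrightarrow> u = G q"
proof -
  obtain l where l: "0 < l" "\<And>x u. u \<in> span (nodal_space N) \<Longrightarrow> l * (norm u)\<^sup>2 \<le> B x u u"
    using B_coercive by blast
  obtain L1 where L1: "0 \<le> L1" "\<And>v x. \<bar>F x v\<bar> \<le> L1 * norm v" "\<And>v x y. \<bar>F x v - F y v\<bar> \<le> L1 * norm v * dist x y"
    using F_blf by (auto simp: bounded_lipschitz_family_def)
  obtain L2 where L2: "0 \<le> L2" "\<And>u v x y. \<bar>B x u v - B y u v\<bar> \<le> L2 * (norm u * norm v) * dist x y"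
    using B_blf by (auto simp: bounded_lipschitz_family_def)
  define K where "K = max L1 L2"
  have K: "L1 \<le> K" "L2 \<le> K" by (auto simp: K_def)
  have 1: "\<bar>F x v\<bar> \<le> K * norm v" for x v
    using L1(2)[of x v] mult_right_mono[OF K(1), of "norm v"] by simp
  have 2: "\<bar>F x v - F y v\<bar> \<le> K * norm v * norm (x - y)" for x y v
  proof -
    have "L1 * norm v * dist x y \<le> K * norm v * dist x y" using K by (intro mult_right_mono) auto
    with L1(3)[of x v y] show ?thesis by (simp add: dist_norm)
  qed
  have 3: "\<bar>B x u v - B y u v\<bar> \<le> K * (norm u * norm v) * norm (x - y)" for x y u v
  proof -
    have "L2 * (norm u * norm v) * dist x y \<le> K * (norm u * norm v) * dist x y" using K by (intro mult_right_mono) auto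
    with L2(2)[of x u v y] show ?thesis by (simp add: dist_norm)
  qed
  show thesis
  proof (rule lax_milgram_lipschitz[OF finite_nodal_space[of N] linear_B(1) linear_B(2) linear_F _ l(1) order_trans[OF L1(1) K(1)] 1 2 3])
    fix G L'
    assume "0 < L'" "\<And>q r. norm (G q - G r) \<le> L' * norm (q - r)" "\<And>q. G q \<in> span (nodal_space N)"
      "\<And>q v. v \<in> span (nodal_space N) \<Longrightarrow> B q (G q) v = F q v"
      "\<And>q u. u \<in> span (nodal_space N) \<Longrightarrow> (\<And>v. v \<in> span (nodal_space N) \<Longrightarrow> B q u v = F q v) \<Longrightarrow> u = G q"
    then show thesis by (rule that)
  qed (rule l(2))
qed

text \<open>The clipping is inactive as long as all edges have length between \<open>\<mu>\<close> and \<open>R\<close>.\<close>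

definition clipped_solution :: "real \<Rightarrow> (nat \<Rightarrow> real \<Rightarrow> real^2) \<Rightarrow> (nat \<Rightarrow> real \<Rightarrow> real^2) \<Rightarrow> bool" where
  "clipped_solution T c d \<longleftrightarrow> (\<forall>t\<in>{0..T}.
     (\<forall>j\<in>{1..N}. (c j has_vector_derivative d j t) (at t within {0..T})) \<and>
     (\<forall>v. let q = (\<lambda>j. clip R (edge (wrap N (\<lambda>j. c j t)) j)) in
        mass_form \<alpha> N h (\<lambda>j. max (\<mu>\<^sup>2) ((norm (q j))\<^sup>2)) q (wrap N (\<lambda>j. d j t)) (wrap N v)
        + load_form N h q (f (max \<mu> (\<Sum>j=1..N. norm (q j)))) (wrap N v) = 0))"

lemma mass_form_cong:
  "(\<And>j. j \<le> N \<Longrightarrow> u j = u' j) \<Longrightarrow> (\<And>j. j \<le> N \<Longrightarrow> v j = v' j) \<Longrightarrow> (\<And>j. j \<in> {1..N} \<Longrightarrow> s j = s' j) \<Longrightarrow>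
   (\<And>j. j \<in> {1..N} \<Longrightarrow> q j = q' j) \<Longrightarrow> mass_form \<alpha> N h s q u v = mass_form \<alpha> N h s' q' u' v'"
  unfolding mass_form_def by (intro sum.cong) auto

lemma load_form_cong:
  "(\<And>j. j \<le> N \<Longrightarrow> v j = v' j) \<Longrightarrow> (\<And>j. j \<in> {1..N} \<Longrightarrow> q j = q' j) \<Longrightarrow> load_form N h q y v = load_form N h q' y v'"
  unfolding load_form_def by (intro arg_cong2[of _ _ _ _ "(+)"] arg_cong2[of _ _ _ _ "(*)"] sum.cong) auto

text \<open>The solution of \<open>u' = G u\<close> in the nodal space, read entry by entry. The
  velocities are continuous because \<open>G\<close> is, which later gives their measurability and
  boundedness in time.\<close>

lemma clipped_solution_exists:
  assumes "0 \<le> T"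
  obtains c d where "clipped_solution T c d" "\<And>j. j \<in> {1..N} \<Longrightarrow> c j 0 = c0 j"
    "\<And>j. continuous_on {0..T} (d j)"
proof -
  obtain G L where L: "0 < L" and lip: "\<And>q r. norm (G q - G r) \<le> L * norm (q - r)"
    and G: "\<And>q. G q \<in> span (nodal_space N)" "\<And>q v. v \<in> span (nodal_space N) \<Longrightarrow> B q (G q) v = F q v"
    using velocity_field by metis
  obtain u where u0: "u 0 = embed_nodal N c0"
    and u: "\<And>t. t \<in> {0..T} \<Longrightarrow> (u has_vector_derivative G (u t)) (at t within {0..T})"
    using ode_existence[of G L T "embed_nodal N c0", OF lip L assms] by blast
  define c where "c j t = apply_bcontfun (u t) j" for j t
  define d where "d j t = apply_bcontfun (G (u t)) j" for j t
  have bl: "bounded_linear (\<lambda>x::nodal. apply_bcontfun x j)" for j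
    by (rule bounded_linear_intro[of _ 1]) (auto simp: norm_bounded)
  have u_cont: "continuous_on {0..T} u"
    unfolding continuous_on_eq_continuous_within using has_vector_derivative_continuous[OF u] by blast
  have G_cont: "continuous_on UNIV G"
    by (rule lipschitz_on_continuous_on[of L]) (use lip L in \<open>auto intro!: lipschitz_onI simp: dist_norm\<close>)
  show thesis
  proof
    show "c j 0 = c0 j" if "j \<in> {1..N}" for j
      using that by (simp add: c_def u0 apply_embed_nodal)
    show "continuous_on {0..T} (d j)" for j
      unfolding d_def
      by (rule bounded_linear.continuous_on[OF bl continuous_on_compose2[OF G_cont u_cont]]) auto
    show "clipped_solution T c d"
      unfolding clipped_solution_def
    proof (intro ballI conjI allI)
      fix t assume t: "t \<in> {0..T}"
      show "(c j has_vector_derivative d j t) (at t within {0..T})" for j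
        unfolding c_def d_def by (rule bounded_linear.has_vector_derivative[OF bl u[OF t]])
      fix v
      define q where "q = (\<lambda>j. clip R (edge (wrap N (\<lambda>j. c j t)) j))"
      have q: "q = cq (u t)" by (rule ext) (simp add: q_def cq_def c_def wrap_def edge_def)
      \<comment> \<open>The test sequence \<open>v\<close> is arbitrary and need not be bounded; the
        forms read only its wrapped entries up to \<open>N\<close>, which \<open>embed_nodal\<close>
        preserves.\<close>
      have v: "wrap N (apply_bcontfun (embed_nodal N v)) j = wrap N v j" if "j \<le> N" for j
        using that N by (simp add: wrap_def apply_embed_nodal)
      have "B (u t) (G (u t)) (embed_nodal N v) = F (u t) (embed_nodal N v)"
        by (rule G(2)[OF embed_nodal_in_span])
      then have "mass_form \<alpha> N h (cs (u t)) (cq (u t)) (wrap N (apply_bcontfun (G (u t)))) (wrap N v)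
          + load_form N h (cq (u t)) (cf (u t)) (wrap N v) = 0"
        unfolding B_def F_def
        using mass_form_cong[OF refl v refl refl] load_form_cong[OF v refl] by simp
      then show "let q = (\<lambda>j. clip R (edge (wrap N (\<lambda>j. c j t)) j)) in
        mass_form \<alpha> N h (\<lambda>j. max (\<mu>\<^sup>2) ((norm (q j))\<^sup>2)) q (wrap N (\<lambda>j. d j t)) (wrap N v)
        + load_form N h q (f (max \<mu> (\<Sum>j=1..N. norm (q j)))) (wrap N v) = 0"
        unfolding Let_def q_def[symmetric] q by (simp add: cs_def[abs_def] cf_def d_def)
    qed
  qed
qed

text \<open>Embedded into the nodal space, each solution has the velocity \<open>G\<close> of its
  position by the uniqueness clause of \<open>velocity_field\<close>, so both solve the same
  Lipschitz equation.\<close>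

lemma clipped_solution_unique:
  assumes "0 \<le> T" and c: "clipped_solution T c d" and c': "clipped_solution T c' d'"
    and init: "\<And>j. j \<in> {1..N} \<Longrightarrow> c j 0 = c' j 0" and t: "t \<in> {0..T}" and j: "j \<in> {1..N}"
  shows "c j t = c' j t"
proof -
  obtain G L where L: "0 < L" and lip: "\<And>q r. norm (G q - G r) \<le> L * norm (q - r)"
    and G: "\<And>q u. u \<in> span (nodal_space N) \<Longrightarrow> (\<And>v. v \<in> span (nodal_space N) \<Longrightarrow> B q u v = F q v) \<Longrightarrow> u = G q"
    using velocity_field by metis
  define E where "E c t = embed_nodal N (\<lambda>j. c j t)" for c :: "nat \<Rightarrow> real \<Rightarrow> real^2" and t
  have E_deriv: "(E c has_vector_derivative G (E c t)) (at t within {0..T})"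
    if sol: "clipped_solution T c d" and t: "t \<in> {0..T}" for c d t
  proof -
    have D: "(E c has_vector_derivative embed_nodal N (\<lambda>j. d j t)) (at t within {0..T})"
      unfolding E_def embed_nodal_def
    proof (intro has_vector_derivative_sum)
      fix i and e :: "real^2" assume "i \<in> {1..N}"
      then have "(c i has_vector_derivative d i t) (at t within {0..T})"
        using sol t by (simp add: clipped_solution_def)
      then have "((\<lambda>t. c i t \<bullet> e) has_vector_derivative (d i t \<bullet> e)) (at t within {0..T})"
        by (rule bounded_linear.has_vector_derivative[OF bounded_linear_inner_left])
      then show "((\<lambda>t. (c i t \<bullet> e) *\<^sub>R unit_nodal i e) has_vector_derivative (d i t \<bullet> e) *\<^sub>R unit_nodal i e) (at t within {0..T})"
        by (rule bounded_linear.has_vector_derivative[OF bounded_linear_scaleR_left])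
    qed
    have "embed_nodal N (\<lambda>j. d j t) = G (E c t)"
    proof (rule G[OF embed_nodal_in_span])
      fix v :: nodal assume v: "v \<in> span (nodal_space N)"
      have w: "wrap N (apply_bcontfun (embed_nodal N y)) j = wrap N y j" if "j \<le> N" for j y
        using that N by (simp add: wrap_def apply_embed_nodal)
      define q where "q = (\<lambda>j. clip R (edge (wrap N (\<lambda>j. c j t)) j))"
      have q: "cq (E c t) j = q j" if "j \<in> {1..N}" for j
        using that N by (auto simp: q_def cq_def E_def edge_def w)
      have cs: "cs (E c t) j = max (\<mu>\<^sup>2) ((norm (q j))\<^sup>2)" if "j \<in> {1..N}" for j
        using q[OF that] by (simp add: cs_def)
      have cf: "cf (E c t) = f (max \<mu> (\<Sum>j=1..N. norm (q j)))"
        unfolding cf_def using q by (intro arg_cong[of _ _ f] arg_cong2[of _ _ _ _ max] sum.cong refl) auto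
      have "mass_form \<alpha> N h (\<lambda>j. max (\<mu>\<^sup>2) ((norm (q j))\<^sup>2)) q (wrap N (\<lambda>j. d j t)) (wrap N (apply_bcontfun v))
        + load_form N h q (f (max \<mu> (\<Sum>j=1..N. norm (q j)))) (wrap N (apply_bcontfun v)) = 0"
        using sol t by (auto simp: clipped_solution_def Let_def q_def)
      then show "B (E c t) (embed_nodal N (\<lambda>j. d j t)) v = F (E c t) v"
        unfolding B_def F_def cf
        using mass_form_cong[OF w refl cs q] load_form_cong[OF refl q] by simp
    qed
    with D show ?thesis by simp
  qed
  have "E c 0 = E c' 0" unfolding E_def embed_nodal_def using init by (intro sum.cong refl) auto
  then have "E c t = E c' t"
    by (intro ode_uniqueness[where u="E c" and w="E c'" and G=G and L=L and T=T, OF lip L \<open>0 \<le> T\<close> _ _ _ t]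
        E_deriv[OF c] E_deriv[OF c'])
  then have "apply_bcontfun (E c t) j = apply_bcontfun (E c' t) j" by simp
  then show ?thesis using j by (simp add: E_def apply_embed_nodal)
qed

end

section \<open>Periodic functions\<close>

definition periodize :: "(real \<Rightarrow> 'a) \<Rightarrow> real \<Rightarrow> 'a" where
  "periodize f x = f (x - 2*pi * real_of_int \<lfloor>x / (2*pi)\<rfloor>)"

lemma periodic_periodize: "periodic (periodize f)"
proof -
  have "(x + 2*pi) / (2*pi) = x / (2*pi) + 1" for x by (simp add: add_divide_distrib)
  then show ?thesis by (auto simp: periodic_def periodize_def algebra_simps)
qed

lemma periodize_eq:
  assumes "2*pi * real_of_int k \<le> x" "x < 2*pi * (real_of_int k + 1)"
  shows "periodize f x = f (x - 2*pi * real_of_int k)"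
proof -
  have "\<lfloor>x / (2*pi)\<rfloor> = k"
    using assms by (intro floor_unique) (simp_all add: pos_le_divide_eq pos_divide_less_eq mult.commute)
  then show ?thesis by (simp add: periodize_def)
qed

lemma periodize_eq_0: "0 \<le> x \<Longrightarrow> x < 2*pi \<Longrightarrow> periodize f x = f x"
  using periodize_eq[of 0 x f] by simp

lemma periodize_2pi: "periodize f (2*pi) = f 0"
  using periodize_eq[of 1 "2*pi" f] by simp

lemma periodize_Icc: "f (2*pi) = f 0 \<Longrightarrow> x \<in> {0..2*pi} \<Longrightarrow> periodize f x = f x"
  by (cases "x = 2*pi") (auto simp: periodize_2pi periodize_eq_0)

text \<open>On an open window of length \<open>4 * pi\<close> only two translates of
  \<open>f\<close> vary, and the one that does not act contributes the constant \<open>c\<close>.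
  Continuity and differentiability thus pass to the periodic extension without a case distinction at
  the seam.\<close>

lemma periodize_local:
  fixes f :: "real \<Rightarrow> 'a::real_vector"
  assumes const: "\<And>x. x \<le> 0 \<or> 2*pi \<le> x \<Longrightarrow> f x = c"
    and x: "2*pi * (real_of_int k - 1) < x" "x < 2*pi * (real_of_int k + 1)"
  shows "periodize f x = f (x - 2*pi * real_of_int k) + f (x - 2*pi * (real_of_int k - 1)) - c"
proof (cases "2*pi * real_of_int k \<le> x")
  case True
  then have "periodize f x = f (x - 2*pi * real_of_int k)" using x by (intro periodize_eq)
  moreover have "f (x - 2*pi * (real_of_int k - 1)) = c" using True by (intro const) (simp add: algebra_simps)
  ultimately show ?thesis by simp
next
  case False
  then have "periodize f x = f (x - 2*pi * real_of_int (k - 1))" using x by (intro periodize_eq) auto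
  moreover have "f (x - 2*pi * real_of_int k) = c" using False by (intro const) (simp add: algebra_simps)
  ultimately show ?thesis by simp
qed

lemma periodize_window:
  obtains k where "x \<in> {2*pi * (real_of_int k - 1)<..<2*pi * (real_of_int k + 1)}"
proof
  have "real_of_int \<lfloor>x / (2*pi)\<rfloor> \<le> x / (2*pi)" "x / (2*pi) < real_of_int \<lfloor>x / (2*pi)\<rfloor> + 1" by linarith+
  from mult_left_mono[OF this(1), of "2*pi"] mult_strict_left_mono[OF this(2), of "2*pi"]
  have "2*pi * real_of_int \<lfloor>x / (2*pi)\<rfloor> \<le> x" "x < 2*pi * (real_of_int \<lfloor>x / (2*pi)\<rfloor> + 1)"
    by simp_all
  moreover have "2*pi * (real_of_int \<lfloor>x / (2*pi)\<rfloor> - 1) = 2*pi * real_of_int \<lfloor>x / (2*pi)\<rfloor> - 2*pi" by (simp add: algebra_simps)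
  ultimately have "2*pi * (real_of_int \<lfloor>x / (2*pi)\<rfloor> - 1) < x" using pi_gt_zero by linarith
  with \<open>x < _\<close> show "x \<in> {2*pi * (real_of_int \<lfloor>x / (2*pi)\<rfloor> - 1)<..<2*pi * (real_of_int \<lfloor>x / (2*pi)\<rfloor> + 1)}" by auto
qed

lemma continuous_on_periodize:
  fixes f :: "real \<Rightarrow> 'a::real_normed_vector"
  assumes const: "\<And>x. x \<le> 0 \<or> 2*pi \<le> x \<Longrightarrow> f x = c" and f: "continuous_on UNIV f"
  shows "continuous_on S (periodize f)"
proof -
  have "isCont (periodize f) x" for x
  proof -
    obtain k where k: "x \<in> {2*pi * (real_of_int k - 1)<..<2*pi * (real_of_int k + 1)}" by (rule periodize_window)
    have "continuous_on {2*pi * (real_of_int k - 1)<..<2*pi * (real_of_int k + 1)}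
        (\<lambda>x. f (x - 2*pi * real_of_int k) + f (x - 2*pi * (real_of_int k - 1)) - c)"
      by (intro continuous_intros continuous_on_compose2[OF f]) auto
    then have "continuous_on {2*pi * (real_of_int k - 1)<..<2*pi * (real_of_int k + 1)} (periodize f)"
      by (rule continuous_on_eq) (rule periodize_local[OF const, symmetric], auto)
    with k show ?thesis by (simp add: continuous_on_eq_continuous_at)
  qed
  then show ?thesis by (simp add: continuous_at_imp_continuous_on)
qed

lemma periodize_has_real_derivative:
  assumes zero: "\<And>x. x \<le> 0 \<or> 2*pi \<le> x \<Longrightarrow> f x = 0" "\<And>x. x \<le> 0 \<or> 2*pi \<le> x \<Longrightarrow> f' x = 0"
    and f: "\<And>x. (f has_real_derivative f' x) (at x)"
  shows "(periodize f has_real_derivative periodize f' x) (at x)"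
proof -
  obtain k where k: "x \<in> {2*pi * (real_of_int k - 1)<..<2*pi * (real_of_int k + 1)}" by (rule periodize_window)
  have "((\<lambda>x. f (x - 2*pi * real_of_int k) + f (x - 2*pi * (real_of_int k - 1)) - 0) has_real_derivative
     f' (x - 2*pi * real_of_int k) * 1 + f' (x - 2*pi * (real_of_int k - 1)) * 1 - 0) (at x)"
    by (intro derivative_intros DERIV_chain2[OF f]) (auto intro!: derivative_eq_intros)
  also have "f' (x - 2*pi * real_of_int k) * 1 + f' (x - 2*pi * (real_of_int k - 1)) * 1 - 0 = periodize f' x"
    using periodize_local[where f=f', OF zero(2), of k x] k by simp
  finally show ?thesis
    by (rule has_field_derivative_transform_within_open[OF _ open_greaterThanLessThan k])
      (rule periodize_local[where f=f, OF zero(1), symmetric], auto)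
qed

lemma periodic_shift_2pi: "periodic v \<Longrightarrow> v (2*pi) = v 0"
  unfolding periodic_def by (metis add_0)

section \<open>Square integrable functions\<close>

text \<open>The integral of \<open>((b - a) * g x - m)\<^sup>2\<close> with \<open>m\<close> the
  integral of \<open>g\<close> is nonnegative; this is the Cauchy-Schwarz inequality against the
  constant 1.\<close>

lemma integral_power2_le:
  fixes g :: "real \<Rightarrow> real"
  assumes "a \<le> b" and g: "g integrable_on {a..b}" and g2: "(\<lambda>x. (g x)\<^sup>2) integrable_on {a..b}"
  shows "(integral {a..b} g)\<^sup>2 \<le> (b - a) * integral {a..b} (\<lambda>x. (g x)\<^sup>2)"
proof (cases "a = b")
  case False
  then have ab: "a < b" using assms by simp
  define m where "m = integral {a..b} g"
  have "((\<lambda>x. (b-a)\<^sup>2 * (g x)\<^sup>2 - 2 * (b-a) * m * g x + m\<^sup>2) has_integral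
      ((b-a)\<^sup>2 * integral {a..b} (\<lambda>x. (g x)\<^sup>2) - 2 * (b-a) * m * m + (b-a) * m\<^sup>2)) {a..b}"
    using has_integral_const_real[of "m\<^sup>2" a b] ab
    by (intro has_integral_add has_integral_diff has_integral_mult_right integrable_integral g2)
      (auto simp: m_def g)
  moreover have "(b-a)\<^sup>2 * (g x)\<^sup>2 - 2 * (b-a) * m * g x + m\<^sup>2 = ((b-a) * g x - m)\<^sup>2" for x
    by (simp add: power2_eq_square algebra_simps)
  ultimately have "((\<lambda>x. ((b-a) * g x - m)\<^sup>2) has_integral
      ((b-a)\<^sup>2 * integral {a..b} (\<lambda>x. (g x)\<^sup>2) - 2 * (b-a) * m * m + (b-a) * m\<^sup>2)) {a..b}" by simp
  then have "0 \<le> (b-a)\<^sup>2 * integral {a..b} (\<lambda>x. (g x)\<^sup>2) - 2 * (b-a) * m * m + (b-a) * m\<^sup>2"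
    by (rule has_integral_nonneg) simp
  then have "0 \<le> (b-a) * ((b-a) * integral {a..b} (\<lambda>x. (g x)\<^sup>2) - m\<^sup>2)"
    by (simp add: power2_eq_square algebra_simps)
  then show ?thesis using ab by (simp add: zero_le_mult_iff m_def)
qed simp

lemma L2_fun_square: "L2_fun v \<Longrightarrow> (\<lambda>\<xi>. (norm (v \<xi>))\<^sup>2) absolutely_integrable_on {0..2*pi}"
  unfolding L2_fun_def using integrable_on_lebesgue_on[of "{0..2*pi}" "\<lambda>\<xi>. (norm (v \<xi>))\<^sup>2"]
  by (intro nonnegative_absolutely_integrable_1) auto

lemma L2_fun_absolutely_integrable:
  assumes "L2_fun v" shows "v absolutely_integrable_on {0..2*pi}"
proof (rule measurable_bounded_by_integrable_imp_absolutely_integrable)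
  show "v \<in> borel_measurable circle" using assms by (simp add: L2_fun_def)
  show "(\<lambda>\<xi>. 1 + (norm (v \<xi>))\<^sup>2) integrable_on {0..2*pi}"
    using L2_fun_square[OF assms] by (intro integrable_add) (auto simp: absolutely_integrable_on_def)
  show "norm (v \<xi>) \<le> 1 + (norm (v \<xi>))\<^sup>2" for \<xi>
  proof -
    have "2 * norm (v \<xi>) \<le> 1 + (norm (v \<xi>))\<^sup>2"
      using zero_le_power2[of "norm (v \<xi>) - 1"] by (simp add: power2_diff)
    then show ?thesis using norm_ge_zero[of "v \<xi>"] by linarith
  qed
qed auto

lemma L2_norm_nonneg: "0 \<le> L2_norm v"
  by (simp add: L2_norm_def)

lemma L2_fun_on:
  assumes "L2_fun v" "0 \<le> a" "b \<le> 2*pi"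
  shows "v integrable_on {a..b}" "(\<lambda>x. norm (v x)) integrable_on {a..b}" "(\<lambda>x. (norm (v x))\<^sup>2) integrable_on {a..b}"
  using L2_fun_absolutely_integrable[OF assms(1)] L2_fun_square[OF assms(1)] assms(2,3)
  by (auto simp: absolutely_integrable_on_def intro: integrable_subinterval_real)

lemma L2_norm_eq:
  assumes "L2_fun v" shows "(L2_norm v)\<^sup>2 = integral {0..2*pi} (\<lambda>\<xi>. (norm (v \<xi>))\<^sup>2)"
proof -
  have "0 \<le> integral {0..2*pi} (\<lambda>\<xi>. (norm (v \<xi>))\<^sup>2)"
    by (intro integral_nonneg L2_fun_on assms) auto
  then show ?thesis
    using assms by (simp add: L2_norm_def L2_fun_def lebesgue_integral_eq_integral)
qed

lemma L2_fun_integral_le: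
  assumes v: "L2_fun v" and ab: "0 \<le> a" "a \<le> b" "b \<le> 2*pi"
  shows "(norm (integral {a..b} v))\<^sup>2 \<le> (b - a) * integral {a..b} (\<lambda>x. (norm (v x))\<^sup>2)"
proof -
  have "norm (integral {a..b} v) \<le> integral {a..b} (\<lambda>x. norm (v x))"
    using ab by (intro integral_norm_bound_integral L2_fun_on v) auto
  then have "(norm (integral {a..b} v))\<^sup>2 \<le> (integral {a..b} (\<lambda>x. norm (v x)))\<^sup>2"
    by (intro power_mono) auto
  also have "\<dots> \<le> (b - a) * integral {a..b} (\<lambda>x. (norm (v x))\<^sup>2)"
    using ab by (intro integral_power2_le L2_fun_on v)
  finally show ?thesis .
qed

lemma continuous_AE_eq:
  fixes f g :: "real \<Rightarrow> 'a::euclidean_space"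
  assumes "a < b" "continuous_on {a..b} f" "continuous_on {a..b} g" "AE x in lebesgue_on {a..b}. f x = g x" "x \<in> {a..b}"
  shows "f x = g x"
proof -
  have c: "continuous_on {a..b} (\<lambda>x. norm (f x - g x))" by (intro continuous_intros assms)
  have "integral {a..b} (\<lambda>x. norm (f x - g x)) = integral\<^sup>L (lebesgue_on {a..b}) (\<lambda>x. norm (f x - g x))"
    by (rule lebesgue_integral_eq_integral[symmetric]) (auto intro: integrable_continuous_real continuous_imp_integrable_real c)
  also have "\<dots> = integral\<^sup>L (lebesgue_on {a..b}) (\<lambda>x. 0)"
    using assms(4) by (intro integral_cong_AE) (auto intro!: continuous_imp_measurable_on_sets_lebesgue c)
  finally have "integral {a..b} (\<lambda>x. norm (f x - g x)) = 0" by simp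
  then show ?thesis using integral_eq_0_iff[OF c] assms by auto
qed

lemma weak_deriv_spec:
  assumes "H1_fun v" shows "L2_fun (weak_deriv v)" "has_weak_deriv v (weak_deriv v)"
  using someI_ex[of "\<lambda>g. L2_fun g \<and> has_weak_deriv v g"] assms by (auto simp: H1_fun_def weak_deriv_def)

lemma absolutely_integrable_scaleR:
  fixes v :: "real \<Rightarrow> 'a::euclidean_space"
  assumes "continuous_on {a..b} \<zeta>" "v absolutely_integrable_on {a..b}"
  shows "(\<lambda>x. \<zeta> x *\<^sub>R v x) absolutely_integrable_on {a..b}"
  by (rule absolutely_integrable_bounded_measurable_product)
    (use assms in \<open>auto intro: continuous_imp_measurable_on_sets_lebesgue
      compact_imp_bounded compact_continuous_image simp: bilinear_conv_bounded_bilinear bounded_bilinear_scaleR\<close>)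

lemma LINT_eq_integral:
  fixes f :: "real \<Rightarrow> 'a::euclidean_space"
  assumes "f absolutely_integrable_on {a..b}"
  shows "(LINT x|lebesgue_on {a..b}. f x) = integral {a..b} f"
  by (rule lebesgue_integral_eq_integral) (use assms in \<open>auto intro: absolutely_integrable_imp_integrable\<close>)

text \<open>Test functions supported inside the period extend periodically, which reduces the circle
  to \<open>du_Bois_Reymond\<close> on an interval; the constant test function 1 supplies the
  vanishing mean of \<open>g\<close>.\<close>

lemma weak_deriv_representation:
  fixes v g :: "real \<Rightarrow> 'a::euclidean_space"
  assumes v: "L2_fun v" and g: "L2_fun g" and weak: "has_weak_deriv v g"
  obtains c where "AE \<xi> in circle. v \<xi> = c + integral {0..\<xi>} g" "integral {0..2*pi} g = 0"
proof -
  note ai = L2_fun_absolutely_integrable[OF v] L2_fun_absolutely_integrable[OF g]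
  have mean: "integral {0..2*pi} g = 0"
  proof -
    have "(LINT \<xi>|circle. 0 *\<^sub>R v \<xi>) = - (LINT \<xi>|circle. 1 *\<^sub>R g \<xi>)"
      using weak[unfolded has_weak_deriv_def, rule_format, of "\<lambda>_. 1" "\<lambda>_. 0"] by (simp add: periodic_def)
    then show ?thesis using LINT_eq_integral[OF ai(2)] by simp
  qed
  show thesis
  proof (rule du_Bois_Reymond[of 0 "2*pi" v g])
    fix \<phi> \<phi>' :: "real \<Rightarrow> real" and s t :: real
    assume \<phi>: "\<And>x. (\<phi> has_real_derivative \<phi>' x) (at x)" "continuous_on UNIV \<phi>'" "0 < s" "t < 2*pi"
      "\<And>x. x \<notin> {s..t} \<Longrightarrow> \<phi> x = 0" "\<And>x. x \<notin> {s..t} \<Longrightarrow> \<phi>' x = 0"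
    have out: "\<phi> x = 0" "\<phi>' x = 0" if "x \<le> 0 \<or> 2*pi \<le> x" for x
      using \<phi>(3-) that by auto
    have \<phi>_cont: "continuous_on {0..2*pi} \<phi>"
      using \<phi>(1) by (meson DERIV_continuous continuous_at_imp_continuous_on)
    have \<phi>'_cont: "continuous_on {0..2*pi} \<phi>'" using \<phi>(2) continuous_on_subset by blast
    have "(LINT \<xi>|circle. periodize \<phi>' \<xi> *\<^sub>R v \<xi>) = - (LINT \<xi>|circle. periodize \<phi> \<xi> *\<^sub>R g \<xi>)"
      using weak[unfolded has_weak_deriv_def, rule_format, of "periodize \<phi>" "periodize \<phi>'"]
        periodize_has_real_derivative[OF out \<phi>(1)] continuous_on_periodize[OF out(2) \<phi>(2)] periodic_periodize by blast
    moreover have "(LINT \<xi>|circle. periodize \<phi>' \<xi> *\<^sub>R v \<xi>) = (LINT \<xi>|circle. \<phi>' \<xi> *\<^sub>R v \<xi>)"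
      "(LINT \<xi>|circle. periodize \<phi> \<xi> *\<^sub>R g \<xi>) = (LINT \<xi>|circle. \<phi> \<xi> *\<^sub>R g \<xi>)"
      using out by (auto intro!: Bochner_Integration.integral_cong simp: periodize_Icc)
    ultimately show "integral {0..2*pi} (\<lambda>x. \<phi>' x *\<^sub>R v x) = - integral {0..2*pi} (\<lambda>x. \<phi> x *\<^sub>R g x)"
      by (simp add: LINT_eq_integral absolutely_integrable_scaleR \<phi>_cont \<phi>'_cont ai)
  qed (use ai mean that in auto)
qed

text \<open>Converse of the representation: in the integration by parts the boundary terms at 0 and
  \<open>2*pi\<close> cancel by periodicity of \<open>v\<close> and \<phi>.\<close>

lemma has_weak_derivI:
  fixes v g :: "real \<Rightarrow> 'a::euclidean_space"
  assumes v: "periodic v" and g: "g absolutely_integrable_on {0..2*pi}"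
    and eq: "\<And>\<xi>. \<xi> \<in> {0..2*pi} \<Longrightarrow> v \<xi> = v 0 + integral {0..\<xi>} g"
  shows "has_weak_deriv v g"
  unfolding has_weak_deriv_def
proof (intro allI impI, elim conjE)
  fix \<phi> \<phi>' :: "real \<Rightarrow> real"
  assume \<phi>: "periodic \<phi>" "\<forall>\<xi>. (\<phi> has_real_derivative \<phi>' \<xi>) (at \<xi>)" "continuous_on UNIV \<phi>'"
  have \<phi>_cont: "continuous_on {0..2*pi} \<phi>"
    using \<phi>(2) by (meson DERIV_continuous continuous_at_imp_continuous_on)
  have \<phi>'_cont: "continuous_on S \<phi>'" for S using \<phi>(3) continuous_on_subset by blast
  have "continuous_on {0..2*pi} (\<lambda>\<xi>. v 0 + integral {0..\<xi>} g)"
    using g by (intro continuous_intros indefinite_integral_continuous_1) (simp add: absolutely_integrable_on_def)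
  then have v_cont: "continuous_on {0..2*pi} v" by (rule continuous_on_eq) (rule eq[symmetric])
  have v_ai: "v absolutely_integrable_on {0..2*pi}" using v_cont by (rule absolutely_integrable_continuous_real)
  obtain B where B: "\<And>x. x \<in> {0..2*pi} \<Longrightarrow> norm (\<phi>' x) \<le> B"
    using compact_imp_bounded[OF compact_continuous_image[OF \<phi>'_cont, of "{0..2*pi}"]]
    unfolding bounded_iff by blast
  have \<phi>_eq: "\<phi> t = \<phi> 0 + integral {0..t} \<phi>'" if "t \<in> {0..2*pi}" for t
  proof -
    have "(\<phi>' has_integral (\<phi> t - \<phi> 0)) {0..t}"
      using that \<phi>(2) by (intro fundamental_theorem_of_calculus)
        (auto simp flip: has_real_derivative_iff_has_vector_derivative intro: has_field_derivative_at_within)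
    then show ?thesis by (simp add: integral_unique)
  qed
  have "((\<lambda>x. (\<lambda>x y. y *\<^sub>R x) (g x) (\<phi> x) + (\<lambda>x y. y *\<^sub>R x) (v x) (\<phi>' x)) has_integral
          ((\<lambda>x y. y *\<^sub>R x) (v (2*pi)) (\<phi> (2*pi)) - (\<lambda>x y. y *\<^sub>R x) (v 0) (\<phi> 0))) {0..2*pi}"
    by (rule integral_product_rule[OF bounded_bilinear.flip[OF bounded_bilinear_scaleR] _ g _ B eq \<phi>_eq])
      (auto intro!: continuous_imp_measurable_on_sets_lebesgue \<phi>'_cont)
  then have "integral {0..2*pi} (\<lambda>x. \<phi> x *\<^sub>R g x + \<phi>' x *\<^sub>R v x) = 0"
    using periodic_shift_2pi[OF v] periodic_shift_2pi[OF \<phi>(1)] by (simp add: integral_unique)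
  moreover have ai: "(\<lambda>x. \<phi> x *\<^sub>R g x) absolutely_integrable_on {0..2*pi}" "(\<lambda>x. \<phi>' x *\<^sub>R v x) absolutely_integrable_on {0..2*pi}"
    by (intro absolutely_integrable_scaleR \<phi>_cont \<phi>'_cont g v_ai)+
  moreover have "integral {0..2*pi} (\<lambda>x. \<phi> x *\<^sub>R g x + \<phi>' x *\<^sub>R v x) = integral {0..2*pi} (\<lambda>x. \<phi> x *\<^sub>R g x) + integral {0..2*pi} (\<lambda>x. \<phi>' x *\<^sub>R v x)"
    using ai by (intro integral_add) (auto simp: absolutely_integrable_on_def)
  ultimately show "(LINT \<xi>|circle. \<phi>' \<xi> *\<^sub>R v \<xi>) = - (LINT \<xi>|circle. \<phi> \<xi> *\<^sub>R g \<xi>)"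
    by (simp add: LINT_eq_integral minus_unique eq_neg_iff_add_eq_0 add.commute)
qed

lemma integral_cong_AE_interval:
  fixes f g :: "real \<Rightarrow> 'a::euclidean_space"
  assumes "AE x in lebesgue_on {a..b}. f x = g x" "a \<le> s" "t \<le> b"
  shows "integral {s..t} f = integral {s..t} g"
proof -
  have "AE x in lebesgue. x \<in> {a..b} \<longrightarrow> f x = g x"
    using assms(1) by (subst (asm) AE_restrict_space_iff) auto
  then obtain Z where Z: "Z \<in> null_sets lebesgue" "{x. \<not> (x \<in> {a..b} \<longrightarrow> f x = g x)} \<subseteq> Z"
    by (auto simp: eventually_ae_filter)
  then have "negligible Z" by (simp add: negligible_iff_null_sets)
  then show ?thesis
  proof (rule integral_spike)
    fix x assume "x \<in> {s..t} - Z"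
    then have "x \<in> {a..b}" "x \<notin> Z" using assms by auto
    moreover have "x \<notin> {x. \<not> (x \<in> {a..b} \<longrightarrow> f x = g x)}" by (rule contra_subsetD[OF Z(2)]) fact
    ultimately show "g x = f x" by simp
  qed
qed

text \<open>Both representations are continuous, so they agree everywhere and not only a.e.; then
  all integrals of \<open>g\<close> and \<open>g'\<close> over subintervals agree.\<close>

lemma weak_deriv_unique:
  fixes v g g' :: "real \<Rightarrow> 'a::euclidean_space"
  assumes v: "L2_fun v" and g: "L2_fun g" "has_weak_deriv v g" and g': "L2_fun g'" "has_weak_deriv v g'"
  shows "AE \<xi> in circle. g \<xi> = g' \<xi>"
proof -
  obtain c where c: "AE \<xi> in circle. v \<xi> = c + integral {0..\<xi>} g" using weak_deriv_representation[OF v g] by blast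
  obtain c' where c': "AE \<xi> in circle. v \<xi> = c' + integral {0..\<xi>} g'" using weak_deriv_representation[OF v g'] by blast
  have "AE \<xi> in circle. c + integral {0..\<xi>} g = c' + integral {0..\<xi>} g'" using c c' by eventually_elim simp
  then have eq: "c + integral {0..\<xi>} g = c' + integral {0..\<xi>} g'" if "\<xi> \<in> {0..2*pi}" for \<xi>
    using that L2_fun_on(1)[OF g(1)] L2_fun_on(1)[OF g'(1)]
    by (intro continuous_AE_eq[of 0 "2*pi" "\<lambda>\<xi>. c + integral {0..\<xi>} g" "\<lambda>\<xi>. c' + integral {0..\<xi>} g'"]
        continuous_intros indefinite_integral_continuous_1) auto
  have cc: "c = c'" using eq[of 0] by simp
  have "AE \<xi> in circle. g \<xi> - g' \<xi> = 0"
  proof (rule AE_zero_of_indefinite_integral_zero)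
    show "(\<lambda>\<xi>. g \<xi> - g' \<xi>) absolutely_integrable_on {0..2*pi}"
      by (intro set_integral_diff L2_fun_absolutely_integrable g g')
    fix s t :: real assume st: "0 \<le> s" "s \<le> t" "t \<le> 2*pi"
    have 1: "integral {0..s} g + integral {s..t} g = integral {0..t} g"
      using st by (intro Henstock_Kurzweil_Integration.integral_combine L2_fun_on(1)[OF g(1)]) auto
    have 2: "integral {0..s} g' + integral {s..t} g' = integral {0..t} g'"
      using st by (intro Henstock_Kurzweil_Integration.integral_combine L2_fun_on(1)[OF g'(1)]) auto
    have "integral {s..t} g = integral {s..t} g'"
    proof -
      have "integral {0..s} g = integral {0..s} g'" "integral {0..t} g = integral {0..t} g'"
        using eq[of s] eq[of t] cc st by auto
      with 1 2 show ?thesis by (metis add_left_cancel)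
    qed
    then show "integral {s..t} (\<lambda>\<xi>. g \<xi> - g' \<xi>) = 0"
      using st by (subst integral_diff) (auto intro: L2_fun_on(1)[OF g(1)] L2_fun_on(1)[OF g'(1)])
  qed
  then show ?thesis by simp
qed

section \<open>Continuous representatives\<close>

text \<open>Meaningful on one closed period only, where it is the absolutely continuous function
  agreeing with \<open>v\<close> a.e.; the chosen constant is the one from
  \<open>weak_deriv_representation\<close>. Since \<open>weak_deriv\<close> is a choice up to null
  sets, point values of derivatives are always taken through this function.\<close>

definition cont_rep :: "(real \<Rightarrow> 'a::euclidean_space) \<Rightarrow> real \<Rightarrow> 'a" where
  "cont_rep v \<xi> = (SOME c. AE x in circle. v x = c + integral {0..x} (weak_deriv v)) + integral {0..\<xi>} (weak_deriv v)"

lemma cont_rep: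
  fixes v :: "real \<Rightarrow> 'a::euclidean_space"
  assumes "H1_fun v"
  shows "AE \<xi> in circle. v \<xi> = cont_rep v \<xi>" "cont_rep v (2*pi) = cont_rep v 0"
    "\<And>s t. 0 \<le> s \<Longrightarrow> s \<le> t \<Longrightarrow> t \<le> 2*pi \<Longrightarrow> cont_rep v t - cont_rep v s = integral {s..t} (weak_deriv v)"
    "continuous_on {0..2*pi} (cont_rep v)"
proof -
  note spec = weak_deriv_spec[OF assms]
  have v: "L2_fun v" using assms by (simp add: H1_fun_def)
  obtain c where c: "AE \<xi> in circle. v \<xi> = c + integral {0..\<xi>} (weak_deriv v)" "integral {0..2*pi} (weak_deriv v) = 0"
    using weak_deriv_representation[OF v spec] by blast
  show "AE \<xi> in circle. v \<xi> = cont_rep v \<xi>"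
    unfolding cont_rep_def by (rule someI[of _ c]) (rule c)
  show "cont_rep v (2*pi) = cont_rep v 0" by (simp add: cont_rep_def c)
  show "cont_rep v t - cont_rep v s = integral {s..t} (weak_deriv v)" if "0 \<le> s" "s \<le> t" "t \<le> 2*pi" for s t
  proof -
    have "integral {0..s} (weak_deriv v) + integral {s..t} (weak_deriv v) = integral {0..t} (weak_deriv v)"
      using that by (intro Henstock_Kurzweil_Integration.integral_combine L2_fun_on(1)[OF spec(1)]) auto
    then show ?thesis by (simp add: cont_rep_def algebra_simps)
  qed
  show "continuous_on {0..2*pi} (cont_rep v)"
    unfolding cont_rep_def by (intro continuous_intros indefinite_integral_continuous_1 L2_fun_on(1)[OF spec(1)]) auto
qed

lemma cont_rep_diff_le:
  assumes "H1_fun v" "0 \<le> a" "b \<le> 2*pi" "s \<in> {a..b}" "t \<in> {a..b}"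
  shows "(norm (cont_rep v t - cont_rep v s))\<^sup>2 \<le> (b - a) * integral {a..b} (\<lambda>x. (norm (weak_deriv v x))\<^sup>2)"
proof -
  note spec = weak_deriv_spec[OF assms(1)]
  have *: "(norm (cont_rep v t - cont_rep v s))\<^sup>2 \<le> (b - a) * integral {a..b} (\<lambda>x. (norm (weak_deriv v x))\<^sup>2)"
    if "a \<le> s" "s \<le> t" "t \<le> b" for s t
  proof -
    have "(norm (cont_rep v t - cont_rep v s))\<^sup>2 \<le> (t - s) * integral {s..t} (\<lambda>x. (norm (weak_deriv v x))\<^sup>2)"
      using that assms cont_rep(3)[OF assms(1), of s t] L2_fun_integral_le[OF spec(1), of s t] by simp
    also have "\<dots> \<le> (b - a) * integral {a..b} (\<lambda>x. (norm (weak_deriv v x))\<^sup>2)"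
      using that assms
      by (intro mult_mono integral_subset_le L2_fun_on(3)[OF spec(1)] integral_nonneg) auto
    finally show ?thesis .
  qed
  show ?thesis
    using *[of s t] *[of t s] assms by (cases "s \<le> t") (auto simp: norm_minus_commute)
qed

text \<open>The value at \<open>x\<close> is compared with the value at \<open>y\<close> by
  \<open>cont_rep_diff_le\<close>, and the inequality is averaged over all \<open>y\<close> in the
  circle.\<close>

lemma cont_rep_bound:
  assumes v: "H1_fun v" and x: "x \<in> {0..2*pi}"
  shows "(norm (cont_rep v x))\<^sup>2 \<le> (L2_norm v)\<^sup>2 + 16 * (L2_norm (weak_deriv v))\<^sup>2"
proof -
  note spec = weak_deriv_spec[OF v]
  have vL: "L2_fun v" using v by (simp add: H1_fun_def)
  define D where "D = (L2_norm (weak_deriv v))\<^sup>2"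
  have "integral {0..2*pi} (\<lambda>y. (norm (cont_rep v x))\<^sup>2) \<le> integral {0..2*pi} (\<lambda>y. 2 * (norm (cont_rep v y))\<^sup>2 + 4 * pi * D)"
  proof (rule integral_le)
    show "(\<lambda>y. 2 * (norm (cont_rep v y))\<^sup>2 + 4 * pi * D) integrable_on {0..2*pi}"
      by (intro integrable_continuous_real continuous_intros cont_rep(4)[OF v])
    fix y assume y: "y \<in> {0..2*pi}"
    have "(norm (cont_rep v x - cont_rep v y))\<^sup>2 \<le> 2 * pi * D"
      using cont_rep_diff_le[OF v, of 0 "2*pi" y x] x y by (simp add: D_def L2_norm_eq[OF spec(1)])
    moreover have "(norm (cont_rep v x))\<^sup>2 \<le> 2 * (norm (cont_rep v y))\<^sup>2 + 2 * (norm (cont_rep v x - cont_rep v y))\<^sup>2"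
    proof -
      have "norm (cont_rep v x) \<le> norm (cont_rep v y) + norm (cont_rep v x - cont_rep v y)"
        using norm_triangle_sub[of "cont_rep v x" "cont_rep v y"] by simp
      then have "(norm (cont_rep v x))\<^sup>2 \<le> (norm (cont_rep v y) + norm (cont_rep v x - cont_rep v y))\<^sup>2"
        by (intro power_mono) auto
      also have "\<dots> \<le> 2 * (norm (cont_rep v y))\<^sup>2 + 2 * (norm (cont_rep v x - cont_rep v y))\<^sup>2"
        using zero_le_power2[of "norm (cont_rep v y) - norm (cont_rep v x - cont_rep v y)"]
        unfolding power2_sum power2_diff by linarith
      finally show ?thesis .
    qed
    ultimately show "(norm (cont_rep v x))\<^sup>2 \<le> 2 * (norm (cont_rep v y))\<^sup>2 + 4 * pi * D" by linarith
  qed auto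
  also have "\<dots> = 2 * integral {0..2*pi} (\<lambda>y. (norm (cont_rep v y))\<^sup>2) + 8 * pi\<^sup>2 * D"
    by (subst integral_add) (auto intro!: integrable_continuous_real continuous_intros cont_rep(4)[OF v] simp: power2_eq_square)
  also have "integral {0..2*pi} (\<lambda>y. (norm (cont_rep v y))\<^sup>2) = (L2_norm v)\<^sup>2"
    unfolding L2_norm_eq[OF vL]
    by (rule integral_cong_AE_interval[where a=0 and b="2*pi"]) (use cont_rep(1)[OF v] in auto)
  finally have *: "2 * pi * (norm (cont_rep v x))\<^sup>2 \<le> 2 * (L2_norm v)\<^sup>2 + 8 * pi\<^sup>2 * D" by simp
  \<comment> \<open>Dividing by \<open>2 * pi\<close> leaves the coefficients \<open>1 / pi\<close>
    and \<open>4 * pi\<close>; they are rounded up to 1 and 16.\<close>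
  have "pi * (norm (cont_rep v x))\<^sup>2 \<le> pi * ((L2_norm v)\<^sup>2 + 16 * D)"
  proof -
    have "(L2_norm v)\<^sup>2 * 1 \<le> (L2_norm v)\<^sup>2 * pi" using pi_gt3 by (intro mult_left_mono) auto
    moreover have "pi\<^sup>2 * D \<le> 4 * pi * D"
      using pi_less_4 by (intro mult_right_mono) (auto simp: power2_eq_square D_def)
    ultimately show ?thesis using * by (simp add: algebra_simps)
  qed
  then show ?thesis by (simp add: D_def)
qed

lemma H2_norm_bounds:
  assumes "H2_norm v \<le> K"
  shows "(L2_norm v)\<^sup>2 \<le> K\<^sup>2" "(L2_norm (weak_deriv v))\<^sup>2 \<le> K\<^sup>2" "(L2_norm (weak_deriv (weak_deriv v)))\<^sup>2 \<le> K\<^sup>2" "0 \<le> K"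
proof -
  have *: "(L2_norm v)\<^sup>2 + (L2_norm (weak_deriv v))\<^sup>2 + (L2_norm (weak_deriv (weak_deriv v)))\<^sup>2 \<le> K\<^sup>2"
    by (rule sqrt_le_D) (use assms in \<open>simp only: H2_norm_def\<close>)
  have n: "0 \<le> (L2_norm v)\<^sup>2" "0 \<le> (L2_norm (weak_deriv v))\<^sup>2" "0 \<le> (L2_norm (weak_deriv (weak_deriv v)))\<^sup>2"
    by (rule zero_le_power2)+
  show "(L2_norm v)\<^sup>2 \<le> K\<^sup>2" using * n by linarith
  show "(L2_norm (weak_deriv v))\<^sup>2 \<le> K\<^sup>2" using * n by linarith
  show "(L2_norm (weak_deriv (weak_deriv v)))\<^sup>2 \<le> K\<^sup>2" using * n by linarith
  have "0 \<le> H2_norm v" unfolding H2_norm_def by (intro real_sqrt_ge_zero add_nonneg_nonneg n)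
  then show "0 \<le> K" using assms by simp
qed

text \<open>The constant 5 comes from \<open>1 + 16 \<le> 5\<^sup>2\<close> in
  \<open>cont_rep_bound\<close>, applied to \<open>v\<close> for the size and to its weak derivative
  for the Lipschitz constant.\<close>

lemma cont_rep_bounds_H2:
  assumes v: "H2_fun v" and K: "H2_norm v \<le> K"
  shows "\<And>x. x \<in> {0..2*pi} \<Longrightarrow> norm (cont_rep v x) \<le> 5 * K"
    "\<And>x y. x \<in> {0..2*pi} \<Longrightarrow> y \<in> {0..2*pi} \<Longrightarrow> norm (cont_rep v x - cont_rep v y) \<le> 5 * K * \<bar>x - y\<bar>"
proof -
  note K' = H2_norm_bounds[OF K]
  have v1: "H1_fun v" "H1_fun (weak_deriv v)" using v by (auto simp: H2_fun_def)
  have b: "norm (cont_rep w x) \<le> 5 * K" if "H1_fun w" "(L2_norm w)\<^sup>2 \<le> K\<^sup>2" "(L2_norm (weak_deriv w))\<^sup>2 \<le> K\<^sup>2" "x \<in> {0..2*pi}"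
    for w :: "real \<Rightarrow> 'a" and x
  proof -
    have "(norm (cont_rep w x))\<^sup>2 \<le> (5 * K)\<^sup>2"
    proof -
      have "(norm (cont_rep w x))\<^sup>2 \<le> 25 * K\<^sup>2"
        using cont_rep_bound[OF that(1,4)] that(2,3) zero_le_power2[of K] by linarith
      then show ?thesis by (simp add: power_mult_distrib)
    qed
    then show ?thesis by (rule power2_le_imp_le) (use K' in auto)
  qed
  show "\<And>x. x \<in> {0..2*pi} \<Longrightarrow> norm (cont_rep v x) \<le> 5 * K" using b[OF v1(1)] K' by auto
  have *: "norm (cont_rep v x - cont_rep v y) \<le> 5 * K * \<bar>x - y\<bar>" if "0 \<le> y" "y \<le> x" "x \<le> 2*pi" for x y
  proof -
    have "cont_rep v x - cont_rep v y = integral {y..x} (weak_deriv v)" by (rule cont_rep(3)[OF v1(1) that])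
    also have "\<dots> = integral {y..x} (cont_rep (weak_deriv v))"
      by (rule integral_cong_AE_interval[OF cont_rep(1)[OF v1(2)]]) (use that in auto)
    also have "norm \<dots> \<le> integral {y..x} (\<lambda>_. 5 * K)"
      using that b[OF v1(2)] K'
      by (intro integral_norm_bound_integral integrable_continuous_real continuous_on_subset[OF cont_rep(4)[OF v1(2)]]) auto
    also have "\<dots> = 5 * K * \<bar>x - y\<bar>" using that by simp
    finally show ?thesis .
  qed
  show "norm (cont_rep v x - cont_rep v y) \<le> 5 * K * \<bar>x - y\<bar>" if "x \<in> {0..2*pi}" "y \<in> {0..2*pi}" for x y
    using *[of x y] *[of y x] that by (cases "y \<le> x") (auto simp: norm_minus_commute abs_minus_commute)
qed

text \<open>A continuous \<open>v\<close> coincides with its representative, hence is a primitive of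
  the continuous representative of its weak derivative. The ends of the period are left out because
  that representative is controlled only on one closed period.\<close>

lemma H2_continuous_deriv:
  fixes v :: "real \<Rightarrow> real^2"
  assumes v: "H2_fun v" and cont: "continuous_on {0..2*pi} v"
  shows "\<And>x. 0 < x \<Longrightarrow> x < 2*pi \<Longrightarrow> (v has_vector_derivative cont_rep (weak_deriv v) x) (at x)"
    "\<And>x. 0 < x \<Longrightarrow> x < 2*pi \<Longrightarrow> dxi v x = cont_rep (weak_deriv v) x"
    "\<And>s t. 0 \<le> s \<Longrightarrow> s \<le> t \<Longrightarrow> t \<le> 2*pi \<Longrightarrow> v t - v s = integral {s..t} (cont_rep (weak_deriv v))"
proof -
  have v1: "H1_fun v" "H1_fun (weak_deriv v)" using v by (auto simp: H2_fun_def)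
  let ?a = "cont_rep (weak_deriv v)"
  have eq: "v x = cont_rep v x" if "x \<in> {0..2*pi}" for x
    using that by (intro continuous_AE_eq[of 0 "2*pi" v]) (auto intro: cont cont_rep(1,4)[OF v1(1)])
  show int: "v t - v s = integral {s..t} ?a" if "0 \<le> s" "s \<le> t" "t \<le> 2*pi" for s t
  proof -
    have "v t - v s = integral {s..t} (weak_deriv v)"
      using eq[of s] eq[of t] cont_rep(3)[OF v1(1) that] that by auto
    also have "\<dots> = integral {s..t} ?a"
      by (rule integral_cong_AE_interval[OF cont_rep(1)[OF v1(2)]]) (use that in auto)
    finally show ?thesis .
  qed
  fix x :: real assume x: "0 < x" "x < 2*pi"
  have "((\<lambda>y. v 0 + integral {0..y} ?a) has_vector_derivative 0 + ?a x) (at x within {0..2*pi})"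
    by (intro derivative_intros integral_has_vector_derivative cont_rep(4)[OF v1(2)]) (use x in auto)
  then have *: "((\<lambda>y. v 0 + integral {0..y} ?a) has_vector_derivative ?a x) (at x within {0..2*pi})" by simp
  have "(v has_vector_derivative ?a x) (at x within {0..2*pi})"
  proof (rule has_vector_derivative_transform[OF _ _ *])
    show "x \<in> {0..2*pi}" using x by auto
    show "v y = v 0 + integral {0..y} ?a" if "y \<in> {0..2*pi}" for y
      using int[of 0 y] that by (auto simp: algebra_simps)
  qed
  then show d: "(v has_vector_derivative ?a x) (at x)" using x by (simp add: at_within_Icc_at)
  then show "dxi v x = ?a x" by (rule vector_derivative_at)
qed

section \<open>Pointwise values of the weak time derivative\<close>

lemma L2_fun_diff:
  fixes u w :: "real \<Rightarrow> 'a::euclidean_space"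
  assumes u: "L2_fun u" and w: "L2_fun w"
  shows "L2_fun (\<lambda>x. u x - w x)"
  unfolding L2_fun_def
proof (intro conjI)
  show "periodic (\<lambda>x. u x - w x)" using assms by (simp add: L2_fun_def periodic_def)
  have m: "u \<in> borel_measurable circle" "w \<in> borel_measurable circle" using assms by (auto simp: L2_fun_def)
  then show m': "(\<lambda>x. u x - w x) \<in> borel_measurable circle" by simp
  show "integrable circle (\<lambda>x. (norm (u x - w x))\<^sup>2)"
  proof (rule Bochner_Integration.integrable_bound)
    show "integrable circle (\<lambda>x. 2 * (norm (u x))\<^sup>2 + 2 * (norm (w x))\<^sup>2)"
      using assms by (simp add: L2_fun_def)
    show "(\<lambda>x. (norm (u x - w x))\<^sup>2) \<in> borel_measurable circle" using m' by measurable
    have "(norm (u x - w x))\<^sup>2 \<le> 2 * (norm (u x))\<^sup>2 + 2 * (norm (w x))\<^sup>2" for x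
    proof -
      have "(norm (u x - w x))\<^sup>2 \<le> (norm (u x) + norm (w x))\<^sup>2"
        by (intro power_mono norm_triangle_ineq4) auto
      then show ?thesis
        using zero_le_power2[of "norm (u x) - norm (w x)"] by (simp add: power2_sum power2_diff)
    qed
    then show "AE x in circle. norm ((norm (u x - w x))\<^sup>2) \<le> norm (2 * (norm (u x))\<^sup>2 + 2 * (norm (w x))\<^sup>2)"
      by (intro AE_I2) (smt (verit) real_norm_def zero_le_power2)
  qed
qed

lemma L2_norm_le_H2_norm: "L2_norm v \<le> H2_norm v"
  unfolding H2_norm_def by (rule real_le_rsqrt) simp

lemma L2_norm1_le:
  assumes "L2_fun u"
  shows "integral {0..2*pi} (\<lambda>x. norm (u x)) \<le> sqrt (2*pi) * L2_norm u"
proof -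
  have "(integral {0..2*pi} (\<lambda>x. norm (u x)))\<^sup>2 \<le> (2*pi - 0) * integral {0..2*pi} (\<lambda>x. (norm (u x))\<^sup>2)"
    by (intro integral_power2_le L2_fun_on assms) auto
  also have "\<dots> = (sqrt (2*pi) * L2_norm u)\<^sup>2"
    by (simp add: L2_norm_eq[OF assms] power_mult_distrib)
  finally show ?thesis by (rule power2_le_imp_le) (simp add: L2_norm_nonneg)
qed

lemma pairing_integrable:
  fixes u \<psi> :: "real \<Rightarrow> 'a::euclidean_space"
  assumes u: "L2_fun u" and \<psi>: "L2_fun \<psi>" "\<And>x. norm (\<psi> x) \<le> 1"
  shows "(\<lambda>x. u x \<bullet> \<psi> x) absolutely_integrable_on {0..2*pi}"
proof -
  have "bilinear (\<lambda>(x::'a) y. y \<bullet> x)"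
    by (simp add: bilinear_conv_bounded_bilinear bounded_bilinear.flip[OF bounded_bilinear_inner])
  then show ?thesis
    by (rule absolutely_integrable_bounded_measurable_product)
      (use \<psi> L2_fun_absolutely_integrable[OF u] in \<open>auto simp: L2_fun_def bounded_iff\<close>)
qed

lemma pairing_le:
  fixes u \<psi> :: "real \<Rightarrow> 'a::euclidean_space"
  assumes u: "L2_fun u" and \<psi>: "L2_fun \<psi>" "\<And>x. norm (\<psi> x) \<le> 1"
  shows "\<bar>LINT x|circle. u x \<bullet> \<psi> x\<bar> \<le> sqrt (2*pi) * L2_norm u"
proof -
  have "\<bar>LINT x|circle. u x \<bullet> \<psi> x\<bar> = norm (integral {0..2*pi} (\<lambda>x. u x \<bullet> \<psi> x))"
    by (simp add: LINT_eq_integral[OF pairing_integrable[OF assms]])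
  also have "\<dots> \<le> integral {0..2*pi} (\<lambda>x. norm (u x))"
  proof (rule integral_norm_bound_integral)
    show "(\<lambda>x. u x \<bullet> \<psi> x) integrable_on {0..2*pi}"
      using pairing_integrable[OF assms] by (simp add: absolutely_integrable_on_def)
    show "norm (u x \<bullet> \<psi> x) \<le> norm (u x)" for x
      using Cauchy_Schwarz_ineq2[of "u x" "\<psi> x"] mult_left_mono[OF \<psi>(2)[of x], of "norm (u x)"] by simp
  qed (rule L2_fun_on[OF u], auto)
  also note L2_norm1_le[OF u]
  finally show ?thesis .
qed

lemma borel_measurable_AE_limit:
  fixes l :: "real \<Rightarrow> 'b::euclidean_space"
  assumes lim: "AE t in lebesgue_on S. (\<lambda>n. k n t) \<longlonglongrightarrow> l t"
    and k: "\<And>n. k n \<in> borel_measurable (lebesgue_on S)" and S: "S \<in> sets lebesgue"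
  shows "l \<in> borel_measurable (lebesgue_on S)"
proof -
  define l' where "l' t = lim (\<lambda>n. k n t)" for t
  have "l' \<in> borel_measurable (lebesgue_on S)"
    unfolding l'_def by (rule borel_measurable_lim_metric) (rule k)
  then have "(\<lambda>t. if t \<in> S then l' t else 0) \<in> borel_measurable lebesgue"
    using S by (rule borel_measurable_if_I)
  moreover have "AE t in lebesgue. (if t \<in> S then l' t else 0) = (if t \<in> S then l t else 0)"
  proof -
    have "AE t in lebesgue. t \<in> S \<longrightarrow> (\<lambda>n. k n t) \<longlonglongrightarrow> l t"
      using lim S by (subst (asm) AE_restrict_space_iff) auto
    then show ?thesis by eventually_elim (auto simp: l'_def limI)
  qed
  ultimately have "(\<lambda>t. if t \<in> S then l t else 0) \<in> borel_measurable lebesgue"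
    by (rule borel_measurable_AE)
  then show ?thesis by (rule borel_measurable_if_D)
qed

text \<open>For a simple function the pairing takes finitely many values on measurable sets, and
  pairing is continuous for the \<open>H\<^sup>2\<close> norm, so measurability passes to the a.e.
  limit.\<close>

lemma pairing_measurable:
  assumes Y: "H2_strongly_measurable T Y" and \<psi>: "L2_fun \<psi>" "\<And>x. norm (\<psi> x) \<le> 1"
  shows "(\<lambda>t. LINT x|circle. Y t x \<bullet> \<psi> x) \<in> borel_measurable (lebesgue_on {0..T})"
proof -
  obtain s where s: "\<And>n. H2_simple T (s n)"
    and lim: "AE t in lebesgue_on {0..T}. (\<lambda>n. H2_norm (\<lambda>\<xi>. s n t \<xi> - Y t \<xi>)) \<longlonglongrightarrow> 0"
    and YH: "\<And>t. t \<in> {0..T} \<Longrightarrow> H2_fun (Y t)"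
    using Y unfolding H2_strongly_measurable_def by blast
  define k where "k n t = (LINT x|circle. s n t x \<bullet> \<psi> x)" for n t
  have k_meas: "k n \<in> borel_measurable (lebesgue_on {0..T})" for n
  proof (rule measurableI)
    fix A :: "real set"
    have fin: "finite (s n ` {0..T})" and lev: "\<And>v. {t \<in> {0..T}. s n t = v} \<in> sets lebesgue"
      using s[of n] by (auto simp: H2_simple_def)
    have "k n -` A \<inter> space (lebesgue_on {0..T}) = (\<Union>v\<in>{v \<in> s n ` {0..T}. (LINT x|circle. v x \<bullet> \<psi> x) \<in> A}. {t \<in> {0..T}. s n t = v})"
      by (auto simp: k_def)
    also have "\<dots> \<in> sets (lebesgue_on {0..T})"
    proof (intro sets.finite_UN)
      show "{t \<in> {0..T}. s n t = v} \<in> sets (lebesgue_on {0..T})" for v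
        using lev[of v] by (subst sets_restrict_space_iff) auto
    qed (use fin in auto)
    finally show "k n -` A \<inter> space (lebesgue_on {0..T}) \<in> sets (lebesgue_on {0..T})" .
  qed auto
  have "AE t in lebesgue_on {0..T}. (\<lambda>n. k n t) \<longlonglongrightarrow> (LINT x|circle. Y t x \<bullet> \<psi> x)"
    using lim AE_space
  proof eventually_elim
    case (elim t)
    then have t: "t \<in> {0..T}" by simp
    have L2: "L2_fun (Y t)" "L2_fun (s n t)" for n
      using YH[OF t] s[of n] t by (auto simp: H2_fun_def H1_fun_def H2_simple_def)
    have diff: "\<bar>k n t - (LINT x|circle. Y t x \<bullet> \<psi> x)\<bar> \<le> sqrt (2*pi) * H2_norm (\<lambda>\<xi>. s n t \<xi> - Y t \<xi>)" for n
    proof -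
      have "k n t - (LINT x|circle. Y t x \<bullet> \<psi> x) = (LINT x|circle. (s n t x - Y t x) \<bullet> \<psi> x)"
        unfolding k_def inner_diff_left
        by (rule Bochner_Integration.integral_diff[symmetric])
          (intro absolutely_integrable_imp_integrable pairing_integrable L2 \<psi>, simp)+
      also have "\<bar>\<dots>\<bar> \<le> sqrt (2*pi) * L2_norm (\<lambda>x. s n t x - Y t x)"
        by (rule pairing_le[OF L2_fun_diff[OF L2(2,1)] \<psi>])
      also have "\<dots> \<le> sqrt (2*pi) * H2_norm (\<lambda>\<xi>. s n t \<xi> - Y t \<xi>)"
        by (intro mult_left_mono L2_norm_le_H2_norm) auto
      finally show ?thesis .
    qed
    have "(\<lambda>n. sqrt (2*pi) * H2_norm (\<lambda>\<xi>. s n t \<xi> - Y t \<xi>)) \<longlonglongrightarrow> sqrt (2*pi) * 0"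
      using elim by (intro tendsto_intros) auto
    then have lim0: "(\<lambda>n. sqrt (2*pi) * H2_norm (\<lambda>\<xi>. s n t \<xi> - Y t \<xi>)) \<longlonglongrightarrow> 0" by simp
    have "(\<lambda>n. k n t - (LINT x|circle. Y t x \<bullet> \<psi> x)) \<longlonglongrightarrow> 0"
    proof (rule Lim_null_comparison[OF _ lim0])
      show "\<forall>\<^sub>F n in sequentially. norm (k n t - (LINT x|circle. Y t x \<bullet> \<psi> x)) \<le> sqrt (2*pi) * H2_norm (\<lambda>\<xi>. s n t \<xi> - Y t \<xi>)"
        unfolding real_norm_def by (intro always_eventually allI diff)
    qed
    then show ?case by (simp add: LIM_zero_iff)
  qed
  then show ?thesis
    by (rule borel_measurable_AE_limit[OF _ k_meas]) simp
qed

text \<open>Paired with a fixed \<psi>, the weak time derivative becomes a scalar one, and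
  \<open>du_Bois_Reymond\<close> applies in time. The pairing of \<open>X\<close> is continuous in
  time, so the identity holds at every \<open>t\<close>.\<close>

lemma weak_time_deriv_pairing:
  fixes X Y :: "real \<Rightarrow> real \<Rightarrow> real^2"
  assumes T: "0 < T" and cont: "continuous_on ({0..T} \<times> UNIV) (\<lambda>(t, \<xi>). X t \<xi>)"
    and X: "\<And>t. t \<in> {0..T} \<Longrightarrow> L2_fun (X t)"
    and Y: "H2_strongly_measurable T Y" and weak: "has_weak_time_deriv T X Y"
    and bound: "AE t in lebesgue_on {0..T}. H2_norm (Y t) \<le> K"
    and \<psi>: "L2_fun \<psi>" "\<And>x. norm (\<psi> x) \<le> 1" and t: "t \<in> {0..T}"
  shows "(LINT x|circle. X t x \<bullet> \<psi> x) - (LINT x|circle. X 0 x \<bullet> \<psi> x)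
    = integral {0..t} (\<lambda>s. LINT x|circle. Y s x \<bullet> \<psi> x)"
proof -
  define m where "m t = (LINT x|circle. X t x \<bullet> \<psi> x)" for t
  define k where "k t = (LINT x|circle. Y t x \<bullet> \<psi> x)" for t
  have YL: "L2_fun (Y t)" if "t \<in> {0..T}" for t
    using Y that by (auto simp: H2_strongly_measurable_def H2_fun_def H1_fun_def)
  have "AE t in lebesgue_on {0..T}. norm (k t) \<le> sqrt (2*pi) * K"
    using bound AE_space
  proof eventually_elim
    case (elim t)
    have "norm (k t) \<le> sqrt (2*pi) * L2_norm (Y t)"
      using pairing_le[OF YL \<psi>, of t] elim by (simp add: k_def)
    also have "\<dots> \<le> sqrt (2*pi) * K"
      using elim L2_norm_le_H2_norm[of "Y t"] by (intro mult_left_mono) auto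
    finally show ?case .
  qed
  then have "integrable (lebesgue_on {0..T}) k"
    using pairing_measurable[OF Y \<psi>] unfolding k_def
    by (intro finite_measure.integrable_const_bound[OF finite_measure_lebesgue_on]) auto
  then have k_ai: "k absolutely_integrable_on {0..T}"
    by (simp add: absolutely_integrable_measurable o_def)
  \<comment> \<open>Joint continuity of \<open>X\<close> is uniform on the compact set of times and
    one period.\<close>
  have m_cont: "continuous_on {0..T} m"
    unfolding continuous_on_iff
  proof (intro ballI allI impI)
    fix s and e :: real assume s: "s \<in> {0..T}" and "0 < e"
    have "uniformly_continuous_on ({0..T} \<times> {0..2*pi}) (\<lambda>(t, \<xi>). X t \<xi>)"
      by (intro compact_uniformly_continuous compact_Times continuous_on_subset[OF cont]) auto
    moreover define e' where "e' = e / (2*pi + 1)"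
    moreover have "0 < e'" using \<open>0 < e\<close> by (simp add: e'_def add_pos_pos)
    ultimately obtain d where d: "0 < d" "\<And>p q. p \<in> {0..T} \<times> {0..2*pi} \<Longrightarrow> q \<in> {0..T} \<times> {0..2*pi} \<Longrightarrow> dist q p < d \<Longrightarrow>
        dist ((\<lambda>(t, \<xi>). X t \<xi>) q) ((\<lambda>(t, \<xi>). X t \<xi>) p) < e'"
      unfolding uniformly_continuous_on_def by metis
    show "\<exists>d>0. \<forall>r\<in>{0..T}. dist r s < d \<longrightarrow> dist (m r) (m s) < e"
    proof (intro exI conjI ballI impI)
      fix r assume r: "r \<in> {0..T}" "dist r s < d"
      have near: "norm (X r x - X s x) \<le> e'" if "x \<in> {0..2*pi}" for x
        using d(2)[of "(s,x)" "(r,x)"] r s that by (simp add: dist_Pair_Pair dist_norm)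
      have ai: "(\<lambda>x. X r x \<bullet> \<psi> x) absolutely_integrable_on {0..2*pi}" "(\<lambda>x. X s x \<bullet> \<psi> x) absolutely_integrable_on {0..2*pi}"
        by (intro pairing_integrable X r s \<psi>)+
      then have i: "(\<lambda>x. X r x \<bullet> \<psi> x) integrable_on {0..2*pi}" "(\<lambda>x. X s x \<bullet> \<psi> x) integrable_on {0..2*pi}"
        by (auto simp: absolutely_integrable_on_def)
      have "m r - m s = integral {0..2*pi} (\<lambda>x. X r x \<bullet> \<psi> x - X s x \<bullet> \<psi> x)"
        by (simp add: m_def LINT_eq_integral ai integral_diff i)
      also have "norm \<dots> \<le> integral {0..2*pi} (\<lambda>x. e')"
      proof (rule integral_norm_bound_integral)
        show "norm (X r x \<bullet> \<psi> x - X s x \<bullet> \<psi> x) \<le> e'" if "x \<in> {0..2*pi}" for x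
        proof -
          have "norm (X r x \<bullet> \<psi> x - X s x \<bullet> \<psi> x) \<le> norm (X r x - X s x) * norm (\<psi> x)"
            by (simp add: Cauchy_Schwarz_ineq2 flip: inner_diff_left)
          also have "\<dots> \<le> e' * 1" using near[OF that] \<psi>(2) \<open>0 < e'\<close> by (intro mult_mono) auto
          finally show ?thesis by simp
        qed
      qed (auto intro!: integrable_diff i)
      also have "\<dots> = 2*pi * e'" by simp
      also have "\<dots> < (2*pi + 1) * e'" using \<open>0 < e'\<close> by (simp add: algebra_simps)
      also have "\<dots> = e" by (simp add: e'_def add_pos_pos less_imp_neq[symmetric])
      finally show "dist (m r) (m s) < e" by (simp add: dist_norm)
    qed (rule d)
  qed
  have m_ai: "m absolutely_integrable_on {0..T}" using m_cont by (rule absolutely_integrable_continuous_real)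
  obtain c where c: "AE s in lebesgue_on {0..T}. m s = c + integral {0..s} k"
  proof (rule du_Bois_Reymond[OF T m_ai k_ai])
    fix \<phi> \<phi>' :: "real \<Rightarrow> real" and a b :: real
    assume \<phi>: "\<And>x. (\<phi> has_real_derivative \<phi>' x) (at x)" "continuous_on UNIV \<phi>'" "0 < a" "b < T"
      "\<And>x. x \<notin> {a..b} \<Longrightarrow> \<phi> x = 0" "\<And>x. x \<notin> {a..b} \<Longrightarrow> \<phi>' x = 0"
    have \<phi>_cont: "continuous_on {0..T} \<phi>"
      using \<phi>(1) by (meson DERIV_continuous continuous_at_imp_continuous_on)
    have \<phi>'_cont: "continuous_on {0..T} \<phi>'" using \<phi>(2) continuous_on_subset by blast
    have "(LINT t|lebesgue_on {0..T}. \<phi>' t * m t) = - (LINT t|lebesgue_on {0..T}. \<phi> t * k t)"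
      using weak[unfolded has_weak_time_deriv_def, rule_format, of \<phi> \<phi>' a b \<psi>] \<phi> \<psi>(1)
      unfolding m_def k_def by blast
    then show "integral {0..T} (\<lambda>x. \<phi>' x *\<^sub>R m x) = - integral {0..T} (\<lambda>x. \<phi> x *\<^sub>R k x)"
      using absolutely_integrable_scaleR[OF \<phi>'_cont m_ai] absolutely_integrable_scaleR[OF \<phi>_cont k_ai]
      by (simp add: LINT_eq_integral)
  qed
  have m_eq: "m s = c + integral {0..s} k" if "s \<in> {0..T}" for s
    using T that k_ai
    by (intro continuous_AE_eq[OF T m_cont _ c] continuous_intros indefinite_integral_continuous_1)
      (auto simp: absolutely_integrable_on_def)
  have "m t - m 0 = integral {0..t} k" using m_eq[OF t] m_eq[of 0] T by simp
  then show ?thesis by (simp add: m_def k_def[abs_def])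
qed

section \<open>From pairings to values at a point\<close>

lemma periodize_borel_measurable:
  fixes f :: "real \<Rightarrow> 'a::{real_normed_vector, second_countable_topology}"
  assumes "f \<in> borel_measurable borel"
  shows "periodize f \<in> borel_measurable circle"
proof -
  have [measurable]: "f \<in> borel_measurable borel" by fact
  have "periodize f \<in> borel_measurable borel" unfolding periodize_def by measurable
  then have "periodize f \<in> borel_measurable lborel" by simp
  then have "periodize f \<in> borel_measurable lebesgue" by (rule measurable_completion)
  then show ?thesis by (rule measurable_restrict_space1)
qed

text \<open>The weight whose pairing with \<open>u\<close> integrates the component along
  \<open>e\<close> over \<open>{a..b}\<close>; made periodic because test weights on the circle must
  be.\<close>

definition window :: "real \<Rightarrow> real \<Rightarrow> 'a::euclidean_space \<Rightarrow> real \<Rightarrow> 'a" where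
  "window a b e = periodize (\<lambda>x. if x \<in> {a..b} then e else 0)"

lemma window_bound: "norm (window a b e x) \<le> norm e"
  by (simp add: window_def periodize_def)

lemma window_L2: "L2_fun (window a b e)"
  unfolding L2_fun_def
proof (intro conjI)
  show "periodic (window a b e)" by (simp add: window_def periodic_periodize)
  have [measurable]: "(\<lambda>x::real. if x \<in> {a..b} then e else 0) \<in> borel_measurable borel" by measurable
  show m: "window a b e \<in> borel_measurable circle"
    unfolding window_def by (rule periodize_borel_measurable) measurable
  show "integrable circle (\<lambda>\<xi>. (norm (window a b e \<xi>))\<^sup>2)"
    by (rule finite_measure.integrable_const_bound[OF finite_measure_lebesgue_on, where B="(norm e)\<^sup>2"])
      (use m in \<open>auto intro!: AE_I2 power_mono window_bound\<close>)
qed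

lemma window_pairing:
  fixes u :: "real \<Rightarrow> 'a::euclidean_space"
  assumes u: "L2_fun u" and ab: "0 \<le> a" "b \<le> 2*pi" and e: "norm e \<le> 1"
  shows "(LINT x|circle. u x \<bullet> window a b e x) = integral {a..b} (\<lambda>x. u x \<bullet> e)"
proof -
  have "(LINT x|circle. u x \<bullet> window a b e x) = integral {0..2*pi} (\<lambda>x. u x \<bullet> window a b e x)"
    by (intro LINT_eq_integral pairing_integrable u window_L2) (use window_bound e order_trans in blast)
  also have "\<dots> = integral {0..2*pi} (\<lambda>x. if x \<in> {a..b} then u x \<bullet> e else 0)"
    \<comment> \<open>Periodizing replaces the value at \<open>2*pi\<close> by the value at 0, a
      null set.\<close>
    by (rule integral_spike[of "{2*pi}"]) (auto simp: window_def periodize_eq_0)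
  also have "\<dots> = integral {a..b} (\<lambda>x. u x \<bullet> e)"
    unfolding integral_def integrable_on_def using ab by (subst (1 2) has_integral_restrict) auto
  finally show ?thesis .
qed

text \<open>One-sided averages to the right of \<open>x\<close>, with widths chosen so that every
  window stays inside \<open>{a..b}\<close> even for \<open>x = a\<close>.\<close>

lemma averages_tendsto:
  fixes f :: "real \<Rightarrow> 'a::banach"
  assumes f: "continuous_on {a..b} f" and x: "a \<le> x" "x < b"
  defines "\<epsilon> \<equiv> \<lambda>n::nat. (b - x) / (real n + 1)"
  shows "(\<lambda>n. (1 / \<epsilon> n) *\<^sub>R integral {x..x + \<epsilon> n} f) \<longlonglongrightarrow> f x"
proof -
  have \<epsilon>_pos: "0 < \<epsilon> n" and \<epsilon>_le: "x + \<epsilon> n \<le> b" for n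
  proof -
    show "0 < \<epsilon> n" using x by (simp add: \<epsilon>_def)
    have "(b - x) / (real n + 1) \<le> (b - x) / 1" using x by (intro divide_left_mono) auto
    then show "x + \<epsilon> n \<le> b" by (simp add: \<epsilon>_def)
  qed
  have \<epsilon>_lim: "\<epsilon> \<longlonglongrightarrow> 0"
    unfolding \<epsilon>_def using tendsto_mult[OF tendsto_const[of "b - x"] lim_inverse_n'[THEN LIMSEQ_Suc]]
    by (simp add: divide_inverse add.commute)
  have "((\<lambda>y. integral {a..y} f) has_vector_derivative f x) (at x within {a..b})"
    using integral_has_vector_derivative[OF f, of x] x by auto
  then have "((\<lambda>y. (1 / norm (y - x)) *\<^sub>R (integral {a..y} f - (integral {a..x} f + (y - x) *\<^sub>R f x))) \<longlongrightarrow> 0) (at x within {a..b})"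
    by (simp add: has_vector_derivative_def has_derivative_within)
  moreover have "filterlim (\<lambda>n. x + \<epsilon> n) (at x within {a..b}) sequentially"
    unfolding filterlim_at using tendsto_add[OF tendsto_const[of x] \<epsilon>_lim] \<epsilon>_pos \<epsilon>_le x
    by (auto intro!: always_eventually simp: less_imp_le less_imp_neq add_nonneg_nonneg order_trans[OF x(1)] order_less_imp_not_eq2)
  ultimately have "(\<lambda>n. (1 / norm (x + \<epsilon> n - x)) *\<^sub>R (integral {a..x + \<epsilon> n} f - (integral {a..x} f + (x + \<epsilon> n - x) *\<^sub>R f x))) \<longlonglongrightarrow> 0"
    by (rule filterlim_compose)
  moreover have "(1 / norm (x + \<epsilon> n - x)) *\<^sub>R (integral {a..x + \<epsilon> n} f - (integral {a..x} f + (x + \<epsilon> n - x) *\<^sub>R f x))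
      = (1 / \<epsilon> n) *\<^sub>R integral {x..x + \<epsilon> n} f - f x" for n
  proof -
    have "integral {a..x} f + integral {x..x + \<epsilon> n} f = integral {a..x + \<epsilon> n} f"
      using x \<epsilon>_pos[of n] \<epsilon>_le[of n]
      by (intro Henstock_Kurzweil_Integration.integral_combine integrable_continuous_real continuous_on_subset[OF f]) auto
    then have "integral {a..x + \<epsilon> n} f - (integral {a..x} f + (x + \<epsilon> n - x) *\<^sub>R f x) = integral {x..x + \<epsilon> n} f - \<epsilon> n *\<^sub>R f x"
      by (simp add: algebra_simps)
    then show ?thesis using \<epsilon>_pos[of n] by (simp only: scaleR_diff_right) simp
  qed
  ultimately show ?thesis by (simp add: LIM_zero_iff)
qed

text \<open>Evaluation at a point is no functional on \<open>L\<^sup>2\<close>, so it is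
  approximated by pairings with shrinking windows. For these the identity is
  \<open>weak_time_deriv_pairing\<close>; the time integrals converge because the averages are
  bounded by \<open>5 * K\<close> for almost every time.\<close>

lemma time_representation:
  fixes X Y :: "real \<Rightarrow> real \<Rightarrow> real^2"
  assumes T: "0 < T" and cont: "continuous_on ({0..T} \<times> UNIV) (\<lambda>(t, \<xi>). X t \<xi>)"
    and X: "\<And>t. t \<in> {0..T} \<Longrightarrow> L2_fun (X t)"
    and Y: "H2_strongly_measurable T Y" and weak: "has_weak_time_deriv T X Y"
    and bound: "AE t in lebesgue_on {0..T}. H2_norm (Y t) \<le> K"
    and x: "x \<in> {0..2*pi}"
  shows "(\<lambda>s. cont_rep (Y s) x) \<in> borel_measurable (lebesgue_on {0..T})"
    and "t \<in> {0..T} \<Longrightarrow> X t x = X 0 x + integral {0..t} (\<lambda>s. cont_rep (Y s) x)"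
proof -
  have YH: "H2_fun (Y t)" if "t \<in> {0..T}" for t
    using Y that by (auto simp: H2_strongly_measurable_def)
  have YL: "L2_fun (Y t)" "H1_fun (Y t)" if "t \<in> {0..T}" for t
    using YH[OF that] by (auto simp: H2_fun_def H1_fun_def)
  have main: "(\<lambda>s. cont_rep (Y s) x \<bullet> e) \<in> borel_measurable (lebesgue_on {0..T}) \<and>
      (\<forall>t\<in>{0..T}. (X t x - X 0 x) \<bullet> e = (LINT s|lebesgue_on {0..t}. cont_rep (Y s) x \<bullet> e))"
    if x: "0 \<le> x" "x < 2*pi" and e: "e \<in> Basis" for x and e :: "real^2"
  proof -
    define \<epsilon> where "\<epsilon> n = (2*pi - x) / (real n + 1)" for n :: nat
    have \<epsilon>: "0 < \<epsilon> n" "x + \<epsilon> n \<le> 2*pi" for n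
    proof -
      show "0 < \<epsilon> n" using x by (simp add: \<epsilon>_def)
      have "(2*pi - x) / (real n + 1) \<le> (2*pi - x) / 1" using x by (intro divide_left_mono) auto
      then show "x + \<epsilon> n \<le> 2*pi" by (simp add: \<epsilon>_def)
    qed
    have avg: "(\<lambda>n. 1 / \<epsilon> n * integral {x..x + \<epsilon> n} (\<lambda>y. v y \<bullet> e)) \<longlonglongrightarrow> v x \<bullet> e"
      if "continuous_on {0..2*pi} v" for v :: "real \<Rightarrow> real^2"
      using averages_tendsto[of 0 "2*pi" "\<lambda>y. v y \<bullet> e" x] that x
      unfolding \<epsilon>_def by (simp add: continuous_intros)
    have e1: "norm e \<le> 1" using e by simp
    define \<psi> where "\<psi> n = window x (x + \<epsilon> n) e" for n
    have \<psi>: "L2_fun (\<psi> n)" "\<And>y. norm (\<psi> n y) \<le> 1" for n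
      using window_bound[of x "x + \<epsilon> n" e] e1 by (auto simp: \<psi>_def window_L2 intro: order_trans)
    have pair: "(LINT y|circle. v y \<bullet> \<psi> n y) = integral {x..x + \<epsilon> n} (\<lambda>y. v y \<bullet> e)" if "L2_fun v" for v n
      unfolding \<psi>_def using x \<epsilon>(2)[of n] by (intro window_pairing that e1) auto
    define G where "G n s = 1 / \<epsilon> n * (LINT y|circle. Y s y \<bullet> \<psi> n y)" for n s
    have G_eq: "G n s = 1 / \<epsilon> n * integral {x..x + \<epsilon> n} (\<lambda>y. cont_rep (Y s) y \<bullet> e)" if s: "s \<in> {0..T}" for n s
    proof -
      have "AE y in circle. Y s y \<bullet> e = cont_rep (Y s) y \<bullet> e"
        using cont_rep(1)[OF YL(2)[OF s]] by eventually_elim simp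
      then have "integral {x..x + \<epsilon> n} (\<lambda>y. Y s y \<bullet> e) = integral {x..x + \<epsilon> n} (\<lambda>y. cont_rep (Y s) y \<bullet> e)"
        by (rule integral_cong_AE_interval) (use x \<epsilon> in auto)
      then show ?thesis by (simp add: G_def pair[OF YL(1)[OF s]])
    qed
    have G_lim: "(\<lambda>n. G n s) \<longlonglongrightarrow> cont_rep (Y s) x \<bullet> e" if s: "s \<in> {0..T}" for s
      unfolding G_eq[OF s] by (rule avg[OF cont_rep(4)[OF YL(2)[OF s]]])
    have G_meas: "G n \<in> borel_measurable (lebesgue_on {0..T})" for n
      unfolding G_def[abs_def] by (intro borel_measurable_times borel_measurable_const pairing_measurable[OF Y \<psi>])
    have meas: "(\<lambda>s. cont_rep (Y s) x \<bullet> e) \<in> borel_measurable (lebesgue_on {0..T})"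
      by (rule borel_measurable_LIMSEQ_real[where u=G]) (use G_lim G_meas in auto)
    have G_bound: "AE s in lebesgue_on {0..T}. \<forall>n. norm (G n s) \<le> 5 * K"
      using bound AE_space
    proof eventually_elim
      case (elim s)
      then have s: "s \<in> {0..T}" by simp
      show ?case
      proof
        fix n
        have "norm (integral {x..x + \<epsilon> n} (\<lambda>y. cont_rep (Y s) y \<bullet> e)) \<le> integral {x..x + \<epsilon> n} (\<lambda>y. 5 * K)"
        proof (rule integral_norm_bound_integral)
          show "(\<lambda>y. cont_rep (Y s) y \<bullet> e) integrable_on {x..x + \<epsilon> n}"
            using x \<epsilon>(2)[of n]
            by (intro integrable_continuous_real continuous_intros continuous_on_subset[OF cont_rep(4)[OF YL(2)[OF s]]]) auto
          fix y assume "y \<in> {x..x + \<epsilon> n}"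
          then have "y \<in> {0..2*pi}" using x \<epsilon>(2)[of n] by auto
          from cont_rep_bounds_H2(1)[OF YH[OF s] elim(1) this]
          show "norm (cont_rep (Y s) y \<bullet> e) \<le> 5 * K"
            using Basis_le_norm[OF e, of "cont_rep (Y s) y"] by simp
        qed auto
        also have "\<dots> = \<epsilon> n * (5 * K)" using \<epsilon>(1)[of n] by simp
        finally have "1 / \<epsilon> n * norm (integral {x..x + \<epsilon> n} (\<lambda>y. cont_rep (Y s) y \<bullet> e)) \<le> 1 / \<epsilon> n * (\<epsilon> n * (5 * K))"
          using \<epsilon>(1)[of n] by (intro mult_left_mono) auto
        then show "norm (G n s) \<le> 5 * K" using \<epsilon>(1)[of n] by (simp add: G_eq[OF s] abs_mult)
      qed
    qed
    have "(X t x - X 0 x) \<bullet> e = (LINT s|lebesgue_on {0..t}. cont_rep (Y s) x \<bullet> e)" if t: "t \<in> {0..T}" for t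
    proof -
      have sub: "{0..t} \<subseteq> {0..T}" using t by auto
      have meas_t: "g \<in> borel_measurable (lebesgue_on {0..t})" if "g \<in> borel_measurable (lebesgue_on {0..T})" for g :: "real \<Rightarrow> real"
        using measurable_restrict_mono[OF that sub] .
      have AE_t: "AE s in lebesgue_on {0..t}. P s" if "AE s in lebesgue_on {0..T}. P s" for P
        using that sub by (auto simp: AE_restrict_space_iff elim!: eventually_mono)
      have lim_R: "(\<lambda>n. LINT s|lebesgue_on {0..t}. G n s) \<longlonglongrightarrow> (LINT s|lebesgue_on {0..t}. cont_rep (Y s) x \<bullet> e)"
      proof (rule integral_dominated_convergence[where w="\<lambda>_. 5 * K"])
        show "AE s in lebesgue_on {0..t}. (\<lambda>n. G n s) \<longlonglongrightarrow> cont_rep (Y s) x \<bullet> e"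
          using t by (intro AE_I2 G_lim) auto
        show "AE s in lebesgue_on {0..t}. norm (G n s) \<le> 5 * K" for n
          using AE_t[OF G_bound] by eventually_elim auto
      qed (auto intro: meas_t meas G_meas)
      have G_int: "integrable (lebesgue_on {0..t}) (G n)" for n
      proof (rule finite_measure.integrable_const_bound[OF finite_measure_lebesgue_on])
        show "AE s in lebesgue_on {0..t}. norm (G n s) \<le> 5 * K"
          using AE_t[OF G_bound] by eventually_elim auto
      qed (auto intro: meas_t G_meas)
      have eq: "(LINT s|lebesgue_on {0..t}. G n s) = 1 / \<epsilon> n * integral {x..x + \<epsilon> n} (\<lambda>y. X t y \<bullet> e) - 1 / \<epsilon> n * integral {x..x + \<epsilon> n} (\<lambda>y. X 0 y \<bullet> e)" for n
      proof -
        have "(LINT s|lebesgue_on {0..t}. G n s) = integral {0..t} (G n)"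
          using G_int by (intro lebesgue_integral_eq_integral) auto
        also have "\<dots> = 1 / \<epsilon> n * integral {0..t} (\<lambda>s. LINT y|circle. Y s y \<bullet> \<psi> n y)"
          unfolding G_def[abs_def] by (rule integral_mult_right)
        also have "integral {0..t} (\<lambda>s. LINT y|circle. Y s y \<bullet> \<psi> n y) = (LINT y|circle. X t y \<bullet> \<psi> n y) - (LINT y|circle. X 0 y \<bullet> \<psi> n y)"
          by (rule weak_time_deriv_pairing[OF T cont X Y weak bound \<psi> t, symmetric])
        also have "\<dots> = integral {x..x + \<epsilon> n} (\<lambda>y. X t y \<bullet> e) - integral {x..x + \<epsilon> n} (\<lambda>y. X 0 y \<bullet> e)"
          using X[OF t] X[of 0] T by (simp add: pair)
        finally show ?thesis by (simp add: right_diff_distrib)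
      qed
      have X_cont: "continuous_on {0..2*pi} (X s)" if "s \<in> {0..T}" for s
      proof -
        have "continuous_on {0..2*pi} (\<lambda>y. (\<lambda>(t, \<xi>). X t \<xi>) (s, y))"
          by (rule continuous_on_compose2[OF cont])
            (use that in \<open>auto intro!: continuous_on_Pair continuous_on_const continuous_on_id\<close>)
        then show ?thesis by simp
      qed
      have "(\<lambda>n. LINT s|lebesgue_on {0..t}. G n s) \<longlonglongrightarrow> X t x \<bullet> e - X 0 x \<bullet> e"
        unfolding eq using t T by (intro tendsto_diff avg X_cont) auto
      from LIMSEQ_unique[OF this lim_R] show ?thesis by (simp add: inner_diff_left)
    qed
    with meas show ?thesis by blast
  qed
  \<comment> \<open>There is no window to the right of \<open>2*pi\<close> within the period; by
    periodicity that point is handled at 0.\<close>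
  define x' where "x' = (if x = 2*pi then 0 else x)"
  have x': "0 \<le> x'" "x' < 2*pi" using x by (auto simp: x'_def)
  have rep_x': "cont_rep (Y s) x = cont_rep (Y s) x'" if "s \<in> {0..T}" for s
    using cont_rep(2)[OF YL(2)[OF that]] by (simp add: x'_def)
  have X_x': "X t x = X t x'" if "t \<in> {0..T}" for t
    using X[OF that] periodic_shift_2pi[of "X t"] by (simp add: x'_def L2_fun_def)
  have meas': "(\<lambda>s. cont_rep (Y s) x') \<in> borel_measurable (lebesgue_on {0..T})"
    by (subst borel_measurable_euclidean_space) (use main[OF x'] in blast)
  show meas: "(\<lambda>s. cont_rep (Y s) x) \<in> borel_measurable (lebesgue_on {0..T})"
    using meas' by (subst measurable_cong[where g="\<lambda>s. cont_rep (Y s) x'"]) (auto simp: rep_x')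
  have "AE s in lebesgue_on {0..T}. norm (cont_rep (Y s) x') \<le> 5 * K"
    using bound AE_space by eventually_elim (use x' in \<open>auto intro!: cont_rep_bounds_H2(1)[OF YH]\<close>)
  then have i0: "integrable (lebesgue_on {0..T}) (\<lambda>s. cont_rep (Y s) x')"
    using meas' by (intro finite_measure.integrable_const_bound[OF finite_measure_lebesgue_on]) auto
  then have int: "integrable (lebesgue_on {0..t}) (\<lambda>s. cont_rep (Y s) x')" if "t \<in> {0..T}" for t
    using that by (intro integrable_subinterval[OF i0]) auto
  show "X t x = X 0 x + integral {0..t} (\<lambda>s. cont_rep (Y s) x)" if t: "t \<in> {0..T}"
  proof -
    have "X t x' - X 0 x' = integral {0..t} (\<lambda>s. cont_rep (Y s) x')"
    proof (rule euclidean_eqI)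
      fix e :: "real^2" assume e: "e \<in> Basis"
      have "(X t x' - X 0 x') \<bullet> e = (LINT s|lebesgue_on {0..t}. cont_rep (Y s) x' \<bullet> e)"
        using main[OF x' e] t by blast
      also have "\<dots> = (LINT s|lebesgue_on {0..t}. cont_rep (Y s) x') \<bullet> e"
        by (rule integral_inner_left) (use int[OF t] in auto)
      also have "(LINT s|lebesgue_on {0..t}. cont_rep (Y s) x') = integral {0..t} (\<lambda>s. cont_rep (Y s) x')"
        using int[OF t] by (intro lebesgue_integral_eq_integral) auto
      finally show "(X t x' - X 0 x') \<bullet> e = integral {0..t} (\<lambda>s. cont_rep (Y s) x') \<bullet> e" .
    qed
    also have "integral {0..t} (\<lambda>s. cont_rep (Y s) x') = integral {0..t} (\<lambda>s. cont_rep (Y s) x)"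
      using t by (intro integral_cong) (auto simp: rep_x')
    finally show ?thesis using X_x'[OF t] X_x'[of 0] T by (simp add: algebra_simps)
  qed
qed

section \<open>Piecewise linear functions\<close>

lemma periodic_shift_int:
  assumes "periodic v" shows "v (x + 2*pi * real_of_int k) = v x"
proof (induction k rule: int_induct[of _ 0])
  case base
  then show ?case by simp
next
  case (step1 i)
  have "v (x + 2*pi * real_of_int (i + 1)) = v ((x + 2*pi * real_of_int i) + 2*pi)" by (simp add: algebra_simps)
  with step1 assms show ?case by (simp add: periodic_def)
next
  case (step2 i)
  have "v (x + 2*pi * real_of_int i) = v ((x + 2*pi * real_of_int (i - 1)) + 2*pi)" by (simp add: algebra_simps)
  with step2 assms show ?case by (simp add: periodic_def)
qed

lemma periodize_periodic: "periodic v \<Longrightarrow> periodize v = v"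
  using periodic_shift_int[of v "_ - 2*pi * real_of_int k" k for k] by (auto simp: periodize_def fun_eq_iff)

lemma periodize_range:
  obtains y where "0 \<le> y" "y < 2*pi" "\<And>f. periodize f x = f y"
proof
  define n where "n = real_of_int \<lfloor>x / (2*pi)\<rfloor>"
  have "n \<le> x / (2*pi)" "x / (2*pi) < n + 1" unfolding n_def by linarith+
  from mult_left_mono[OF this(1), of "2*pi"] mult_strict_left_mono[OF this(2), of "2*pi"]
  show "0 \<le> x - 2*pi*n" "x - 2*pi*n < 2*pi" by (simp_all add: algebra_simps)
  show "periodize f x = f (x - 2*pi*n)" for f by (simp add: periodize_def n_def)
qed

lemma periodic_eqI:
  assumes "periodic u" "periodic v" "\<And>x. 0 \<le> x \<Longrightarrow> x < 2*pi \<Longrightarrow> u x = v x"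
  shows "u = v"
proof
  fix x
  obtain y where "0 \<le> y" "y < 2*pi" "periodize u x = u y" "periodize v x = v y"
    using periodize_range[of x] by metis
  then show "u x = v x" using assms by (simp add: periodize_periodic)
qed

section \<open>Exact integration on one element\<close>

text \<open>In the local coordinate \<theta> the integrand is the quadratic
  \<open>m u0 v0 + \<theta> * P + \<theta>^2 * Q\<close>, with explicit primitive
  \<open>A\<close>.\<close>

lemma integral_bilinear_affine:
  fixes m :: "'a::real_vector \<Rightarrow> 'a \<Rightarrow> real"
  assumes lin: "\<And>v. linear (\<lambda>u. m u v)" "\<And>u. linear (m u)" and ab: "a < b"
  shows "((\<lambda>x. m (u0 + ((x - a) / (b - a)) *\<^sub>R (u1 - u0)) (v0 + ((x - a) / (b - a)) *\<^sub>R (v1 - v0)))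
     has_integral ((b - a) / 6 * (2 * m u0 v0 + m u0 v1 + m u1 v0 + 2 * m u1 v1))) {a..b}"
proof -
  define h where "h = b - a"
  have h: "0 < h" using ab by (simp add: h_def)
  define P where "P = m u0 (v1 - v0) + m (u1 - u0) v0"
  define Q where "Q = m (u1 - u0) (v1 - v0)"
  define A where "A x = (x - a) * m u0 v0 + (x - a)^2 / (2 * h) * P + (x - a)^3 / (3 * h^2) * Q" for x
  have "m (u0 + \<theta> *\<^sub>R (u1 - u0)) (v0 + \<theta> *\<^sub>R (v1 - v0)) = m u0 v0 + \<theta> * P + \<theta>^2 * Q" for \<theta>
    unfolding P_def Q_def linear_add[OF lin(1)] linear_add[OF lin(2)] linear_cmul[OF lin(1)] linear_cmul[OF lin(2)]
    by (simp only: real_scaleR_def power2_eq_square algebra_simps)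
  from this[of "(x - a) / h" for x]
  have eq: "m (u0 + ((x - a) / (b - a)) *\<^sub>R (u1 - u0)) (v0 + ((x - a) / (b - a)) *\<^sub>R (v1 - v0))
      = m u0 v0 + (x - a) / h * P + ((x - a) / h)^2 * Q" for x
    unfolding h_def .
  have "((\<lambda>x. m u0 v0 + (x - a) / h * P + ((x - a) / h)^2 * Q) has_integral (A b - A a)) {a..b}"
    using ab h unfolding A_def
    by (intro fundamental_theorem_of_calculus)
      (auto intro!: derivative_eq_intros simp: power2_eq_square field_simps simp flip: has_real_derivative_iff_has_vector_derivative)
  moreover have "A b - A a = (b - a) / 6 * (2 * m u0 v0 + m u0 v1 + m u1 v0 + 2 * m u1 v1)"
  proof -
    have "A b - A a = h * m u0 v0 + h / 2 * P + h / 3 * Q"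
      using h by (simp add: A_def flip: h_def) (simp add: power2_eq_square power3_eq_cube field_simps)
    moreover have "P = m u0 v1 + m u1 v0 - 2 * m u0 v0" "Q = m u1 v1 - m u1 v0 - m u0 v1 + m u0 v0"
      by (simp_all add: P_def Q_def linear_diff[OF lin(1)] linear_diff[OF lin(2)])
    ultimately show ?thesis unfolding h_def[symmetric] by (simp add: field_simps)
  qed
  ultimately show ?thesis unfolding eq by simp
qed

lemma integral_affine:
  fixes A B :: real
  assumes "a < b"
  shows "((\<lambda>x. A + (x - a) / (b - a) * B) has_integral ((b - a) * A + (b - a) / 2 * B)) {a..b}"
proof -
  have lin: "linear (\<lambda>u::real. u * v)" "linear ((*) v)" for v :: real
    by (auto intro!: linearI simp: algebra_simps)
  have "((\<lambda>x. (1 + ((x - a) / (b - a)) *\<^sub>R (1 - 1)) * (A + ((x - a) / (b - a)) *\<^sub>R (A + B - A))) has_integral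
      ((b - a) / 6 * (2 * (1 * A) + 1 * (A + B) + 1 * A + 2 * (1 * (A + B))))) {a..b}"
    by (rule integral_bilinear_affine[OF lin assms])
  moreover have "(b - a) / 6 * (2 * (1 * A) + 1 * (A + B) + 1 * A + 2 * (1 * (A + B))) = (b - a) * A + (b - a) / 2 * B"
    by (simp add: field_simps)
  ultimately show ?thesis
    by (simp only: diff_self mult_zero_right scaleR_zero_right add_0_right mult_1_left add_diff_cancel_left' real_scaleR_def)
qed

section \<open>The mesh and its piecewise linear functions\<close>

locale mesh =
  fixes N :: nat and p :: "nat \<Rightarrow> real"
  assumes partition: "circle_partition N p"
begin

definition h :: "nat \<Rightarrow> real" where "h j = p j - p (j - 1)"

lemma N: "1 \<le> N" and p0 [simp]: "p 0 = 0" and pN [simp]: "p N = 2*pi"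
  and p_less: "j < N \<Longrightarrow> p j < p (Suc j)"
  using partition by (auto simp: circle_partition_def)

lemma h_pos: "j \<in> {1..N} \<Longrightarrow> 0 < h j"
  using p_less[of "j - 1"] by (auto simp: h_def)

lemma p_mono: "i \<le> j \<Longrightarrow> j \<le> N \<Longrightarrow> p i \<le> p j"
proof (induction j)
  case (Suc j)
  then show ?case using p_less[of j] by (cases "i = Suc j") auto
qed simp

lemma p_bounds: "j \<le> N \<Longrightarrow> 0 \<le> p j \<and> p j \<le> 2*pi"
  using p_mono[of 0 j] p_mono[of j N] by auto

lemma mesh_step_eq: "j \<in> {1..N} \<Longrightarrow> mesh_step N p j = h j"
  by (auto simp: mesh_step_def h_def)

lemma element_cover:
  assumes "0 \<le> x" "x < 2*pi"
  obtains i where "i \<in> {1..N}" "p (i - 1) \<le> x" "x < p i"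
proof -
  define i where "i = (LEAST i. x < p i)"
  have "x < p N" using assms by simp
  then have i: "x < p i" "i \<le> N" unfolding i_def by (rule LeastI, rule Least_le)
  have "i \<noteq> 0" using i assms by (auto intro: ccontr)
  then have "\<not> x < p (i - 1)" using not_less_Least[of "i - 1" "\<lambda>i. x < p i"] by (auto simp: i_def)
  with i \<open>i \<noteq> 0\<close> show thesis by (intro that[of i]) auto
qed

text \<open>Each summand climbs from 0 to the increment \<open>c j - c (j - 1)\<close> across
  element \<open>j\<close> and is constant elsewhere. Written this way, continuity is evident and no
  gluing at the nodes arises.\<close>

definition ramp :: "(nat \<Rightarrow> 'a::real_normed_vector) \<Rightarrow> real \<Rightarrow> 'a" where
  "ramp c x = c 0 + (\<Sum>j=1..N. (max 0 (min (x - p (j - 1)) (h j)) / h j) *\<^sub>R (c j - c (j - 1)))"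

definition pl :: "(nat \<Rightarrow> 'a::real_normed_vector) \<Rightarrow> real \<Rightarrow> 'a" where
  "pl c = periodize (ramp c)"

lemma telescope: "i \<le> N \<Longrightarrow> c 0 + (\<Sum>j=1..i. c j - c (j - 1)) = (c i :: 'a::real_normed_vector)"
proof (induction i)
  case (Suc i)
  have "c 0 + (\<Sum>j=1..Suc i. c j - c (j - 1)) = (c 0 + (\<Sum>j=1..i. c j - c (j - 1))) + (c (Suc i) - c i)"
    by (simp add: add.assoc)
  with Suc show ?case by simp
qed simp

text \<open>Left of element \<open>i\<close> all ramps are saturated and telescope to
  \<open>c (i - 1)\<close>; right of it all are still 0.\<close>

lemma ramp_element:
  assumes i: "i \<in> {1..N}" and x: "p (i - 1) \<le> x" "x \<le> p i"
  shows "ramp c x = c (i - 1) + ((x - p (i - 1)) / h i) *\<^sub>R (c i - c (i - 1))"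
proof -
  let ?g = "\<lambda>j. (max 0 (min (x - p (j - 1)) (h j)) / h j) *\<^sub>R (c j - c (j - 1))"
  have "{1..N} = {1..i-1} \<union> {i..N}" using i by auto
  then have "(\<Sum>j=1..N. ?g j) = (\<Sum>j\<in>{1..i-1} \<union> {i..N}. ?g j)" by (rule sum.cong) simp
  also have "\<dots> = (\<Sum>j=1..i-1. ?g j) + (\<Sum>j=i..N. ?g j)"
    by (rule sum.union_disjoint) (use i in auto)
  also have "(\<Sum>j=i..N. ?g j) = ?g i + (\<Sum>j=i+1..N. ?g j)"
    using sum.atLeast_Suc_atMost[of i N ?g] i by simp
  also have "(\<Sum>j=1..i-1. ?g j) + (?g i + (\<Sum>j=i+1..N. ?g j)) = (\<Sum>j=1..i-1. ?g j) + ?g i + (\<Sum>j=i+1..N. ?g j)"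
    by (rule add.assoc[symmetric])
  also have "(\<Sum>j=1..i-1. ?g j) = (\<Sum>j=1..i-1. c j - c (j - 1))"
  proof (intro sum.cong refl)
    fix j assume j: "j \<in> {1..i-1}"
    then have "p j \<le> p (i - 1)" using i by (intro p_mono) auto
    then have "h j \<le> x - p (j - 1)" using x by (simp add: h_def)
    moreover have "0 < h j" using j i by (intro h_pos) auto
    ultimately show "?g j = c j - c (j - 1)" by (simp add: min_absorb2)
  qed
  also have "(\<Sum>j=i+1..N. ?g j) = 0"
  proof (intro sum.neutral ballI)
    fix j assume j: "j \<in> {i+1..N}"
    then have "p i \<le> p (j - 1)" using i by (intro p_mono) auto
    then show "?g j = 0" using x by simp
  qed
  also have "?g i = ((x - p (i - 1)) / h i) *\<^sub>R (c i - c (i - 1))"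
    using x h_pos[OF i] by (simp add: h_def)
  also have "c 0 + ((\<Sum>j=1..i-1. c j - c (j - 1)) + ((x - p (i - 1)) / h i) *\<^sub>R (c i - c (i - 1)) + 0)
      = c (i - 1) + ((x - p (i - 1)) / h i) *\<^sub>R (c i - c (i - 1))"
  proof -
    have "i - 1 \<le> N" using i by auto
    from telescope[OF this, of c] show ?thesis by (simp add: add.assoc[symmetric])
  qed
  finally show ?thesis by (simp add: ramp_def)
qed

text \<open>Being constant outside one period is what \<open>continuous_on_periodize\<close> asks
  for; \<open>c 0 = c N\<close> makes the two outer values equal.\<close>

lemma ramp_outside:
  assumes "c 0 = c N" "x \<le> 0 \<or> 2*pi \<le> x"
  shows "ramp c x = c 0"
proof (cases "x \<le> 0")
  case True
  have "(\<Sum>j=1..N. (max 0 (min (x - p (j - 1)) (h j)) / h j) *\<^sub>R (c j - c (j - 1))) = 0"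
  proof (intro sum.neutral ballI)
    fix j assume "j \<in> {1..N}"
    then have "0 \<le> p (j - 1)" using p_bounds[of "j - 1"] by auto
    then show "(max 0 (min (x - p (j - 1)) (h j)) / h j) *\<^sub>R (c j - c (j - 1)) = 0" using True by simp
  qed
  then show ?thesis by (simp add: ramp_def)
next
  case False
  have "(\<Sum>j=1..N. (max 0 (min (x - p (j - 1)) (h j)) / h j) *\<^sub>R (c j - c (j - 1))) = (\<Sum>j=1..N. c j - c (j - 1))"
  proof (intro sum.cong refl)
    fix j assume j: "j \<in> {1..N}"
    then have "h j \<le> x - p (j - 1)" using p_bounds[of j] False assms by (auto simp: h_def)
    with h_pos[OF j] show "(max 0 (min (x - p (j - 1)) (h j)) / h j) *\<^sub>R (c j - c (j - 1)) = c j - c (j - 1)"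
      by (simp add: min_absorb2)
  qed
  then show ?thesis using telescope[of N c] assms by (simp add: ramp_def)
qed

lemma pl_eq_ramp: "c 0 = c N \<Longrightarrow> x \<in> {0..2*pi} \<Longrightarrow> pl c x = ramp c x"
  unfolding pl_def by (intro periodize_Icc) (simp_all add: ramp_outside)

lemma pl_element:
  assumes "c 0 = c N" "i \<in> {1..N}" "p (i - 1) \<le> x" "x \<le> p i"
  shows "pl c x = c (i - 1) + ((x - p (i - 1)) / h i) *\<^sub>R (c i - c (i - 1))"
proof -
  have "i - 1 \<le> N" using assms(2) by auto
  then have "x \<in> {0..2*pi}" using assms p_bounds[of i] p_bounds[of "i - 1"] by auto
  then show ?thesis using assms by (simp add: pl_eq_ramp ramp_element)
qed

lemma pl_node: "c 0 = c N \<Longrightarrow> i \<le> N \<Longrightarrow> pl c (p i) = c i"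
proof (cases "i = 0")
  case True
  assume "c 0 = c N"
  then show ?thesis using True pl_element[of c 1 0] N p_less[of 0] by simp
next
  case False
  assume "c 0 = c N" "i \<le> N"
  then show ?thesis
    using False pl_element[of c i "p i"] h_pos[of i] by (simp add: h_def)
qed

lemma continuous_on_pl: "c 0 = c N \<Longrightarrow> continuous_on S (pl c)"
  unfolding pl_def
proof (rule continuous_on_periodize[of _ "c 0"])
  show "continuous_on UNIV (ramp c)"
    unfolding ramp_def[abs_def] divide_inverse by (intro continuous_intros)
qed (rule ramp_outside)

lemma pl_in_P1: "c 0 = c N \<Longrightarrow> pl c \<in> P1_space N p"
  unfolding P1_space_def
proof (intro CollectI conjI ballI)
  assume c: "c 0 = c N"
  show "periodic (pl c)" by (simp add: pl_def periodic_periodize)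
  show "continuous_on UNIV (pl c)" by (rule continuous_on_pl[OF c])
  fix j assume j: "j \<in> {1..N}"
  show "\<exists>a b. \<forall>\<xi>\<in>{p (j - 1)..p j}. pl c \<xi> = a + \<xi> *\<^sub>R b"
  proof (intro exI ballI)
    fix \<xi> assume "\<xi> \<in> {p (j - 1)..p j}"
    then have "pl c \<xi> = c (j - 1) + ((\<xi> - p (j - 1)) / h j) *\<^sub>R (c j - c (j - 1))"
      using pl_element[OF c j] by auto
    then show "pl c \<xi> = (c (j - 1) - (p (j - 1) / h j) *\<^sub>R (c j - c (j - 1))) + \<xi> *\<^sub>R ((1 / h j) *\<^sub>R (c j - c (j - 1)))"
      by (simp add: diff_divide_distrib scaleR_diff_left algebra_simps)
  qed
qed

lemma P1_eq_pl:
  assumes "v \<in> P1_space N p"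
  shows "v (p 0) = v (p N)" "v = pl (\<lambda>i. v (p i))"
proof -
  have per: "periodic v" using assms by (simp add: P1_space_def)
  show 0: "v (p 0) = v (p N)" using periodic_shift_2pi[OF per] by simp
  show "v = pl (\<lambda>i. v (p i))"
  proof (rule periodic_eqI[OF per])
    show "periodic (pl (\<lambda>i. v (p i)))" by (simp add: pl_def periodic_periodize)
    fix x assume "0 \<le> x" "x < 2*pi"
    then obtain i where i: "i \<in> {1..N}" "p (i - 1) \<le> x" "x < p i" by (rule element_cover)
    obtain a b where ab: "\<And>\<xi>. \<xi> \<in> {p (i - 1)..p i} \<Longrightarrow> v \<xi> = a + \<xi> *\<^sub>R b"
      using assms i(1) unfolding P1_space_def by blast
    have "pl (\<lambda>i. v (p i)) x = v (p (i - 1)) + ((x - p (i - 1)) / h i) *\<^sub>R (v (p i) - v (p (i - 1)))"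
      using i 0 by (intro pl_element) auto
    also have "\<dots> = a + p (i - 1) *\<^sub>R b + ((x - p (i - 1)) / h i) *\<^sub>R (h i *\<^sub>R b)"
      using i by (simp add: ab h_def scaleR_diff_left)
    also have "\<dots> = a + x *\<^sub>R b" using h_pos[OF i(1)] by (simp add: scaleR_diff_left)
    also have "\<dots> = v x" using ab[of x] i by simp
    finally show "v x = pl (\<lambda>i. v (p i)) x" by simp
  qed
qed

lemma P1_eqI:
  assumes "u \<in> P1_space N p" "v \<in> P1_space N p" "\<And>i. i \<in> {1..N} \<Longrightarrow> u (p i) = v (p i)"
  shows "u = v"
proof -
  have "u (p i) = v (p i)" if "i \<le> N" for i
  proof (cases "i = 0")
    case True
    have "u (p N) = v (p N)" by (rule assms(3)) (use N in auto)
    with True show ?thesis by (simp only: P1_eq_pl(1)[OF assms(1)] P1_eq_pl(1)[OF assms(2)])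
  next
    case False
    with that show ?thesis by (intro assms(3)) auto
  qed
  note eq = this
  have "pl (\<lambda>i. u (p i)) x = pl (\<lambda>i. v (p i)) x" for x
    unfolding pl_def periodize_def ramp_def
    by (intro sum.cong refl arg_cong2[of _ _ _ _ "(+)"] arg_cong2[of _ _ _ _ "(*\<^sub>R)"] arg_cong2[of _ _ _ _ "(-)"] eq) auto
  then show ?thesis using P1_eq_pl(2)[OF assms(1)] P1_eq_pl(2)[OF assms(2)] by (metis ext)
qed

text \<open>The definite description needs both existence, provided by \<open>pl\<close>, and
  uniqueness, provided by \<open>P1_eqI\<close>.\<close>

lemma hat_props:
  assumes j: "j \<in> {1..N}"
  shows "hat N p j \<in> P1_space N p" "\<And>i. i \<in> {1..N} \<Longrightarrow> hat N p j (p i) = (if i = j then 1 else 0)"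
proof -
  define c :: "nat \<Rightarrow> real" where "c = wrap N (\<lambda>i. if i = j then 1 else 0)"
  have c0: "c 0 = c N" using N by (simp add: c_def wrap_def)
  have ex: "pl c \<in> P1_space N p \<and> (\<forall>i\<in>{1..N}. pl c (p i) = (if i = j then 1 else 0))"
  proof (intro conjI ballI)
    fix i assume "i \<in> {1..N}"
    then show "pl c (p i) = (if i = j then 1 else 0)"
      by (subst pl_node[OF c0]) (auto simp: c_def wrap_def)
  qed (rule pl_in_P1[OF c0])
  have "hat N p j \<in> P1_space N p \<and> (\<forall>i\<in>{1..N}. hat N p j (p i) = (if i = j then 1 else 0))"
    unfolding hat_def by (rule theI[of _ "pl c"]) (use ex in \<open>auto intro!: P1_eqI\<close>)
  then show "hat N p j \<in> P1_space N p" "\<And>i. i \<in> {1..N} \<Longrightarrow> hat N p j (p i) = (if i = j then 1 else 0)" by auto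
qed

text \<open>Links the basis expansion in the problem statement to the explicit function
  \<open>pl\<close>, on which all computations are done. Both sides are in the space and agree at
  the nodes.\<close>

lemma sum_hat:
  fixes c :: "nat \<Rightarrow> 'a::real_normed_vector"
  shows "(\<lambda>\<xi>. \<Sum>j=1..N. hat N p j \<xi> *\<^sub>R c j) = pl (wrap N c)"
proof (rule P1_eqI)
  show "pl (wrap N c) \<in> P1_space N p" using N by (intro pl_in_P1) (simp add: wrap_def)
  show "(\<lambda>\<xi>. \<Sum>j=1..N. hat N p j \<xi> *\<^sub>R c j) \<in> P1_space N p"
    unfolding P1_space_def
  proof (intro CollectI conjI ballI)
    show "periodic (\<lambda>\<xi>. \<Sum>j=1..N. hat N p j \<xi> *\<^sub>R c j)"
      using hat_props(1) by (simp add: P1_space_def periodic_def)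
    show "continuous_on UNIV (\<lambda>\<xi>. \<Sum>j=1..N. hat N p j \<xi> *\<^sub>R c j)"
      using hat_props(1) by (intro continuous_intros) (auto simp: P1_space_def)
    fix i assume i: "i \<in> {1..N}"
    have "\<exists>a b. \<forall>\<xi>\<in>{p (i - 1)..p i}. hat N p j \<xi> = a + \<xi> *\<^sub>R b" if "j \<in> {1..N}" for j
      using hat_props(1)[OF that] i by (simp add: P1_space_def)
    then obtain A B where AB: "\<And>j \<xi>. j \<in> {1..N} \<Longrightarrow> \<xi> \<in> {p (i - 1)..p i} \<Longrightarrow> hat N p j \<xi> = A j + \<xi> *\<^sub>R B j"
      by metis
    show "\<exists>a b. \<forall>\<xi>\<in>{p (i - 1)..p i}. (\<Sum>j=1..N. hat N p j \<xi> *\<^sub>R c j) = a + \<xi> *\<^sub>R b"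
    proof (intro exI ballI)
      fix \<xi> assume \<xi>: "\<xi> \<in> {p (i - 1)..p i}"
      have "(\<Sum>j=1..N. hat N p j \<xi> *\<^sub>R c j) = (\<Sum>j=1..N. A j *\<^sub>R c j + \<xi> *\<^sub>R (B j *\<^sub>R c j))"
        by (intro sum.cong refl) (simp add: AB[OF _ \<xi>] scaleR_add_left)
      then show "(\<Sum>j=1..N. hat N p j \<xi> *\<^sub>R c j) = (\<Sum>j=1..N. A j *\<^sub>R c j) + \<xi> *\<^sub>R (\<Sum>j=1..N. B j *\<^sub>R c j)"
        by (simp add: sum.distrib scaleR_sum_right)
    qed
  qed
  fix i assume i: "i \<in> {1..N}"
  have "(\<Sum>j=1..N. hat N p j (p i) *\<^sub>R c j) = (\<Sum>j=1..N. if i = j then c j else 0)"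
    using hat_props(2)[OF _ i] by (intro sum.cong refl) simp
  also have "\<dots> = c i" using i by simp
  also have "\<dots> = pl (wrap N c) (p i)" using i N by (subst pl_node) (auto simp: wrap_def)
  finally show "(\<Sum>j=1..N. hat N p j (p i) *\<^sub>R c j) = pl (wrap N c) (p i)" .
qed

lemma pl_derivative:
  fixes c :: "nat \<Rightarrow> 'a::real_normed_vector"
  assumes "c 0 = c N" "i \<in> {1..N}" "p (i - 1) < x" "x < p i"
  shows "(pl c has_vector_derivative (1 / h i) *\<^sub>R (c i - c (i - 1))) (at x)"
proof (rule has_vector_derivative_transform_within_open[where S="{p (i - 1)<..<p i}"])
  show "((\<lambda>x. c (i - 1) + ((x - p (i - 1)) / h i) *\<^sub>R (c i - c (i - 1))) has_vector_derivative (1 / h i) *\<^sub>R (c i - c (i - 1))) (at x)"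
    by (auto intro!: derivative_eq_intros simp: divide_inverse)
qed (use assms in \<open>auto simp: pl_element\<close>)

lemma has_integral_elements:
  fixes F :: "real \<Rightarrow> 'a::banach"
  assumes "\<And>i. i \<in> {1..N} \<Longrightarrow> (F has_integral I i) {p (i - 1)..p i}"
  shows "(F has_integral (\<Sum>i=1..N. I i)) {0..2*pi}"
proof -
  have "(F has_integral (\<Sum>i=1..k. I i)) {0..p k}" if "k \<le> N" for k
    using that
  proof (induction k)
    case 0
    then show ?case using has_integral_refl(2)[of F 0] by simp
  next
    case (Suc k)
    have "(F has_integral ((\<Sum>i=1..k. I i) + I (Suc k))) {0..p (Suc k)}"
      using Suc assms[of "Suc k"] p_bounds[of k] p_less[of k]
      by (intro has_integral_combine[of 0 "p k"]) auto
    then show ?case by simp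
  qed
  from this[of N] show ?thesis by simp
qed

lemma integrable_elements:
  fixes F :: "real \<Rightarrow> 'a::euclidean_space"
  assumes "\<And>i. i \<in> {1..N} \<Longrightarrow> F absolutely_integrable_on {p (i - 1)..p i}"
  shows "F absolutely_integrable_on {0..2*pi}" "integral {0..2*pi} F = (\<Sum>i=1..N. integral {p (i - 1)..p i} F)"
proof -
  have i: "(F has_integral (\<Sum>i=1..N. integral {p (i - 1)..p i} F)) {0..2*pi}"
    "((\<lambda>x. norm (F x)) has_integral (\<Sum>i=1..N. integral {p (i - 1)..p i} (\<lambda>x. norm (F x)))) {0..2*pi}"
    using assms by (intro has_integral_elements; auto simp: absolutely_integrable_on_def)+
  then show "F absolutely_integrable_on {0..2*pi}" "integral {0..2*pi} F = (\<Sum>i=1..N. integral {p (i - 1)..p i} F)"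
    by (auto simp: absolutely_integrable_on_def integral_unique)
qed

text \<open>At the ends of an element the derivative of a piecewise linear function is unspecified;
  a finite set does not affect the integrals.\<close>

lemma element_spike:
  fixes F :: "real \<Rightarrow> 'a::euclidean_space"
  assumes "continuous_on {a..b} G" "\<And>x. a < x \<Longrightarrow> x < b \<Longrightarrow> F x = G x"
  shows "F absolutely_integrable_on {a..b}" "integral {a..b} F = integral {a..b} G"
proof -
  have G: "G absolutely_integrable_on {a..b}" using assms(1) by (rule absolutely_integrable_continuous_real)
  then show "F absolutely_integrable_on {a..b}"
    by (rule absolutely_integrable_spike[where S="{a, b}"]) (use assms(2) in \<open>auto simp: less_le\<close>)
  show "integral {a..b} F = integral {a..b} G"
    by (rule integral_spike[where S="{a, b}"]) (use assms(2) in \<open>auto simp: less_le\<close>)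
qed

lemma LINT_elements:
  fixes F :: "real \<Rightarrow> real"
  assumes "\<And>i. i \<in> {1..N} \<Longrightarrow> continuous_on {p (i - 1)..p i} (G i)"
    and "\<And>i x. i \<in> {1..N} \<Longrightarrow> p (i - 1) < x \<Longrightarrow> x < p i \<Longrightarrow> F x = G i x"
    and "\<And>i. i \<in> {1..N} \<Longrightarrow> (G i has_integral I i) {p (i - 1)..p i}"
  shows "(LINT x|circle. F x) = (\<Sum>i=1..N. I i)" "F absolutely_integrable_on {0..2*pi}"
proof -
  have ai: "F absolutely_integrable_on {p (i - 1)..p i}" "integral {p (i - 1)..p i} F = I i" if "i \<in> {1..N}" for i
    using element_spike[of "p (i - 1)" "p i" "G i" F] assms that by (auto simp: integral_unique)
  show "F absolutely_integrable_on {0..2*pi}" by (rule integrable_elements(1)[OF ai(1)])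
  then have "(LINT x|circle. F x) = integral {0..2*pi} F" by (rule LINT_eq_integral)
  also have "\<dots> = (\<Sum>i=1..N. integral {p (i - 1)..p i} F)" by (rule integrable_elements(2)[OF ai(1)])
  also have "\<dots> = (\<Sum>i=1..N. I i)" by (intro sum.cong refl ai(2))
  finally show "(LINT x|circle. F x) = (\<Sum>i=1..N. I i)" .
qed

end

section \<open>The integrals of the scheme as nodal forms\<close>

text \<open>The factor \<open>(norm b)\<^sup>2\<close> cancels the normalisation, since
  \<open>norm b\<close> times the unit normal is \<open>perp b\<close>; this also holds for
  \<open>b = 0\<close>, where both sides vanish.\<close>

lemma unit_normal_simps:
  assumes "dxi x \<xi> = b"
  shows "(norm (dxi x \<xi>))\<^sup>2 * ((\<alpha> *\<^sub>R u + (1 - \<alpha>) *\<^sub>R ((u \<bullet> unit_normal x \<xi>) *\<^sub>R unit_normal x \<xi>)) \<bullet> v)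
      = mass_density \<alpha> ((norm b)\<^sup>2) b u v"
    "(norm (dxi x \<xi>))\<^sup>2 * (unit_normal x \<xi> \<bullet> v) = norm b * (v \<bullet> perp b)"
proof -
  have n: "norm b *\<^sub>R unit_normal x \<xi> = perp b"
    by (cases "b = 0") (simp_all add: unit_normal_def assms perp_scaleR)
  have "(norm b)\<^sup>2 * ((u \<bullet> unit_normal x \<xi>) * (unit_normal x \<xi> \<bullet> v)) = (u \<bullet> (norm b *\<^sub>R unit_normal x \<xi>)) * ((norm b *\<^sub>R unit_normal x \<xi>) \<bullet> v)"
    by (simp add: power2_eq_square)
  then have "(norm b)\<^sup>2 * ((u \<bullet> unit_normal x \<xi>) * (unit_normal x \<xi> \<bullet> v)) = (u \<bullet> perp b) * (v \<bullet> perp b)"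
    unfolding n by (simp add: inner_commute)
  then show "(norm (dxi x \<xi>))\<^sup>2 * ((\<alpha> *\<^sub>R u + (1 - \<alpha>) *\<^sub>R ((u \<bullet> unit_normal x \<xi>) *\<^sub>R unit_normal x \<xi>)) \<bullet> v)
      = mass_density \<alpha> ((norm b)\<^sup>2) b u v"
    by (simp add: assms mass_density_def inner_add_left distrib_left mult.left_commute)
  have "(norm b)\<^sup>2 * (unit_normal x \<xi> \<bullet> v) = norm b * ((norm b *\<^sub>R unit_normal x \<xi>) \<bullet> v)"
    by (simp add: power2_eq_square)
  then show "(norm (dxi x \<xi>))\<^sup>2 * (unit_normal x \<xi> \<bullet> v) = norm b * (v \<bullet> perp b)"
    unfolding n assms by (simp add: inner_commute)
qed

text \<open>Quadratic homogeneity in \<open>q\<close>, used to pass from the derivative on an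
  element to its edge.\<close>

lemma mass_density_scale:
  "mass_density \<alpha> ((norm ((1/k) *\<^sub>R q))\<^sup>2) ((1/k) *\<^sub>R q) u v = 1 / k\<^sup>2 * mass_density \<alpha> ((norm q)\<^sup>2) q u v"
proof -
  have "mass_density \<alpha> ((norm (c *\<^sub>R q))\<^sup>2) (c *\<^sub>R q) u v = c\<^sup>2 * mass_density \<alpha> ((norm q)\<^sup>2) q u v" for c
    by (simp add: mass_density_def perp_scaleR power_mult_distrib power2_eq_square algebra_simps)
  from this[of "1/k"] show ?thesis by (simp add: power_divide)
qed

lemma continuous_on_mass_density:
  "continuous_on S u \<Longrightarrow> continuous_on S v \<Longrightarrow> continuous_on S (\<lambda>x. mass_density \<alpha> s q (u x) (v x))"
  unfolding mass_density_def by (intro continuous_intros)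

context mesh begin

text \<open>The factor \<open>1 / (h i)\<^sup>2\<close> comes from the two derivatives hidden in the
  density, and one \<open>h i\<close> from the length of the element; this leaves the single power
  of \<open>1 / h i\<close> in the nodal forms.\<close>

lemma scheme_integrals:
  fixes c d w :: "nat \<Rightarrow> real^2"
  assumes c: "c 0 = c N" and d: "d 0 = d N" and w: "w 0 = w N"
  shows "(LINT \<xi>|circle. (norm (dxi (pl c) \<xi>))\<^sup>2 *
      ((\<alpha> *\<^sub>R pl d \<xi> + (1 - \<alpha>) *\<^sub>R ((pl d \<xi> \<bullet> unit_normal (pl c) \<xi>) *\<^sub>R unit_normal (pl c) \<xi>)) \<bullet> pl w \<xi>))
      = mass_form \<alpha> N h (\<lambda>j. (norm (edge c j))\<^sup>2) (edge c) d w" (is ?A)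
    and "(LINT \<xi>|circle. dxi (pl c) \<xi> \<bullet> dxi (pl w) \<xi>)
      + (LINT \<xi>|circle. y * (norm (dxi (pl c) \<xi>))\<^sup>2 * (unit_normal (pl c) \<xi> \<bullet> pl w \<xi>))
      = load_form N h (edge c) y w" (is ?B)
proof -
  let ?l = "\<lambda>c i x. c (i - 1) + ((x - p (i - 1)) / (p i - p (i - 1))) *\<^sub>R (c i - c (i - 1)) :: real^2"
  have el: "pl c x = ?l c i x" if "c 0 = c N" "i \<in> {1..N}" "p (i - 1) < x" "x < p i" for c :: "nat \<Rightarrow> real^2" and i x
    using pl_element[of c i x] that by (simp add: h_def)
  have dl: "dxi (pl c) x = (1 / h i) *\<^sub>R edge c i" if "c 0 = c N" "i \<in> {1..N}" "p (i - 1) < x" "x < p i" for c :: "nat \<Rightarrow> real^2" and i x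
    using pl_derivative[OF that] by (simp add: vector_derivative_at edge_def)
  have ab: "p (i - 1) < p i" if "i \<in> {1..N}" for i using h_pos[OF that] by (simp add: h_def)
  have l_cont: "continuous_on S (?l c i)" for c :: "nat \<Rightarrow> real^2" and i S
    unfolding divide_inverse by (intro continuous_intros)
  have "(LINT \<xi>|circle. (norm (dxi (pl c) \<xi>))\<^sup>2 *
      ((\<alpha> *\<^sub>R pl d \<xi> + (1 - \<alpha>) *\<^sub>R ((pl d \<xi> \<bullet> unit_normal (pl c) \<xi>) *\<^sub>R unit_normal (pl c) \<xi>)) \<bullet> pl w \<xi>))
    = (\<Sum>i=1..N. 1 / (h i)\<^sup>2 * (let m = mass_density \<alpha> ((norm (edge c i))\<^sup>2) (edge c i) in
        (p i - p (i - 1)) / 6 * (2 * m (d (i - 1)) (w (i - 1)) + m (d (i - 1)) (w i) + m (d i) (w (i - 1)) + 2 * m (d i) (w i))))"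
  proof (rule LINT_elements(1)[where G="\<lambda>i x. 1 / (h i)\<^sup>2 * mass_density \<alpha> ((norm (edge c i))\<^sup>2) (edge c i) (?l d i x) (?l w i x)"])
    fix i assume i: "i \<in> {1..N}"
    show "continuous_on {p (i - 1)..p i} (\<lambda>x. 1 / (h i)\<^sup>2 * mass_density \<alpha> ((norm (edge c i))\<^sup>2) (edge c i) (?l d i x) (?l w i x))"
      by (rule continuous_on_mult_left) (rule continuous_on_mass_density[OF l_cont l_cont])
    show "(norm (dxi (pl c) x))\<^sup>2 *
      ((\<alpha> *\<^sub>R pl d x + (1 - \<alpha>) *\<^sub>R ((pl d x \<bullet> unit_normal (pl c) x) *\<^sub>R unit_normal (pl c) x)) \<bullet> pl w x)
      = 1 / (h i)\<^sup>2 * mass_density \<alpha> ((norm (edge c i))\<^sup>2) (edge c i) (?l d i x) (?l w i x)" if "p (i - 1) < x" "x < p i" for x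
      unfolding unit_normal_simps(1)[OF dl[OF c i that]] mass_density_scale using el[OF d i that] el[OF w i that] by simp
    show "((\<lambda>x. 1 / (h i)\<^sup>2 * mass_density \<alpha> ((norm (edge c i))\<^sup>2) (edge c i) (?l d i x) (?l w i x)) has_integral
      1 / (h i)\<^sup>2 * (let m = mass_density \<alpha> ((norm (edge c i))\<^sup>2) (edge c i) in
        (p i - p (i - 1)) / 6 * (2 * m (d (i - 1)) (w (i - 1)) + m (d (i - 1)) (w i) + m (d i) (w (i - 1)) + 2 * m (d i) (w i)))) {p (i - 1)..p i}"
      unfolding Let_def
      by (intro has_integral_mult_right integral_bilinear_affine linear_mass_density ab[OF i])
  qed
  also have "\<dots> = mass_form \<alpha> N h (\<lambda>j. (norm (edge c j))\<^sup>2) (edge c) d w"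
    unfolding mass_form_def Let_def h_def[symmetric]
  proof (intro sum.cong refl)
    fix i assume "i \<in> {1..N}"
    from h_pos[OF this] have "1 / (h i)\<^sup>2 * (h i / 6 * S) = 1 / (6 * h i) * S" for S
      by (simp add: power2_eq_square)
    then show "1 / (h i)\<^sup>2 * (h i / 6 * (2 * mass_density \<alpha> ((norm (edge c i))\<^sup>2) (edge c i) (d (i - 1)) (w (i - 1))
        + mass_density \<alpha> ((norm (edge c i))\<^sup>2) (edge c i) (d (i - 1)) (w i)
        + mass_density \<alpha> ((norm (edge c i))\<^sup>2) (edge c i) (d i) (w (i - 1))
        + 2 * mass_density \<alpha> ((norm (edge c i))\<^sup>2) (edge c i) (d i) (w i)))
      = 1 / (6 * h i) * (2 * mass_density \<alpha> ((norm (edge c i))\<^sup>2) (edge c i) (d (i - 1)) (w (i - 1))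
        + mass_density \<alpha> ((norm (edge c i))\<^sup>2) (edge c i) (d (i - 1)) (w i)
        + mass_density \<alpha> ((norm (edge c i))\<^sup>2) (edge c i) (d i) (w (i - 1))
        + 2 * mass_density \<alpha> ((norm (edge c i))\<^sup>2) (edge c i) (d i) (w i))" .
  qed
  finally show ?A .
  have 1: "(LINT \<xi>|circle. dxi (pl c) \<xi> \<bullet> dxi (pl w) \<xi>) = (\<Sum>i=1..N. (p i - p (i - 1)) *\<^sub>R (1 / (h i)\<^sup>2 * (edge c i \<bullet> edge w i)))"
  proof (rule LINT_elements(1)[where G="\<lambda>i x. 1 / (h i)\<^sup>2 * (edge c i \<bullet> edge w i)"])
    fix i assume i: "i \<in> {1..N}"
    show "dxi (pl c) x \<bullet> dxi (pl w) x = 1 / (h i)\<^sup>2 * (edge c i \<bullet> edge w i)" if "p (i - 1) < x" "x < p i" for x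
      by (simp add: dl[OF c i that] dl[OF w i that] power2_eq_square)
    show "((\<lambda>x. 1 / (h i)\<^sup>2 * (edge c i \<bullet> edge w i)) has_integral (p i - p (i - 1)) *\<^sub>R (1 / (h i)\<^sup>2 * (edge c i \<bullet> edge w i))) {p (i - 1)..p i}"
      using has_integral_const_real[of "1 / (h i)\<^sup>2 * (edge c i \<bullet> edge w i)" "p (i - 1)" "p i"] ab[OF i] by simp
  qed auto
  have 2: "(LINT \<xi>|circle. y * (norm (dxi (pl c) \<xi>))\<^sup>2 * (unit_normal (pl c) \<xi> \<bullet> pl w \<xi>))
      = (\<Sum>i=1..N. y * (1 / (h i)\<^sup>2 * norm (edge c i) * ((p i - p (i - 1)) / 2 * ((w (i - 1) + w i) \<bullet> perp (edge c i)))))"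
  proof (rule LINT_elements(1)[where G="\<lambda>i x. y * (1 / (h i)\<^sup>2 * norm (edge c i) * (?l w i x \<bullet> perp (edge c i)))"])
    fix i assume i: "i \<in> {1..N}"
    show "continuous_on {p (i - 1)..p i} (\<lambda>x. y * (1 / (h i)\<^sup>2 * norm (edge c i) * (?l w i x \<bullet> perp (edge c i))))"
      by (intro continuous_intros l_cont)
    show "y * (norm (dxi (pl c) x))\<^sup>2 * (unit_normal (pl c) x \<bullet> pl w x)
        = y * (1 / (h i)\<^sup>2 * norm (edge c i) * (?l w i x \<bullet> perp (edge c i)))" if "p (i - 1) < x" "x < p i" for x
      unfolding mult.assoc[of y] unit_normal_simps(2)[OF dl[OF c i that]] el[OF w i that]
      using h_pos[OF i] by (simp add: perp_scaleR power2_eq_square)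
    show "((\<lambda>x. y * (1 / (h i)\<^sup>2 * norm (edge c i) * (?l w i x \<bullet> perp (edge c i)))) has_integral
        y * (1 / (h i)\<^sup>2 * norm (edge c i) * ((p i - p (i - 1)) / 2 * ((w (i - 1) + w i) \<bullet> perp (edge c i))))) {p (i - 1)..p i}"
    proof (intro has_integral_mult_right)
      let ?a = "w (i - 1) \<bullet> perp (edge c i)" and ?b = "(w i - w (i - 1)) \<bullet> perp (edge c i)" and ?k = "p i - p (i - 1)"
      have "((\<lambda>x. ?a + (x - p (i - 1)) / ?k * ?b) has_integral (?k * ?a + ?k / 2 * ?b)) {p (i - 1)..p i}"
        by (rule integral_affine[OF ab[OF i]])
      also have "?k * ?a + ?k / 2 * ?b = ?k / 2 * ((w (i - 1) + w i) \<bullet> perp (edge c i))"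
        by (simp add: inner_diff_left inner_add_left algebra_simps)
      finally show "((\<lambda>x. ?l w i x \<bullet> perp (edge c i)) has_integral ?k / 2 * ((w (i - 1) + w i) \<bullet> perp (edge c i))) {p (i - 1)..p i}"
        by (simp add: inner_add_left)
    qed
  qed
  show ?B
    unfolding 1 2 load_form_def h_def[symmetric] sum_distrib_left
  proof (intro arg_cong2[of _ _ _ _ "(+)"] sum.cong refl)
    fix i assume "i \<in> {1..N}"
    from h_pos[OF this] show "h i *\<^sub>R (1 / (h i)\<^sup>2 * (edge c i \<bullet> edge w i)) = 1 / h i * (edge c i \<bullet> (w i - w (i - 1)))"
      "y * (1 / (h i)\<^sup>2 * norm (edge c i) * (h i / 2 * ((w (i - 1) + w i) \<bullet> perp (edge c i))))
        = y * (1 / (2 * h i) * (norm (edge c i) * ((w (i - 1) + w i) \<bullet> perp (edge c i))))"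
      by (simp_all add: power2_eq_square edge_def)
  qed
qed

end

section \<open>The scheme in nodal values\<close>

context mesh begin

text \<open>The scheme for nodal values \<open>c\<close> with velocities \<open>d\<close>; keeping
  \<open>d\<close> as a separate function avoids derivatives chosen by description in all
  estimates.\<close>

definition nodal_solution :: "real \<Rightarrow> (real \<Rightarrow> real) \<Rightarrow> real \<Rightarrow> (nat \<Rightarrow> real \<Rightarrow> real^2) \<Rightarrow> (nat \<Rightarrow> real \<Rightarrow> real^2) \<Rightarrow> bool" where
  "nodal_solution \<alpha> f T c d \<longleftrightarrow> (\<forall>t\<in>{0..T}. let C = wrap N (\<lambda>j. c j t) in
     (\<forall>j\<in>{1..N}. (c j has_vector_derivative d j t) (at t within {0..T})) \<and>
     (\<forall>j\<in>{1..N}. edge C j \<noteq> 0) \<and>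
     (\<forall>v. mass_form \<alpha> N h (\<lambda>j. (norm (edge C j))\<^sup>2) (edge C) (wrap N (\<lambda>j. d j t)) (wrap N v)
        + load_form N h (edge C) (f (\<Sum>j=1..N. norm (edge C j))) (wrap N v) = 0))"

lemma wrap_0_N: "wrap N c 0 = wrap N c N"
  using N by (simp add: wrap_def)

lemma polygon_length_pl:
  "c 0 = c N \<Longrightarrow> polygon_length N p (pl c) = (\<Sum>j=1..N. norm (edge c j))"
  unfolding polygon_length_def edge_def
  by (intro sum.cong refl arg_cong[of _ _ norm] arg_cong2[of _ _ _ _ "(-)"] pl_node) auto

lemma P1_wrap:
  assumes "v \<in> P1_space N p"
  obtains w where "v = pl (wrap N w)"
proof -
  have "v = (\<lambda>\<xi>. \<Sum>j=1..N. hat N p j \<xi> *\<^sub>R v (p j))"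
  proof (rule P1_eqI[OF assms])
    show "(\<lambda>\<xi>. \<Sum>j=1..N. hat N p j \<xi> *\<^sub>R v (p j)) \<in> P1_space N p"
      unfolding sum_hat by (rule pl_in_P1[OF wrap_0_N])
    fix i assume i: "i \<in> {1..N}"
    have "(\<Sum>j=1..N. hat N p j (p i) *\<^sub>R v (p j)) = pl (wrap N (\<lambda>j. v (p j))) (p i)"
      by (rule fun_cong[OF sum_hat])
    also have "\<dots> = v (p i)" using i by (subst pl_node[OF wrap_0_N]) (auto simp: wrap_def)
    finally show "v (p i) = (\<Sum>j=1..N. hat N p j (p i) *\<^sub>R v (p j))" by simp
  qed
  then have "v = pl (wrap N (\<lambda>j. v (p j)))" unfolding sum_hat .
  then show thesis by (rule that)
qed

lemma interpolant_pl: "interpolant N p v = pl (wrap N (\<lambda>j. v (p j)))"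
  unfolding interpolant_def[abs_def] by (rule sum_hat)

text \<open>\<open>pl\<close> is linear in the nodal values with time-independent coefficients. A
  nondegenerate interval, \<open>0 < T\<close>, makes the one-sided derivative at its ends
  unique.\<close>

lemma dt_on_pl:
  assumes T: "0 < T" and t: "t \<in> {0..T}"
    and x: "\<And>s \<xi>. s \<in> {0..T} \<Longrightarrow> x s \<xi> = pl (wrap N (\<lambda>j. c j s)) \<xi>"
    and c: "\<And>j. j \<in> {1..N} \<Longrightarrow> (c j has_vector_derivative d j t) (at t within {0..T})"
  shows "dt_on T x t \<xi> = pl (wrap N (\<lambda>j. d j t)) \<xi>"
proof -
  have x': "x s \<xi> = (\<Sum>j=1..N. hat N p j \<xi> *\<^sub>R c j s)" if "s \<in> {0..T}" for s
    using x[OF that] fun_cong[OF sum_hat[of "\<lambda>j. c j s"], of \<xi>] by simp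
  have "((\<lambda>s. \<Sum>j=1..N. hat N p j \<xi> *\<^sub>R c j s) has_vector_derivative (\<Sum>j=1..N. hat N p j \<xi> *\<^sub>R d j t)) (at t within {0..T})"
    by (intro has_vector_derivative_sum bounded_linear.has_vector_derivative[OF bounded_linear_scaleR_right] c)
  then have "((\<lambda>s. x s \<xi>) has_vector_derivative (\<Sum>j=1..N. hat N p j \<xi> *\<^sub>R d j t)) (at t within {0..T})"
    by (rule has_vector_derivative_transform[OF t, rotated]) (rule x')
  then have "dt_on T x t \<xi> = (\<Sum>j=1..N. hat N p j \<xi> *\<^sub>R d j t)"
    using vector_derivative_within_cbox[of 0 T t] T t by simp
  also have "\<dots> = pl (wrap N (\<lambda>j. d j t)) \<xi>" by (rule fun_cong[OF sum_hat])
  finally show ?thesis .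
qed

lemma scheme_eq:
  assumes x: "x = pl (wrap N c)" and u: "u = pl (wrap N d)" and v: "v = pl (wrap N w)"
  shows "(LINT \<xi>|circle. (norm (dxi x \<xi>))\<^sup>2 *
      ((\<alpha> *\<^sub>R u \<xi> + (1 - \<alpha>) *\<^sub>R ((u \<xi> \<bullet> unit_normal x \<xi>) *\<^sub>R unit_normal x \<xi>)) \<bullet> v \<xi>))
    + (LINT \<xi>|circle. dxi x \<xi> \<bullet> dxi v \<xi>)
    + (LINT \<xi>|circle. f (polygon_length N p x) * (norm (dxi x \<xi>))\<^sup>2 * (unit_normal x \<xi> \<bullet> v \<xi>))
    = mass_form \<alpha> N h (\<lambda>j. (norm (edge (wrap N c) j))\<^sup>2) (edge (wrap N c)) (wrap N d) (wrap N w)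
      + load_form N h (edge (wrap N c)) (f (\<Sum>j=1..N. norm (edge (wrap N c) j))) (wrap N w)"
  unfolding x u v polygon_length_pl[OF wrap_0_N] add.assoc scheme_integrals(2)[OF wrap_0_N wrap_0_N wrap_0_N]
  by (simp only: scheme_integrals(1)[OF wrap_0_N wrap_0_N wrap_0_N])

lemma nodal_imp_semidiscrete:
  assumes T: "0 < T" and sol: "nodal_solution \<alpha> f T c d" and init: "\<And>j. j \<in> {1..N} \<Longrightarrow> c j 0 = X0 (p j)"
  shows "semidiscrete_solution \<alpha> f T N p X0 (\<lambda>t. pl (wrap N (\<lambda>j. c j t)))"
  unfolding semidiscrete_solution_def
proof (intro conjI ballI allI)
  have der: "(c j has_vector_derivative d j t) (at t within {0..T})" if "t \<in> {0..T}" "j \<in> {1..N}" for j t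
    using sol that by (auto simp: nodal_solution_def Let_def)
  show "\<exists>c'. (\<forall>j\<in>{1..N}. c' j differentiable_on {0..T}) \<and>
      (\<forall>t\<in>{0..T}. \<forall>\<xi>. pl (wrap N (\<lambda>j. c j t)) \<xi> = (\<Sum>j=1..N. hat N p j \<xi> *\<^sub>R c' j t))"
  proof (intro exI[of _ c] conjI ballI allI)
    show "c j differentiable_on {0..T}" if "j \<in> {1..N}" for j
      unfolding differentiable_on_def by (intro ballI differentiableI_vector[OF der[OF _ that]])
    show "pl (wrap N (\<lambda>j. c j t)) \<xi> = (\<Sum>j=1..N. hat N p j \<xi> *\<^sub>R c j t)" for t \<xi>
      using fun_cong[OF sum_hat[of "\<lambda>j. c j t"], of \<xi>] by simp
  qed
  show "pl (wrap N (\<lambda>j. c j t)) (p j) \<noteq> pl (wrap N (\<lambda>j. c j t)) (p (j - 1))" if "t \<in> {0..T}" "j \<in> {1..N}" for t j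
  proof -
    have "edge (wrap N (\<lambda>j. c j t)) j \<noteq> 0"
      using sol that unfolding nodal_solution_def Let_def by blast
    moreover have "j \<le> N" "j - 1 \<le> N" using that by auto
    ultimately show ?thesis by (simp add: pl_node[OF wrap_0_N] edge_def)
  qed
  show "pl (wrap N (\<lambda>j. c j 0)) \<xi> = interpolant N p X0 \<xi>" for \<xi>
  proof -
    have "pl (wrap N (\<lambda>j. c j 0)) = (\<lambda>\<xi>. \<Sum>j=1..N. hat N p j \<xi> *\<^sub>R c j 0)" by (rule sum_hat[symmetric])
    also have "\<dots> = interpolant N p X0" unfolding interpolant_def[abs_def] by (intro ext sum.cong refl) (simp add: init)
    finally show ?thesis by simp
  qed
  fix t and v :: "real \<Rightarrow> real^2" assume t: "t \<in> {0..T}" and v: "v \<in> P1_space N p"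
  obtain w where w: "v = pl (wrap N w)" using P1_wrap[OF v] .
  have "(\<lambda>\<xi>. dt_on T (\<lambda>t. pl (wrap N (\<lambda>j. c j t))) t \<xi>) = pl (wrap N (\<lambda>j. d j t))"
    by (intro ext dt_on_pl[where c=c and d=d, OF T t refl der[OF t]])
  note scheme_eq[where c="\<lambda>j. c j t" and x="pl (wrap N (\<lambda>j. c j t))" and \<alpha>=\<alpha> and f=f, OF refl this w]
  also have "mass_form \<alpha> N h (\<lambda>j. (norm (edge (wrap N (\<lambda>j. c j t)) j))\<^sup>2) (edge (wrap N (\<lambda>j. c j t))) (wrap N (\<lambda>j. d j t)) (wrap N w)
      + load_form N h (edge (wrap N (\<lambda>j. c j t))) (f (\<Sum>j=1..N. norm (edge (wrap N (\<lambda>j. c j t)) j))) (wrap N w) = 0"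
    using sol t unfolding nodal_solution_def Let_def by blast
  finally show "(LINT \<xi>|circle. (norm (dxi (pl (wrap N (\<lambda>j. c j t))) \<xi>))\<^sup>2 *
           ((\<alpha> *\<^sub>R dt_on T (\<lambda>t. pl (wrap N (\<lambda>j. c j t))) t \<xi>
             + (1 - \<alpha>) *\<^sub>R ((dt_on T (\<lambda>t. pl (wrap N (\<lambda>j. c j t))) t \<xi> \<bullet> unit_normal (pl (wrap N (\<lambda>j. c j t))) \<xi>) *\<^sub>R unit_normal (pl (wrap N (\<lambda>j. c j t))) \<xi>)) \<bullet> v \<xi>))
        + (LINT \<xi>|circle. dxi (pl (wrap N (\<lambda>j. c j t))) \<xi> \<bullet> dxi v \<xi>)
        + (LINT \<xi>|circle. f (polygon_length N p (pl (wrap N (\<lambda>j. c j t)))) * (norm (dxi (pl (wrap N (\<lambda>j. c j t))) \<xi>))\<^sup>2 * (unit_normal (pl (wrap N (\<lambda>j. c j t))) \<xi> \<bullet> v \<xi>))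
        = 0" .
qed

lemma semidiscrete_imp_nodal:
  assumes T: "0 < T" and sol: "semidiscrete_solution \<alpha> f T N p X0 x"
  obtains c d where "nodal_solution \<alpha> f T c d" "\<And>j. j \<in> {1..N} \<Longrightarrow> c j 0 = X0 (p j)"
    "\<And>t. t \<in> {0..T} \<Longrightarrow> x t = pl (wrap N (\<lambda>j. c j t))"
proof -
  obtain c where c: "\<And>j. j \<in> {1..N} \<Longrightarrow> c j differentiable_on {0..T}"
    and xc: "\<And>t \<xi>. t \<in> {0..T} \<Longrightarrow> x t \<xi> = (\<Sum>j=1..N. hat N p j \<xi> *\<^sub>R c j t)"
    using sol unfolding semidiscrete_solution_def by blast
  have x: "x t = pl (wrap N (\<lambda>j. c j t))" if "t \<in> {0..T}" for t
    unfolding sum_hat[symmetric] by (rule ext) (rule xc[OF that])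
  define d where "d j t = vector_derivative (c j) (at t within {0..T})" for j t
  have der: "(c j has_vector_derivative d j t) (at t within {0..T})" if "t \<in> {0..T}" "j \<in> {1..N}" for j t
    using c[OF that(2)] that(1) unfolding d_def differentiable_on_def by (simp add: vector_derivative_works)
  have node: "x t (p j) = c j t" if "t \<in> {0..T}" "j \<in> {1..N}" for t j
    using that by (simp add: x pl_node[OF wrap_0_N]) (simp add: wrap_def)
  show thesis
  proof (rule that[of c d])
    show "c j 0 = X0 (p j)" if j: "j \<in> {1..N}" for j
    proof -
      have "x 0 (p j) = interpolant N p X0 (p j)" using sol unfolding semidiscrete_solution_def by blast
      also have "\<dots> = X0 (p j)" using j unfolding interpolant_pl by (subst pl_node[OF wrap_0_N]) (auto simp: wrap_def)
      finally show ?thesis using node[of 0 j] j T by simp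
    qed
    show "nodal_solution \<alpha> f T c d"
      unfolding nodal_solution_def Let_def
    proof (intro ballI conjI allI)
      fix t assume t: "t \<in> {0..T}"
      show "(c j has_vector_derivative d j t) (at t within {0..T})" if "j \<in> {1..N}" for j by (rule der[OF t that])
      show "edge (wrap N (\<lambda>j. c j t)) j \<noteq> 0" if j: "j \<in> {1..N}" for j
      proof -
        have "x t (p j) \<noteq> x t (p (j - 1))" using sol t j unfolding semidiscrete_solution_def by blast
        moreover have "j \<le> N" "j - 1 \<le> N" using j by auto
        ultimately show ?thesis by (simp add: x[OF t] pl_node[OF wrap_0_N] edge_def)
      qed
      fix w
      have dt: "(\<lambda>\<xi>. dt_on T x t \<xi>) = pl (wrap N (\<lambda>j. d j t))"
        by (intro ext dt_on_pl[where c=c and d=d, OF T t _ der[OF t]]) (simp_all add: x)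
      have "(LINT \<xi>|circle. (norm (dxi (x t) \<xi>))\<^sup>2 *
           ((\<alpha> *\<^sub>R dt_on T x t \<xi>
             + (1 - \<alpha>) *\<^sub>R ((dt_on T x t \<xi> \<bullet> unit_normal (x t) \<xi>) *\<^sub>R unit_normal (x t) \<xi>)) \<bullet> pl (wrap N w) \<xi>))
        + (LINT \<xi>|circle. dxi (x t) \<xi> \<bullet> dxi (pl (wrap N w)) \<xi>)
        + (LINT \<xi>|circle. f (polygon_length N p (x t)) * (norm (dxi (x t) \<xi>))\<^sup>2 * (unit_normal (x t) \<xi> \<bullet> pl (wrap N w) \<xi>))
        = 0"
        using sol t pl_in_P1[OF wrap_0_N[of w]] unfolding semidiscrete_solution_def by blast
      then show "mass_form \<alpha> N h (\<lambda>j. (norm (edge (wrap N (\<lambda>j. c j t)) j))\<^sup>2) (edge (wrap N (\<lambda>j. c j t))) (wrap N (\<lambda>j. d j t)) (wrap N w)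
          + load_form N h (edge (wrap N (\<lambda>j. c j t))) (f (\<Sum>j=1..N. norm (edge (wrap N (\<lambda>j. c j t)) j))) (wrap N w) = 0"
        unfolding scheme_eq[where \<alpha>=\<alpha> and f=f and w=w, OF x[OF t] dt refl] .
    qed
  qed (rule x)
qed

lemma wrap_derivative:
  assumes "\<And>j. j \<in> {1..N} \<Longrightarrow> (c j has_vector_derivative d j t) F" "j \<le> N"
  shows "((\<lambda>t. wrap N (\<lambda>j. c j t) j) has_vector_derivative wrap N (\<lambda>j. d j t) j) F"
  using assms N by (auto simp: wrap_def)

lemma edge_derivative:
  assumes "\<And>j. j \<in> {1..N} \<Longrightarrow> (c j has_vector_derivative d j t) F" "j \<in> {1..N}"
  shows "((\<lambda>t. edge (wrap N (\<lambda>j. c j t)) j) has_vector_derivative edge (wrap N (\<lambda>j. d j t)) j) F"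
  unfolding edge_def using assms(2) by (intro has_vector_derivative_diff wrap_derivative assms(1)) auto

lemma edge_continuous:
  assumes "\<And>t j. t \<in> {0..T} \<Longrightarrow> j \<in> {1..N} \<Longrightarrow> (c j has_vector_derivative d j t) (at t within {0..T})" "j \<in> {1..N}"
  shows "continuous_on {0..T} (\<lambda>t. edge (wrap N (\<lambda>j. c j t)) j)"
  unfolding continuous_on_eq_continuous_within
proof
  fix t assume t: "t \<in> {0..T}"
  show "continuous (at t within {0..T}) (\<lambda>t. edge (wrap N (\<lambda>j. c j t)) j)"
    by (rule has_vector_derivative_continuous[OF edge_derivative[where c=c and d=d, OF assms(1)[OF t] assms(2)]])
qed

section \<open>Comparison of the scheme with the clipped scheme\<close>

text \<open>Edge lengths are continuous and positive on a compact time interval and finitely many.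
  So each solution, however large or degenerate, solves some clipped system.\<close>

lemma nodal_solution_edge_bounds:
  assumes T: "0 \<le> T" and sol: "nodal_solution \<alpha> f T c d"
  obtains \<mu> R where "0 < \<mu>" "\<mu> \<le> R"
    "\<And>t j. t \<in> {0..T} \<Longrightarrow> j \<in> {1..N} \<Longrightarrow> \<mu> \<le> norm (edge (wrap N (\<lambda>j. c j t)) j) \<and> norm (edge (wrap N (\<lambda>j. c j t)) j) \<le> R"
proof -
  define g where "g j t = norm (edge (wrap N (\<lambda>j. c j t)) j)" for j t
  have der: "(c j has_vector_derivative d j t) (at t within {0..T})" if "t \<in> {0..T}" "j \<in> {1..N}" for j t
    using sol that by (auto simp: nodal_solution_def Let_def)
  have g_cont: "continuous_on {0..T} (g j)" if "j \<in> {1..N}" for j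
    unfolding g_def by (intro continuous_on_norm edge_continuous[OF der that])
  have g_pos: "0 < g j t" if "t \<in> {0..T}" "j \<in> {1..N}" for t j
    using sol that unfolding nodal_solution_def Let_def g_def by simp
  have "\<exists>m M. 0 < m \<and> (\<forall>t\<in>{0..T}. m \<le> g j t \<and> g j t \<le> M)" if j: "j \<in> {1..N}" for j
  proof -
    obtain s where s: "s \<in> {0..T}" "\<And>t. t \<in> {0..T} \<Longrightarrow> g j s \<le> g j t"
      using continuous_attains_inf[OF _ _ g_cont[OF j]] T by auto
    obtain r where r: "r \<in> {0..T}" "\<And>t. t \<in> {0..T} \<Longrightarrow> g j t \<le> g j r"
      using continuous_attains_sup[OF _ _ g_cont[OF j]] T by auto
    show ?thesis using g_pos[OF s(1) j] s(2) r(2) by blast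
  qed
  then obtain m M where mM: "\<And>j. j \<in> {1..N} \<Longrightarrow> 0 < m j" "\<And>j t. j \<in> {1..N} \<Longrightarrow> t \<in> {0..T} \<Longrightarrow> m j \<le> g j t \<and> g j t \<le> M j"
    by metis
  define \<mu> R where "\<mu> = Min (m ` {1..N})" and "R = Max (M ` {1..N})"
  have ne: "m ` {1..N} \<noteq> {}" using N by auto
  have bounds: "\<mu> \<le> g j t \<and> g j t \<le> R" if "t \<in> {0..T}" "j \<in> {1..N}" for t j
  proof -
    have "\<mu> \<le> m j" "M j \<le> R" using that by (auto simp: \<mu>_def R_def)
    with mM(2)[OF that(2,1)] show ?thesis by linarith
  qed
  have "0 < \<mu>" unfolding \<mu>_def using mM(1) ne by (subst Min_gr_iff) auto
  moreover have "\<mu> \<le> R" using bounds[of 0 1] N T by auto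
  ultimately show thesis using that bounds unfolding g_def by blast
qed

lemma nodal_imp_clipped:
  assumes fem: "fem_ode \<alpha> N h \<mu> R f" and sol: "nodal_solution \<alpha> f T c d"
    and bounds: "\<And>t j. t \<in> {0..T} \<Longrightarrow> j \<in> {1..N} \<Longrightarrow> \<mu> \<le> norm (edge (wrap N (\<lambda>j. c j t)) j) \<and> norm (edge (wrap N (\<lambda>j. c j t)) j) \<le> R"
  shows "fem_ode.clipped_solution \<alpha> N h \<mu> R f T c d"
proof -
  interpret fem_ode \<alpha> N h \<mu> R f by (rule fem)
  show ?thesis
    unfolding clipped_solution_def
  proof (intro ballI conjI allI)
    fix t assume t: "t \<in> {0..T}"
    show "(c j has_vector_derivative d j t) (at t within {0..T})" if "j \<in> {1..N}" for j
      using sol t that by (auto simp: nodal_solution_def Let_def)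
    fix v
    define q where "q = edge (wrap N (\<lambda>j. c j t))"
    define q' where "q' j = clip R (q j)" for j
    have q: "q' j = q j" "max (\<mu>\<^sup>2) ((norm (q' j))\<^sup>2) = (norm (q j))\<^sup>2" if "j \<in> {1..N}" for j
    proof -
      show 1: "q' j = q j" using bounds[OF t that] by (simp add: q'_def q_def clip_id)
      have "\<mu>\<^sup>2 \<le> (norm (q j))\<^sup>2" using bounds[OF t that] \<mu> by (intro power_mono) (auto simp: q_def)
      then show "max (\<mu>\<^sup>2) ((norm (q' j))\<^sup>2) = (norm (q j))\<^sup>2" by (simp add: 1 max_absorb2)
    qed
    \<comment> \<open>A single edge already has length at least \<mu>, so the lower clipping of the
      perimeter is inactive too.\<close>
    have len: "max \<mu> (\<Sum>j=1..N. norm (q' j)) = (\<Sum>j=1..N. norm (q j))"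
    proof -
      have eq: "(\<Sum>j=1..N. norm (q' j)) = (\<Sum>j=1..N. norm (q j))" using q(1) by (intro sum.cong refl) auto
      have "\<mu> \<le> norm (q 1)" using bounds[OF t, of 1] mesh.N[OF mesh_axioms] by (simp add: q_def)
      also have "\<dots> \<le> (\<Sum>j=1..N. norm (q j))" using mesh.N[OF mesh_axioms] by (intro member_le_sum) auto
      finally show ?thesis unfolding eq by (rule max_absorb2)
    qed
    have "mass_form \<alpha> N h (\<lambda>j. (norm (q j))\<^sup>2) q (wrap N (\<lambda>j. d j t)) (wrap N v) + load_form N h q (f (\<Sum>j=1..N. norm (q j))) (wrap N v) = 0"
      using sol t unfolding nodal_solution_def Let_def q_def by blast
    then have "mass_form \<alpha> N h (\<lambda>j. max (\<mu>\<^sup>2) ((norm (q' j))\<^sup>2)) q' (wrap N (\<lambda>j. d j t)) (wrap N v)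
        + load_form N h q' (f (max \<mu> (\<Sum>j=1..N. norm (q' j)))) (wrap N v) = 0"
      unfolding len using mass_form_cong[OF refl refl q(2,1)] load_form_cong[OF refl q(1)] by simp
    then show "let q = (\<lambda>j. clip R (edge (wrap N (\<lambda>j. c j t)) j)) in
        mass_form \<alpha> N h (\<lambda>j. max (\<mu>\<^sup>2) ((norm (q j))\<^sup>2)) q (wrap N (\<lambda>j. d j t)) (wrap N v)
        + load_form N h q (f (max \<mu> (\<Sum>j=1..N. norm (q j)))) (wrap N v) = 0"
      unfolding Let_def q'_def[abs_def] q_def .
  qed
qed

text \<open>Stated up to an intermediate time \<tau>, since during the continuation the edge bounds
  are known only that far.\<close>

lemma clipped_imp_nodal:
  assumes fem: "fem_ode \<alpha> N h \<mu> R f" and sol: "fem_ode.clipped_solution \<alpha> N h \<mu> R f T c d"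
    and bounds: "\<And>t j. t \<in> {0..\<tau>} \<Longrightarrow> j \<in> {1..N} \<Longrightarrow> \<mu> \<le> norm (edge (wrap N (\<lambda>j. c j t)) j) \<and> norm (edge (wrap N (\<lambda>j. c j t)) j) \<le> R"
    and \<tau>: "\<tau> \<le> T"
  shows "nodal_solution \<alpha> f \<tau> c d"
proof -
  interpret fem_ode \<alpha> N h \<mu> R f by (rule fem)
  show ?thesis
    unfolding nodal_solution_def Let_def
  proof (intro ballI conjI allI)
    fix t assume t: "t \<in> {0..\<tau>}"
    then have tT: "t \<in> {0..T}" using \<tau> by auto
    show "(c j has_vector_derivative d j t) (at t within {0..\<tau>})" if "j \<in> {1..N}" for j
    proof (rule has_vector_derivative_within_subset)
      show "(c j has_vector_derivative d j t) (at t within {0..T})"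
        using sol tT that by (auto simp: clipped_solution_def)
    qed (use \<tau> in auto)
    show "edge (wrap N (\<lambda>j. c j t)) j \<noteq> 0" if "j \<in> {1..N}" for j
      using bounds[OF t that] \<mu> by auto
    fix v
    define q where "q = edge (wrap N (\<lambda>j. c j t))"
    define q' where "q' j = clip R (q j)" for j
    have q: "q' j = q j" "max (\<mu>\<^sup>2) ((norm (q' j))\<^sup>2) = (norm (q j))\<^sup>2" if "j \<in> {1..N}" for j
    proof -
      show 1: "q' j = q j" using bounds[OF t that] by (simp add: q'_def q_def clip_id)
      have "\<mu>\<^sup>2 \<le> (norm (q j))\<^sup>2" using bounds[OF t that] \<mu> by (intro power_mono) (auto simp: q_def)
      then show "max (\<mu>\<^sup>2) ((norm (q' j))\<^sup>2) = (norm (q j))\<^sup>2" by (simp add: 1 max_absorb2)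
    qed
    have len: "max \<mu> (\<Sum>j=1..N. norm (q' j)) = (\<Sum>j=1..N. norm (q j))"
    proof -
      have eq: "(\<Sum>j=1..N. norm (q' j)) = (\<Sum>j=1..N. norm (q j))" using q(1) by (intro sum.cong refl) auto
      have "\<mu> \<le> norm (q 1)" using bounds[OF t, of 1] mesh.N[OF mesh_axioms] by (simp add: q_def)
      also have "\<dots> \<le> (\<Sum>j=1..N. norm (q j))" using mesh.N[OF mesh_axioms] by (intro member_le_sum) auto
      finally show ?thesis unfolding eq by (rule max_absorb2)
    qed
    have "let q = (\<lambda>j. clip R (edge (wrap N (\<lambda>j. c j t)) j)) in
        mass_form \<alpha> N h (\<lambda>j. max (\<mu>\<^sup>2) ((norm (q j))\<^sup>2)) q (wrap N (\<lambda>j. d j t)) (wrap N v)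
        + load_form N h q (f (max \<mu> (\<Sum>j=1..N. norm (q j)))) (wrap N v) = 0"
      using sol tT unfolding clipped_solution_def by blast
    then have "mass_form \<alpha> N h (\<lambda>j. max (\<mu>\<^sup>2) ((norm (q' j))\<^sup>2)) q' (wrap N (\<lambda>j. d j t)) (wrap N v)
        + load_form N h q' (f (max \<mu> (\<Sum>j=1..N. norm (q' j)))) (wrap N v) = 0"
      unfolding Let_def q'_def[abs_def] q_def .
    then have "mass_form \<alpha> N h (\<lambda>j. (norm (q j))\<^sup>2) q (wrap N (\<lambda>j. d j t)) (wrap N v) + load_form N h q (f (\<Sum>j=1..N. norm (q j))) (wrap N v) = 0"
      unfolding len using mass_form_cong[OF refl refl q(2,1)] load_form_cong[OF refl q(1)] by simp
    then show "mass_form \<alpha> N h (\<lambda>j. (norm (edge (wrap N (\<lambda>j. c j t)) j))\<^sup>2) (edge (wrap N (\<lambda>j. c j t))) (wrap N (\<lambda>j. d j t)) (wrap N v)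
        + load_form N h (edge (wrap N (\<lambda>j. c j t))) (f (\<Sum>j=1..N. norm (edge (wrap N (\<lambda>j. c j t)) j))) (wrap N v) = 0"
      unfolding q_def .
  qed
qed

text \<open>The smaller lower level and the larger upper level turn both solutions into solutions of
  one clipped system, which is uniquely solvable. In this way uniqueness holds among all solutions,
  not only among those close to \<open>X\<close>.\<close>

lemma nodal_solution_unique:
  assumes \<alpha>: "0 < \<alpha>" "\<alpha> \<le> 1" and f: "\<exists>l. l-lipschitz_on {0<..} f" and T: "0 \<le> T"
    and sol: "nodal_solution \<alpha> f T c d" "nodal_solution \<alpha> f T c' d'"
    and init: "\<And>j. j \<in> {1..N} \<Longrightarrow> c j 0 = c' j 0" and t: "t \<in> {0..T}" and j: "j \<in> {1..N}"
  shows "c j t = c' j t"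
proof -
  obtain \<mu>1 R1 where 1: "0 < \<mu>1" "\<mu>1 \<le> R1"
    "\<And>t j. t \<in> {0..T} \<Longrightarrow> j \<in> {1..N} \<Longrightarrow> \<mu>1 \<le> norm (edge (wrap N (\<lambda>j. c j t)) j) \<and> norm (edge (wrap N (\<lambda>j. c j t)) j) \<le> R1"
    by (rule nodal_solution_edge_bounds[OF T sol(1)]) blast
  obtain \<mu>2 R2 where 2: "0 < \<mu>2" "\<mu>2 \<le> R2"
    "\<And>t j. t \<in> {0..T} \<Longrightarrow> j \<in> {1..N} \<Longrightarrow> \<mu>2 \<le> norm (edge (wrap N (\<lambda>j. c' j t)) j) \<and> norm (edge (wrap N (\<lambda>j. c' j t)) j) \<le> R2"
    by (rule nodal_solution_edge_bounds[OF T sol(2)]) blast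
  have fem: "fem_ode \<alpha> N h (min \<mu>1 \<mu>2) (max R1 R2) f"
  proof
    show "0 < min \<mu>1 \<mu>2" "min \<mu>1 \<mu>2 \<le> max R1 R2" using 1(1,2) 2(1,2) by auto
  qed (use \<alpha> N h_pos f in auto)
  show ?thesis
  proof (rule fem_ode.clipped_solution_unique[where c=c and c'=c' and d=d and d'=d', OF fem T _ _ init t j])
    show "fem_ode.clipped_solution \<alpha> N h (min \<mu>1 \<mu>2) (max R1 R2) f T c d"
      by (rule nodal_imp_clipped[OF fem sol(1)]) (use 1(3) in \<open>auto simp: min_le_iff_disj le_max_iff_disj\<close>)
    show "fem_ode.clipped_solution \<alpha> N h (min \<mu>1 \<mu>2) (max R1 R2) f T c' d'"
      by (rule nodal_imp_clipped[OF fem sol(2)]) (use 2(3) in \<open>auto simp: min_le_iff_disj le_max_iff_disj\<close>)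
  qed
qed

end

section \<open>Estimates at a fixed time\<close>

text \<open>The value the flow assigns to the second \<xi>-derivative of a curve with tangent
  \<open>a\<close>, velocity \<open>Y\<close> and \<open>y = f L\<close>: the equation multiplied by
  \<open>(norm a)\<^sup>2\<close>, with \<open>norm a\<close> times the normal written as
  \<open>perp a\<close>.\<close>

definition flow_rhs :: "real \<Rightarrow> real \<Rightarrow> real^2 \<Rightarrow> real^2 \<Rightarrow> real^2" where
  "flow_rhs \<alpha> y a Y = (\<alpha> * (norm a)\<^sup>2) *\<^sub>R Y + ((1 - \<alpha>) * (Y \<bullet> perp a)) *\<^sub>R perp a + (y * norm a) *\<^sub>R perp a"

lemma flow_rhs_inner:
  "flow_rhs \<alpha> y a Y \<bullet> v = mass_density \<alpha> ((norm a)\<^sup>2) a Y v + y * (norm a * (v \<bullet> perp a))"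
  by (simp add: flow_rhs_def mass_density_def inner_add_left inner_commute[of "perp a" v])

lemma abs_inner_le: "norm x \<le> A \<Longrightarrow> norm y \<le> B \<Longrightarrow> \<bar>x \<bullet> y\<bar> \<le> A * B"
  using Cauchy_Schwarz_ineq2[of x y] mult_mono[of "norm x" A "norm y" B] norm_ge_zero[of x] by (smt (verit) norm_ge_zero)

lemma mass_density_le:
  assumes \<alpha>: "0 \<le> \<alpha>" "\<alpha> \<le> 1"
  shows "\<bar>mass_density \<alpha> ((norm q)\<^sup>2) q u v\<bar> \<le> (norm q)\<^sup>2 * norm u * norm v"
proof -
  have 1: "\<bar>\<alpha> * (norm q)\<^sup>2 * (u \<bullet> v)\<bar> \<le> \<alpha> * ((norm q)\<^sup>2 * norm u * norm v)"
    using Cauchy_Schwarz_ineq2[of u v] \<alpha> by (simp add: abs_mult mult.assoc mult_left_mono)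
  have "\<bar>(u \<bullet> perp q) * (v \<bullet> perp q)\<bar> \<le> (norm u * norm q) * (norm v * norm q)"
    unfolding abs_mult using Cauchy_Schwarz_ineq2[of u "perp q"] Cauchy_Schwarz_ineq2[of v "perp q"]
    by (intro mult_mono) auto
  then have "(1 - \<alpha>) * \<bar>(u \<bullet> perp q) * (v \<bullet> perp q)\<bar> \<le> (1 - \<alpha>) * ((norm u * norm q) * (norm v * norm q))"
    using \<alpha> by (intro mult_left_mono) auto
  then have 2: "\<bar>(1 - \<alpha>) * ((u \<bullet> perp q) * (v \<bullet> perp q))\<bar> \<le> (1 - \<alpha>) * ((norm q)\<^sup>2 * norm u * norm v)"
    using \<alpha> by (simp add: abs_mult power2_eq_square ac_simps)
  show ?thesis
    using abs_triangle_ineq[of "\<alpha> * (norm q)\<^sup>2 * (u \<bullet> v)" "(1 - \<alpha>) * ((u \<bullet> perp q) * (v \<bullet> perp q))"] 1 2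
    unfolding mass_density_def by (simp add: left_diff_distrib)
qed

text \<open>Tested with itself through \<open>flow_rhs_inner\<close>; one factor of the norm is then
  cancelled.\<close>

lemma norm_flow_rhs_le:
  assumes \<alpha>: "0 \<le> \<alpha>" "\<alpha> \<le> 1"
  shows "norm (flow_rhs \<alpha> y a Y) \<le> (norm a)\<^sup>2 * (norm Y + \<bar>y\<bar>)"
proof -
  let ?g = "flow_rhs \<alpha> y a Y"
  have "norm ?g * norm ?g = mass_density \<alpha> ((norm a)\<^sup>2) a Y ?g + y * (norm a * (?g \<bullet> perp a))"
    unfolding flow_rhs_inner[symmetric] by (simp add: norm_eq_sqrt_inner)
  also have "\<dots> \<le> (norm a)\<^sup>2 * norm Y * norm ?g + \<bar>y\<bar> * (norm a * (norm ?g * norm a))"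
  proof (rule add_mono)
    show "mass_density \<alpha> ((norm a)\<^sup>2) a Y ?g \<le> (norm a)\<^sup>2 * norm Y * norm ?g"
      using mass_density_le[OF \<alpha>, of a Y ?g] by linarith
    have "\<bar>y * (norm a * (?g \<bullet> perp a))\<bar> \<le> \<bar>y\<bar> * (norm a * (norm ?g * norm a))"
      using Cauchy_Schwarz_ineq2[of ?g "perp a"] by (simp add: abs_mult mult_left_mono)
    then show "y * (norm a * (?g \<bullet> perp a)) \<le> \<bar>y\<bar> * (norm a * (norm ?g * norm a))" by linarith
  qed
  finally have "norm ?g * norm ?g \<le> norm ?g * ((norm a)\<^sup>2 * (norm Y + \<bar>y\<bar>))"
    by (simp add: power2_eq_square algebra_simps)
  then show ?thesis by (cases "norm ?g = 0") (auto simp: mult_le_cancel_left)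
qed

text \<open>Half of the constant 4 comes from the difference of squared lengths, the other half from
  the two factors that contain \<open>perp\<close>.\<close>

lemma mass_density_diff_le:
  assumes \<alpha>: "0 \<le> \<alpha>" "\<alpha> \<le> 1" and B: "norm a \<le> B" "norm b \<le> B"
  shows "\<bar>mass_density \<alpha> ((norm b)\<^sup>2) b u v - mass_density \<alpha> ((norm a)\<^sup>2) a u v\<bar> \<le> 4 * B * norm u * norm v * norm (a - b)"
proof -
  have B0: "0 \<le> B" using B(1) norm_ge_zero order_trans by blast
  have nd: "\<bar>norm b - norm a\<bar> \<le> norm (a - b)" using norm_triangle_ineq3[of b a] by (simp add: norm_minus_commute)
  have s: "\<bar>(norm b)\<^sup>2 - (norm a)\<^sup>2\<bar> \<le> 2 * B * norm (a - b)"
  proof -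
    have "(norm b)\<^sup>2 - (norm a)\<^sup>2 = (norm b + norm a) * (norm b - norm a)" by (simp add: power2_eq_square algebra_simps)
    then have "\<bar>(norm b)\<^sup>2 - (norm a)\<^sup>2\<bar> = (norm b + norm a) * \<bar>norm b - norm a\<bar>" by (simp add: abs_mult)
    also have "\<dots> \<le> (2 * B) * norm (a - b)" using B B0 nd by (intro mult_mono) auto
    finally show ?thesis .
  qed
  have 1: "\<bar>\<alpha> * ((norm b)\<^sup>2 - (norm a)\<^sup>2) * (u \<bullet> v)\<bar> \<le> 1 * (2 * B * norm (a - b)) * (norm u * norm v)"
    unfolding abs_mult using s \<alpha> Cauchy_Schwarz_ineq2[of u v] by (intro mult_mono) auto
  have "(u \<bullet> perp b) * (v \<bullet> perp b) - (u \<bullet> perp a) * (v \<bullet> perp a)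
      = (u \<bullet> perp (b - a)) * (v \<bullet> perp b) + (u \<bullet> perp a) * (v \<bullet> perp (b - a))"
    by (simp add: perp_diff inner_diff_right algebra_simps)
  moreover have "\<bar>(u \<bullet> perp (b - a)) * (v \<bullet> perp b)\<bar> \<le> (norm u * norm (a - b)) * (norm v * B)"
    unfolding abs_mult using B B0 by (intro mult_mono abs_inner_le) (auto simp: norm_minus_commute)
  moreover have "\<bar>(u \<bullet> perp a) * (v \<bullet> perp (b - a))\<bar> \<le> (norm u * B) * (norm v * norm (a - b))"
    unfolding abs_mult using B B0 by (intro mult_mono abs_inner_le) (auto simp: norm_minus_commute)
  ultimately have "\<bar>(u \<bullet> perp b) * (v \<bullet> perp b) - (u \<bullet> perp a) * (v \<bullet> perp a)\<bar> \<le> 2 * B * norm u * norm v * norm (a - b)"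
    by (simp add: algebra_simps)
  then have 2: "\<bar>(1 - \<alpha>) * ((u \<bullet> perp b) * (v \<bullet> perp b) - (u \<bullet> perp a) * (v \<bullet> perp a))\<bar> \<le> 1 * (2 * B * norm u * norm v * norm (a - b))"
    unfolding abs_mult using \<alpha> by (intro mult_mono) auto
  have "mass_density \<alpha> ((norm b)\<^sup>2) b u v - mass_density \<alpha> ((norm a)\<^sup>2) a u v
     = \<alpha> * ((norm b)\<^sup>2 - (norm a)\<^sup>2) * (u \<bullet> v) + (1 - \<alpha>) * ((u \<bullet> perp b) * (v \<bullet> perp b) - (u \<bullet> perp a) * (v \<bullet> perp a))"
    by (simp add: mass_density_def algebra_simps)
  then show ?thesis using 1 2 by (simp add: algebra_simps)
qed

text \<open>The three factors \<open>y\<close>, \<open>norm a\<close> and \<open>perp a\<close> are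
  exchanged one at a time.\<close>

lemma forcing_diff_le:
  assumes B: "norm a \<le> B" "norm b \<le> B" and F: "\<bar>y'\<bar> \<le> F"
  shows "\<bar>y * (norm a * (w \<bullet> perp a)) - y' * (norm b * (w \<bullet> perp b))\<bar> \<le> (B\<^sup>2 * \<bar>y - y'\<bar> + 2 * B * F * norm (a - b)) * norm w"
proof -
  have B0: "0 \<le> B" using B(1) norm_ge_zero order_trans by blast
  have nd: "\<bar>norm a - norm b\<bar> \<le> norm (a - b)" by (rule norm_triangle_ineq3)
  have "y * (norm a * (w \<bullet> perp a)) - y' * (norm b * (w \<bullet> perp b))
    = (y - y') * (norm a * (w \<bullet> perp a)) + y' * ((norm a - norm b) * (w \<bullet> perp a)) + y' * (norm b * (w \<bullet> perp (a - b)))"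
    by (simp add: perp_diff inner_diff_right algebra_simps)
  moreover have "\<bar>(y - y') * (norm a * (w \<bullet> perp a))\<bar> \<le> \<bar>y - y'\<bar> * (B * (norm w * B))"
    unfolding abs_mult using B B0 by (intro mult_mono abs_inner_le) auto
  moreover have "\<bar>y' * ((norm a - norm b) * (w \<bullet> perp a))\<bar> \<le> F * (norm (a - b) * (norm w * B))"
    unfolding abs_mult using B B0 F nd by (intro mult_mono abs_inner_le) auto
  moreover have "\<bar>y' * (norm b * (w \<bullet> perp (a - b)))\<bar> \<le> F * (B * (norm w * norm (a - b)))"
    unfolding abs_mult using B B0 F by (intro mult_mono abs_inner_le) auto
  ultimately show ?thesis by (simp add: power2_eq_square algebra_simps)
qed

lemma young: "0 < \<epsilon> \<Longrightarrow> x * y \<le> \<epsilon> / 2 * y\<^sup>2 + x\<^sup>2 / (2 * (\<epsilon>::real))"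
proof -
  assume e: "0 < \<epsilon>"
  have "0 \<le> (\<epsilon> * y - x)\<^sup>2 / (2 * \<epsilon>)" using e by simp
  also have "\<dots> = \<epsilon> / 2 * y\<^sup>2 + x\<^sup>2 / (2 * \<epsilon>) - x * y" using e by (simp add: power2_eq_square field_simps)
  finally show ?thesis by simp
qed

lemma square_sum3_le: "(x + y + z)\<^sup>2 \<le> 3 * (x\<^sup>2 + y\<^sup>2 + (z::real)\<^sup>2)"
proof -
  have "0 \<le> (x - y)\<^sup>2 + (y - z)\<^sup>2 + (x - z)\<^sup>2" by simp
  then show ?thesis by (simp add: power2_eq_square algebra_simps)
qed

lemma square_sum2_le: "(x + y)\<^sup>2 \<le> 2 * (x\<^sup>2 + (y::real)\<^sup>2)"
proof -
  have "0 \<le> (x - y)\<^sup>2" by simp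
  then show ?thesis by (simp add: power2_eq_square algebra_simps)
qed

section \<open>Constants and the estimate at one point\<close>

locale flow_const =
  fixes f :: "real \<Rightarrow> real" and lf C1 C2 K :: real
  assumes lip_f: "lf-lipschitz_on {0<..} f" and C1: "0 < C1" and C12: "C1 < C2" and K: "0 \<le> K"
begin

text \<open>Bounds \<open>f\<close> up to the perimeter \<open>4 * pi * C2\<close>, the largest one
  a polygon can have when its edges are at most \<open>2 * C2\<close> times the mesh steps.\<close>

definition "F0 = \<bar>f 1\<bar> + lf * (1 + 4 * pi * C2)"
text \<open>The bound from \<open>norm_flow_rhs_le\<close> for tangents of length at most
  \<open>C2\<close> and velocities of size at most \<open>5 * K\<close>; it becomes the spatial
  Lipschitz constant of the exact tangent.\<close>

definition "La = C2\<^sup>2 * (5 * K + F0)"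
text \<open>Collects the coefficients of \<open>mass_density_diff_le\<close>,
  \<open>mass_density_le\<close> and \<open>forcing_diff_le\<close> for tangents of length at most
  \<open>2 * C2\<close>.\<close>

definition "G0 = 4 * (2 * C2) * (5 * K) + (2 * C2)\<^sup>2 + 2 * (2 * C2) * F0"
text \<open>Young's inequality with weight \<open>\<alpha> * C1\<^sup>2 / 4\<close> contributes
  \<open>2 / (\<alpha> * C1\<^sup>2)\<close>, the square of a sum of three terms the factor 3;
  \<alpha> is kept outside.\<close>

definition "\<kappa>0 = 6 * G0\<^sup>2 / C1\<^sup>2"
text \<open>The sum of all coefficients of \<open>H\<^sup>2\<close> and of the energy after
  summation over the elements; the final 1 ensures positivity.\<close>

definition "\<kappa> = \<kappa>0 * ((2 * La\<^sup>2 + 25 * K\<^sup>2) * (2 * pi) + 2 + 2 * pi * lf\<^sup>2 * (8 * pi\<^sup>2 * La\<^sup>2 + 4 * pi)) + 1"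

lemma lf: "0 \<le> lf" using lip_f by (rule lipschitz_on_nonneg)

lemma f_lip: "0 < x \<Longrightarrow> 0 < y \<Longrightarrow> \<bar>f x - f y\<bar> \<le> lf * \<bar>x - y\<bar>"
  using lipschitz_onD[OF lip_f, of x y] by (simp add: dist_real_def)

lemma f_bound: "0 < x \<Longrightarrow> x \<le> 4 * pi * C2 \<Longrightarrow> \<bar>f x\<bar> \<le> F0"
proof -
  assume x: "0 < x" "x \<le> 4 * pi * C2"
  have "\<bar>f x - f 1\<bar> \<le> lf * \<bar>x - 1\<bar>" using x by (intro f_lip) auto
  also have "\<dots> \<le> lf * (1 + 4 * pi * C2)" using x lf by (intro mult_left_mono) auto
  finally show ?thesis using abs_triangle_ineq2[of "f x" "f 1"] by (simp add: F0_def)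
qed

lemma C2: "0 < C2" using C1 C12 by simp
lemma F0: "0 \<le> F0" unfolding F0_def using lf C2 by (intro add_nonneg_nonneg mult_nonneg_nonneg) auto
lemma La: "0 \<le> La" unfolding La_def using K F0 by simp
lemma G0: "0 \<le> G0" unfolding G0_def using K F0 C2 by simp
lemma \<kappa>0: "0 \<le> \<kappa>0" unfolding \<kappa>0_def by simp
lemma \<kappa>: "0 < \<kappa>" unfolding \<kappa>_def using \<kappa>0 by (intro add_nonneg_pos mult_nonneg_nonneg add_nonneg_nonneg) auto

text \<open>Here \<open>a\<close> and \<open>b\<close> are the exact and the discrete tangent, and
  the exact velocity splits into the discrete velocity \<open>d\<close>, the nodal error
  \<open>w\<close> and the interpolation error \<eta>. After cancellation every term has one factor
  \<open>w\<close> and one small factor, so half of the mass density of \<open>w\<close> absorbs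
  them.\<close>

lemma pointwise_estimate:
  assumes \<alpha>: "0 < \<alpha>" "\<alpha> \<le> 1" and a: "norm a \<le> 2 * C2" and b: "C1 / 2 \<le> norm b" "norm b \<le> 2 * C2"
    and Y: "norm Y \<le> 5 * K" and y': "\<bar>y'\<bar> \<le> F0" and eq: "Y = d + w + \<eta>"
  shows "mass_density \<alpha> ((norm b)\<^sup>2) b w w - flow_rhs \<alpha> y a Y \<bullet> w
      + (mass_density \<alpha> ((norm b)\<^sup>2) b d w + y' * (norm b * (w \<bullet> perp b)))
    \<le> 1/2 * mass_density \<alpha> ((norm b)\<^sup>2) b w w + \<kappa>0 / \<alpha> * ((norm (a - b))\<^sup>2 + (norm \<eta>)\<^sup>2 + (y - y')\<^sup>2)"
proof -
  let ?m = "mass_density \<alpha> ((norm b)\<^sup>2) b" and ?ma = "mass_density \<alpha> ((norm a)\<^sup>2) a"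
  have Ym: "?m Y w = ?m d w + ?m w w + ?m \<eta> w"
    unfolding eq by (simp add: linear_add[OF linear_mass_density(1)])
  have "?m w w - flow_rhs \<alpha> y a Y \<bullet> w + (?m d w + y' * (norm b * (w \<bullet> perp b)))
    = (?m Y w - ?ma Y w) - ?m \<eta> w - (y * (norm a * (w \<bullet> perp a)) - y' * (norm b * (w \<bullet> perp b)))"
    unfolding flow_rhs_inner Ym by simp
  also have "\<dots> \<le> 4 * (2 * C2) * norm Y * norm w * norm (a - b) + (norm b)\<^sup>2 * norm \<eta> * norm w
      + ((2 * C2)\<^sup>2 * \<bar>y - y'\<bar> + 2 * (2 * C2) * F0 * norm (a - b)) * norm w"
    using mass_density_diff_le[of \<alpha> a "2*C2" b Y w] mass_density_le[of \<alpha> b \<eta> w]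
      forcing_diff_le[OF a b(2) y', of y w] \<alpha> a b by linarith
  also have "\<dots> \<le> 4 * (2 * C2) * (5 * K) * norm w * norm (a - b) + (2 * C2)\<^sup>2 * norm \<eta> * norm w
      + ((2 * C2)\<^sup>2 * \<bar>y - y'\<bar> + 2 * (2 * C2) * F0 * norm (a - b)) * norm w"
    using Y b C2 by (intro add_mono mult_right_mono mult_left_mono power_mono order_refl) auto
  also have "\<dots> \<le> G0 * (norm (a - b) + norm \<eta> + \<bar>y - y'\<bar>) * norm w"
  proof -
    have "4 * (2 * C2) * (5 * K) + 2 * (2 * C2) * F0 \<le> G0" "(2 * C2)\<^sup>2 \<le> G0"
      using K F0 C2 by (auto simp: G0_def)
    then have "(4 * (2 * C2) * (5 * K) + 2 * (2 * C2) * F0) * norm (a - b) \<le> G0 * norm (a - b)"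
      "(2 * C2)\<^sup>2 * norm \<eta> \<le> G0 * norm \<eta>" "(2 * C2)\<^sup>2 * \<bar>y - y'\<bar> \<le> G0 * \<bar>y - y'\<bar>"
      by (auto intro: mult_right_mono)
    then have "(4 * (2 * C2) * (5 * K) + 2 * (2 * C2) * F0) * norm (a - b) + (2 * C2)\<^sup>2 * norm \<eta> + (2 * C2)\<^sup>2 * \<bar>y - y'\<bar>
       \<le> G0 * (norm (a - b) + norm \<eta> + \<bar>y - y'\<bar>)" by (simp add: distrib_left)
    from mult_right_mono[OF this, of "norm w"] show ?thesis by (simp add: algebra_simps)
  qed
  \<comment> \<open>The weight is chosen so that the first summand is at most half of the mass
    density, whose \<alpha>-part is at least \<open>\<alpha> * C1\<^sup>2 / 4\<close> times
    \<open>(norm w)\<^sup>2\<close> because \<open>norm b \<ge> C1 / 2\<close>.\<close>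
  also have "\<dots> \<le> (\<alpha> * C1\<^sup>2 / 4) / 2 * (norm w)\<^sup>2 + (G0 * (norm (a - b) + norm \<eta> + \<bar>y - y'\<bar>))\<^sup>2 / (2 * (\<alpha> * C1\<^sup>2 / 4))"
    using \<alpha> C1 by (intro young) auto
  also have "\<dots> \<le> 1/2 * ?m w w + \<kappa>0 / \<alpha> * ((norm (a - b))\<^sup>2 + (norm \<eta>)\<^sup>2 + (y - y')\<^sup>2)"
  proof (rule add_mono)
    have "C1\<^sup>2 / 4 \<le> (norm b)\<^sup>2" using power_mono[OF b(1), of 2] C1 by (simp add: power_divide)
    then have "\<alpha> * (C1\<^sup>2 / 4) * (norm w)\<^sup>2 \<le> \<alpha> * (norm b)\<^sup>2 * (norm w)\<^sup>2" using \<alpha> by (intro mult_right_mono mult_left_mono) auto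
    also have "\<dots> \<le> ?m w w" using \<alpha> by (intro mass_density_ge) auto
    finally show "(\<alpha> * C1\<^sup>2 / 4) / 2 * (norm w)\<^sup>2 \<le> 1/2 * ?m w w" by simp
    have "(G0 * (norm (a - b) + norm \<eta> + \<bar>y - y'\<bar>))\<^sup>2 \<le> G0\<^sup>2 * (3 * ((norm (a - b))\<^sup>2 + (norm \<eta>)\<^sup>2 + \<bar>y - y'\<bar>\<^sup>2))"
      unfolding power_mult_distrib by (intro mult_left_mono square_sum3_le) auto
    then have "(G0 * (norm (a - b) + norm \<eta> + \<bar>y - y'\<bar>))\<^sup>2 / (2 * (\<alpha> * C1\<^sup>2 / 4))
      \<le> G0\<^sup>2 * (3 * ((norm (a - b))\<^sup>2 + (norm \<eta>)\<^sup>2 + (y - y')\<^sup>2)) / (2 * (\<alpha> * C1\<^sup>2 / 4))"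
      using \<alpha> by (intro divide_right_mono) auto
    also have "\<dots> = \<kappa>0 / \<alpha> * ((norm (a - b))\<^sup>2 + (norm \<eta>)\<^sup>2 + (y - y')\<^sup>2)"
      using \<alpha> C1 by (simp add: \<kappa>0_def field_simps)
    finally show "(G0 * (norm (a - b) + norm \<eta> + \<bar>y - y'\<bar>))\<^sup>2 / (2 * (\<alpha> * C1\<^sup>2 / 4))
      \<le> \<kappa>0 / \<alpha> * ((norm (a - b))\<^sup>2 + (norm \<eta>)\<^sup>2 + (y - y')\<^sup>2)" .
  qed
  finally show ?thesis .
qed

end

context mesh begin

lemma element_mass:
  fixes u v :: "nat \<Rightarrow> real^2"
  assumes u: "u 0 = u N" and v: "v 0 = v N" and i: "i \<in> {1..N}"
  shows "((\<lambda>x. mass_density \<alpha> ((norm ((1 / h i) *\<^sub>R q))\<^sup>2) ((1 / h i) *\<^sub>R q) (pl u x) (pl v x)) has_integral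
     (1 / (6 * h i) * (2 * mass_density \<alpha> ((norm q)\<^sup>2) q (u (i-1)) (v (i-1)) + mass_density \<alpha> ((norm q)\<^sup>2) q (u (i-1)) (v i)
      + mass_density \<alpha> ((norm q)\<^sup>2) q (u i) (v (i-1)) + 2 * mass_density \<alpha> ((norm q)\<^sup>2) q (u i) (v i)))) {p (i-1)..p i}"
proof -
  let ?m = "mass_density \<alpha> ((norm q)\<^sup>2) q"
  let ?S = "2 * ?m (u (i-1)) (v (i-1)) + ?m (u (i-1)) (v i) + ?m (u i) (v (i-1)) + 2 * ?m (u i) (v i)"
  have lt: "p (i-1) < p i" and hi: "h i = p i - p (i-1)" using h_pos[OF i] by (auto simp: h_def)
  have "((\<lambda>x. 1 / (h i)\<^sup>2 * ?m (u (i-1) + ((x - p (i-1)) / (p i - p (i-1))) *\<^sub>R (u i - u (i-1)))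
       (v (i-1) + ((x - p (i-1)) / (p i - p (i-1))) *\<^sub>R (v i - v (i-1)))) has_integral
      1 / (h i)\<^sup>2 * ((p i - p (i-1)) / 6 * ?S)) {p (i-1)..p i}"
    by (intro has_integral_mult_right integral_bilinear_affine linear_mass_density lt)
  moreover have "1 / (h i)\<^sup>2 * ((p i - p (i-1)) / 6 * ?S) = 1 / (6 * h i) * ?S"
    unfolding hi[symmetric] using h_pos[OF i] by (simp add: power2_eq_square)
  ultimately have "((\<lambda>x. 1 / (h i)\<^sup>2 * ?m (u (i-1) + ((x - p (i-1)) / (p i - p (i-1))) *\<^sub>R (u i - u (i-1)))
       (v (i-1) + ((x - p (i-1)) / (p i - p (i-1))) *\<^sub>R (v i - v (i-1)))) has_integral 1 / (6 * h i) * ?S) {p (i-1)..p i}"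
    by simp
  then show ?thesis
    by (rule has_integral_eq[rotated])
      (simp only: mass_density_scale pl_element[where c=u, OF u i] pl_element[where c=v, OF v i] hi[symmetric] atLeastAtMost_iff)
qed

lemma element_load:
  fixes v :: "nat \<Rightarrow> real^2"
  assumes v: "v 0 = v N" and i: "i \<in> {1..N}"
  shows "((\<lambda>x. norm ((1 / h i) *\<^sub>R q) * (pl v x \<bullet> perp ((1 / h i) *\<^sub>R q))) has_integral
     (1 / (2 * h i) * (norm q * ((v (i-1) + v i) \<bullet> perp q)))) {p (i-1)..p i}"
proof -
  let ?a = "v (i-1) \<bullet> perp q" and ?b = "(v i - v (i-1)) \<bullet> perp q"
  have lt: "p (i-1) < p i" and hi: "h i = p i - p (i-1)" using h_pos[OF i] by (auto simp: h_def)
  have "((\<lambda>x. 1 / (h i)\<^sup>2 * norm q * (?a + (x - p (i-1)) / (p i - p (i-1)) * ?b)) has_integral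
    1 / (h i)\<^sup>2 * norm q * ((p i - p (i-1)) * ?a + (p i - p (i-1)) / 2 * ?b)) {p (i-1)..p i}"
    by (intro has_integral_mult_right integral_affine lt)
  moreover have "1 / (h i)\<^sup>2 * norm q * ((p i - p (i-1)) * ?a + (p i - p (i-1)) / 2 * ?b)
     = 1 / (2 * h i) * (norm q * ((v (i-1) + v i) \<bullet> perp q))"
    unfolding hi[symmetric] using h_pos[OF i] by (simp add: power2_eq_square inner_diff_left inner_add_left field_simps)
  ultimately have "((\<lambda>x. 1 / (h i)\<^sup>2 * norm q * (?a + (x - p (i-1)) / (p i - p (i-1)) * ?b)) has_integral
     1 / (2 * h i) * (norm q * ((v (i-1) + v i) \<bullet> perp q))) {p (i-1)..p i}" by simp
  then show ?thesis
    by (rule has_integral_eq[rotated], simp only: pl_element[where c=v, OF v i] hi[symmetric] atLeastAtMost_iff)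
      (use h_pos[OF i] in \<open>simp add: perp_scaleR inner_add_left power2_eq_square\<close>)
qed

lemma sum_h: "(\<Sum>i=1..N. h i) = 2*pi"
  using telescope[of N p] by (simp add: h_def)

text \<open>On an element the error is the convex combination of the two differences to the end
  values. First order is all that Lipschitz continuity of the velocity offers.\<close>

lemma nodal_interpolation_error:
  fixes Y :: "real \<Rightarrow> 'a::real_normed_vector"
  assumes Y: "\<And>x y. x \<in> {0..2*pi} \<Longrightarrow> y \<in> {0..2*pi} \<Longrightarrow> norm (Y x - Y y) \<le> L * \<bar>x - y\<bar>" and L: "0 \<le> L"
    and per: "Y 0 = Y (2*pi)" and H: "\<And>j. j \<in> {1..N} \<Longrightarrow> h j \<le> H" and i: "i \<in> {1..N}" and x: "p (i-1) \<le> x" "x \<le> p i"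
  shows "norm (Y x - pl (\<lambda>j. Y (p j)) x) \<le> L * H"
proof -
  have pos: "0 < h i" and hi: "h i = p i - p (i-1)" using h_pos[OF i] by (auto simp: h_def)
  define \<theta> where "\<theta> = (x - p (i-1)) / h i"
  have \<theta>: "0 \<le> \<theta>" "\<theta> \<le> 1" using x pos hi by (auto simp: \<theta>_def)
  have "i - 1 \<le> N" "i \<le> N" using i by auto
  then have mem: "p (i-1) \<in> {0..2*pi}" "p i \<in> {0..2*pi}" using p_bounds by auto
  then have xm: "x \<in> {0..2*pi}" using x by auto
  have near: "norm (Y x - Y (p (i-1))) \<le> L * H" "norm (Y x - Y (p i)) \<le> L * H"
    using Y[OF xm mem(1)] Y[OF xm mem(2)] x hi H[OF i] mult_left_mono[OF _ L, of "\<bar>x - p (i-1)\<bar>" H] mult_left_mono[OF _ L, of "\<bar>x - p i\<bar>" H]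
    by auto
  have "pl (\<lambda>j. Y (p j)) x = Y (p (i-1)) + \<theta> *\<^sub>R (Y (p i) - Y (p (i-1)))"
    using i x per unfolding \<theta>_def by (intro pl_element) auto
  then have "Y x - pl (\<lambda>j. Y (p j)) x = (1 - \<theta>) *\<^sub>R (Y x - Y (p (i-1))) + \<theta> *\<^sub>R (Y x - Y (p i))"
    by (simp add: algebra_simps)
  also have "norm \<dots> \<le> (1 - \<theta>) * norm (Y x - Y (p (i-1))) + \<theta> * norm (Y x - Y (p i))"
    using \<theta> norm_triangle_ineq[of "(1 - \<theta>) *\<^sub>R (Y x - Y (p (i-1)))" "\<theta> *\<^sub>R (Y x - Y (p i))"] by simp
  also have "\<dots> \<le> (1 - \<theta>) * (L * H) + \<theta> * (L * H)"
    using \<theta> near by (intro add_mono mult_left_mono) auto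
  also have "\<dots> = L * H" by (simp add: algebra_simps)
  finally show ?thesis .
qed

text \<open>Applied to the exact tangent, whose mean over an element is the slope of the
  interpolated curve there.\<close>

lemma mean_value_error:
  fixes a :: "real \<Rightarrow> 'a::euclidean_space"
  assumes a: "\<And>x y. x \<in> {0..2*pi} \<Longrightarrow> y \<in> {0..2*pi} \<Longrightarrow> norm (a x - a y) \<le> L * \<bar>x - y\<bar>" and L: "0 \<le> L"
    and cont: "continuous_on {0..2*pi} a"
    and H: "\<And>j. j \<in> {1..N} \<Longrightarrow> h j \<le> H" and i: "i \<in> {1..N}" and x: "p (i-1) \<le> x" "x \<le> p i"
  shows "norm (a x - (1 / h i) *\<^sub>R integral {p (i-1)..p i} a) \<le> L * H"
proof -
  have pos: "0 < h i" and hi: "h i = p i - p (i-1)" using h_pos[OF i] by (auto simp: h_def)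
  have "i - 1 \<le> N" "i \<le> N" using i by auto
  then have mem: "p (i-1) \<in> {0..2*pi}" "p i \<in> {0..2*pi}" using p_bounds by auto
  have ai: "a integrable_on {p (i-1)..p i}"
    using mem by (intro integrable_continuous_real continuous_on_subset[OF cont]) auto
  have "h i *\<^sub>R a x - integral {p (i-1)..p i} a = integral {p (i-1)..p i} (\<lambda>y. a x - a y)"
    using pos hi ai by (subst integral_diff) auto
  also have "norm \<dots> \<le> integral {p (i-1)..p i} (\<lambda>y. L * H)"
  proof (rule integral_norm_bound_integral)
    fix y assume y: "y \<in> {p (i-1)..p i}"
    have "norm (a x - a y) \<le> L * \<bar>x - y\<bar>" using mem x y by (intro a) auto
    also have "\<dots> \<le> L * H" using x y hi H[OF i] L by (intro mult_left_mono) auto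
    finally show "norm (a x - a y) \<le> L * H" .
  qed (use ai in \<open>auto intro: integrable_diff\<close>)
  also have "\<dots> = h i * (L * H)" using pos hi by simp
  finally have "norm (h i *\<^sub>R a x - integral {p (i-1)..p i} a) \<le> h i * (L * H)" .
  moreover have "h i *\<^sub>R a x - integral {p (i-1)..p i} a = h i *\<^sub>R (a x - (1 / h i) *\<^sub>R integral {p (i-1)..p i} a)"
    using pos by (simp add: scaleR_diff_right)
  ultimately show ?thesis using pos by simp
qed

end

section \<open>The energy inequality at a fixed time\<close>

locale flow_mesh = flow_const f lf C1 C2 K + mesh N p
  for f lf C1 C2 K N p +
  fixes \<alpha> H :: real
  assumes \<alpha>: "0 < \<alpha>" "\<alpha> \<le> 1" and H: "\<And>j. j \<in> {1..N} \<Longrightarrow> h j \<le> H"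
begin

lemma H_pos: "0 < H"
  using H[of 1] h_pos[of 1] N by auto

text \<open>Since \<open>edge W\<close> is constant on elements, the derivative of the interpolation error of \<open>X\<close> is orthogonal to it,
  and only the nodal error \<open>Xn - c\<close> enters the first sum.\<close>

lemma spatial_estimate:
  fixes a Y :: "real \<Rightarrow> real^2" and c d Xn :: "nat \<Rightarrow> real^2"
  assumes a: "continuous_on {0..2*pi} a" "a (2*pi) = a 0" "\<And>x. x \<in> {0..2*pi} \<Longrightarrow> norm (a x) \<le> C2"
    and a_lip: "\<And>x y. x \<in> {0..2*pi} \<Longrightarrow> y \<in> {0..2*pi} \<Longrightarrow> norm (a x - a y) \<le> La * \<bar>x - y\<bar>"
    and Y: "continuous_on {0..2*pi} Y" "Y (2*pi) = Y 0" "\<And>x. x \<in> {0..2*pi} \<Longrightarrow> norm (Y x) \<le> 5 * K"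
    and Y_lip: "\<And>x y. x \<in> {0..2*pi} \<Longrightarrow> y \<in> {0..2*pi} \<Longrightarrow> norm (Y x - Y y) \<le> 5 * K * \<bar>x - y\<bar>"
    and a_rhs: "\<And>s t. 0 \<le> s \<Longrightarrow> s \<le> t \<Longrightarrow> t \<le> 2*pi \<Longrightarrow> a t - a s = integral {s..t} (\<lambda>x. flow_rhs \<alpha> (f L) (a x) (Y x))"
    and L: "L = integral {0..2*pi} (\<lambda>x. norm (a x))" "0 < L"
    and Xn: "\<And>i. i \<in> {1..N} \<Longrightarrow> edge Xn i = integral {p (i-1)..p i} a"
    and c: "\<And>i. i \<in> {1..N} \<Longrightarrow> C1 / 2 * h i \<le> norm (edge c i) \<and> norm (edge c i) \<le> 2 * C2 * h i"
    and d: "d 0 = d N"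
    and scheme: "\<And>v. v 0 = v N \<Longrightarrow> mass_form \<alpha> N h (\<lambda>j. (norm (edge c j))\<^sup>2) (edge c) d v
      + load_form N h (edge c) (f (\<Sum>j=1..N. norm (edge c j))) v = 0"
  defines "W \<equiv> \<lambda>j. Y (p j) - d j" and "R \<equiv> \<lambda>j. edge Xn j - edge c j"
  shows "(\<Sum>i=1..N. (R i \<bullet> edge W i) / h i) + 1/2 * mass_form \<alpha> N h (\<lambda>j. (norm (edge c j))\<^sup>2) (edge c) W W
     \<le> \<kappa> / \<alpha> * (H\<^sup>2 + (\<Sum>i=1..N. (norm (R i))\<^sup>2 / h i))"
proof -
  define b where "b i = (1 / h i) *\<^sub>R edge c i" for i
  define l where "l = (\<Sum>j=1..N. norm (edge c j))"
  define E where "E = (\<Sum>i=1..N. (norm (R i))\<^sup>2 / h i)"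
  define S where "S = (\<Sum>i=1..N. norm (R i))"
  have W: "W 0 = W N" using Y(2) d by (simp add: W_def)
  have el: "{p (i-1)..p i} \<subseteq> {0..2*pi}" "p (i-1) \<le> p i" "h i = p i - p (i-1)" if i: "i \<in> {1..N}" for i
  proof -
    have "i - 1 \<le> N" "i \<le> N" using i by auto
    then show "{p (i-1)..p i} \<subseteq> {0..2*pi}" using p_bounds by auto
    show "p (i-1) \<le> p i" "h i = p i - p (i-1)" using h_pos[OF i] by (auto simp: h_def)
  qed
  have b: "C1 / 2 \<le> norm (b i)" "norm (b i) \<le> 2 * C2" if i: "i \<in> {1..N}" for i
    using c[OF i] h_pos[OF i] by (auto simp: b_def field_simps)
  \<comment> \<open>The exact tangent differs from its mean by \<open>La * H\<close>, and this mean
    differs from the discrete tangent by \<open>R i / h i\<close>.\<close>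
  have near: "norm (a x - b i) \<le> La * H + norm (R i) / h i" if i: "i \<in> {1..N}" and x: "x \<in> {p (i-1)..p i}" for i x
  proof -
    define A where "A = (1 / h i) *\<^sub>R integral {p (i-1)..p i} a"
    have "norm (a x - A) \<le> La * H"
      unfolding A_def using x by (intro mean_value_error[OF a_lip La a(1) H i]) auto
    moreover have "A - b i = (1 / h i) *\<^sub>R R i"
      by (simp add: A_def b_def R_def Xn[OF i] scaleR_diff_right)
    then have "norm (A - b i) = norm (R i) / h i" using h_pos[OF i] by simp
    moreover have "norm (a x - b i) \<le> norm (a x - A) + norm (A - b i)"
      using norm_triangle_ineq[of "a x - A" "A - b i"] by simp
    ultimately show ?thesis by simp
  qed
  have na: "continuous_on {0..2*pi} (\<lambda>x. norm (a x))" by (intro continuous_intros a)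
  have lL: "\<bar>L - l\<bar> \<le> 2 * pi * La * H + S"
  proof -
    have ai: "(\<lambda>x. norm (a x)) absolutely_integrable_on {p (i-1)..p i}" if i: "i \<in> {1..N}" for i
      by (intro absolutely_integrable_continuous_real continuous_on_subset[OF na] el i)
    have "L - l = (\<Sum>i=1..N. integral {p (i-1)..p i} (\<lambda>x. norm (a x)) - norm (edge c i))"
      unfolding sum_subtractf l_def L(1) by (simp only: integrable_elements(2)[where F="\<lambda>x. norm (a x)", OF ai])
    also have "\<bar>\<dots>\<bar> \<le> (\<Sum>i=1..N. \<bar>integral {p (i-1)..p i} (\<lambda>x. norm (a x)) - norm (edge c i)\<bar>)" by (rule sum_abs)
    also have "\<dots> \<le> (\<Sum>i=1..N. h i * (La * H) + norm (R i))"
    proof (rule sum_mono)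
      fix i assume i: "i \<in> {1..N}"
      have ii: "(\<lambda>x. norm (a x)) integrable_on {p (i-1)..p i}" using ai[OF i] by (simp add: absolutely_integrable_on_def)
      have "integral {p (i-1)..p i} (\<lambda>x. norm (b i)) = h i * norm (b i)" using el[OF i] by simp
      also have "\<dots> = norm (edge c i)" using h_pos[OF i] by (simp add: b_def)
      finally have "integral {p (i-1)..p i} (\<lambda>x. norm (a x)) - norm (edge c i) = integral {p (i-1)..p i} (\<lambda>x. norm (a x) - norm (b i))"
        using ii by (subst integral_diff) auto
      also have "norm \<dots> \<le> integral {p (i-1)..p i} (\<lambda>x. La * H + norm (R i) / h i)"
      proof (rule integral_norm_bound_integral)
        show "norm (norm (a x) - norm (b i)) \<le> La * H + norm (R i) / h i" if "x \<in> {p (i-1)..p i}" for x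
          using near[OF i that] norm_triangle_ineq3[of "a x" "b i"] unfolding real_norm_def by linarith
      qed (use ii in \<open>auto intro: integrable_diff\<close>)
      also have "\<dots> = h i * (La * H + norm (R i) / h i)" using el(2,3)[OF i] by simp
      also have "\<dots> = h i * (La * H) + norm (R i)" using h_pos[OF i] by (simp add: distrib_left)
      finally show "\<bar>integral {p (i-1)..p i} (\<lambda>x. norm (a x)) - norm (edge c i)\<bar> \<le> h i * (La * H) + norm (R i)" by simp
    qed
    also have "\<dots> = 2 * pi * La * H + S"
      unfolding sum.distrib sum_distrib_right[symmetric] sum_h S_def by simp
    finally show ?thesis .
  qed
  have l: "0 < l" "l \<le> 4 * pi * C2"
  proof -
    have 1: "(1::nat) \<in> {1..N}" using N by auto
    have "0 < norm (edge c 1)" using c[OF 1] h_pos[OF 1] C1 by (smt (verit) mult_pos_pos divide_pos_pos)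
    also have "\<dots> \<le> l" unfolding l_def by (intro member_le_sum 1) auto
    finally show "0 < l" .
    have "l \<le> (\<Sum>j=1..N. 2 * C2 * h j)" unfolding l_def using c by (intro sum_mono) auto
    also have "\<dots> = 4 * pi * C2" unfolding sum_distrib_left[symmetric] sum_h by simp
    finally show "l \<le> 4 * pi * C2" .
  qed
  have hn: "h i \<noteq> 0 \<and> 0 \<le> h i" if "i \<in> {1..N}" for i
    using h_pos[OF that] by auto
  \<comment> \<open>Cauchy-Schwarz with weights \<open>sqrt (h i)\<close>, whose squares add up to
    \<open>2 * pi\<close>; this puts the perimeter error in terms of the energy.\<close>
  have S2: "S\<^sup>2 \<le> 2 * pi * E"
  proof -
    have "S = (\<Sum>i=1..N. sqrt (h i) * (norm (R i) / sqrt (h i)))"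
      unfolding S_def by (intro sum.cong refl) (simp add: hn)
    also have "\<dots>\<^sup>2 \<le> (\<Sum>i=1..N. (sqrt (h i))\<^sup>2) * (\<Sum>i=1..N. (norm (R i) / sqrt (h i))\<^sup>2)"
      by (rule Cauchy_Schwarz_ineq_sum)
    also have "(\<Sum>i=1..N. (sqrt (h i))\<^sup>2) = (\<Sum>i=1..N. h i)"
      by (intro sum.cong refl) (simp add: hn)
    also have "(\<Sum>i=1..N. (norm (R i) / sqrt (h i))\<^sup>2) = E"
      unfolding E_def by (intro sum.cong refl) (simp add: hn power_divide)
    finally show ?thesis unfolding sum_h .
  qed
  define \<delta> where "\<delta> = f L - f l"
  have \<delta>: "\<delta>\<^sup>2 \<le> lf\<^sup>2 * (8 * pi\<^sup>2 * La\<^sup>2 * H\<^sup>2 + 4 * pi * E)"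
  proof -
    have "\<bar>\<delta>\<bar> \<le> lf * (2 * pi * La * H + S)"
      using f_lip[OF L(2) l(1)] mult_left_mono[OF lL lf] by (simp add: \<delta>_def)
    then have "\<bar>\<delta>\<bar>\<^sup>2 \<le> (lf * (2 * pi * La * H + S))\<^sup>2" by (intro power_mono) auto
    also have "\<dots> \<le> lf\<^sup>2 * (2 * ((2 * pi * La * H)\<^sup>2 + S\<^sup>2))"
      unfolding power_mult_distrib[of lf] by (intro mult_left_mono square_sum2_le) auto
    also have "\<dots> \<le> lf\<^sup>2 * (2 * ((2 * pi * La * H)\<^sup>2 + 2 * pi * E))"
      using S2 by (intro mult_left_mono add_left_mono) auto
    finally show ?thesis by (simp add: power_mult_distrib algebra_simps)
  qed
  define y' where "y' = f l"
  have y': "\<bar>y'\<bar> \<le> F0" unfolding y'_def by (rule f_bound[OF l])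
  let ?m = "\<lambda>i. mass_density \<alpha> ((norm (edge c i))\<^sup>2) (edge c i)"
  define M where "M u v i = 1 / (6 * h i) * (2 * ?m i (u (i-1)) (v (i-1)) + ?m i (u (i-1)) (v i) + ?m i (u i) (v (i-1)) + 2 * ?m i (u i) (v i))" for u v i
  define Lo where "Lo i = 1 / (2 * h i) * (norm (edge c i) * ((W (i-1) + W i) \<bullet> perp (edge c i)))" for i
  \<comment> \<open>The element integral of \<open>flow_rhs\<close> against the nodal error:
    integration by parts leaves boundary terms, which will telescope around the circle, and the
    stiffness term of the interpolated curve.\<close>
  define J where "J i = a (p i) \<bullet> W i - a (p (i-1)) \<bullet> W (i-1) - (edge Xn i \<bullet> edge W i) / h i" for i
  define Ct where "Ct i = \<kappa>0 / \<alpha> * (2 * (La\<^sup>2 * H\<^sup>2 + (norm (R i))\<^sup>2 / (h i)\<^sup>2) + 25 * K\<^sup>2 * H\<^sup>2 + \<delta>\<^sup>2)" for i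
  \<comment> \<open>The integrated form of \<open>pointwise_estimate\<close> on element
    \<open>i\<close>, with \<open>w\<close>, \<open>d\<close> and \<eta> the piecewise linear nodal
    error, the discrete velocity and the interpolation error of \<open>Y\<close>.\<close>
  have main: "M W W i - J i + (M d W i + y' * Lo i) \<le> 1/2 * M W W i + h i * Ct i" if i: "i \<in> {1..N}" for i
  proof -
    let ?mb = "mass_density \<alpha> ((norm (b i))\<^sup>2) (b i)"
    have I1: "((\<lambda>x. ?mb (pl W x) (pl W x)) has_integral M W W i) {p (i-1)..p i}"
      unfolding b_def M_def by (rule element_mass[OF W W i])
    have I4: "((\<lambda>x. ?mb (pl d x) (pl W x)) has_integral M d W i) {p (i-1)..p i}"
      unfolding b_def M_def by (rule element_mass[OF d W i])
    have I5: "((\<lambda>x. norm (b i) * (pl W x \<bullet> perp (b i))) has_integral Lo i) {p (i-1)..p i}"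
      unfolding b_def Lo_def by (rule element_load[OF W i])
    \<comment> \<open>\<open>a\<close> is a primitive of \<open>flow_rhs\<close>, and the derivative
      \<open>k\<close> of \<open>pl W\<close> is constant on the element, so only the integral of
      \<open>a\<close>, that is, the edge of the interpolated curve, is left.\<close>
    have I3: "((\<lambda>x. flow_rhs \<alpha> (f L) (a x) (Y x) \<bullet> pl W x) has_integral J i) {p (i-1)..p i}"
    proof -
      define k where "k = (1 / h i) *\<^sub>R edge W i"
      have g_cont: "continuous_on {p (i-1)..p i} (\<lambda>x. flow_rhs \<alpha> (f L) (a x) (Y x))"
        unfolding flow_rhs_def
        by (intro continuous_intros linear_continuous_on_compose[OF _ perp_linear] continuous_on_subset[OF a(1)] continuous_on_subset[OF Y(1)] el i)
      have ai: "a integrable_on {p (i-1)..p i}"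
        by (intro integrable_continuous_real continuous_on_subset[OF a(1)] el i)
      have plW: "pl W t = pl W (p (i-1)) + integral {p (i-1)..t} (\<lambda>_. k)" if "t \<in> {p (i-1)..p i}" for t
        using that pl_element[OF W i, of t] pl_element[OF W i, of "p (i-1)"] el[OF i] h_pos[OF i] by (simp add: k_def edge_def divide_inverse)
      have at: "a t = a (p (i-1)) + integral {p (i-1)..t} (\<lambda>x. flow_rhs \<alpha> (f L) (a x) (Y x))" if "t \<in> {p (i-1)..p i}" for t
        using a_rhs[of "p (i-1)" t] that el(1)[OF i] el(2)[OF i] by (auto simp: algebra_simps)
      have "((\<lambda>x. flow_rhs \<alpha> (f L) (a x) (Y x) \<bullet> pl W x + a x \<bullet> k) has_integral (a (p i) \<bullet> pl W (p i) - a (p (i-1)) \<bullet> pl W (p (i-1)))) {p (i-1)..p i}"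
        by (rule integral_product_rule[OF bounded_bilinear_inner el(2)[OF i] absolutely_integrable_continuous_real[OF g_cont] _ _ at plW, of "norm k"]) auto
      from has_integral_diff[OF this has_integral_linear[OF integrable_integral[OF ai] bounded_linear_inner_left[of k]]]
      have "((\<lambda>x. flow_rhs \<alpha> (f L) (a x) (Y x) \<bullet> pl W x) has_integral (a (p i) \<bullet> pl W (p i) - a (p (i-1)) \<bullet> pl W (p (i-1)) - integral {p (i-1)..p i} a \<bullet> k)) {p (i-1)..p i}"
        by (simp add: o_def)
      moreover have "i \<le> N" "i - 1 \<le> N" using i by auto
      ultimately show ?thesis unfolding J_def Xn[OF i, symmetric] k_def by (simp add: pl_node[OF W])
    qed
    show ?thesis
    proof (rule has_integral_le)
      show "((\<lambda>x. ?mb (pl W x) (pl W x) - flow_rhs \<alpha> (f L) (a x) (Y x) \<bullet> pl W x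
          + (?mb (pl d x) (pl W x) + y' * (norm (b i) * (pl W x \<bullet> perp (b i))))) has_integral M W W i - J i + (M d W i + y' * Lo i)) {p (i-1)..p i}"
        by (intro has_integral_add has_integral_diff has_integral_mult_right I1 I3 I4 I5)
      have "((\<lambda>x. Ct i) has_integral h i * Ct i) {p (i-1)..p i}"
        using has_integral_const_real[of "Ct i" "p (i-1)" "p i"] el(2,3)[OF i] by simp
      then show "((\<lambda>x. 1/2 * ?mb (pl W x) (pl W x) + Ct i) has_integral 1/2 * M W W i + h i * Ct i) {p (i-1)..p i}"
        by (intro has_integral_add has_integral_mult_right I1)
      fix x assume x: "x \<in> {p (i-1)..p i}"
      then have x2: "x \<in> {0..2*pi}" using el(1)[OF i] by auto
      define \<eta> where "\<eta> = Y x - pl (\<lambda>j. Y (p j)) x"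
      have \<eta>: "norm \<eta> \<le> 5 * K * H"
        unfolding \<eta>_def using x Y(2) K by (intro nodal_interpolation_error[OF Y_lip _ _ H i]) auto
      \<comment> \<open>Interpolation is linear, and \<open>W\<close> is the nodal difference of
        \<open>Y\<close> and \<open>d\<close>.\<close>
      have eq: "Y x = pl d x + pl W x + \<eta>"
      proof -
        have xl: "p (i-1) \<le> x" "x \<le> p i" using x by auto
        define \<theta> where "\<theta> = (x - p (i-1)) / h i"
        have Yp: "Y (p 0) = Y (p N)" using Y(2) by simp
        have "pl d x = d (i-1) + \<theta> *\<^sub>R (d i - d (i-1))" unfolding \<theta>_def by (rule pl_element[OF d i xl])
        moreover have "pl W x = W (i-1) + \<theta> *\<^sub>R (W i - W (i-1))" unfolding \<theta>_def by (rule pl_element[OF W i xl])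
        moreover have "pl (\<lambda>j. Y (p j)) x = Y (p (i-1)) + \<theta> *\<^sub>R (Y (p i) - Y (p (i-1)))"
          unfolding \<theta>_def by (rule pl_element[where c="\<lambda>j. Y (p j)", OF Yp i xl])
        ultimately have "pl (\<lambda>j. Y (p j)) x = pl d x + pl W x"
          unfolding W_def by (simp only:) (simp add: scaleR_diff_right)
        then show ?thesis by (simp add: \<eta>_def)
      qed
      have "norm (a x) \<le> 2 * C2" using a(3)[OF x2] C2 by linarith
      note pe = pointwise_estimate[OF \<alpha> this b(1)[OF i] b(2)[OF i] Y(3)[OF x2] y' eq, of "f L"]
      have "(norm (a x - b i))\<^sup>2 \<le> (La * H + norm (R i) / h i)\<^sup>2"
        by (intro power_mono near[OF i x]) auto
      also have "\<dots> \<le> 2 * ((La * H)\<^sup>2 + (norm (R i) / h i)\<^sup>2)" by (rule square_sum2_le)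
      finally have 1: "(norm (a x - b i))\<^sup>2 \<le> 2 * (La\<^sup>2 * H\<^sup>2 + (norm (R i))\<^sup>2 / (h i)\<^sup>2)"
        by (simp add: power_mult_distrib power_divide)
      have "(norm \<eta>)\<^sup>2 \<le> (5 * K * H)\<^sup>2" by (intro power_mono \<eta>) auto
      then have 2: "(norm \<eta>)\<^sup>2 \<le> 25 * K\<^sup>2 * H\<^sup>2" by (simp add: power_mult_distrib)
      have "\<kappa>0 / \<alpha> * ((norm (a x - b i))\<^sup>2 + (norm \<eta>)\<^sup>2 + (f L - y')\<^sup>2) \<le> Ct i"
        unfolding Ct_def \<delta>_def y'_def using 1 2 \<alpha> \<kappa>0 by (intro mult_left_mono add_mono) auto
      with pe show "?mb (pl W x) (pl W x) - flow_rhs \<alpha> (f L) (a x) (Y x) \<bullet> pl W x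
          + (?mb (pl d x) (pl W x) + y' * (norm (b i) * (pl W x \<bullet> perp (b i)))) \<le> 1/2 * ?mb (pl W x) (pl W x) + Ct i"
        by linarith
    qed
  qed
  have MWW: "mass_form \<alpha> N h (\<lambda>j. (norm (edge c j))\<^sup>2) (edge c) W W = (\<Sum>i=1..N. M W W i)"
    and MdW: "mass_form \<alpha> N h (\<lambda>j. (norm (edge c j))\<^sup>2) (edge c) d W = (\<Sum>i=1..N. M d W i)"
    unfolding mass_form_def M_def by simp_all
  have sch: "(\<Sum>i=1..N. M d W i) + ((\<Sum>i=1..N. (edge c i \<bullet> edge W i) / h i) + y' * (\<Sum>i=1..N. Lo i)) = 0"
    using scheme[OF W] unfolding MdW load_form_def Lo_def y'_def l_def edge_def[of W] by simp
  \<comment> \<open>Periodicity of \<open>a\<close> and \<open>W\<close> closes the telescoping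
    sum.\<close>
  have tel: "(\<Sum>i=1..N. a (p i) \<bullet> W i - a (p (i-1)) \<bullet> W (i-1)) = 0"
    using telescope[of N "\<lambda>i. a (p i) \<bullet> W i"] a(2) W by simp
  have "(\<Sum>i=1..N. M W W i - J i + (M d W i + y' * Lo i)) \<le> (\<Sum>i=1..N. 1/2 * M W W i + h i * Ct i)"
    by (rule sum_mono) (rule main)
  moreover have "(\<Sum>i=1..N. M W W i - J i + (M d W i + y' * Lo i))
     = (\<Sum>i=1..N. M W W i) - (\<Sum>i=1..N. J i) + ((\<Sum>i=1..N. M d W i) + y' * (\<Sum>i=1..N. Lo i))"
    by (simp add: sum.distrib sum_subtractf sum_distrib_left)
  moreover have "(\<Sum>i=1..N. J i) = - (\<Sum>i=1..N. (edge Xn i \<bullet> edge W i) / h i)"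
    using tel unfolding J_def by (simp add: sum_subtractf)
  moreover have "(\<Sum>i=1..N. 1/2 * M W W i + h i * Ct i) = 1/2 * (\<Sum>i=1..N. M W W i) + (\<Sum>i=1..N. h i * Ct i)"
    unfolding sum.distrib sum_distrib_left ..
  moreover have "(\<Sum>i=1..N. (R i \<bullet> edge W i) / h i) = (\<Sum>i=1..N. (edge Xn i \<bullet> edge W i) / h i) - (\<Sum>i=1..N. (edge c i \<bullet> edge W i) / h i)"
    unfolding R_def by (simp add: inner_diff_left diff_divide_distrib sum_subtractf)
  ultimately have "(\<Sum>i=1..N. (R i \<bullet> edge W i) / h i) + 1/2 * (\<Sum>i=1..N. M W W i) \<le> (\<Sum>i=1..N. h i * Ct i)"
    using sch by linarith
  also have "(\<Sum>i=1..N. h i * Ct i) = \<kappa>0 / \<alpha> * ((2 * La\<^sup>2 * H\<^sup>2 + 25 * K\<^sup>2 * H\<^sup>2 + \<delta>\<^sup>2) * (2 * pi) + 2 * E)"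
  proof -
    have "h i * Ct i = \<kappa>0 / \<alpha> * ((2 * La\<^sup>2 * H\<^sup>2 + 25 * K\<^sup>2 * H\<^sup>2 + \<delta>\<^sup>2) * h i + 2 * ((norm (R i))\<^sup>2 / h i))" if "i \<in> {1..N}" for i
      using h_pos[OF that] \<alpha> by (simp add: Ct_def field_simps power2_eq_square)
    then have "(\<Sum>i=1..N. h i * Ct i) = (\<Sum>i=1..N. \<kappa>0 / \<alpha> * ((2 * La\<^sup>2 * H\<^sup>2 + 25 * K\<^sup>2 * H\<^sup>2 + \<delta>\<^sup>2) * h i + 2 * ((norm (R i))\<^sup>2 / h i)))"
      by (intro sum.cong refl) auto
    also have "\<dots> = \<kappa>0 / \<alpha> * ((2 * La\<^sup>2 * H\<^sup>2 + 25 * K\<^sup>2 * H\<^sup>2 + \<delta>\<^sup>2) * (\<Sum>i=1..N. h i) + 2 * E)"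
      unfolding E_def sum_distrib_left[symmetric] sum.distrib ..
    finally show ?thesis unfolding sum_h .
  qed
  \<comment> \<open>The perimeter error contributes to both \<open>H\<^sup>2\<close> and
    \<open>E\<close>; to get a single constant, every coefficient is charged to both.\<close>
  also have "\<dots> \<le> \<kappa> / \<alpha> * (H\<^sup>2 + E)"
  proof -
    have E0: "0 \<le> E" unfolding E_def using h_pos by (intro sum_nonneg divide_nonneg_pos) auto
    have "(2 * La\<^sup>2 * H\<^sup>2 + 25 * K\<^sup>2 * H\<^sup>2 + \<delta>\<^sup>2) * (2 * pi) + 2 * E
      \<le> (2 * La\<^sup>2 * H\<^sup>2 + 25 * K\<^sup>2 * H\<^sup>2 + lf\<^sup>2 * (8 * pi\<^sup>2 * La\<^sup>2 * H\<^sup>2 + 4 * pi * E)) * (2 * pi) + 2 * E"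
      using \<delta> by (intro add_mono mult_right_mono order_refl) auto
    also have "\<dots> \<le> ((2 * La\<^sup>2 + 25 * K\<^sup>2) * (2 * pi) + 2 + 2 * pi * lf\<^sup>2 * (8 * pi\<^sup>2 * La\<^sup>2 + 4 * pi)) * (H\<^sup>2 + E)"
    proof -
      have "0 \<le> ((2 * La\<^sup>2 + 25 * K\<^sup>2) * (2 * pi)) * E" "0 \<le> 2 * H\<^sup>2"
        "0 \<le> 2 * pi * lf\<^sup>2 * (8 * pi\<^sup>2 * La\<^sup>2) * E" "0 \<le> 2 * pi * lf\<^sup>2 * (4 * pi) * H\<^sup>2"
        using E0 by auto
      moreover have "((2 * La\<^sup>2 + 25 * K\<^sup>2) * (2 * pi) + 2 + 2 * pi * lf\<^sup>2 * (8 * pi\<^sup>2 * La\<^sup>2 + 4 * pi)) * (H\<^sup>2 + E)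
        = (2 * La\<^sup>2 * H\<^sup>2 + 25 * K\<^sup>2 * H\<^sup>2 + lf\<^sup>2 * (8 * pi\<^sup>2 * La\<^sup>2 * H\<^sup>2 + 4 * pi * E)) * (2 * pi) + 2 * E
          + ((2 * La\<^sup>2 + 25 * K\<^sup>2) * (2 * pi)) * E + 2 * H\<^sup>2
          + 2 * pi * lf\<^sup>2 * (8 * pi\<^sup>2 * La\<^sup>2) * E + 2 * pi * lf\<^sup>2 * (4 * pi) * H\<^sup>2"
        by (simp add: algebra_simps)
      ultimately show ?thesis by linarith
    qed
    finally have "\<kappa>0 / \<alpha> * ((2 * La\<^sup>2 * H\<^sup>2 + 25 * K\<^sup>2 * H\<^sup>2 + \<delta>\<^sup>2) * (2 * pi) + 2 * E)
      \<le> \<kappa>0 / \<alpha> * (((2 * La\<^sup>2 + 25 * K\<^sup>2) * (2 * pi) + 2 + 2 * pi * lf\<^sup>2 * (8 * pi\<^sup>2 * La\<^sup>2 + 4 * pi)) * (H\<^sup>2 + E))"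
      using \<kappa>0 \<alpha> by (intro mult_left_mono) auto
    also have "\<dots> = (\<kappa> - 1) / \<alpha> * (H\<^sup>2 + E)" by (simp add: \<kappa>_def)
    also have "\<dots> \<le> \<kappa> / \<alpha> * (H\<^sup>2 + E)"
      using \<alpha> E0 by (intro mult_right_mono divide_right_mono) auto
    finally show ?thesis .
  qed
  finally show ?thesis unfolding MWW E_def .
qed

end

section \<open>Regularity of the exact solution\<close>

text \<open>Both summands of the norm are nonnegative, so each is at most \<open>K\<close>.
  Nonnegativity uses \<open>0 < T\<close>: only on a set of positive measure is the essential
  supremum of the constant 0 equal to 0.\<close>

lemma W1inf_norm_bounds:
  assumes T: "0 < T" and X: "W1inf_H2 T X" and K: "W1inf_H2_norm T X = ereal K"
  shows "0 \<le> K" "Linf_H2 T (time_deriv T X)" "has_weak_time_deriv T X (time_deriv T X)"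
    "AE t in lebesgue_on {0..T}. H2_norm (time_deriv T X t) \<le> K"
proof -
  have "\<exists>w. Linf_H2 T w \<and> has_weak_time_deriv T X w" using X unfolding W1inf_H2_def by (rule conjunct2)
  then have "Linf_H2 T (time_deriv T X) \<and> has_weak_time_deriv T X (time_deriv T X)"
    unfolding time_deriv_def by (rule someI_ex)
  then show Y: "Linf_H2 T (time_deriv T X)" "has_weak_time_deriv T X (time_deriv T X)" by auto
  have H0: "0 \<le> H2_norm v" for v :: "real \<Rightarrow> real^2"
    unfolding H2_norm_def by (intro real_sqrt_ge_zero add_nonneg_nonneg) auto
  have nn: "0 \<le> Linf_H2_norm T u" for u
  proof -
    have "emeasure (lebesgue_on {0..T}) (space (lebesgue_on {0..T})) \<noteq> 0"
      using T by (simp add: emeasure_restrict_space)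
    then have "0 = esssup (lebesgue_on {0..T}) (\<lambda>t. 0::ereal)" by (simp add: esssup_const)
    also have "\<dots> \<le> Linf_H2_norm T u"
      unfolding Linf_H2_norm_def by (rule esssup_mono) (auto simp: H0)
    finally show ?thesis .
  qed
  have sum: "Linf_H2_norm T X + Linf_H2_norm T (time_deriv T X) = ereal K"
    using K by (simp add: W1inf_H2_norm_def)
  have "0 \<le> ereal K" unfolding sum[symmetric] by (intro add_nonneg_nonneg nn)
  then show "0 \<le> K" by simp
  have "Linf_H2_norm T (time_deriv T X) \<le> ereal K"
    unfolding sum[symmetric] using nn[of X] by (metis add.left_neutral add_right_mono)
  moreover have "AE t in lebesgue_on {0..T}. ereal (H2_norm (time_deriv T X t)) \<le> Linf_H2_norm T (time_deriv T X)"
    unfolding Linf_H2_norm_def by (rule esssup_AE)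
  ultimately show "AE t in lebesgue_on {0..T}. H2_norm (time_deriv T X t) \<le> K"
    by (auto elim!: eventually_mono dest: order_trans)
qed

lemma flow_rhs_eq:
  assumes b: "b \<noteq> 0" and n: "n = perp (b /\<^sub>R norm b)"
    and eq: "\<alpha> *\<^sub>R Y + (1 - \<alpha>) *\<^sub>R ((Y \<bullet> n) *\<^sub>R n) = g /\<^sub>R (norm b)\<^sup>2 - y *\<^sub>R n"
  shows "g = flow_rhs \<alpha> y b Y"
proof -
  have bn: "perp b = norm b *\<^sub>R n" using b by (simp add: n perp_scaleR)
  have "g = (norm b)\<^sup>2 *\<^sub>R (g /\<^sub>R (norm b)\<^sup>2)" using b by simp
  also have "g /\<^sub>R (norm b)\<^sup>2 = \<alpha> *\<^sub>R Y + (1 - \<alpha>) *\<^sub>R ((Y \<bullet> n) *\<^sub>R n) + y *\<^sub>R n" using eq by simp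
  also have "(norm b)\<^sup>2 *\<^sub>R \<dots> = flow_rhs \<alpha> y b Y"
    unfolding flow_rhs_def bn by (simp add: scaleR_add_right power2_eq_square mult.assoc mult.left_commute mult.commute)
  finally show ?thesis .
qed

text \<open>A set of full measure is dense, since an interval that misses it would be null.\<close>

lemma AE_imp_near:
  fixes T t \<epsilon> :: real
  assumes T: "0 < T" and ae: "AE t in lebesgue_on {0..T}. P t" and t: "t \<in> {0..T}" and \<epsilon>: "0 < \<epsilon>"
  obtains s where "s \<in> {0..T}" "\<bar>s - t\<bar> < \<epsilon>" "P s"
proof -
  note goal = that
  have meas: "{r..s} \<in> sets lebesgue" for r s :: real
    using sets_lebesgue_Icc[of r s] by simp
  have ae': "AE s in lebesgue. s \<in> {0..T} \<longrightarrow> P s"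
    using ae AE_restrict_space_iff[of "{0..T}" lebesgue P] meas[of 0 T] by simp
  define u v where "u = max 0 (t - \<epsilon>/2)" and "v = min T (t + \<epsilon>/2)"
  have uv: "u < v" "{u..v} \<subseteq> {0..T}" using T t \<epsilon> by (auto simp: u_def v_def)
  show thesis
  proof (rule ccontr)
    assume nt: "\<not> thesis"
    have no: "\<not> P s" if s: "s \<in> {u..v}" for s
    proof
      assume "P s"
      moreover have "s \<in> {0..T}" using s uv(2) by (rule set_rev_mp)
      moreover have "t - \<epsilon>/2 \<le> s" "s \<le> t + \<epsilon>/2" using s by (simp_all add: u_def v_def)
      then have "\<bar>s - t\<bar> < \<epsilon>" using \<epsilon> by linarith
      ultimately show False using goal nt by metis
    qed
    have "AE s in lebesgue. s \<notin> {u..v}" using ae'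
    proof eventually_elim
      case (elim s)
      then show ?case using no[of s] set_mp[OF uv(2), of s] by metis
    qed
    then have "{u..v} \<in> null_sets lebesgue" using AE_iff_null_sets[OF meas[of u v]] by simp
    then have "negligible (cbox u v)" by (simp add: negligible_iff_null_sets)
    then show False unfolding negligible_interval using uv(1) by simp
  qed
qed

locale flow_data = flow_const f lf C1 C2 K for f lf C1 C2 K +
  fixes \<alpha> T :: real and X0 :: "real \<Rightarrow> real^2" and X :: "real \<Rightarrow> real \<Rightarrow> real^2"
  assumes \<alpha>01: "0 < \<alpha>" "\<alpha> \<le> 1" and T: "0 < T"
    and sol: "flow_solution \<alpha> f T X0 X" and norm_X: "W1inf_H2_norm T X = ereal K"
    and dxi_bounds: "\<And>t \<xi>. t \<in> {0..T} \<Longrightarrow> C1 \<le> norm (dxi (X t) \<xi>) \<and> norm (dxi (X t) \<xi>) \<le> C2"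
begin

abbreviation "Y \<equiv> time_deriv T X"

text \<open>The tangent as a continuous function on the closed period. It agrees with
  \<open>dxi (X t)\<close> in the interior, and estimates reach the end points by
  continuity.\<close>

definition a :: "real \<Rightarrow> real \<Rightarrow> real^2" where "a t = cont_rep (weak_deriv (X t))"

text \<open>Vanishes on a null set of times, so that its bounds hold at every time.\<close>

definition V :: "real \<Rightarrow> real \<Rightarrow> real^2" where
  "V t x = (if H2_norm (Y t) \<le> K then cont_rep (Y t) x else 0)"

lemma W1inf: "W1inf_H2 T X" and X_cont: "continuous_on ({0..T} \<times> UNIV) (\<lambda>(t, \<xi>). X t \<xi>)"
  and X_init: "X 0 \<xi> = X0 \<xi>"
  using sol by (auto simp: flow_solution_def)

lemmas Y_props = W1inf_norm_bounds[OF T W1inf norm_X]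

lemma X_H2: "t \<in> {0..T} \<Longrightarrow> H2_fun (X t)"
  using W1inf by (auto simp: W1inf_H2_def Linf_H2_def H2_strongly_measurable_def)

lemma X_H1: "t \<in> {0..T} \<Longrightarrow> H1_fun (X t)" "t \<in> {0..T} \<Longrightarrow> H1_fun (weak_deriv (X t))"
  using X_H2 by (auto simp: H2_fun_def)

lemma X_L2: "t \<in> {0..T} \<Longrightarrow> L2_fun (X t)"
  using X_H1 by (auto simp: H1_fun_def)

lemma Y_H2: "t \<in> {0..T} \<Longrightarrow> H2_fun (Y t)"
  using Y_props(2) by (auto simp: Linf_H2_def H2_strongly_measurable_def)

lemma Y_H1: "t \<in> {0..T} \<Longrightarrow> H1_fun (Y t)"
  using Y_H2 by (auto simp: H2_fun_def)

lemma X_space_cont: "t \<in> {0..T} \<Longrightarrow> continuous_on {0..2*pi} (X t)"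
proof -
  assume t: "t \<in> {0..T}"
  have "continuous_on {0..2*pi} (\<lambda>y. (\<lambda>(t, \<xi>). X t \<xi>) (t, y))"
    by (rule continuous_on_compose2[OF X_cont])
      (use t in \<open>auto intro!: continuous_on_Pair continuous_on_const continuous_on_id\<close>)
  then show ?thesis by simp
qed

lemma X_periodic: "t \<in> {0..T} \<Longrightarrow> X t (2*pi) = X t 0"
  using X_L2[of t] by (intro periodic_shift_2pi) (simp add: L2_fun_def)

lemma a_cont: "t \<in> {0..T} \<Longrightarrow> continuous_on {0..2*pi} (a t)"
  and a_per: "t \<in> {0..T} \<Longrightarrow> a t (2*pi) = a t 0"
  unfolding a_def using cont_rep(2,4)[OF X_H1(2)] by auto

lemma a_deriv: "t \<in> {0..T} \<Longrightarrow> 0 < x \<Longrightarrow> x < 2*pi \<Longrightarrow> (X t has_vector_derivative a t x) (at x)"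
  and a_dxi: "t \<in> {0..T} \<Longrightarrow> 0 < x \<Longrightarrow> x < 2*pi \<Longrightarrow> dxi (X t) x = a t x"
  and a_int: "t \<in> {0..T} \<Longrightarrow> 0 \<le> r \<Longrightarrow> r \<le> s \<Longrightarrow> s \<le> 2*pi \<Longrightarrow> X t s - X t r = integral {r..s} (a t)"
  unfolding a_def using H2_continuous_deriv[OF X_H2 X_space_cont] by auto

lemma closure_circle: "x \<in> {0..2*pi} \<Longrightarrow> x \<in> closure {0<..<2*pi}"
  by simp

lemma a_le: "t \<in> {0..T} \<Longrightarrow> x \<in> {0..2*pi} \<Longrightarrow> norm (a t x) \<le> C2"
proof (rule continuous_on_closure_norm_le[OF _ _ closure_circle])
  assume t: "t \<in> {0..T}"
  then show "continuous_on (closure {0<..<2*pi}) (a t)" using a_cont by simp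
  show "\<forall>x\<in>{0<..<2*pi}. norm (a t x) \<le> C2" using a_dxi[OF t] dxi_bounds[OF t] by (metis greaterThanLessThan_iff)
qed

lemma V_bounds:
  assumes t: "t \<in> {0..T}"
  shows "x \<in> {0..2*pi} \<Longrightarrow> norm (V t x) \<le> 5 * K"
    "x \<in> {0..2*pi} \<Longrightarrow> y \<in> {0..2*pi} \<Longrightarrow> norm (V t x - V t y) \<le> 5 * K * \<bar>x - y\<bar>"
    "continuous_on {0..2*pi} (V t)" "V t (2*pi) = V t 0"
proof -
  show "norm (V t x) \<le> 5 * K" if "x \<in> {0..2*pi}"
    using cont_rep_bounds_H2(1)[OF Y_H2[OF t] _ that, of K] K by (auto simp: V_def)
  show "norm (V t x - V t y) \<le> 5 * K * \<bar>x - y\<bar>" if "x \<in> {0..2*pi}" "y \<in> {0..2*pi}"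
    using cont_rep_bounds_H2(2)[OF Y_H2[OF t] _ that, of K] K by (auto simp: V_def)
  show "continuous_on {0..2*pi} (V t)" "V t (2*pi) = V t 0"
    using cont_rep(2,4)[OF Y_H1[OF t]] by (cases "H2_norm (Y t) \<le> K"; simp add: V_def[abs_def])+
qed

lemma Y_sm: "H2_strongly_measurable T Y"
  using Y_props(2) by (simp add: Linf_H2_def)

lemma V_measurable: "x \<in> {0..2*pi} \<Longrightarrow> (\<lambda>t. V t x) \<in> borel_measurable (lebesgue_on {0..T})"
proof -
  assume x: "x \<in> {0..2*pi}"
  show ?thesis
  proof (rule borel_measurable_AE_limit)
    show "(\<lambda>t. cont_rep (Y t) x) \<in> borel_measurable (lebesgue_on {0..T})"
      by (rule time_representation(1)[OF T X_cont X_L2 Y_sm Y_props(3,4) x])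
    show "AE t in lebesgue_on {0..T}. (\<lambda>n::nat. cont_rep (Y t) x) \<longlonglongrightarrow> V t x"
      using Y_props(4) by eventually_elim (simp add: V_def)
    show "{0..T} \<in> sets lebesgue" using sets_lebesgue_Icc[of 0 T] by simp
  qed
qed

lemma X_time:
  assumes x: "x \<in> {0..2*pi}" and t: "t \<in> {0..T}"
  shows "X t x = X 0 x + integral {0..t} (\<lambda>s. V s x)"
proof -
  have "integral {0..t} (\<lambda>s. V s x) = integral {0..t} (\<lambda>s. cont_rep (Y s) x)"
  proof (rule integral_cong_AE_interval)
    show "AE s in lebesgue_on {0..T}. V s x = cont_rep (Y s) x"
      using Y_props(4) by eventually_elim (simp add: V_def)
  qed (use t in auto)
  then show ?thesis using time_representation(2)[OF T X_cont X_L2 Y_sm Y_props(3,4) x t] by simp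
qed

lemma V_integrable: "x \<in> {0..2*pi} \<Longrightarrow> 0 \<le> s \<Longrightarrow> t \<le> T \<Longrightarrow> (\<lambda>r. V r x) integrable_on {s..t}"
proof -
  assume x: "x \<in> {0..2*pi}" and st: "0 \<le> s" "t \<le> T"
  have "(\<lambda>r. V r x) integrable_on {0..T}"
    by (rule measurable_bounded_by_integrable_imp_integrable[OF V_measurable[OF x] integrable_const_ivl[of "5 * K"]])
      (use V_bounds(1)[OF _ x] in auto)
  then show ?thesis by (rule integrable_subinterval_real) (use st in auto)
qed

text \<open>The increment of \<open>X\<close> between two times is the time integral of
  \<open>V\<close>, which is Lipschitz in space with constant \<open>5 * K\<close>; its spatial
  derivative inherits the bound, and mixed derivatives are avoided.\<close>

lemma a_time_lipschitz:
  assumes st: "s \<in> {0..T}" "t \<in> {0..T}" and x: "x \<in> {0..2*pi}"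
  shows "norm (a t x - a s x) \<le> 5 * K * \<bar>t - s\<bar>"
proof -
  have *: "norm (a t x - a s x) \<le> 5 * K * (t - s)" if st: "0 \<le> s" "s \<le> t" "t \<le> T" and x: "0 < x" "x < 2*pi" for s t x
  proof -
    have mem: "s \<in> {0..T}" "t \<in> {0..T}" using st by auto
    define D where "D y = X t y - X s y" for y
    have Dd: "(D has_vector_derivative a t x - a s x) (at x)"
      unfolding D_def by (intro has_vector_derivative_diff a_deriv mem x)
    have diff: "norm (D y - D x) \<le> 5 * K * (t - s) * \<bar>y - x\<bar>" if y: "y \<in> {0..2*pi}" for y
    proof -
      have xi: "x \<in> {0..2*pi}" using x by auto
      have Deq: "D z = integral {s..t} (\<lambda>r. V r z)" if z: "z \<in> {0..2*pi}" for z
        using X_time[OF z mem(1)] X_time[OF z mem(2)] st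
          Henstock_Kurzweil_Integration.integral_combine[OF st(1,2) V_integrable[OF z order_refl st(3)]]
        by (simp add: D_def) (metis add_diff_cancel_left')
      have "D y - D x = integral {s..t} (\<lambda>r. V r y - V r x)"
        unfolding Deq[OF y] Deq[OF xi] by (rule integral_diff[symmetric]) (intro V_integrable y xi st)+
      also have "norm \<dots> \<le> integral {s..t} (\<lambda>r. 5 * K * \<bar>y - x\<bar>)"
        using st by (intro integral_norm_bound_integral integrable_diff V_integrable y xi V_bounds(2)) auto
      also have "\<dots> = 5 * K * (t - s) * \<bar>y - x\<bar>" using st by simp
      finally show ?thesis .
    qed
    \<comment> \<open>The signed difference quotient of \<open>D\<close>, obtained from the
      derivative in remainder form; its bound passes to the limit.\<close>
    have "((\<lambda>y. norm ((1 / (y - x)) *\<^sub>R (D y - D x))) \<longlongrightarrow> norm (a t x - a s x)) (at x)"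
    proof (rule tendsto_norm)
      have "((\<lambda>y. (1 / norm (y - x)) *\<^sub>R (D y - (D x + (y - x) *\<^sub>R (a t x - a s x)))) \<longlongrightarrow> 0) (at x)"
        using Dd by (simp add: has_vector_derivative_def has_derivative_within)
      then have "((\<lambda>y. norm ((1 / norm (y - x)) *\<^sub>R (D y - (D x + (y - x) *\<^sub>R (a t x - a s x))))) \<longlongrightarrow> 0) (at x)"
        by (rule tendsto_norm_zero)
      then have "((\<lambda>y. (1 / (y - x)) *\<^sub>R (D y - D x) - (a t x - a s x)) \<longlongrightarrow> 0) (at x)"
      proof (rule Lim_null_comparison[rotated])
        show "\<forall>\<^sub>F y in at x. norm ((1 / (y - x)) *\<^sub>R (D y - D x) - (a t x - a s x))
            \<le> norm ((1 / norm (y - x)) *\<^sub>R (D y - (D x + (y - x) *\<^sub>R (a t x - a s x))))"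
        proof (rule eventually_at_filter[THEN iffD2, OF always_eventually], intro allI impI)
          fix y assume "y \<noteq> x"
          have "(1 / (y - x)) *\<^sub>R (D y - D x) - (a t x - a s x) = (1 / (y - x)) *\<^sub>R (D y - (D x + (y - x) *\<^sub>R (a t x - a s x)))"
            using \<open>y \<noteq> x\<close> by (simp add: scaleR_diff_right scaleR_add_right)
          then show "norm ((1 / (y - x)) *\<^sub>R (D y - D x) - (a t x - a s x))
            \<le> norm ((1 / norm (y - x)) *\<^sub>R (D y - (D x + (y - x) *\<^sub>R (a t x - a s x))))" by simp
        qed
      qed
      then show "((\<lambda>y. (1 / (y - x)) *\<^sub>R (D y - D x)) \<longlongrightarrow> a t x - a s x) (at x)" by (simp add: LIM_zero_iff)
    qed
    moreover have "\<forall>\<^sub>F y in at x. norm ((1 / (y - x)) *\<^sub>R (D y - D x)) \<le> 5 * K * (t - s)"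
    proof -
      have "\<forall>\<^sub>F y in at x. y \<in> {0<..<2*pi} \<and> y \<noteq> x"
        using x by (intro eventually_conj eventually_at_in_open' eventually_neq_at_within) auto
      then show ?thesis
      proof eventually_elim
        case (elim y)
        have "norm (D y - D x) \<le> 5 * K * (t - s) * \<bar>y - x\<bar>" using elim by (intro diff) auto
        moreover have "norm ((1 / (y - x)) *\<^sub>R (D y - D x)) = norm (D y - D x) / \<bar>y - x\<bar>" by simp
        moreover have "0 < \<bar>y - x\<bar>" using elim by simp
        ultimately show ?case by (simp only: pos_divide_le_eq)
      qed
    qed
    ultimately show ?thesis by (rule tendsto_upperbound) simp
  qed
  have **: "norm (a t x - a s x) \<le> 5 * K * (t - s)" if st: "0 \<le> s" "s \<le> t" "t \<le> T" for s t
  proof (rule continuous_on_closure_norm_le[of "{0<..<2*pi}" "\<lambda>x. a t x - a s x", OF _ _ closure_circle[OF x]])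
    show "continuous_on (closure {0<..<2*pi}) (\<lambda>x. a t x - a s x)"
      using st a_cont[of s] a_cont[of t] by (auto intro!: continuous_intros)
  qed (use *[OF st] in auto)
  show ?thesis using **[of s t] **[of t s] st by (cases "s \<le> t") (auto simp: norm_minus_commute)
qed

lemma perimeter_eq:
  assumes t: "t \<in> {0..T}"
  shows "perimeter (X t) = integral {0..2*pi} (\<lambda>x. norm (a t x))" "0 < perimeter (X t)"
proof -
  have c: "continuous_on {0..2*pi} (\<lambda>x. norm (a t x))" by (intro continuous_intros a_cont t)
  have G: "(\<lambda>x. norm (a t x)) absolutely_integrable_on {0..2*pi}" using c by (rule absolutely_integrable_continuous_real)
  have eq: "norm (dxi (X t) x) = norm (a t x)" if "x \<in> {0..2*pi} - {0, 2*pi}" for x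
  proof -
    have "0 < x" "x < 2*pi" using that by auto
    then show ?thesis by (simp only: a_dxi[OF t])
  qed
  have F: "(\<lambda>x. norm (dxi (X t) x)) absolutely_integrable_on {0..2*pi}"
    by (rule absolutely_integrable_spike[OF G _ eq, where S="{0, 2*pi}"]) auto
  have "integral {0..2*pi} (\<lambda>x. norm (dxi (X t) x)) = integral {0..2*pi} (\<lambda>x. norm (a t x))"
    by (rule integral_spike[OF _ eq[symmetric], where S="{0, 2*pi}"]) auto
  then show "perimeter (X t) = integral {0..2*pi} (\<lambda>x. norm (a t x))"
    unfolding perimeter_def by (simp add: LINT_eq_integral[OF F])
  have "integral {0..2*pi} (\<lambda>x. C1) \<le> integral {0..2*pi} (\<lambda>x. norm (dxi (X t) x))"
    using F dxi_bounds[OF t] by (intro integral_le) (auto simp: absolutely_integrable_on_def)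
  then have "2 * pi * C1 \<le> perimeter (X t)"
    unfolding perimeter_def by (simp add: LINT_eq_integral[OF F])
  moreover have "0 < 2 * pi * C1" using C1 by simp
  ultimately show "0 < perimeter (X t)" by linarith
qed

text \<open>The integrated form speaks of continuous representatives only and so has a meaning for
  every pair of end points, while the differential equation itself holds a.e. in \<xi>.\<close>

definition good :: "real \<Rightarrow> bool" where
  "good t \<longleftrightarrow> t \<in> {0..T} \<and> H2_norm (Y t) \<le> K \<and>
     (\<forall>r s. 0 \<le> r \<longrightarrow> r \<le> s \<longrightarrow> s \<le> 2*pi \<longrightarrow>
        a t s - a t r = integral {r..s} (\<lambda>x. flow_rhs \<alpha> (f (perimeter (X t))) (a t x) (V t x)))"

lemma AE_good: "AE t in lebesgue_on {0..T}. good t"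
proof -
  have "AE t in lebesgue_on {0..T}. AE \<xi> in circle.
        \<alpha> *\<^sub>R Y t \<xi> + (1 - \<alpha>) *\<^sub>R ((Y t \<xi> \<bullet> unit_normal (X t) \<xi>) *\<^sub>R unit_normal (X t) \<xi>)
        = weak_deriv (weak_deriv (X t)) \<xi> /\<^sub>R (norm (dxi (X t) \<xi>))\<^sup>2 - f (perimeter (X t)) *\<^sub>R unit_normal (X t) \<xi>"
    using sol by (simp add: flow_solution_def)
  then show ?thesis
    using Y_props(4) AE_space
  proof eventually_elim
    case (elim t)
    then have t: "t \<in> {0..T}" by simp
    have V: "V t = cont_rep (Y t)" using elim(2) by (simp add: V_def[abs_def])
    \<comment> \<open>\<open>a t\<close> is identified with the derivative of \<open>X t\<close>
      only in the open period.\<close>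
    have nodes: "AE \<xi> in circle. \<xi> \<notin> {0, 2*pi}"
    proof -
      have "AE \<xi> in lebesgue. \<xi> \<notin> {0, 2*pi::real}"
        by (rule AE_not_in) (simp add: finite_imp_null_set_lborel null_sets_completionI)
      then have "AE \<xi> in lebesgue. \<xi> \<in> {0..2*pi} \<longrightarrow> \<xi> \<notin> {0, 2*pi::real}" by eventually_elim (rule impI)
      then show ?thesis
        by (rule AE_restrict_space_iff[THEN iffD2, rotated]) (use sets_lebesgue_Icc[of 0 "2*pi::real"] in simp)
    qed
    have "AE \<xi> in circle. weak_deriv (weak_deriv (X t)) \<xi> = flow_rhs \<alpha> (f (perimeter (X t))) (a t \<xi>) (V t \<xi>)"
      using elim(1) cont_rep(1)[OF Y_H1[OF t]] nodes AE_space
    proof eventually_elim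
      case (elim \<xi>)
      have \<xi>: "0 < \<xi>" "\<xi> < 2*pi" using elim(3,4) by auto
      show ?case
      proof (rule flow_rhs_eq[OF _ refl])
        show "a t \<xi> \<noteq> 0" using dxi_bounds[OF t, of \<xi>] C1 by (auto simp: a_dxi[OF t \<xi>])
        show "\<alpha> *\<^sub>R V t \<xi> + (1 - \<alpha>) *\<^sub>R ((V t \<xi> \<bullet> perp (a t \<xi> /\<^sub>R norm (a t \<xi>))) *\<^sub>R perp (a t \<xi> /\<^sub>R norm (a t \<xi>)))
          = weak_deriv (weak_deriv (X t)) \<xi> /\<^sub>R (norm (a t \<xi>))\<^sup>2 - f (perimeter (X t)) *\<^sub>R perp (a t \<xi> /\<^sub>R norm (a t \<xi>))"
          using elim unfolding unit_normal_def a_dxi[OF t \<xi>] V by simp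
      qed
    qed
    then have "integral {r..s} (weak_deriv (weak_deriv (X t))) = integral {r..s} (\<lambda>x. flow_rhs \<alpha> (f (perimeter (X t))) (a t x) (V t x))"
      if "0 \<le> r" "s \<le> 2*pi" for r s
      by (rule integral_cong_AE_interval) (use that in auto)
    then show "good t"
      unfolding good_def a_def using t elim(2) cont_rep(3)[OF X_H1(2)[OF t]] by auto
  qed
qed

lemma perimeter_le: "t \<in> {0..T} \<Longrightarrow> perimeter (X t) \<le> 4 * pi * C2"
proof -
  assume t: "t \<in> {0..T}"
  have "perimeter (X t) \<le> integral {0..2*pi} (\<lambda>x. C2)"
    unfolding perimeter_eq(1)[OF t] using a_le[OF t]
    by (intro integral_le integrable_continuous_real continuous_intros a_cont t) auto
  also have "\<dots> \<le> 4 * pi * C2" using C2 by simp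
  finally show ?thesis .
qed

lemma good_lipschitz:
  assumes g: "good t" and x: "x \<in> {0..2*pi}" "y \<in> {0..2*pi}"
  shows "norm (a t x - a t y) \<le> La * \<bar>x - y\<bar>"
proof -
  have t: "t \<in> {0..T}" using g by (simp add: good_def)
  let ?g = "\<lambda>x. flow_rhs \<alpha> (f (perimeter (X t))) (a t x) (V t x)"
  have g_le: "norm (?g x) \<le> La" if "x \<in> {0..2*pi}" for x
  proof -
    have "norm (?g x) \<le> (norm (a t x))\<^sup>2 * (norm (V t x) + \<bar>f (perimeter (X t))\<bar>)"
      using \<alpha>01 by (intro norm_flow_rhs_le) auto
    also have "\<dots> \<le> C2\<^sup>2 * (5 * K + F0)"
      using a_le[OF t that] V_bounds(1)[OF t that] f_bound[OF perimeter_eq(2)[OF t] perimeter_le[OF t]]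
      by (intro mult_mono power_mono add_mono) auto
    finally show ?thesis by (simp add: La_def)
  qed
  have g_cont: "continuous_on {0..2*pi} ?g"
    unfolding flow_rhs_def
    by (intro continuous_intros linear_continuous_on_compose[OF _ perp_linear] a_cont V_bounds(3) t)
  have *: "norm (a t x - a t y) \<le> La * (x - y)" if "0 \<le> y" "y \<le> x" "x \<le> 2*pi" for x y
  proof -
    have "a t x - a t y = integral {y..x} ?g" using g that unfolding good_def by blast
    also have "norm \<dots> \<le> integral {y..x} (\<lambda>_. La)"
      using that g_le by (intro integral_norm_bound_integral integrable_continuous_real continuous_on_subset[OF g_cont]) auto
    also have "\<dots> = La * (x - y)" using that by simp
    finally show ?thesis .
  qed
  show ?thesis using *[of x y] *[of y x] x by (cases "y \<le> x") (auto simp: norm_minus_commute)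
qed

text \<open>For almost every time this is \<open>good_lipschitz\<close>; the remaining times are
  limits of good ones, and the tangent is continuous in time uniformly in \<xi>.\<close>

lemma a_lipschitz:
  assumes t: "t \<in> {0..T}" and x: "x \<in> {0..2*pi}" "y \<in> {0..2*pi}"
  shows "norm (a t x - a t y) \<le> La * \<bar>x - y\<bar>"
proof (rule field_le_epsilon)
  fix e :: real assume e: "0 < e"
  \<comment> \<open>Two changes of time cost \<open>5 * K * \<epsilon>\<close> each; the 1 covers
    \<open>K = 0\<close>.\<close>
  define \<epsilon> where "\<epsilon> = e / (10 * K + 1)"
  have \<epsilon>: "0 < \<epsilon>" "10 * K * \<epsilon> \<le> e" using e K by (auto simp: \<epsilon>_def field_simps)
  obtain s where s: "s \<in> {0..T}" "\<bar>s - t\<bar> < \<epsilon>" "good s"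
    using AE_imp_near[OF T AE_good t \<epsilon>(1)] by blast
  have 1: "norm (a t z - a s z) \<le> 5 * K * \<epsilon>" if "z \<in> {0..2*pi}" for z
  proof -
    have "norm (a t z - a s z) \<le> 5 * K * \<bar>t - s\<bar>" by (rule a_time_lipschitz[OF s(1) t that])
    also have "\<dots> \<le> 5 * K * \<epsilon>" using s(2) K by (intro mult_left_mono) auto
    finally show ?thesis .
  qed
  have "a t x - a t y = (a t x - a s x) + (a s x - a s y) - (a t y - a s y)" by simp
  also have "norm \<dots> \<le> norm (a t x - a s x) + norm (a s x - a s y) + norm (a t y - a s y)"
    by (meson norm_triangle_ineq norm_triangle_ineq4 add_right_mono order_trans)
  also have "\<dots> \<le> 5 * K * \<epsilon> + La * \<bar>x - y\<bar> + 5 * K * \<epsilon>"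
    by (intro add_mono 1 x good_lipschitz[OF s(3)])
  finally show "norm (a t x - a t y) \<le> La * \<bar>x - y\<bar> + e" using \<epsilon>(2) by simp
qed

end

section \<open>The energy estimate\<close>

lemma AE_lebesgue_on_Icc_subset:
  fixes a b c d :: real
  assumes ae: "AE x in lebesgue_on {a..b}. P x" and sub: "a \<le> c" "d \<le> b"
  shows "AE x in lebesgue_on {c..d}. P x"
proof -
  have meas: "{r..s} \<in> sets lebesgue" for r s :: real
    using sets_lebesgue_Icc[of r s] by simp
  have "AE x in lebesgue. x \<in> {a..b} \<longrightarrow> P x"
    using ae AE_restrict_space_iff[of "{a..b}" lebesgue P] meas[of a b] by simp
  then have "AE x in lebesgue. x \<in> {c..d} \<longrightarrow> P x" by eventually_elim (use sub in auto)
  then show ?thesis using AE_restrict_space_iff[of "{c..d}" lebesgue P] meas[of c d] by simp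
qed

lemma bounded_measurable_absolutely_integrable:
  fixes f :: "real \<Rightarrow> 'a::euclidean_space"
  assumes "f \<in> borel_measurable (lebesgue_on {a..b})" "\<And>x. x \<in> {a..b} \<Longrightarrow> norm (f x) \<le> B"
  shows "f absolutely_integrable_on {a..b}"
proof (rule measurable_bounded_by_integrable_imp_absolutely_integrable[OF assms(1) _ integrable_const_ivl[of B]])
  show "{a..b} \<in> sets lebesgue" using sets_lebesgue_Icc[of a b] by simp
qed (rule assms(2))

lemma integral_le_AE:
  fixes f g :: "real \<Rightarrow> real"
  assumes "f absolutely_integrable_on {a..b}" "g absolutely_integrable_on {a..b}" "AE x in lebesgue_on {a..b}. f x \<le> g x"
  shows "integral {a..b} f \<le> integral {a..b} g"
  unfolding LINT_eq_integral[OF assms(1), symmetric] LINT_eq_integral[OF assms(2), symmetric]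
  by (rule integral_mono_AE[OF _ _ assms(3)]) (rule absolutely_integrable_imp_integrable[OF assms(1)] absolutely_integrable_imp_integrable[OF assms(2)];
    use sets_lebesgue_Icc[of a b] in simp)+

locale flow_error = flow_data f lf C1 C2 K \<alpha> T X0 X + flow_mesh f lf C1 C2 K N p \<alpha> H
  for f lf C1 C2 K \<alpha> T X0 X N p H
begin

definition err :: "(nat \<Rightarrow> real \<Rightarrow> real^2) \<Rightarrow> real \<Rightarrow> nat \<Rightarrow> real^2" where
  "err c t i = edge (\<lambda>j. X t (p j)) i - edge (wrap N (\<lambda>j. c j t)) i"

text \<open>The time derivative of the nodal error, in the integrated sense of
  \<open>node_error\<close>; \<open>V\<close> supplies a bounded value at every time.\<close>

definition rate :: "(nat \<Rightarrow> real \<Rightarrow> real^2) \<Rightarrow> real \<Rightarrow> nat \<Rightarrow> real^2" where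
  "rate d t j = V t (p j) - wrap N (\<lambda>j. d j t) j"

definition energy :: "(nat \<Rightarrow> real \<Rightarrow> real^2) \<Rightarrow> real \<Rightarrow> real" where
  "energy c t = (\<Sum>i=1..N. (norm (err c t i))\<^sup>2 / h i)"

definition dissip :: "(nat \<Rightarrow> real \<Rightarrow> real^2) \<Rightarrow> (nat \<Rightarrow> real \<Rightarrow> real^2) \<Rightarrow> real \<Rightarrow> real" where
  "dissip c d t = (let q = edge (wrap N (\<lambda>j. c j t)) in mass_form \<alpha> N h (\<lambda>j. (norm (q j))\<^sup>2) q (rate d t) (rate d t))"

lemma energy_nonneg: "0 \<le> energy c t"
  unfolding energy_def using h_pos by (intro sum_nonneg divide_nonneg_pos) auto

lemma rate_0_N: "t \<in> {0..T} \<Longrightarrow> rate d t 0 = rate d t N"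
  using V_bounds(4) wrap_0_N by (simp add: rate_def)

end

text \<open>The setting of the bootstrap: \<open>edge_bounds\<close> is assumed only up to \<tau>.
  The bounds on the energy derived here are strong enough to return these edge bounds strictly on
  fine meshes.\<close>

locale nodal_error = flow_error f lf C1 C2 K \<alpha> T X0 X N p H
  for f lf C1 C2 K \<alpha> T X0 X N p H +
  fixes \<tau> :: real and c d :: "nat \<Rightarrow> real \<Rightarrow> real^2"
  assumes \<tau>: "0 \<le> \<tau>" "\<tau> \<le> T"
    and nodal: "nodal_solution \<alpha> f \<tau> c d"
    and d_cont: "\<And>j. continuous_on {0..\<tau>} (d j)"
    and init: "\<And>j. j \<in> {1..N} \<Longrightarrow> c j 0 = X0 (p j)"
    and edge_bounds: "\<And>t i. t \<in> {0..\<tau>} \<Longrightarrow> i \<in> {1..N} \<Longrightarrow>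
      C1 / 2 * h i \<le> norm (edge (wrap N (\<lambda>j. c j t)) i) \<and> norm (edge (wrap N (\<lambda>j. c j t)) i) \<le> 2 * C2 * h i"
begin

lemma sub_T: "t \<in> {0..\<tau>} \<Longrightarrow> t \<in> {0..T}" using \<tau> by auto

lemma c_deriv: "t \<in> {0..\<tau>} \<Longrightarrow> j \<in> {1..N} \<Longrightarrow> (c j has_vector_derivative d j t) (at t within {0..\<tau>})"
  using nodal by (auto simp: nodal_solution_def Let_def)

lemma p_mem: "k \<le> N \<Longrightarrow> p k \<in> {0..2*pi}"
  using p_bounds[of k] by simp

lemma rate_measurable: "k \<le> N \<Longrightarrow> (\<lambda>s. rate d s k) \<in> borel_measurable (lebesgue_on {0..\<tau>})"
proof -
  assume k: "k \<le> N"
  have sub: "{0..\<tau>} \<subseteq> {0..T}" using \<tau> by auto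
  have 1: "(\<lambda>s. V s (p k)) \<in> borel_measurable (lebesgue_on {0..\<tau>})"
    by (rule measurable_restrict_mono[OF V_measurable[OF p_mem[OF k]] sub])
  have 2: "d j \<in> borel_measurable (lebesgue_on {0..\<tau>})" for j
    by (rule continuous_imp_measurable_on_sets_lebesgue[OF d_cont])
      (use sets_lebesgue_Icc[of 0 \<tau>] in simp)
  show ?thesis unfolding rate_def wrap_def by (rule borel_measurable_diff[OF 1 2])
qed

lemma rate_bounded: obtains B where "0 \<le> B" "\<And>s k. s \<in> {0..\<tau>} \<Longrightarrow> k \<le> N \<Longrightarrow> norm (rate d s k) \<le> B"
proof -
  have "\<exists>B. \<forall>s\<in>{0..\<tau>}. norm (d j s) \<le> B" for j
  proof -
    have "bounded (d j ` {0..\<tau>})" by (intro compact_imp_bounded compact_continuous_image d_cont) simp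
    then show ?thesis unfolding bounded_iff by auto
  qed
  then obtain B where B: "\<And>j s. s \<in> {0..\<tau>} \<Longrightarrow> norm (d j s) \<le> B j" by metis
  have B0: "0 \<le> B j" for j using order_trans[OF norm_ge_zero B[of 0 j]] \<tau> by simp
  show thesis
  proof (rule that[of "5 * K + (\<Sum>j\<le>N. B j)"])
    show "0 \<le> 5 * K + (\<Sum>j\<le>N. B j)" using K B0 by (intro add_nonneg_nonneg sum_nonneg) auto
    fix s k assume s: "s \<in> {0..\<tau>}" and k: "k \<le> N"
    define j where "j = (if k = 0 then N else k)"
    have "rate d s k = V s (p k) - d j s" by (simp add: rate_def wrap_def j_def)
    also have "norm \<dots> \<le> norm (V s (p k)) + norm (d j s)" by (rule norm_triangle_ineq4)
    also have "\<dots> \<le> 5 * K + B j" by (intro add_mono V_bounds(1)[OF sub_T[OF s] p_mem[OF k]] B s)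
    also have "B j \<le> (\<Sum>j\<le>N. B j)" using k B0 by (intro member_le_sum) (auto simp: j_def)
    finally show "norm (rate d s k) \<le> 5 * K + (\<Sum>j\<le>N. B j)" by simp
  qed
qed

lemma node_error:
  assumes k: "k \<le> N" and t: "t \<in> {0..\<tau>}"
  shows "((\<lambda>s. rate d s k) has_integral (X t (p k) - wrap N (\<lambda>j. c j t) k)) {0..t}"
proof -
  define j where "j = (if k = 0 then N else k)"
  have j: "j \<in> {1..N}" using k N by (auto simp: j_def)
  have A: "(d j has_integral (c j t - c j 0)) {0..t}"
  proof (rule fundamental_theorem_of_calculus)
    show "0 \<le> t" using t by simp
    fix s assume "s \<in> {0..t}"
    then have "s \<in> {0..\<tau>}" "{0..t} \<subseteq> {0..\<tau>}" using t by auto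
    then show "(c j has_vector_derivative d j s) (at s within {0..t})"
      by (meson c_deriv[OF _ j] has_vector_derivative_within_subset)
  qed
  have B: "((\<lambda>s. V s (p k)) has_integral (X t (p k) - X 0 (p k))) {0..t}"
    using integrable_integral[OF V_integrable[OF p_mem[OF k], of 0 t]] X_time[OF p_mem[OF k] sub_T[OF t]] sub_T[OF t]
    by simp
  have "c j 0 = X 0 (p k)"
  proof -
    have "c j 0 = X 0 (p j)" using init[OF j] X_init by simp
    also have "\<dots> = X 0 (p k)" using X_periodic[of 0] T by (simp add: j_def)
    finally show ?thesis .
  qed
  then have "X t (p k) - X 0 (p k) - (c j t - c j 0) = X t (p k) - wrap N (\<lambda>j. c j t) k"
    by (simp add: wrap_def j_def)
  then show ?thesis
    using has_integral_diff[OF B A] by (simp only: rate_def[abs_def] wrap_def j_def)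
qed

lemma err_integral:
  assumes i: "i \<in> {1..N}" and t: "t \<in> {0..\<tau>}"
  shows "((\<lambda>s. edge (rate d s) i) has_integral err c t i) {0..t}"
proof -
  have "i \<le> N" "i - 1 \<le> N" using i by auto
  from has_integral_diff[OF node_error[OF this(1) t] node_error[OF this(2) t]]
  show ?thesis by (simp add: edge_def err_def algebra_simps)
qed

lemma err_0: "i \<in> {1..N} \<Longrightarrow> err c 0 i = 0"
  using integral_unique[OF err_integral[of i 0]] \<tau> by simp

lemma edge_rate_measurable: "i \<in> {1..N} \<Longrightarrow> (\<lambda>s. edge (rate d s) i) \<in> borel_measurable (lebesgue_on {0..\<tau>})"
  unfolding edge_def by (intro borel_measurable_diff rate_measurable) auto

lemma err_continuous: "i \<in> {1..N} \<Longrightarrow> continuous_on {0..\<tau>} (\<lambda>t. err c t i)"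
proof -
  assume i: "i \<in> {1..N}"
  have "continuous_on {0..\<tau>} (\<lambda>t. integral {0..t} (\<lambda>s. edge (rate d s) i))"
    using err_integral[OF i, of \<tau>] \<tau> by (intro indefinite_integral_continuous_1) (auto simp: integrable_on_def)
  then show ?thesis
    by (rule continuous_on_cong[THEN iffD1, rotated 2]) (use integral_unique[OF err_integral[OF i]] in auto)
qed

lemma energy_continuous: "continuous_on {0..\<tau>} (energy c)"
  unfolding energy_def[abs_def] using h_pos by (intro continuous_intros err_continuous) fastforce+

lemma edge_measurable: "i \<in> {1..N} \<Longrightarrow> (\<lambda>s. edge (wrap N (\<lambda>j. c j s)) i) \<in> borel_measurable (lebesgue_on {0..\<tau>})"
  using sets_lebesgue_Icc[of 0 \<tau>]
  by (intro continuous_imp_measurable_on_sets_lebesgue edge_continuous[where d=d] c_deriv) simp_all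

lemma dissip_measurable: "dissip c d \<in> borel_measurable (lebesgue_on {0..\<tau>})"
proof -
  have perp: "(\<lambda>s. perp (edge (wrap N (\<lambda>j. c j s)) i)) \<in> borel_measurable (lebesgue_on {0..\<tau>})" if "i \<in> {1..N}" for i
    using sets_lebesgue_Icc[of 0 \<tau>] that
    by (intro continuous_imp_measurable_on_sets_lebesgue linear_continuous_on_compose[OF _ perp_linear] edge_continuous[where d=d] c_deriv) simp_all
  have rates: "(\<lambda>s. rate d s i) \<in> borel_measurable (lebesgue_on {0..\<tau>})" "(\<lambda>s. rate d s (i - 1)) \<in> borel_measurable (lebesgue_on {0..\<tau>})"
    if "i \<in> {1..N}" for i using that by (auto intro: rate_measurable)
  show ?thesis
    unfolding dissip_def[abs_def] Let_def mass_form_def mass_density_def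
  proof (rule borel_measurable_sum)
    fix i assume i: "i \<in> {1..N}"
    note [measurable] = perp[OF i] rates[OF i] edge_measurable[OF i]
    show "(\<lambda>s. 1 / (6 * h i) *
       (2 * (\<alpha> * (norm (edge (wrap N (\<lambda>j. c j s)) i))\<^sup>2 * (rate d s (i - 1) \<bullet> rate d s (i - 1)) + (1 - \<alpha>) * (rate d s (i - 1) \<bullet> perp (edge (wrap N (\<lambda>j. c j s)) i) * (rate d s (i - 1) \<bullet> perp (edge (wrap N (\<lambda>j. c j s)) i))))
        + (\<alpha> * (norm (edge (wrap N (\<lambda>j. c j s)) i))\<^sup>2 * (rate d s (i - 1) \<bullet> rate d s i) + (1 - \<alpha>) * (rate d s (i - 1) \<bullet> perp (edge (wrap N (\<lambda>j. c j s)) i) * (rate d s i \<bullet> perp (edge (wrap N (\<lambda>j. c j s)) i))))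
        + (\<alpha> * (norm (edge (wrap N (\<lambda>j. c j s)) i))\<^sup>2 * (rate d s i \<bullet> rate d s (i - 1)) + (1 - \<alpha>) * (rate d s i \<bullet> perp (edge (wrap N (\<lambda>j. c j s)) i) * (rate d s (i - 1) \<bullet> perp (edge (wrap N (\<lambda>j. c j s)) i))))
        + 2 * (\<alpha> * (norm (edge (wrap N (\<lambda>j. c j s)) i))\<^sup>2 * (rate d s i \<bullet> rate d s i) + (1 - \<alpha>) * (rate d s i \<bullet> perp (edge (wrap N (\<lambda>j. c j s)) i) * (rate d s i \<bullet> perp (edge (wrap N (\<lambda>j. c j s)) i))))))
      \<in> borel_measurable (lebesgue_on {0..\<tau>})" by measurable
  qed
qed

text \<open>By \<open>element_mass\<close> each summand is the integral of a nonnegative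
  density.\<close>

lemma dissip_nonneg:
  assumes t: "t \<in> {0..\<tau>}"
  shows "0 \<le> dissip c d t"
  unfolding dissip_def Let_def mass_form_def
proof (rule sum_nonneg)
  fix i assume i: "i \<in> {1..N}"
  let ?q = "edge (wrap N (\<lambda>j. c j t)) i"
  have W: "rate d t 0 = rate d t N" by (rule rate_0_N[OF sub_T[OF t]])
  have "0 \<le> mass_density \<alpha> ((norm q)\<^sup>2) q u u" for q u :: "real^2"
    using \<alpha> by (simp add: mass_density_def)
  then show "0 \<le> 1 / (6 * h i) * (2 * mass_density \<alpha> ((norm ?q)\<^sup>2) ?q (rate d t (i-1)) (rate d t (i-1)) + mass_density \<alpha> ((norm ?q)\<^sup>2) ?q (rate d t (i-1)) (rate d t i)
      + mass_density \<alpha> ((norm ?q)\<^sup>2) ?q (rate d t i) (rate d t (i-1)) + 2 * mass_density \<alpha> ((norm ?q)\<^sup>2) ?q (rate d t i) (rate d t i))"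
    by (intro has_integral_nonneg[OF element_mass[OF W W i]])
qed

lemma dissip_integrable: "dissip c d absolutely_integrable_on {0..\<tau>}"
proof -
  obtain B where B: "0 \<le> B" "\<And>s k. s \<in> {0..\<tau>} \<Longrightarrow> k \<le> N \<Longrightarrow> norm (rate d s k) \<le> B" by (rule rate_bounded) blast
  show ?thesis
  proof (rule bounded_measurable_absolutely_integrable[OF dissip_measurable])
    fix s assume s: "s \<in> {0..\<tau>}"
    show "norm (dissip c d s) \<le> (\<Sum>i=1..N. 1 / (6 * h i) * (6 * ((2 * C2 * h i)\<^sup>2 * B * B)))"
      unfolding dissip_def Let_def mass_form_def real_norm_def
    proof (rule order_trans[OF sum_abs sum_mono])
      fix i assume i: "i \<in> {1..N}"
      let ?q = "edge (wrap N (\<lambda>j. c j s)) i"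
      let ?m = "mass_density \<alpha> ((norm ?q)\<^sup>2) ?q"
      have m: "\<bar>?m (rate d s k) (rate d s l)\<bar> \<le> (2 * C2 * h i)\<^sup>2 * B * B" if "k \<le> N" "l \<le> N" for k l
      proof -
        have "\<bar>?m (rate d s k) (rate d s l)\<bar> \<le> (norm ?q)\<^sup>2 * norm (rate d s k) * norm (rate d s l)"
          using \<alpha> by (intro mass_density_le) auto
        also have "\<dots> \<le> (2 * C2 * h i)\<^sup>2 * B * B"
          using edge_bounds[OF s i] B that s by (intro mult_mono power_mono mult_nonneg_nonneg) auto
        finally show ?thesis .
      qed
      have "i \<le> N" "i - 1 \<le> N" using i by auto
      then have "\<bar>2 * ?m (rate d s (i-1)) (rate d s (i-1)) + ?m (rate d s (i-1)) (rate d s i) + ?m (rate d s i) (rate d s (i-1)) + 2 * ?m (rate d s i) (rate d s i)\<bar>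
        \<le> 6 * ((2 * C2 * h i)\<^sup>2 * B * B)"
        using m[of "i-1" "i-1"] m[of "i-1" i] m[of i "i-1"] m[of i i] by linarith
      then show "\<bar>1 / (6 * h i) * (2 * ?m (rate d s (i-1)) (rate d s (i-1)) + ?m (rate d s (i-1)) (rate d s i) + ?m (rate d s i) (rate d s (i-1)) + 2 * ?m (rate d s i) (rate d s i))\<bar>
        \<le> 1 / (6 * h i) * (6 * ((2 * C2 * h i)\<^sup>2 * B * B))"
        using h_pos[OF i] unfolding abs_mult by (intro mult_mono) auto
    qed
  qed
qed

lemma err_inner_rate_integrable: "i \<in> {1..N} \<Longrightarrow> (\<lambda>s. err c s i \<bullet> edge (rate d s) i) absolutely_integrable_on {0..\<tau>}"
proof -
  assume i: "i \<in> {1..N}"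
  obtain B where B: "0 \<le> B" "\<And>s k. s \<in> {0..\<tau>} \<Longrightarrow> k \<le> N \<Longrightarrow> norm (rate d s k) \<le> B" by (rule rate_bounded) blast
  have "bounded ((\<lambda>t. err c t i) ` {0..\<tau>})"
    by (intro compact_imp_bounded compact_continuous_image err_continuous i) simp
  then obtain M where M: "\<And>s. s \<in> {0..\<tau>} \<Longrightarrow> norm (err c s i) \<le> M" unfolding bounded_iff by blast
  have "(\<lambda>s. err c s i) \<in> borel_measurable (lebesgue_on {0..\<tau>})"
    using sets_lebesgue_Icc[of 0 \<tau>]
    by (intro continuous_imp_measurable_on_sets_lebesgue err_continuous i) simp
  from borel_measurable_inner[OF this edge_rate_measurable[OF i]] show ?thesis
  proof (rule bounded_measurable_absolutely_integrable)
    fix s assume s: "s \<in> {0..\<tau>}"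
    have "i \<le> N" "i - 1 \<le> N" using i by auto
    then have "norm (edge (rate d s) i) \<le> B + B"
      unfolding edge_def by (intro order_trans[OF norm_triangle_ineq4] add_mono B s)
    then have "norm (err c s i) * norm (edge (rate d s) i) \<le> M * (B + B)"
      using M[OF s] order_trans[OF norm_ge_zero M[OF s]] by (intro mult_mono) auto
    then show "norm (err c s i \<bullet> edge (rate d s) i) \<le> M * (B + B)"
      using Cauchy_Schwarz_ineq2[of "err c s i" "edge (rate d s) i"] by simp
  qed
qed

definition energy_rate :: "real \<Rightarrow> real" where
  "energy_rate s = (\<Sum>i=1..N. 2 * ((err c s i \<bullet> edge (rate d s) i) / h i))"

text \<open>The errors have bounded measurable rates and start at 0 because the scheme starts from
  the interpolant, so \<open>integral_product_rule\<close> gives their squares as integrals; a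
  derivative at every time need not exist.\<close>

lemma energy_rate_has_integral:
  assumes t: "t \<in> {0..\<tau>}"
  shows "(energy_rate has_integral energy c t) {0..t}"
  unfolding energy_rate_def[abs_def] energy_def
proof (rule has_integral_sum)
  fix i assume i: "i \<in> {1..N}"
  obtain B where B: "0 \<le> B" "\<And>s k. s \<in> {0..\<tau>} \<Longrightarrow> k \<le> N \<Longrightarrow> norm (rate d s k) \<le> B" by (rule rate_bounded) blast
  have sub: "{0..t} \<subseteq> {0..\<tau>}" using t by auto
  have meas: "(\<lambda>s. edge (rate d s) i) \<in> borel_measurable (lebesgue_on {0..t})"
    by (rule measurable_restrict_mono[OF edge_rate_measurable[OF i] sub])
  have bound: "norm (edge (rate d s) i) \<le> B + B" if "s \<in> {0..t}" for s
  proof -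
    have "i \<le> N" "i - 1 \<le> N" "s \<in> {0..\<tau>}" using i that sub by auto
    then show ?thesis unfolding edge_def by (intro order_trans[OF norm_triangle_ineq4] add_mono B)
  qed
  have prim: "err c s i = err c 0 i + integral {0..s} (\<lambda>s. edge (rate d s) i)" if "s \<in> {0..t}" for s
    using integral_unique[OF err_integral[OF i, of s]] that sub err_0[OF i] by auto
  have "((\<lambda>s. edge (rate d s) i \<bullet> err c s i + err c s i \<bullet> edge (rate d s) i) has_integral (err c t i \<bullet> err c t i - err c 0 i \<bullet> err c 0 i)) {0..t}"
    using t
    by (intro integral_product_rule[OF bounded_bilinear_inner _ bounded_measurable_absolutely_integrable[OF meas bound] meas bound prim prim]) auto
  from has_integral_divide[OF this, of "h i"]
  show "((\<lambda>s. 2 * ((err c s i \<bullet> edge (rate d s) i) / h i)) has_integral (norm (err c t i))\<^sup>2 / h i) {0..t}"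
    by (simp add: err_0[OF i] power2_norm_eq_inner inner_commute add_divide_distrib)
qed simp

text \<open>Twice \<open>spatial_estimate\<close>, the factor 2 stemming from the derivative of a
  square. It holds at good times, hence almost everywhere, which is enough after
  integration.\<close>

lemma energy_rate_dissip_le:
  assumes s: "s \<in> {0..\<tau>}" and g: "good s"
  shows "energy_rate s + dissip c d s \<le> 2 * \<kappa> / \<alpha> * (H\<^sup>2 + energy c s)"
proof -
  let ?c = "wrap N (\<lambda>j. c j s)" and ?d = "wrap N (\<lambda>j. d j s)"
  note sT = sub_T[OF s]
  have scheme: "mass_form \<alpha> N h (\<lambda>j. (norm (edge ?c j))\<^sup>2) (edge ?c) ?d v
      + load_form N h (edge ?c) (f (\<Sum>j=1..N. norm (edge ?c j))) v = 0" if v: "v 0 = v N" for v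
  proof -
    have "mass_form \<alpha> N h (\<lambda>j. (norm (edge ?c j))\<^sup>2) (edge ?c) ?d (wrap N v)
      + load_form N h (edge ?c) (f (\<Sum>j=1..N. norm (edge ?c j))) (wrap N v) = 0"
      using nodal s unfolding nodal_solution_def Let_def by blast
    moreover have "wrap N v = v" using v by (auto simp: wrap_def)
    ultimately show ?thesis by simp
  qed
  have Xn: "edge (\<lambda>j. X s (p j)) i = integral {p (i-1)..p i} (a s)" if i: "i \<in> {1..N}" for i
  proof -
    have "i \<le> N" "i - 1 \<le> N" using i by auto
    then show ?thesis unfolding edge_def using p_bounds p_mono[of "i-1" i] by (intro a_int[OF sT]) auto
  qed
  have rhs: "a s y - a s x = integral {x..y} (\<lambda>x. flow_rhs \<alpha> (f (perimeter (X s))) (a s x) (V s x))"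
    if "0 \<le> x" "x \<le> y" "y \<le> 2*pi" for x y
    using g that unfolding good_def by blast
  have "(\<Sum>i=1..N. ((edge (\<lambda>j. X s (p j)) i - edge ?c i) \<bullet> edge (\<lambda>j. V s (p j) - ?d j) i) / h i)
      + 1/2 * mass_form \<alpha> N h (\<lambda>j. (norm (edge ?c j))\<^sup>2) (edge ?c) (\<lambda>j. V s (p j) - ?d j) (\<lambda>j. V s (p j) - ?d j)
     \<le> \<kappa> / \<alpha> * (H\<^sup>2 + (\<Sum>i=1..N. (norm (edge (\<lambda>j. X s (p j)) i - edge ?c i))\<^sup>2 / h i))"
    by (rule spatial_estimate[OF a_cont[OF sT] a_per[OF sT] a_le[OF sT] a_lipschitz[OF sT] V_bounds(3,4,1,2)[OF sT] rhs
      perimeter_eq[OF sT] Xn edge_bounds[OF s] wrap_0_N scheme])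
  then have "(\<Sum>i=1..N. (err c s i \<bullet> edge (rate d s) i) / h i) + 1/2 * dissip c d s \<le> \<kappa> / \<alpha> * (H\<^sup>2 + energy c s)"
    unfolding err_def rate_def[abs_def] dissip_def energy_def Let_def .
  then show ?thesis unfolding energy_rate_def sum_distrib_left[symmetric] by simp
qed

lemma energy_dissip_le:
  assumes t: "t \<in> {0..\<tau>}"
  shows "energy c t + integral {0..t} (dissip c d) \<le> 2 * \<kappa> / \<alpha> * H\<^sup>2 * T + 2 * \<kappa> / \<alpha> * integral {0..t} (energy c)"
proof -
  have sub: "{0..t} \<subseteq> {0..\<tau>}" using t by auto
  have D: "dissip c d absolutely_integrable_on {0..t}"
    by (rule absolutely_integrable_on_subinterval[OF dissip_integrable sub])
  have P: "energy_rate absolutely_integrable_on {0..t}"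
    unfolding energy_rate_def[abs_def]
  proof (rule absolutely_integrable_sum)
    fix i assume i: "i \<in> {1..N}"
    have "(\<lambda>s. (2 / h i) *\<^sub>R (err c s i \<bullet> edge (rate d s) i)) absolutely_integrable_on {0..t}"
      by (intro absolutely_integrable_scaleR_left absolutely_integrable_on_subinterval[OF err_inner_rate_integrable[OF i] sub])
    then show "(\<lambda>s. 2 * ((err c s i \<bullet> edge (rate d s) i) / h i)) absolutely_integrable_on {0..t}" by simp
  qed simp
  have Ec: "continuous_on {0..t} (energy c)" by (rule continuous_on_subset[OF energy_continuous sub])
  have G: "(\<lambda>s. 2 * \<kappa> / \<alpha> * (H\<^sup>2 + energy c s)) absolutely_integrable_on {0..t}"
    by (intro absolutely_integrable_continuous_real continuous_intros Ec)
  have Dh: "dissip c d integrable_on {0..t}" using D by (simp add: absolutely_integrable_on_def)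
  have Eh: "energy c integrable_on {0..t}" by (rule integrable_continuous_real[OF Ec])
  have "energy c t + integral {0..t} (dissip c d) = integral {0..t} (\<lambda>s. energy_rate s + dissip c d s)"
    using has_integral_add[OF energy_rate_has_integral[OF t] integrable_integral[OF Dh]] by (simp add: integral_unique)
  also have "\<dots> \<le> integral {0..t} (\<lambda>s. 2 * \<kappa> / \<alpha> * (H\<^sup>2 + energy c s))"
  proof (rule integral_le_AE[OF set_integral_add(1)[OF P D] G])
    have "AE s in lebesgue_on {0..t}. good s"
      by (rule AE_lebesgue_on_Icc_subset[OF AE_good]) (use sub_T[OF t] in auto)
    then show "AE s in lebesgue_on {0..t}. energy_rate s + dissip c d s \<le> 2 * \<kappa> / \<alpha> * (H\<^sup>2 + energy c s)"
      using AE_space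
    proof eventually_elim
      case (elim s)
      then have "s \<in> {0..\<tau>}" using sub by auto
      then show ?case using elim(1) by (rule energy_rate_dissip_le)
    qed
  qed
  also have "\<dots> = 2 * \<kappa> / \<alpha> * (H\<^sup>2 * t + integral {0..t} (energy c))"
    using t Henstock_Kurzweil_Integration.integral_add[OF integrable_const_ivl[of "H\<^sup>2" 0 t] Eh] by simp
  also have "\<dots> \<le> 2 * \<kappa> / \<alpha> * (H\<^sup>2 * T + integral {0..t} (energy c))"
    using t \<tau> \<kappa> \<alpha> by (intro mult_left_mono add_right_mono) auto
  finally show ?thesis by (simp add: distrib_left)
qed

text \<open>\<open>gronwall\<close> with rate \<open>2 * \<kappa> / \<alpha>\<close> after dropping
  the nonnegative dissipation.\<close>

lemma energy_bound:
  assumes t: "t \<in> {0..\<tau>}"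
  shows "energy c t \<le> 4 * (\<kappa> * T / \<alpha>) * exp (4 * (\<kappa> * T / \<alpha>)) * H\<^sup>2"
proof -
  have "energy c t \<le> 2 * (2 * \<kappa> / \<alpha> * H\<^sup>2 * T) * exp (2 * (2 * \<kappa> / \<alpha>) * t)"
  proof (rule gronwall[OF energy_continuous \<tau>(1) _ energy_nonneg _ t])
    show "0 < 2 * \<kappa> / \<alpha>" using \<kappa> \<alpha> by simp
    fix t assume t: "t \<in> {0..\<tau>}"
    have "0 \<le> integral {0..t} (dissip c d)"
      using t by (intro Henstock_Kurzweil_Integration.integral_nonneg dissip_nonneg)
        (auto simp: absolutely_integrable_on_def intro: absolutely_integrable_on_subinterval[OF dissip_integrable, THEN set_lebesgue_integral_eq_integral(1)])
    then show "energy c t \<le> 2 * \<kappa> / \<alpha> * H\<^sup>2 * T + 2 * \<kappa> / \<alpha> * integral {0..t} (energy c)"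
      using energy_dissip_le[OF t] by linarith
  qed
  also have "\<dots> \<le> 2 * (2 * \<kappa> / \<alpha> * H\<^sup>2 * T) * exp (2 * (2 * \<kappa> / \<alpha>) * T)"
  proof -
    have "2 * (2 * \<kappa> / \<alpha>) * t \<le> 2 * (2 * \<kappa> / \<alpha>) * T" using t \<tau> \<kappa> \<alpha> by (intro mult_left_mono) auto
    then have "exp (2 * (2 * \<kappa> / \<alpha>) * t) \<le> exp (2 * (2 * \<kappa> / \<alpha>) * T)" by (rule exp_le_cancel_iff[THEN iffD2])
    then show ?thesis using \<kappa> \<alpha> T by (intro mult_left_mono) auto
  qed
  finally show ?thesis by (simp add: mult_ac)
qed

text \<open>The energy is dropped this time, and \<open>energy_bound\<close> is inserted on the
  right.\<close>

lemma dissip_bound: "integral {0..\<tau>} (dissip c d) \<le> exp (12 * (\<kappa> * T / \<alpha>)) * H\<^sup>2"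
proof -
  define z where "z = \<kappa> * T / \<alpha>"
  have z: "0 \<le> z" using \<kappa> \<alpha> T by (simp add: z_def)
  have \<tau>': "\<tau> \<in> {0..\<tau>}" using \<tau> by simp
  have "integral {0..\<tau>} (energy c) \<le> integral {0..\<tau>} (\<lambda>t. 4 * z * exp (4 * z) * H\<^sup>2)"
    using energy_bound energy_continuous unfolding z_def by (intro integral_le integrable_continuous_real) auto
  also have "\<dots> = 4 * z * exp (4 * z) * H\<^sup>2 * \<tau>" using \<tau> by simp
  also have "\<dots> \<le> 4 * z * exp (4 * z) * H\<^sup>2 * T" using \<tau> z by (intro mult_left_mono) auto
  finally have 1: "integral {0..\<tau>} (energy c) \<le> 4 * z * exp (4 * z) * H\<^sup>2 * T" .
  have "integral {0..\<tau>} (dissip c d) \<le> 2 * \<kappa> / \<alpha> * H\<^sup>2 * T + 2 * \<kappa> / \<alpha> * integral {0..\<tau>} (energy c)"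
    using energy_dissip_le[OF \<tau>'] energy_nonneg[of c \<tau>] by linarith
  also have "\<dots> \<le> 2 * \<kappa> / \<alpha> * H\<^sup>2 * T + 2 * \<kappa> / \<alpha> * (4 * z * exp (4 * z) * H\<^sup>2 * T)"
    using 1 \<kappa> \<alpha> by (intro add_left_mono mult_left_mono) auto
  also have "\<dots> = 2 * z * (1 + (4 * z) * exp (4 * z)) * H\<^sup>2" by (simp add: z_def algebra_simps)
  \<comment> \<open>Each of the two linear factors in \<open>z\<close> is absorbed by
    \<open>4 * z \<le> exp (4 * z)\<close>; with the exponential of Gronwall this makes three
    factors \<open>exp (4 * z)\<close>.\<close>
  also have "\<dots> \<le> exp (12 * z) * H\<^sup>2"
  proof (rule mult_right_mono)
    have e: "4 * z \<le> exp (4 * z)" using exp_ge_add_one_self[of "4 * z"] by linarith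
    have "(4 * z) * exp (4 * z) \<le> exp (4 * z) * exp (4 * z)" using e by (intro mult_right_mono) auto
    also have "\<dots> = exp (8 * z)" by (simp add: exp_add[symmetric])
    finally have "1 + (4 * z) * exp (4 * z) \<le> 2 * exp (8 * z)" using z one_le_exp_iff[of "8 * z"] by linarith
    then have "2 * z * (1 + (4 * z) * exp (4 * z)) \<le> 2 * z * (2 * exp (8 * z))" using z by (intro mult_left_mono) auto
    also have "\<dots> = 4 * z * exp (8 * z)" by simp
    also have "\<dots> \<le> exp (4 * z) * exp (8 * z)" using e by (intro mult_right_mono) auto
    also have "\<dots> = exp (12 * z)" by (simp add: exp_add[symmetric])
    finally show "2 * z * (1 + (4 * z) * exp (4 * z)) \<le> exp (12 * z)" .
  qed simp
  finally show ?thesis by (simp add: z_def)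
qed

end

section \<open>Existence by continuation\<close>

context flow_error begin

lemma element_interior:
  assumes i: "i \<in> {1..N}" and x: "p (i-1) < x" "x < p i"
  shows "0 < x" "x < 2*pi"
proof -
  have "i \<le> N" "i - 1 \<le> N" using i by auto
  then show "0 < x" "x < 2*pi" using p_bounds[of i] p_bounds[of "i-1"] x by linarith+
qed

lemma element_subset: "i \<in> {1..N} \<Longrightarrow> {p (i-1)..p i} \<subseteq> {0..2*pi}"
  using p_bounds[of i] p_bounds[of "i-1"] by (auto simp: le_diff_conv)

lemma exact_edge_eq: "t \<in> {0..T} \<Longrightarrow> i \<in> {1..N} \<Longrightarrow> edge (\<lambda>j. X t (p j)) i = integral {p (i-1)..p i} (a t)"
proof -
  assume t: "t \<in> {0..T}" and i: "i \<in> {1..N}"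
  have "i \<le> N" "i - 1 \<le> N" using i by auto
  then show ?thesis unfolding edge_def using p_bounds p_mono[of "i-1" i] by (intro a_int[OF t]) auto
qed

text \<open>At an interior point the tangent has length at least \<open>C1\<close>, and the mean
  slope differs from it by at most \<open>C1 / 4\<close>.\<close>

lemma exact_edge_bounds:
  assumes t: "t \<in> {0..T}" and i: "i \<in> {1..N}" and small: "La * H \<le> C1 / 4"
  shows "3/4 * C1 * h i \<le> norm (edge (\<lambda>j. X t (p j)) i)" "norm (edge (\<lambda>j. X t (p j)) i) \<le> C2 * h i"
proof -
  let ?Q = "integral {p (i-1)..p i} (a t)"
  have hi: "0 < h i" "h i = p i - p (i-1)" using h_pos[OF i] by (auto simp: h_def)
  define x where "x = (p (i-1) + p i) / 2"
  have x: "p (i-1) < x" "x < p i" using hi by (auto simp: x_def)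
  have x': "0 < x" "x < 2*pi" by (rule element_interior[OF i x])+
  have "C1 \<le> norm (a t x)" using dxi_bounds[OF t, of x] by (simp only: a_dxi[OF t x'])
  moreover have "norm (a t x - (1 / h i) *\<^sub>R ?Q) \<le> La * H"
    by (rule mean_value_error[OF a_lipschitz[OF t] La a_cont[OF t] H i]) (use x in auto)
  moreover have "norm (a t x) \<le> norm (a t x - (1 / h i) *\<^sub>R ?Q) + norm ((1 / h i) *\<^sub>R ?Q)"
    using norm_triangle_ineq[of "a t x - (1 / h i) *\<^sub>R ?Q" "(1 / h i) *\<^sub>R ?Q"] by simp
  moreover have "norm ((1 / h i) *\<^sub>R ?Q) = norm ?Q / h i" using hi by simp
  ultimately have "3/4 * C1 \<le> norm ?Q / h i" using small by linarith
  then show "3/4 * C1 * h i \<le> norm (edge (\<lambda>j. X t (p j)) i)"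
    unfolding exact_edge_eq[OF t i] by (simp only: pos_le_divide_eq[OF hi(1)])
  have "norm ?Q \<le> integral {p (i-1)..p i} (\<lambda>_. C2)"
    by (intro integral_norm_bound_integral integrable_continuous_real continuous_on_subset[OF a_cont[OF t]] element_subset i continuous_on_const)
      (use a_le[OF t] element_subset[OF i] in auto)
  also have "\<dots> = C2 * h i" using hi by simp
  finally show "norm (edge (\<lambda>j. X t (p j)) i) \<le> C2 * h i" unfolding exact_edge_eq[OF t i] .
qed

text \<open>A single term of the energy gives \<open>norm (err c t i) \<le> C1 / 4 * h i\<close>;
  quasi-uniformity is what turns the bound in terms of \<open>H\<close> into one in terms of
  \<open>h i\<close>. The lower bound is then \<open>3/4 - 1/4 = 1/2\<close> of
  \<open>C1 * h i\<close>.\<close>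

lemma edge_bounds_of_energy:
  assumes t: "t \<in> {0..T}" and i: "i \<in> {1..N}" and small: "La * H \<le> C1 / 4"
    and cp: "cp * H \<le> h i" and E: "energy c t \<le> cp * H * C1\<^sup>2 / 16"
  shows "C1 / 2 * h i \<le> norm (edge (wrap N (\<lambda>j. c j t)) i) \<and> norm (edge (wrap N (\<lambda>j. c j t)) i) \<le> 2 * C2 * h i"
proof -
  have hi: "0 < h i" by (rule h_pos[OF i])
  have "(norm (err c t i))\<^sup>2 / h i \<le> energy c t"
    unfolding energy_def by (rule member_le_sum[OF i]) (use h_pos in \<open>auto intro!: divide_nonneg_pos\<close>)
  also have "\<dots> \<le> cp * H * (C1\<^sup>2 / 16)" using E by simp
  also have "\<dots> \<le> h i * (C1\<^sup>2 / 16)" by (intro mult_right_mono cp) simp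
  finally have "(norm (err c t i))\<^sup>2 \<le> h i * (C1\<^sup>2 / 16) * h i" by (simp only: pos_divide_le_eq[OF hi])
  also have "\<dots> = (C1 / 4 * h i)\<^sup>2" by (simp add: power2_eq_square)
  finally have "norm (err c t i) \<le> C1 / 4 * h i" by (rule power2_le_imp_le) (use hi C1 in simp)
  moreover have "norm (edge (\<lambda>j. X t (p j)) i) \<le> norm (err c t i) + norm (edge (wrap N (\<lambda>j. c j t)) i)"
    using norm_triangle_ineq[of "err c t i" "edge (wrap N (\<lambda>j. c j t)) i"] by (simp add: err_def)
  moreover have "norm (edge (wrap N (\<lambda>j. c j t)) i) \<le> norm (edge (\<lambda>j. X t (p j)) i) + norm (err c t i)"
    using norm_triangle_ineq4[of "edge (\<lambda>j. X t (p j)) i" "err c t i"] by (simp add: err_def)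
  moreover have "C1 * h i \<le> C2 * h i" using C12 hi by (intro mult_right_mono) auto
  moreover have "0 \<le> C1 * h i" using C1 hi by simp
  ultimately show ?thesis using exact_edge_bounds[OF t i small] by simp
qed

lemma X_time_continuous: "continuous_on {0..T} (\<lambda>t. X t x)"
proof -
  have "continuous_on {0..T} (\<lambda>t. (\<lambda>(t, \<xi>). X t \<xi>) (t, x))"
    by (rule continuous_on_compose2[OF X_cont]) (auto intro!: continuous_on_Pair continuous_on_const continuous_on_id)
  then show ?thesis by simp
qed

lemma nodal_error_exists:
  assumes cp: "0 < cp" "\<And>i. i \<in> {1..N} \<Longrightarrow> cp * H \<le> h i" and small: "La * H \<le> C1 / 4"
    and energy_small: "4 * (\<kappa> * T / \<alpha>) * exp (4 * (\<kappa> * T / \<alpha>)) * H\<^sup>2 < cp * H * C1\<^sup>2 / 16"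
  obtains c d where "nodal_error f lf C1 C2 K \<alpha> T X0 X N p H T c d"
proof -
  define \<mu> R \<epsilon> where "\<mu> = C1 / 2 * (cp * H)" and "R = 2 * C2 * H" and "\<epsilon> = cp * H * C1\<^sup>2 / 16"
  have \<epsilon>: "0 < \<epsilon>" using cp H_pos C1 by (simp add: \<epsilon>_def)
  have one: "(1::nat) \<in> {1..N}" using N by simp
  have "\<mu> \<le> R"
  proof -
    have "\<mu> \<le> C1 / 2 * H" unfolding \<mu>_def using order_trans[OF cp(2)[OF one] H[OF one]] C1 by (intro mult_left_mono) auto
    also have "\<dots> \<le> R" unfolding R_def using C1 C12 H_pos by (intro mult_right_mono) auto
    finally show ?thesis .
  qed
  then have fem: "fem_ode \<alpha> N h \<mu> R f"
    using \<alpha> N h_pos lip_f cp H_pos C1 by unfold_locales (auto simp: \<mu>_def)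
  interpret fem_ode \<alpha> N h \<mu> R f by (rule fem)
  obtain c d where sol: "clipped_solution T c d" and init: "\<And>j. j \<in> {1..N} \<Longrightarrow> c j 0 = X0 (p j)"
    and d: "\<And>j. continuous_on {0..T} (d j)"
    using clipped_solution_exists[of T "\<lambda>j. X0 (p j)"] T by (metis less_imp_le)
  have der: "(c j has_vector_derivative d j t) (at t within {0..T})" if "t \<in> {0..T}" "j \<in> {1..N}" for t j
    using sol that by (auto simp: clipped_solution_def)
  \<comment> \<open>Shown directly for the clipped solution, because
    \<open>energy_continuous\<close> is available only once the edge bounds hold.\<close>
  have cont: "continuous_on {0..T} (energy c)"
    unfolding energy_def[abs_def] err_def edge_def[of "\<lambda>j. X _ (p j)"]
    using h_pos by (intro continuous_intros X_time_continuous edge_continuous[where d=d] der) (fastforce+)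
  have e0: "energy c 0 = 0"
  proof -
    have "err c 0 i = 0" if i: "i \<in> {1..N}" for i
    proof -
      have "wrap N (\<lambda>j. c j 0) k = X 0 (p k)" if "k \<le> N" for k
      proof -
        have "wrap N (\<lambda>j. c j 0) k = X 0 (p (if k = 0 then N else k))"
          unfolding wrap_def X_init by (rule init) (use that N in auto)
        also have "\<dots> = X 0 (p k)" using X_periodic[of 0] T by simp
        finally show ?thesis .
      qed
      moreover have "i \<le> N" "i - 1 \<le> N" using i by auto
      ultimately show ?thesis by (simp only: err_def edge_def) simp
    qed
    then show ?thesis unfolding energy_def by (intro sum.neutral) simp
  qed
  \<comment> \<open>While the energy stays below the threshold, the edge bounds hold, so the
    clipping is inactive and the clipped solution solves the scheme.\<close>
  have step: "nodal_error f lf C1 C2 K \<alpha> T X0 X N p H \<tau> c d"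
    if \<tau>: "\<tau> \<in> {0..T}" and E: "\<And>s. s \<in> {0..\<tau>} \<Longrightarrow> energy c s \<le> \<epsilon>" for \<tau>
  proof -
    have bounds: "C1 / 2 * h i \<le> norm (edge (wrap N (\<lambda>j. c j t)) i) \<and> norm (edge (wrap N (\<lambda>j. c j t)) i) \<le> 2 * C2 * h i"
      if "t \<in> {0..\<tau>}" "i \<in> {1..N}" for t i
      by (rule edge_bounds_of_energy[OF _ that(2) small cp(2)[OF that(2)] E[OF that(1), unfolded \<epsilon>_def]]) (use that \<tau> in auto)
    have "nodal_solution \<alpha> f \<tau> c d"
    proof (rule clipped_imp_nodal[OF fem sol])
      fix t j assume t: "t \<in> {0..\<tau>}" and j: "j \<in> {1..N}"
      have "\<mu> \<le> C1 / 2 * h j" unfolding \<mu>_def using cp(2)[OF j] C1 by (intro mult_left_mono) auto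
      moreover have "2 * C2 * h j \<le> R" unfolding R_def using H[OF j] C2 by (intro mult_left_mono) auto
      ultimately show "\<mu> \<le> norm (edge (wrap N (\<lambda>j. c j t)) j) \<and> norm (edge (wrap N (\<lambda>j. c j t)) j) \<le> R"
        using bounds[OF t j] by linarith
    qed (use \<tau> in auto)
    moreover have "continuous_on {0..\<tau>} (d j)" for j by (rule continuous_on_subset[OF d]) (use \<tau> in auto)
    ultimately show ?thesis
      using \<tau> init bounds by (intro nodal_error.intro flow_error_axioms nodal_error_axioms.intro) auto
  qed
  have small': "energy c t < \<epsilon>" if t: "t \<in> {0..T}" for t
  proof (rule continuation[OF cont _ _ _ t])
    fix \<tau> assume \<tau>: "\<tau> \<in> {0..T}" and E: "\<And>s. s \<in> {0..\<tau>} \<Longrightarrow> energy c s \<le> \<epsilon>"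
    interpret nodal_error f lf C1 C2 K \<alpha> T X0 X N p H \<tau> c d by (rule step[OF \<tau> E])
    have "energy c \<tau> \<le> 4 * (\<kappa> * T / \<alpha>) * exp (4 * (\<kappa> * T / \<alpha>)) * H\<^sup>2" by (rule energy_bound) (use \<tau> in simp)
    then show "energy c \<tau> < \<epsilon>" using energy_small unfolding \<epsilon>_def by linarith
  qed (use T \<epsilon> e0 in auto)
  have "nodal_error f lf C1 C2 K \<alpha> T X0 X N p H T c d"
    by (rule step) (use T small' in \<open>auto intro: less_imp_le\<close>)
  then show thesis by (rule that)
qed

end

section \<open>Error norms\<close>

text \<open>Functions defined only on one closed period, such as a derivative with arbitrary values
  at the nodes, become admissible in \<open>L2_fun\<close> after changing the value at
  \<open>2*pi\<close>.\<close>

lemma L2_fun_periodize: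
  fixes g :: "real \<Rightarrow> 'a::euclidean_space"
  assumes g: "g absolutely_integrable_on {0..2*pi}" and g2: "(\<lambda>x. (norm (g x))\<^sup>2) absolutely_integrable_on {0..2*pi}"
  shows "L2_fun (periodize g)" "periodize g absolutely_integrable_on {0..2*pi}"
    "\<And>r s. 0 \<le> r \<Longrightarrow> s \<le> 2*pi \<Longrightarrow> integral {r..s} (periodize g) = integral {r..s} g"
    "integral {0..2*pi} (\<lambda>x. (norm (periodize g x))\<^sup>2) = integral {0..2*pi} (\<lambda>x. (norm (g x))\<^sup>2)"
proof -
  have eq: "periodize g x = g x" if "0 \<le> x" "x \<le> 2*pi" "x \<noteq> 2*pi" for x
    using that by (intro periodize_eq_0) auto
  have circ: "{0..2*pi::real} \<in> sets lebesgue" using sets_lebesgue_Icc[of 0 "2*pi::real"] by simp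
  show ai: "periodize g absolutely_integrable_on {0..2*pi}"
    by (rule absolutely_integrable_spike[OF g, where S="{2*pi}"]) (auto simp: eq)
  have ai2: "(\<lambda>x. (norm (periodize g x))\<^sup>2) absolutely_integrable_on {0..2*pi}"
    by (rule absolutely_integrable_spike[OF g2, where S="{2*pi}"]) (auto simp: eq)
  show "integral {r..s} (periodize g) = integral {r..s} g" if "0 \<le> r" "s \<le> 2*pi" for r s
    by (rule integral_spike[where S="{2*pi}"]) (use that in \<open>auto simp: eq\<close>)
  show "integral {0..2*pi} (\<lambda>x. (norm (periodize g x))\<^sup>2) = integral {0..2*pi} (\<lambda>x. (norm (g x))\<^sup>2)"
    by (rule integral_spike[where S="{2*pi}"]) (auto simp: eq)
  have "integrable circle (periodize g)" using ai circ by (rule absolutely_integrable_imp_integrable)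
  moreover have "integrable circle (\<lambda>x. (norm (periodize g x))\<^sup>2)" using ai2 circ by (rule absolutely_integrable_imp_integrable)
  ultimately show "L2_fun (periodize g)"
    unfolding L2_fun_def by (intro conjI periodic_periodize borel_measurable_integrable)
qed

text \<open>The seminorm is defined through a chosen weak derivative; the periodized
  \<open>g\<close> is another one by \<open>has_weak_derivI\<close>, and the two agree a.e.\<close>

lemma H1_seminorm_eq:
  fixes v g :: "real \<Rightarrow> 'a::euclidean_space"
  assumes per: "periodic v" and cont: "continuous_on {0..2*pi} v"
    and g: "g absolutely_integrable_on {0..2*pi}" "(\<lambda>x. (norm (g x))\<^sup>2) absolutely_integrable_on {0..2*pi}"
    and v: "\<And>x. x \<in> {0..2*pi} \<Longrightarrow> v x = v 0 + integral {0..x} g"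
  shows "(H1_seminorm v)\<^sup>2 = integral {0..2*pi} (\<lambda>x. (norm (g x))\<^sup>2)"
proof -
  note P = L2_fun_periodize[OF g]
  have circ: "{0..2*pi::real} \<in> sets lebesgue" using sets_lebesgue_Icc[of 0 "2*pi::real"] by simp
  have "(\<lambda>x. (norm (v x))\<^sup>2) absolutely_integrable_on {0..2*pi}"
    by (intro absolutely_integrable_continuous_real continuous_intros cont)
  then have "integrable circle (\<lambda>x. (norm (v x))\<^sup>2)" using circ by (rule absolutely_integrable_imp_integrable)
  then have v2: "L2_fun v"
    unfolding L2_fun_def by (intro conjI per continuous_imp_measurable_on_sets_lebesgue[OF cont circ])
  have weak: "has_weak_deriv v (periodize g)"
  proof (rule has_weak_derivI[OF per P(2)])
    fix x assume "x \<in> {0..2*pi}"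
    then show "v x = v 0 + integral {0..x} (periodize g)" using v[of x] P(3)[of 0 x] by simp
  qed
  then have H1: "H1_fun v" using v2 P(1) unfolding H1_fun_def by blast
  have "AE x in circle. weak_deriv v x = periodize g x"
    by (rule weak_deriv_unique[OF v2 weak_deriv_spec[OF H1] P(1) weak])
  then have "AE x in circle. (norm (weak_deriv v x))\<^sup>2 = (norm (periodize g x))\<^sup>2" by eventually_elim simp
  from integral_cong_AE_interval[OF this order_refl order_refl]
  show ?thesis unfolding H1_seminorm_def L2_norm_eq[OF weak_deriv_spec(1)[OF H1]] P(4) .
qed

lemma norm_unit_normal_le: "norm (unit_normal x \<xi>) \<le> 1"
  by (cases "norm (dxi x \<xi>) = 0") (simp_all add: unit_normal_def)

lemma L2_norm_power2: "(L2_norm v)\<^sup>2 = (LINT \<xi>|circle. (norm (v \<xi>))\<^sup>2)"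
  unfolding L2_norm_def by (intro real_sqrt_pow2 integral_nonneg_AE) simp

context nodal_error begin

lemma discrete_dxi:
  assumes i: "i \<in> {1..N}" and x: "p (i-1) < x" "x < p i"
  shows "dxi (pl (wrap N (\<lambda>j. c j t))) x = (1 / h i) *\<^sub>R edge (wrap N (\<lambda>j. c j t)) i"
  using pl_derivative[where c="wrap N (\<lambda>j. c j t)", OF wrap_0_N i x] by (simp add: vector_derivative_at edge_def)

lemma element_distance:
  assumes t: "t \<in> {0..\<tau>}" and i: "i \<in> {1..N}" and x: "x \<in> {p (i-1)..p i}"
  shows "(norm (a t x - (1 / h i) *\<^sub>R edge (wrap N (\<lambda>j. c j t)) i))\<^sup>2 \<le> 2 * (La\<^sup>2 * H\<^sup>2 + (norm (err c t i))\<^sup>2 / (h i)\<^sup>2)"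
proof -
  define A where "A = (1 / h i) *\<^sub>R integral {p (i-1)..p i} (a t)"
  define b where "b = (1 / h i) *\<^sub>R edge (wrap N (\<lambda>j. c j t)) i"
  have "norm (a t x - A) \<le> La * H"
    unfolding A_def using x by (intro mean_value_error[OF a_lipschitz[OF sub_T[OF t]] La a_cont[OF sub_T[OF t]] H i]) auto
  moreover have "A - b = (1 / h i) *\<^sub>R err c t i"
    by (simp add: A_def b_def err_def exact_edge_eq[OF sub_T[OF t] i] scaleR_diff_right)
  then have "norm (A - b) = norm (err c t i) / h i" using h_pos[OF i] by simp
  moreover have "norm (a t x - b) \<le> norm (a t x - A) + norm (A - b)"
    using norm_triangle_ineq[of "a t x - A" "A - b"] by simp
  ultimately have "norm (a t x - b) \<le> La * H + norm (err c t i) / h i" by simp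
  then have "(norm (a t x - b))\<^sup>2 \<le> (La * H + norm (err c t i) / h i)\<^sup>2" by (rule power_mono) simp
  also have "\<dots> \<le> 2 * ((La * H)\<^sup>2 + (norm (err c t i) / h i)\<^sup>2)" by (rule square_sum2_le)
  finally show ?thesis by (simp add: b_def power_mult_distrib power_divide)
qed

lemma H1_error:
  assumes t: "t \<in> {0..\<tau>}"
  shows "(H1_seminorm (\<lambda>\<xi>. X t \<xi> - pl (wrap N (\<lambda>j. c j t)) \<xi>))\<^sup>2 \<le> 4 * pi * La\<^sup>2 * H\<^sup>2 + 2 * energy c t"
proof -
  note tT = sub_T[OF t]
  let ?c = "wrap N (\<lambda>j. c j t)"
  define G where "G i x = a t x - (1 / h i) *\<^sub>R edge ?c i" for i x
  define g where "g x = a t x - dxi (pl ?c) x" for x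
  have gG: "g x = G i x" if "i \<in> {1..N}" "p (i-1) < x" "x < p i" for i x
    unfolding g_def G_def discrete_dxi[OF that] ..
  have G_cont: "continuous_on {p (i-1)..p i} (G i)" if "i \<in> {1..N}" for i
    unfolding G_def by (intro continuous_intros continuous_on_subset[OF a_cont[OF tT]] element_subset that)
  have G2_cont: "continuous_on {p (i-1)..p i} (\<lambda>x. (norm (G i x))\<^sup>2)" if "i \<in> {1..N}" for i
    by (intro continuous_intros G_cont that)
  have g1: "g absolutely_integrable_on {0..2*pi}"
    by (rule integrable_elements(1)[OF element_spike(1)[OF G_cont gG]])
  have g2: "(\<lambda>x. (norm (g x))\<^sup>2) absolutely_integrable_on {p (i-1)..p i}"
    "integral {p (i-1)..p i} (\<lambda>x. (norm (g x))\<^sup>2) = integral {p (i-1)..p i} (\<lambda>x. (norm (G i x))\<^sup>2)" if "i \<in> {1..N}" for i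
    using element_spike[OF G2_cont[OF that], of "\<lambda>x. (norm (g x))\<^sup>2"] gG[OF that] by auto
  have "(H1_seminorm (\<lambda>\<xi>. X t \<xi> - pl ?c \<xi>))\<^sup>2 = integral {0..2*pi} (\<lambda>x. (norm (g x))\<^sup>2)"
  proof (rule H1_seminorm_eq[OF _ _ g1 integrable_elements(1)[OF g2(1)]])
    have "periodic (pl ?c)" using pl_in_P1[where c="?c", OF wrap_0_N] by (simp add: P1_space_def)
    then show "periodic (\<lambda>\<xi>. X t \<xi> - pl ?c \<xi>)" using X_L2[OF tT] by (simp add: L2_fun_def periodic_def)
    show cont: "continuous_on {0..2*pi} (\<lambda>\<xi>. X t \<xi> - pl ?c \<xi>)"
      by (intro continuous_on_diff X_space_cont[OF tT] continuous_on_pl[where c="?c", OF wrap_0_N])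
    fix x assume x: "x \<in> {0..2*pi}"
    have "(g has_integral ((X t x - pl ?c x) - (X t 0 - pl ?c 0))) {0..x}"
    \<comment> \<open>The piecewise linear part is continuous but not differentiable at the nodes,
      which form the finite exceptional set.\<close>
    proof (rule fundamental_theorem_of_calculus_interior_strong[where S="p ` {0..N}"])
      show "continuous_on {0..x} (\<lambda>\<xi>. X t \<xi> - pl ?c \<xi>)" using x by (intro continuous_on_subset[OF cont]) auto
      fix y assume y: "y \<in> {0<..<x} - p ` {0..N}"
      then have y': "0 < y" "y < 2*pi" using x by auto
      obtain i where i: "i \<in> {1..N}" "p (i-1) \<le> y" "y < p i" using element_cover[of y] y' by auto
      have "p (i-1) \<noteq> y" using y i(1) by (auto simp: image_iff)
      then have lt: "p (i-1) < y" using i(2) by simp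
      have "(pl ?c has_vector_derivative dxi (pl ?c) y) (at y)"
        using pl_derivative[where c="?c", OF wrap_0_N i(1) lt i(3)] by (simp add: vector_derivative_at)
      then show "((\<lambda>\<xi>. X t \<xi> - pl ?c \<xi>) has_vector_derivative g y) (at y)"
        unfolding g_def by (intro has_vector_derivative_diff a_deriv tT y')
    qed (use x in auto)
    then show "X t x - pl ?c x = X t 0 - pl ?c 0 + integral {0..x} g" by (simp add: integral_unique)
  qed
  also have "\<dots> = (\<Sum>i=1..N. integral {p (i-1)..p i} (\<lambda>x. (norm (g x))\<^sup>2))" by (rule integrable_elements(2)[OF g2(1)])
  also have "\<dots> \<le> (\<Sum>i=1..N. 2 * La\<^sup>2 * H\<^sup>2 * h i + 2 * ((norm (err c t i))\<^sup>2 / h i))"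
  proof (rule sum_mono)
    fix i assume i: "i \<in> {1..N}"
    have hi: "0 < h i" "h i = p i - p (i-1)" using h_pos[OF i] by (auto simp: h_def)
    have "integral {p (i-1)..p i} (\<lambda>x. (norm (g x))\<^sup>2) = integral {p (i-1)..p i} (\<lambda>x. (norm (G i x))\<^sup>2)" by (rule g2(2)[OF i])
    also have "\<dots> \<le> integral {p (i-1)..p i} (\<lambda>x. 2 * (La\<^sup>2 * H\<^sup>2 + (norm (err c t i))\<^sup>2 / (h i)\<^sup>2))"
      unfolding G_def by (intro integral_le integrable_continuous_real G2_cont[OF i, unfolded G_def] element_distance[OF t i]) auto
    also have "\<dots> = h i * (2 * (La\<^sup>2 * H\<^sup>2 + (norm (err c t i))\<^sup>2 / (h i)\<^sup>2))" using hi by simp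
    also have "\<dots> = 2 * La\<^sup>2 * H\<^sup>2 * h i + 2 * ((norm (err c t i))\<^sup>2 / h i)"
      using hi(1) by (simp add: distrib_left power2_eq_square)
    finally show "integral {p (i-1)..p i} (\<lambda>x. (norm (g x))\<^sup>2) \<le> 2 * La\<^sup>2 * H\<^sup>2 * h i + 2 * ((norm (err c t i))\<^sup>2 / h i)" .
  qed
  also have "\<dots> = 2 * La\<^sup>2 * H\<^sup>2 * (\<Sum>i=1..N. h i) + 2 * energy c t"
    unfolding energy_def sum_distrib_left sum.distrib ..
  also have "\<dots> = 4 * pi * La\<^sup>2 * H\<^sup>2 + 2 * energy c t" unfolding sum_h by simp
  finally show ?thesis .
qed

text \<open>The density whose integral over the circle is \<open>dissip\<close>; it dominates both
  velocity norms of the theorem pointwise.\<close>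

definition dissip_density :: "real \<Rightarrow> real \<Rightarrow> real" where
  "dissip_density t \<xi> = (let b = dxi (pl (wrap N (\<lambda>j. c j t))) \<xi> in mass_density \<alpha> ((norm b)\<^sup>2) b (pl (rate d t) \<xi>) (pl (rate d t) \<xi>))"

lemma dissip_density_nonneg: "0 \<le> dissip_density t \<xi>"
  using \<alpha> by (simp add: dissip_density_def Let_def mass_density_def)

lemma dissip_density_integral:
  assumes t: "t \<in> {0..\<tau>}"
  shows "(dissip_density t has_integral dissip c d t) {0..2*pi}"
  unfolding dissip_def Let_def mass_form_def
proof (rule has_integral_elements)
  fix i assume i: "i \<in> {1..N}"
  have W: "rate d t 0 = rate d t N" by (rule rate_0_N[OF sub_T[OF t]])
  show "(dissip_density t has_integral 1 / (6 * h i) *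
      (2 * mass_density \<alpha> ((norm (edge (wrap N (\<lambda>j. c j t)) i))\<^sup>2) (edge (wrap N (\<lambda>j. c j t)) i) (rate d t (i - 1)) (rate d t (i - 1))
      + mass_density \<alpha> ((norm (edge (wrap N (\<lambda>j. c j t)) i))\<^sup>2) (edge (wrap N (\<lambda>j. c j t)) i) (rate d t (i - 1)) (rate d t i)
      + mass_density \<alpha> ((norm (edge (wrap N (\<lambda>j. c j t)) i))\<^sup>2) (edge (wrap N (\<lambda>j. c j t)) i) (rate d t i) (rate d t (i - 1))
      + 2 * mass_density \<alpha> ((norm (edge (wrap N (\<lambda>j. c j t)) i))\<^sup>2) (edge (wrap N (\<lambda>j. c j t)) i) (rate d t i) (rate d t i))) {p (i - 1)..p i}"
  proof (rule has_integral_spike[OF _ _ element_mass[OF W W i], where S="{p (i-1), p i}"])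
    fix x assume "x \<in> {p (i-1)..p i} - {p (i-1), p i}"
    then have "p (i-1) < x" "x < p i" by auto
    then show "dissip_density t x = mass_density \<alpha> ((norm ((1 / h i) *\<^sub>R edge (wrap N (\<lambda>j. c j t)) i))\<^sup>2) ((1 / h i) *\<^sub>R edge (wrap N (\<lambda>j. c j t)) i) (pl (rate d t) x) (pl (rate d t) x)"
      unfolding dissip_density_def Let_def by (simp only: discrete_dxi[OF i])
  qed simp
qed

text \<open>The density is \<open>(norm b)\<^sup>2\<close> times a sum of two nonnegative terms, one
  for each claim, and \<open>norm b \<ge> C1 / 2\<close>.\<close>

lemma dissip_density_ge:
  assumes t: "t \<in> {0..\<tau>}" and i: "i \<in> {1..N}" and x: "p (i-1) < x" "x < p i"
  shows "\<alpha> * (norm (pl (rate d t) x))\<^sup>2 \<le> 4 / C1\<^sup>2 * dissip_density t x"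
    "(1 - \<alpha>) * (unit_normal (pl (wrap N (\<lambda>j. c j t))) x \<bullet> pl (rate d t) x)\<^sup>2 \<le> 4 / C1\<^sup>2 * dissip_density t x"
proof -
  let ?w = "pl (rate d t) x" and ?n = "unit_normal (pl (wrap N (\<lambda>j. c j t))) x"
  define b where "b = dxi (pl (wrap N (\<lambda>j. c j t))) x"
  have "C1 / 2 \<le> norm b"
    using edge_bounds[OF t i] h_pos[OF i] unfolding b_def discrete_dxi[OF i x] by (simp add: field_simps)
  then have b2: "C1\<^sup>2 / 4 \<le> (norm b)\<^sup>2" using power_mono[of "C1/2" "norm b" 2] C1 by (simp add: power_divide)
  have eq: "dissip_density t x = (norm b)\<^sup>2 * (\<alpha> * (norm ?w)\<^sup>2) + (norm b)\<^sup>2 * ((1 - \<alpha>) * (?n \<bullet> ?w)\<^sup>2)"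
  proof -
    have "dissip_density t x = (norm b)\<^sup>2 * ((\<alpha> *\<^sub>R ?w + (1 - \<alpha>) *\<^sub>R ((?w \<bullet> ?n) *\<^sub>R ?n)) \<bullet> ?w)"
      unfolding dissip_density_def Let_def b_def unit_normal_simps(1)[OF refl] ..
    also have "\<dots> = (norm b)\<^sup>2 * (\<alpha> * (norm ?w)\<^sup>2) + (norm b)\<^sup>2 * ((1 - \<alpha>) * (?n \<bullet> ?w)\<^sup>2)"
      by (simp add: inner_add_left distrib_left inner_commute[of ?w ?n] power2_eq_square[of "?n \<bullet> ?w"] power2_norm_eq_inner[of ?w] mult.assoc)
    finally show ?thesis .
  qed
  have nn: "0 \<le> \<alpha> * (norm ?w)\<^sup>2" "0 \<le> (1 - \<alpha>) * (?n \<bullet> ?w)\<^sup>2" using \<alpha> by auto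
  have 1: "C1\<^sup>2 / 4 * (\<alpha> * (norm ?w)\<^sup>2) \<le> dissip_density t x"
    using mult_right_mono[OF b2 nn(1)] mult_nonneg_nonneg[OF zero_le_power2[of "norm b"] nn(2)] unfolding eq by linarith
  have 2: "C1\<^sup>2 / 4 * ((1 - \<alpha>) * (?n \<bullet> ?w)\<^sup>2) \<le> dissip_density t x"
    using mult_right_mono[OF b2 nn(2)] mult_nonneg_nonneg[OF zero_le_power2[of "norm b"] nn(1)] unfolding eq by linarith
  have "z \<le> 4 / C1\<^sup>2 * y" if "C1\<^sup>2 / 4 * z \<le> y" for z y
  proof -
    have "4 / C1\<^sup>2 * (C1\<^sup>2 / 4 * z) \<le> 4 / C1\<^sup>2 * y" using that by (intro mult_left_mono) auto
    then show ?thesis using C1 by simp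
  qed
  from this[OF 1] this[OF 2] show "\<alpha> * (norm ?w)\<^sup>2 \<le> 4 / C1\<^sup>2 * dissip_density t x"
    "(1 - \<alpha>) * (?n \<bullet> ?w)\<^sup>2 \<le> 4 / C1\<^sup>2 * dissip_density t x" .
qed

text \<open>The velocity error is the interpolation error of the exact velocity plus the piecewise
  linear nodal rate. Squaring the sum doubles the bounds \<open>25 * K\<^sup>2 * H\<^sup>2\<close>
  and \<open>4 / C1\<^sup>2\<close> of the two parts.\<close>

lemma velocity_error_pointwise:
  assumes t: "t \<in> {0..\<tau>}" and g: "good t" and \<tau>0: "0 < \<tau>"
  defines "x \<equiv> \<lambda>t. pl (wrap N (\<lambda>j. c j t))"
  shows "AE \<xi> in circle. \<alpha> * (norm (Y t \<xi> - dt_on \<tau> x t \<xi>))\<^sup>2 \<le> 50 * K\<^sup>2 * H\<^sup>2 + 8 / C1\<^sup>2 * dissip_density t \<xi> \<and>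
     (1 - \<alpha>) * (norm (unit_normal (x t) \<xi> \<bullet> (Y t \<xi> - dt_on \<tau> x t \<xi>)))\<^sup>2 \<le> 50 * K\<^sup>2 * H\<^sup>2 + 8 / C1\<^sup>2 * dissip_density t \<xi>"
proof -
  note tT = sub_T[OF t]
  have V: "V t = cont_rep (Y t)" using g by (simp add: V_def[abs_def] good_def)
  have nodes: "AE \<xi> in circle. \<xi> \<notin> p ` {0..N}"
  proof -
    have "AE \<xi> in lebesgue. \<xi> \<notin> p ` {0..N}"
      by (rule AE_not_in) (simp add: finite_imp_null_set_lborel null_sets_completionI)
    then have "AE \<xi> in lebesgue. \<xi> \<in> {0..2*pi} \<longrightarrow> \<xi> \<notin> p ` {0..N}" by eventually_elim (rule impI)
    then show ?thesis
      by (rule AE_restrict_space_iff[THEN iffD2, rotated]) (use sets_lebesgue_Icc[of 0 "2*pi::real"] in simp)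
  qed
  show ?thesis
    using cont_rep(1)[OF Y_H1[OF tT]] nodes AE_space
  proof eventually_elim
    case (elim \<xi>)
    have mem: "0 \<le> \<xi>" "\<xi> \<le> 2*pi" using elim(3) by auto
    have "p N \<in> p ` {0..N}" by (intro imageI) simp
    then have "\<xi> \<noteq> p N" using elim(2) by metis
    then have "\<xi> < 2*pi" using mem by simp
    then obtain i where i: "i \<in> {1..N}" "p (i-1) \<le> \<xi>" "\<xi> < p i" using element_cover[of \<xi>] mem by auto
    have "p (i-1) \<noteq> \<xi>" using elim(2) i(1) by (auto simp: image_iff)
    then have lt: "p (i-1) < \<xi>" using i(2) by simp
    define \<eta> where "\<eta> = V t \<xi> - pl (\<lambda>j. V t (p j)) \<xi>"
    have V0: "V t 0 = V t (2*pi)" using V_bounds(4)[OF tT] by simp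
    have \<eta>: "norm \<eta> \<le> 5 * K * H"
      unfolding \<eta>_def using V0 K i(3) by (intro nodal_interpolation_error[OF V_bounds(2)[OF tT] _ _ H i(1) i(2)]) auto
    have dt: "dt_on \<tau> x t \<xi> = pl (wrap N (\<lambda>j. d j t)) \<xi>"
      by (rule dt_on_pl[OF \<tau>0 t, where c=c]) (simp_all add: x_def c_deriv[OF t])
    have eq: "Y t \<xi> - dt_on \<tau> x t \<xi> = \<eta> + pl (rate d t) \<xi>"
    proof -
      let ?d = "wrap N (\<lambda>j. d j t)" and ?\<theta> = "(\<xi> - p (i-1)) / h i"
      have Vp: "V t (p 0) = V t (p N)" using V0 by simp
      have "pl ?d \<xi> = ?d (i-1) + ?\<theta> *\<^sub>R (?d i - ?d (i-1))" by (rule pl_element[OF wrap_0_N i(1,2) less_imp_le[OF i(3)]])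
      moreover have "pl (rate d t) \<xi> = rate d t (i-1) + ?\<theta> *\<^sub>R (rate d t i - rate d t (i-1))"
        by (rule pl_element[OF rate_0_N[OF tT] i(1,2) less_imp_le[OF i(3)]])
      moreover have "pl (\<lambda>j. V t (p j)) \<xi> = V t (p (i-1)) + ?\<theta> *\<^sub>R (V t (p i) - V t (p (i-1)))"
        by (rule pl_element[where c="\<lambda>j. V t (p j)", OF Vp i(1,2) less_imp_le[OF i(3)]])
      ultimately have "pl (rate d t) \<xi> = pl (\<lambda>j. V t (p j)) \<xi> - pl ?d \<xi>"
        unfolding rate_def by (simp only:) (simp add: scaleR_diff_right)
      then show ?thesis using elim(1) by (simp add: dt \<eta>_def V)
    qed
    have \<eta>2: "(norm \<eta>)\<^sup>2 \<le> 25 * K\<^sup>2 * H\<^sup>2" using power_mono[OF \<eta> norm_ge_zero, of 2] by (simp add: power_mult_distrib)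
    have KH: "0 \<le> 25 * K\<^sup>2 * H\<^sup>2" by simp
    show ?case
    proof
      have "(norm (\<eta> + pl (rate d t) \<xi>))\<^sup>2 \<le> (norm \<eta> + norm (pl (rate d t) \<xi>))\<^sup>2"
        by (intro power_mono norm_triangle_ineq norm_ge_zero)
      also have "\<dots> \<le> 2 * ((norm \<eta>)\<^sup>2 + (norm (pl (rate d t) \<xi>))\<^sup>2)" by (rule square_sum2_le)
      finally have "\<alpha> * (norm (\<eta> + pl (rate d t) \<xi>))\<^sup>2 \<le> \<alpha> * (2 * ((norm \<eta>)\<^sup>2 + (norm (pl (rate d t) \<xi>))\<^sup>2))"
        using \<alpha> by (intro mult_left_mono) auto
      also have "\<dots> = 2 * (\<alpha> * (norm \<eta>)\<^sup>2) + 2 * (\<alpha> * (norm (pl (rate d t) \<xi>))\<^sup>2)" by (simp add: distrib_left)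
      also have "\<dots> \<le> 2 * (25 * K\<^sup>2 * H\<^sup>2) + 2 * (4 / C1\<^sup>2 * dissip_density t \<xi>)"
      proof (intro add_mono mult_left_mono dissip_density_ge(1)[OF t i(1) lt i(3)])
        have "\<alpha> * (norm \<eta>)\<^sup>2 \<le> 1 * (25 * K\<^sup>2 * H\<^sup>2)" using \<alpha> \<eta>2 by (intro mult_mono) auto
        then show "\<alpha> * (norm \<eta>)\<^sup>2 \<le> 25 * K\<^sup>2 * H\<^sup>2" by simp
      qed simp_all
      finally show "\<alpha> * (norm (Y t \<xi> - dt_on \<tau> x t \<xi>))\<^sup>2 \<le> 50 * K\<^sup>2 * H\<^sup>2 + 8 / C1\<^sup>2 * dissip_density t \<xi>"
        unfolding eq by simp
      let ?n = "unit_normal (x t) \<xi>"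
      have ge2: "(1 - \<alpha>) * (?n \<bullet> pl (rate d t) \<xi>)\<^sup>2 \<le> 4 / C1\<^sup>2 * dissip_density t \<xi>"
        unfolding x_def by (rule dissip_density_ge(2)[OF t i(1) lt i(3)])
      have "\<bar>?n \<bullet> \<eta>\<bar> \<le> norm ?n * norm \<eta>" by (rule Cauchy_Schwarz_ineq2)
      also have "\<dots> \<le> 1 * norm \<eta>" by (intro mult_right_mono norm_unit_normal_le norm_ge_zero)
      finally have n\<eta>: "\<bar>?n \<bullet> \<eta>\<bar>\<^sup>2 \<le> (norm \<eta>)\<^sup>2" by (intro power_mono) auto
      have "(1 - \<alpha>) * (?n \<bullet> \<eta> + ?n \<bullet> pl (rate d t) \<xi>)\<^sup>2 \<le> (1 - \<alpha>) * (2 * ((?n \<bullet> \<eta>)\<^sup>2 + (?n \<bullet> pl (rate d t) \<xi>)\<^sup>2))"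
        using \<alpha> by (intro mult_left_mono square_sum2_le) auto
      also have "\<dots> = 2 * ((1 - \<alpha>) * (?n \<bullet> \<eta>)\<^sup>2) + 2 * ((1 - \<alpha>) * (?n \<bullet> pl (rate d t) \<xi>)\<^sup>2)" by (simp add: distrib_left)
      also have "\<dots> \<le> 2 * (25 * K\<^sup>2 * H\<^sup>2) + 2 * (4 / C1\<^sup>2 * dissip_density t \<xi>)"
      proof (intro add_mono mult_left_mono ge2)
        have "(1 - \<alpha>) * (?n \<bullet> \<eta>)\<^sup>2 \<le> 1 * (25 * K\<^sup>2 * H\<^sup>2)" using \<alpha> \<eta>2 n\<eta> by (intro mult_mono) auto
        then show "(1 - \<alpha>) * (?n \<bullet> \<eta>)\<^sup>2 \<le> 25 * K\<^sup>2 * H\<^sup>2" by simp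
      qed simp_all
      finally show "(1 - \<alpha>) * (norm (?n \<bullet> (Y t \<xi> - dt_on \<tau> x t \<xi>)))\<^sup>2 \<le> 50 * K\<^sup>2 * H\<^sup>2 + 8 / C1\<^sup>2 * dissip_density t \<xi>"
        unfolding eq by (simp add: inner_add_right)
    qed
  qed
qed

text \<open>The pointwise bound is integrated first in space and then in time. Both integrations go
  through \<open>integral_mono_AE'\<close>, which asks for integrability of the majorant
  only.\<close>

lemma velocity_error:
  assumes \<tau>0: "0 < \<tau>"
  defines "x \<equiv> \<lambda>t. pl (wrap N (\<lambda>j. c j t))"
  shows "\<alpha> * (LINT t|lebesgue_on {0..\<tau>}. (L2_norm (\<lambda>\<xi>. Y t \<xi> - dt_on \<tau> x t \<xi>))\<^sup>2)
      \<le> 100 * pi * K\<^sup>2 * H\<^sup>2 * \<tau> + 8 / C1\<^sup>2 * integral {0..\<tau>} (dissip c d)"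
    "(1 - \<alpha>) * (LINT t|lebesgue_on {0..\<tau>}. (L2_norm (\<lambda>\<xi>. unit_normal (x t) \<xi> \<bullet> (Y t \<xi> - dt_on \<tau> x t \<xi>)))\<^sup>2)
      \<le> 100 * pi * K\<^sup>2 * H\<^sup>2 * \<tau> + 8 / C1\<^sup>2 * integral {0..\<tau>} (dissip c d)"
proof -
  define B where "B t = 100 * pi * K\<^sup>2 * H\<^sup>2 + 8 / C1\<^sup>2 * dissip c d t" for t
  have Icc: "{0..r::real} \<in> sets lebesgue" for r using sets_lebesgue_Icc[of 0 r] by simp
  have space_bound: "(LINT \<xi>|circle. u \<xi>) \<le> B t"
    if t: "t \<in> {0..\<tau>}" and u: "AE \<xi> in circle. u \<xi> \<le> 50 * K\<^sup>2 * H\<^sup>2 + 8 / C1\<^sup>2 * dissip_density t \<xi>" for t u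
  proof -
    define F where "F \<xi> = 50 * K\<^sup>2 * H\<^sup>2 + 8 / C1\<^sup>2 * dissip_density t \<xi>" for \<xi>
    have F0: "0 \<le> F \<xi>" for \<xi> unfolding F_def using dissip_density_nonneg[of t \<xi>] by (intro add_nonneg_nonneg mult_nonneg_nonneg) auto
    have "(F has_integral (50 * K\<^sup>2 * H\<^sup>2 * (2*pi) + 8 / C1\<^sup>2 * dissip c d t)) {0..2*pi}"
      unfolding F_def using has_integral_const_real[of "50 * K\<^sup>2 * H\<^sup>2" 0 "2*pi"]
      by (intro has_integral_add has_integral_mult_right dissip_density_integral t) (simp add: mult.commute)
    then have FI: "F integrable_on {0..2*pi}" "integral {0..2*pi} F = B t"
      by (auto simp: B_def integral_unique has_integral_integrable)
    have ai: "F absolutely_integrable_on {0..2*pi}"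
      by (rule nonnegative_absolutely_integrable_1[OF FI(1)]) (rule F0)
    have "(LINT \<xi>|circle. u \<xi>) \<le> (LINT \<xi>|circle. F \<xi>)"
    proof (rule integral_mono_AE')
      show "integrable circle F" using ai Icc by (rule absolutely_integrable_imp_integrable)
      show "AE \<xi> in circle. u \<xi> \<le> F \<xi>" using u unfolding F_def .
      show "AE \<xi> in circle. 0 \<le> F \<xi>" by (simp add: F0)
    qed
    then show ?thesis unfolding LINT_eq_integral[OF ai] FI(2) .
  qed
  have B0: "0 \<le> B t" if "t \<in> {0..\<tau>}" for t
    unfolding B_def using dissip_nonneg[OF that] by (intro add_nonneg_nonneg mult_nonneg_nonneg) auto
  have B_ai: "B absolutely_integrable_on {0..\<tau>}"
    unfolding B_def by (intro set_integral_add(1) absolutely_integrable_continuous_real continuous_on_const set_integrable_mult_right dissip_integrable)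
  have B_int: "integral {0..\<tau>} B = 100 * pi * K\<^sup>2 * H\<^sup>2 * \<tau> + 8 / C1\<^sup>2 * integral {0..\<tau>} (dissip c d)"
  proof -
    have "dissip c d integrable_on {0..\<tau>}" using dissip_integrable by (simp add: absolutely_integrable_on_def)
    then have "((\<lambda>t. 8 / C1\<^sup>2 * dissip c d t) has_integral 8 / C1\<^sup>2 * integral {0..\<tau>} (dissip c d)) {0..\<tau>}"
      by (intro has_integral_mult_right integrable_integral)
    from has_integral_add[OF has_integral_const_real[of "100 * pi * K\<^sup>2 * H\<^sup>2" 0 \<tau>] this]
    show ?thesis unfolding B_def using \<tau>0 by (simp add: integral_unique mult.commute)
  qed
  have time_bound: "(LINT t|lebesgue_on {0..\<tau>}. u t) \<le> 100 * pi * K\<^sup>2 * H\<^sup>2 * \<tau> + 8 / C1\<^sup>2 * integral {0..\<tau>} (dissip c d)"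
    if u: "\<And>t. t \<in> {0..\<tau>} \<Longrightarrow> good t \<Longrightarrow> u t \<le> B t" for u
  proof -
    have "(LINT t|lebesgue_on {0..\<tau>}. u t) \<le> (LINT t|lebesgue_on {0..\<tau>}. B t)"
    proof (rule integral_mono_AE')
      show "integrable (lebesgue_on {0..\<tau>}) B" using B_ai Icc by (rule absolutely_integrable_imp_integrable)
      have "AE t in lebesgue_on {0..\<tau>}. good t" by (rule AE_lebesgue_on_Icc_subset[OF AE_good]) (use \<tau> in auto)
      then show "AE t in lebesgue_on {0..\<tau>}. u t \<le> B t"
        using AE_space
      proof eventually_elim
        case (elim t)
        then have "t \<in> {0..\<tau>}" by simp
        then show ?case using elim(1) by (rule u)
      qed
      show "AE t in lebesgue_on {0..\<tau>}. 0 \<le> B t" using AE_space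
      proof eventually_elim
        case (elim t)
        then have "t \<in> {0..\<tau>}" by simp
        then show ?case by (rule B0)
      qed
    qed
    then show ?thesis unfolding LINT_eq_integral[OF B_ai] B_int .
  qed
  have "(LINT t|lebesgue_on {0..\<tau>}. \<alpha> * (L2_norm (\<lambda>\<xi>. Y t \<xi> - dt_on \<tau> x t \<xi>))\<^sup>2)
      \<le> 100 * pi * K\<^sup>2 * H\<^sup>2 * \<tau> + 8 / C1\<^sup>2 * integral {0..\<tau>} (dissip c d)"
  proof (rule time_bound)
    fix t assume t: "t \<in> {0..\<tau>}" and g: "good t"
    have "AE \<xi> in circle. \<alpha> * (norm (Y t \<xi> - dt_on \<tau> x t \<xi>))\<^sup>2 \<le> 50 * K\<^sup>2 * H\<^sup>2 + 8 / C1\<^sup>2 * dissip_density t \<xi>"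
      using velocity_error_pointwise[OF t g \<tau>0] unfolding x_def by eventually_elim (rule conjunct1)
    from space_bound[OF t this] show "\<alpha> * (L2_norm (\<lambda>\<xi>. Y t \<xi> - dt_on \<tau> x t \<xi>))\<^sup>2 \<le> B t"
      unfolding L2_norm_power2 by simp
  qed
  then show "\<alpha> * (LINT t|lebesgue_on {0..\<tau>}. (L2_norm (\<lambda>\<xi>. Y t \<xi> - dt_on \<tau> x t \<xi>))\<^sup>2)
      \<le> 100 * pi * K\<^sup>2 * H\<^sup>2 * \<tau> + 8 / C1\<^sup>2 * integral {0..\<tau>} (dissip c d)" by simp
  have "(LINT t|lebesgue_on {0..\<tau>}. (1 - \<alpha>) * (L2_norm (\<lambda>\<xi>. unit_normal (x t) \<xi> \<bullet> (Y t \<xi> - dt_on \<tau> x t \<xi>)))\<^sup>2)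
      \<le> 100 * pi * K\<^sup>2 * H\<^sup>2 * \<tau> + 8 / C1\<^sup>2 * integral {0..\<tau>} (dissip c d)"
  proof (rule time_bound)
    fix t assume t: "t \<in> {0..\<tau>}" and g: "good t"
    have "AE \<xi> in circle. (1 - \<alpha>) * (norm (unit_normal (x t) \<xi> \<bullet> (Y t \<xi> - dt_on \<tau> x t \<xi>)))\<^sup>2 \<le> 50 * K\<^sup>2 * H\<^sup>2 + 8 / C1\<^sup>2 * dissip_density t \<xi>"
      using velocity_error_pointwise[OF t g \<tau>0] unfolding x_def by eventually_elim (rule conjunct2)
    from space_bound[OF t this] show "(1 - \<alpha>) * (L2_norm (\<lambda>\<xi>. unit_normal (x t) \<xi> \<bullet> (Y t \<xi> - dt_on \<tau> x t \<xi>)))\<^sup>2 \<le> B t"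
      unfolding L2_norm_power2 by simp
  qed
  then show "(1 - \<alpha>) * (LINT t|lebesgue_on {0..\<tau>}. (L2_norm (\<lambda>\<xi>. unit_normal (x t) \<xi> \<bullet> (Y t \<xi> - dt_on \<tau> x t \<xi>)))\<^sup>2)
      \<le> 100 * pi * K\<^sup>2 * H\<^sup>2 * \<tau> + 8 / C1\<^sup>2 * integral {0..\<tau>} (dissip c d)" by simp
qed

end

text \<open>Collects two velocity errors (\<open>100 * pi * K\<^sup>2\<close> and
  \<open>8 / C1\<^sup>2\<close> each) and the \<open>H\<^sup>1\<close> error
  (\<open>4 * pi * La\<^sup>2\<close>, and 2 times the energy).\<close>

definition (in flow_const) "C_err = 200 * pi * K\<^sup>2 + 4 * pi * La\<^sup>2 + 2 + 16 / C1\<^sup>2"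

lemma (in flow_const) C_err: "0 < C_err"
  unfolding C_err_def by (intro add_nonneg_pos add_pos_nonneg add_nonneg_nonneg) auto

context nodal_error begin

lemma total_error:
  assumes \<tau>0: "0 < \<tau>"
  defines "x \<equiv> \<lambda>t. pl (wrap N (\<lambda>j. c j t))"
  shows "(SUP t\<in>{0..\<tau>}. (H1_seminorm (\<lambda>\<xi>. X t \<xi> - x t \<xi>))\<^sup>2)
      + \<alpha> * (LINT t|lebesgue_on {0..\<tau>}. (L2_norm (\<lambda>\<xi>. Y t \<xi> - dt_on \<tau> x t \<xi>))\<^sup>2)
      + (1 - \<alpha>) * (LINT t|lebesgue_on {0..\<tau>}. (L2_norm (\<lambda>\<xi>. unit_normal (x t) \<xi> \<bullet> (Y t \<xi> - dt_on \<tau> x t \<xi>)))\<^sup>2)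
      \<le> C_err * T * H\<^sup>2 + C_err * exp (12 * \<kappa> * T / \<alpha>) * H\<^sup>2"
proof -
  define z where "z = \<kappa> * T / \<alpha>"
  define e where "e = exp (12 * z)"
  have z: "0 \<le> z" using \<kappa> \<alpha> T by (simp add: z_def)
  have e1: "1 \<le> e" using z by (simp add: e_def)
  have E: "energy c t \<le> e * H\<^sup>2" if t: "t \<in> {0..\<tau>}" for t
  proof -
    have "4 * z \<le> exp (4 * z)" using exp_ge_add_one_self[of "4 * z"] by linarith
    then have "4 * z * exp (4 * z) \<le> exp (4 * z) * exp (4 * z)" by (intro mult_right_mono) auto
    also have "\<dots> = exp (8 * z)" by (simp add: exp_add[symmetric])
    also have "\<dots> \<le> e" using z by (simp add: e_def)
    finally have "4 * z * exp (4 * z) * H\<^sup>2 \<le> e * H\<^sup>2" by (intro mult_right_mono) auto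
    then show ?thesis using energy_bound[OF t] by (simp add: z_def)
  qed
  have S: "(SUP t\<in>{0..\<tau>}. (H1_seminorm (\<lambda>\<xi>. X t \<xi> - x t \<xi>))\<^sup>2) \<le> 4 * pi * La\<^sup>2 * H\<^sup>2 + 2 * (e * H\<^sup>2)"
  proof (rule cSUP_least)
    fix t assume t: "t \<in> {0..\<tau>}"
    show "(H1_seminorm (\<lambda>\<xi>. X t \<xi> - x t \<xi>))\<^sup>2 \<le> 4 * pi * La\<^sup>2 * H\<^sup>2 + 2 * (e * H\<^sup>2)"
      using H1_error[OF t] E[OF t] unfolding x_def by linarith
  qed (use \<tau>0 in auto)
  have D: "8 / C1\<^sup>2 * integral {0..\<tau>} (dissip c d) \<le> 8 / C1\<^sup>2 * (e * H\<^sup>2)"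
    using dissip_bound unfolding e_def z_def by (intro mult_left_mono) auto
  have v1: "\<alpha> * (LINT t|lebesgue_on {0..\<tau>}. (L2_norm (\<lambda>\<xi>. Y t \<xi> - dt_on \<tau> x t \<xi>))\<^sup>2)
      \<le> 100 * pi * K\<^sup>2 * H\<^sup>2 * \<tau> + 8 / C1\<^sup>2 * integral {0..\<tau>} (dissip c d)"
    unfolding x_def by (rule velocity_error(1)[OF \<tau>0])
  have v2: "(1 - \<alpha>) * (LINT t|lebesgue_on {0..\<tau>}. (L2_norm (\<lambda>\<xi>. unit_normal (x t) \<xi> \<bullet> (Y t \<xi> - dt_on \<tau> x t \<xi>)))\<^sup>2)
      \<le> 100 * pi * K\<^sup>2 * H\<^sup>2 * \<tau> + 8 / C1\<^sup>2 * integral {0..\<tau>} (dissip c d)"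
    unfolding x_def by (rule velocity_error(2)[OF \<tau>0])
  have KT: "100 * pi * K\<^sup>2 * H\<^sup>2 * \<tau> \<le> 100 * pi * K\<^sup>2 * H\<^sup>2 * T" using \<tau> by (intro mult_left_mono) auto
  have "(SUP t\<in>{0..\<tau>}. (H1_seminorm (\<lambda>\<xi>. X t \<xi> - x t \<xi>))\<^sup>2)
      + \<alpha> * (LINT t|lebesgue_on {0..\<tau>}. (L2_norm (\<lambda>\<xi>. Y t \<xi> - dt_on \<tau> x t \<xi>))\<^sup>2)
      + (1 - \<alpha>) * (LINT t|lebesgue_on {0..\<tau>}. (L2_norm (\<lambda>\<xi>. unit_normal (x t) \<xi> \<bullet> (Y t \<xi> - dt_on \<tau> x t \<xi>)))\<^sup>2)
      \<le> 4 * pi * La\<^sup>2 * H\<^sup>2 + 2 * (e * H\<^sup>2) + (100 * pi * K\<^sup>2 * H\<^sup>2 * T + 8 / C1\<^sup>2 * (e * H\<^sup>2)) + (100 * pi * K\<^sup>2 * H\<^sup>2 * T + 8 / C1\<^sup>2 * (e * H\<^sup>2))"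
    using S v1 v2 D KT by linarith
  also have "\<dots> = 200 * pi * K\<^sup>2 * (T * H\<^sup>2) + (4 * pi * La\<^sup>2 * H\<^sup>2 + (2 + 16 / C1\<^sup>2) * (e * H\<^sup>2))"
    by (simp add: algebra_simps)
  \<comment> \<open>The interpolation part of the \<open>H\<^sup>1\<close> error has neither
    \<open>T\<close> nor the exponential as a factor; it is moved to the exponential part by
    \<open>1 \<le> e\<close>.\<close>
  also have "\<dots> \<le> C_err * (T * H\<^sup>2) + (4 * pi * La\<^sup>2 * (e * H\<^sup>2) + (2 + 16 / C1\<^sup>2) * (e * H\<^sup>2))"
  proof (intro add_mono mult_right_mono order_refl)
    show "200 * pi * K\<^sup>2 \<le> C_err" by (simp add: C_err_def)
    show "4 * pi * La\<^sup>2 * H\<^sup>2 \<le> 4 * pi * La\<^sup>2 * (e * H\<^sup>2)"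
      using mult_right_mono[OF e1, of "H\<^sup>2"] by (intro mult_left_mono) auto
    have "0 \<le> e" using e1 by linarith
    then show "0 \<le> e * H\<^sup>2" by (intro mult_nonneg_nonneg zero_le_power2)
  qed (use T in auto)
  also have "\<dots> = C_err * (T * H\<^sup>2) + (4 * pi * La\<^sup>2 + (2 + 16 / C1\<^sup>2)) * (e * H\<^sup>2)"
    by (simp only: distrib_right)
  also have "\<dots> \<le> C_err * (T * H\<^sup>2) + C_err * (e * H\<^sup>2)"
    using e1 by (intro add_left_mono mult_right_mono) (auto simp: C_err_def)
  finally show ?thesis by (simp add: e_def z_def mult.assoc)
qed

end

text \<open>The witnesses are \<open>C_err\<close> and \<open>12 * \<kappa>\<close>, which are built
  from \<open>f\<close>, \<open>C1\<close>, \<open>C2\<close> and \<open>K\<close> alone and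
  therefore precede \<alpha> and \<open>T\<close>.\<close>

theorem theorem4p6:
  fixes f :: "real \<Rightarrow> real" and cp cP C1 C2 K :: real
  assumes "\<exists>l. l-lipschitz_on {0<..} f"
    and "0 < cp" and "0 < C1" and "C1 < C2"
  shows "\<exists>C M. 0 < C \<and> 0 < M \<and>
    (\<forall>\<alpha> T. 0 < \<alpha> \<and> \<alpha> \<le> 1 \<and> 0 < T \<longrightarrow>
      (\<exists>h0>0. \<forall>X0 X N p.
         H2_fun X0 \<and> flow_solution \<alpha> f T X0 X \<and> W1inf_H2_norm T X = ereal K \<and>
         (\<forall>t\<in>{0..T}. \<forall>\<xi>. C1 \<le> norm (dxi (X t) \<xi>) \<and> norm (dxi (X t) \<xi>) \<le> C2) \<and>
         circle_partition N p \<and>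
         Min (mesh_step N p ` {1..N}) \<ge> cp * mesh_size N p \<and>
         (\<forall>j\<in>{1..N}. \<bar>mesh_step N p (j + 1) - mesh_step N p j\<bar> \<le> cP * (mesh_size N p)\<^sup>2) \<and>
         mesh_size N p \<le> h0 \<longrightarrow>
         (\<exists>x. semidiscrete_solution \<alpha> f T N p X0 x \<and>
              (\<forall>y. semidiscrete_solution \<alpha> f T N p X0 y \<longrightarrow> (\<forall>t\<in>{0..T}. \<forall>\<xi>. y t \<xi> = x t \<xi>)) \<and>
              (SUP t\<in>{0..T}. (H1_seminorm (\<lambda>\<xi>. X t \<xi> - x t \<xi>))\<^sup>2)
              + \<alpha> * (LINT t|lebesgue_on {0..T}. (L2_norm (\<lambda>\<xi>. time_deriv T X t \<xi> - dt_on T x t \<xi>))\<^sup>2)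
              + (1 - \<alpha>) * (LINT t|lebesgue_on {0..T}.
                  (L2_norm (\<lambda>\<xi>. unit_normal (x t) \<xi> \<bullet> (time_deriv T X t \<xi> - dt_on T x t \<xi>)))\<^sup>2)
              \<le> C * T * (mesh_size N p)\<^sup>2 + C * exp (M * T / \<alpha>) * (mesh_size N p)\<^sup>2)))"
proof (cases "0 \<le> K")
  case False
  \<comment> \<open>A norm cannot be negative, so for \<open>K < 0\<close> no data satisfy the
    hypotheses and any constants serve.\<close>
  have "False" if "0 < T" "flow_solution \<alpha> f T X0 X" "W1inf_H2_norm T X = ereal K" for \<alpha> T X0 X
    using W1inf_norm_bounds(1)[OF that(1) _ that(3)] that(2) False by (simp add: flow_solution_def)
  then show ?thesis by (intro exI[of _ "1::real"] conjI allI impI zero_less_one) blast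
next
  case K: True
  obtain lf where lf: "lf-lipschitz_on {0<..} f" using assms(1) by blast
  interpret flow_const f lf C1 C2 K by unfold_locales (use lf assms K in auto)
  have main: "\<exists>h0>0. \<forall>X0 X N p.
         H2_fun X0 \<and> flow_solution \<alpha> f T X0 X \<and> W1inf_H2_norm T X = ereal K \<and>
         (\<forall>t\<in>{0..T}. \<forall>\<xi>. C1 \<le> norm (dxi (X t) \<xi>) \<and> norm (dxi (X t) \<xi>) \<le> C2) \<and>
         circle_partition N p \<and>
         Min (mesh_step N p ` {1..N}) \<ge> cp * mesh_size N p \<and>
         (\<forall>j\<in>{1..N}. \<bar>mesh_step N p (j + 1) - mesh_step N p j\<bar> \<le> cP * (mesh_size N p)\<^sup>2) \<and>
         mesh_size N p \<le> h0 \<longrightarrow>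
         (\<exists>x. semidiscrete_solution \<alpha> f T N p X0 x \<and>
              (\<forall>y. semidiscrete_solution \<alpha> f T N p X0 y \<longrightarrow> (\<forall>t\<in>{0..T}. \<forall>\<xi>. y t \<xi> = x t \<xi>)) \<and>
              (SUP t\<in>{0..T}. (H1_seminorm (\<lambda>\<xi>. X t \<xi> - x t \<xi>))\<^sup>2)
              + \<alpha> * (LINT t|lebesgue_on {0..T}. (L2_norm (\<lambda>\<xi>. time_deriv T X t \<xi> - dt_on T x t \<xi>))\<^sup>2)
              + (1 - \<alpha>) * (LINT t|lebesgue_on {0..T}.
                  (L2_norm (\<lambda>\<xi>. unit_normal (x t) \<xi> \<bullet> (time_deriv T X t \<xi> - dt_on T x t \<xi>)))\<^sup>2)
              \<le> C_err * T * (mesh_size N p)\<^sup>2 + C_err * exp (12 * \<kappa> * T / \<alpha>) * (mesh_size N p)\<^sup>2)"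
    if \<alpha>: "0 < \<alpha>" "\<alpha> \<le> 1" and T: "0 < T" for \<alpha> T
  proof -
    define A where "A = 4 * (\<kappa> * T / \<alpha>) * exp (4 * (\<kappa> * T / \<alpha>))"
    \<comment> \<open>The first entry gives \<open>La * H \<le> C1 / 4\<close>; the second makes the
      Gronwall bound \<open>A * H\<^sup>2\<close> smaller than the threshold
      \<open>cp * H * C1\<^sup>2 / 16\<close>, possible because it is of higher order in
      \<open>H\<close>. Adding 1 to \<open>La\<close> and \<open>A\<close> avoids division by 0 and
      yields the strict inequality.\<close>
    define h0 where "h0 = min (C1 / (4 * (La + 1))) (cp * C1\<^sup>2 / (16 * (A + 1)))"
    have A: "0 \<le> A" using \<kappa> \<alpha> T by (simp add: A_def)
    have h0: "0 < h0" using assms(2) C1 La A by (simp add: h0_def)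
    show ?thesis
    proof (intro exI[of _ h0] conjI h0 allI impI, elim conjE)
      fix X0 :: "real \<Rightarrow> real^2" and X N p
      assume flow: "flow_solution \<alpha> f T X0 X" and norm: "W1inf_H2_norm T X = ereal K"
        and dxi: "\<forall>t\<in>{0..T}. \<forall>\<xi>. C1 \<le> norm (dxi (X t) \<xi>) \<and> norm (dxi (X t) \<xi>) \<le> C2"
        and part: "circle_partition N p" and Min: "cp * mesh_size N p \<le> Min (mesh_step N p ` {1..N})"
        and H: "mesh_size N p \<le> h0"
      interpret mesh N p by unfold_locales (rule part)
      have h_le: "h j \<le> mesh_size N p" and h_ge: "cp * mesh_size N p \<le> h j" if j: "j \<in> {1..N}" for j
      proof -
        have "mesh_step N p j \<in> mesh_step N p ` {1..N}" using j by (rule imageI)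
        from Max_ge[OF _ this] Min_le[OF _ this] Min
        show "h j \<le> mesh_size N p" "cp * mesh_size N p \<le> h j"
          by (auto simp: mesh_size_def mesh_step_eq[OF j])
      qed
      interpret E: flow_error f lf C1 C2 K \<alpha> T X0 X N p "mesh_size N p"
      proof unfold_locales
        show "C1 \<le> norm (dxi (X t) \<xi>) \<and> norm (dxi (X t) \<xi>) \<le> C2" if "t \<in> {0..T}" for t \<xi>
          using dxi that by blast
      qed (rule \<alpha> T flow norm h_le; assumption?)+
      have Hp: "0 < mesh_size N p" by (rule E.H_pos)
      have small: "La * mesh_size N p \<le> C1 / 4"
      proof -
        have "mesh_size N p \<le> C1 / (4 * (La + 1))" using H by (simp add: h0_def)
        then have "mesh_size N p * (4 * (La + 1)) \<le> C1" using La by (simp add: pos_le_divide_eq)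
        then show ?thesis using Hp by (simp add: algebra_simps)
      qed
      have energy_small: "A * (mesh_size N p)\<^sup>2 < cp * mesh_size N p * C1\<^sup>2 / 16"
      proof -
        have "mesh_size N p \<le> cp * C1\<^sup>2 / (16 * (A + 1))" using H by (simp add: h0_def)
        then have "mesh_size N p * (16 * (A + 1)) \<le> cp * C1\<^sup>2" using A by (simp add: pos_le_divide_eq)
        then have "A * mesh_size N p < cp * C1\<^sup>2 / 16" using Hp by (simp add: algebra_simps)
        from mult_strict_right_mono[OF this Hp] show ?thesis by (simp add: power2_eq_square mult_ac)
      qed
      obtain c d where S: "nodal_error f lf C1 C2 K \<alpha> T X0 X N p (mesh_size N p) T c d"
        by (rule E.nodal_error_exists[OF assms(2) h_ge small energy_small[unfolded A_def]])
      interpret S: nodal_error f lf C1 C2 K \<alpha> T X0 X N p "mesh_size N p" T c d by (rule S)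
      show "\<exists>x. semidiscrete_solution \<alpha> f T N p X0 x \<and>
              (\<forall>y. semidiscrete_solution \<alpha> f T N p X0 y \<longrightarrow> (\<forall>t\<in>{0..T}. \<forall>\<xi>. y t \<xi> = x t \<xi>)) \<and>
              (SUP t\<in>{0..T}. (H1_seminorm (\<lambda>\<xi>. X t \<xi> - x t \<xi>))\<^sup>2)
              + \<alpha> * (LINT t|lebesgue_on {0..T}. (L2_norm (\<lambda>\<xi>. time_deriv T X t \<xi> - dt_on T x t \<xi>))\<^sup>2)
              + (1 - \<alpha>) * (LINT t|lebesgue_on {0..T}.
                  (L2_norm (\<lambda>\<xi>. unit_normal (x t) \<xi> \<bullet> (time_deriv T X t \<xi> - dt_on T x t \<xi>)))\<^sup>2)
              \<le> C_err * T * (mesh_size N p)\<^sup>2 + C_err * exp (12 * \<kappa> * T / \<alpha>) * (mesh_size N p)\<^sup>2"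
      proof (intro exI conjI allI impI ballI)
        show "semidiscrete_solution \<alpha> f T N p X0 (\<lambda>t. pl (wrap N (\<lambda>j. c j t)))"
          by (rule nodal_imp_semidiscrete[OF T S.nodal S.init])
        fix y t \<xi> assume y: "semidiscrete_solution \<alpha> f T N p X0 y" and t: "t \<in> {0..T}"
        obtain c' d' where nodal': "nodal_solution \<alpha> f T c' d'" and init': "\<And>j. j \<in> {1..N} \<Longrightarrow> c' j 0 = X0 (p j)"
          and y_eq: "\<And>t. t \<in> {0..T} \<Longrightarrow> y t = pl (wrap N (\<lambda>j. c' j t))"
          by (rule semidiscrete_imp_nodal[OF T y]) blast
        have "c' j t = c j t" if j: "j \<in> {1..N}" for j
          by (rule nodal_solution_unique[OF \<alpha> assms(1) less_imp_le[OF T] nodal' S.nodal _ t j]) (simp only: init' S.init)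
        then show "y t \<xi> = pl (wrap N (\<lambda>j. c j t)) \<xi>"
          unfolding y_eq[OF t] sum_hat[symmetric] by (intro sum.cong refl) simp
      qed (rule S.total_error[OF T])
    qed
  qed
  show ?thesis
    by (rule exI[of _ C_err], rule exI[of _ "12 * \<kappa>"]) (use C_err \<kappa> main in simp)
qed

end
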